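(* Let $k\in\mathbb{R}$, $s<-\tfrac12$ and $T>0$. Then the data-to-solution map $(u_0,n_0,n_1)\mapsto(u,n,\partial_t n)$ of the one-dimensional Zakharov system, as a map from the unit ball of $H^k\times H^s\times H^{s-1}$ to $C([0,T];H^k)\times C([0,T];H^s)\times C([0,T];H^{s-1})$, fails to be $C^2$.
   Context: The one-dimensional Zakharov system (1D ZS) is the initial value problem $$i\partial_t u+\partial_x^2u=nu,\qquad \partial_t^2 n-\partial_x^2 n=\partial_x^2|u|^2,$$ $$u(x,0)=u_0(x),\quad n(x,0)=n_0(x),\quad \partial_t n(x,0)=n_1(x),$$ for $x,t\in\mathbb{R}$, with $u=u(x,t)\in\mathbb{C}$ and $n=n(x,t)\in\mathbb{R}$. $H^s=H^s(\mathbb{R})$ denotes the inhomogeneous $L^2$-based Sobolev space, $\|\phi\|_{H^s}=\left(\int\langle\xi\rangle^{2s}|\hat\phi(\xi)|^2\,d\xi\right)^{1/2}$ with $\langle\xi\rangle=(1+|\xi|^2)^{1/2}$ ($n_0,n_1$ are real-valued, $u_0$ complex-valued; the spaces are regarded as real Banach spaces). For data in $H^\infty=\bigcap_m H^m$, "the solution" means the unique solution with $u\in C([0,T];H^m)$, $n\in C([0,T];H^m)$, $\partial_t n\in C([0,T];H^{m-1})$ for all $m$. Meaning of the conclusion: $C^2$ is twice continuous differentiability in the Fréchet sense, and "the data-to-solution map fails to be $C^2$" means that there is no $C^2$ map from the unit ball of $H^k\times H^s\times H^{s-1}$ to $C([0,T];H^k)\times C([0,T];H^s)\times C([0,T];H^{s-1})$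 that sends each $H^\infty$ data triple $(u_0,n_0,n_1)$ in the unit ball to the corresponding solution $(u,n,\partial_t n)$ on $[0,T]$. *)

theory Defs
  imports "HOL-Analysis.Analysis" "HOL-Library.Function_Algebras"
begin

section \<open>Normed spaces carried by a subspace of a real vector space\<close>

text \<open>
  The spaces \<open>H\<^sup>s\<close> depend on a real parameter \<open>s\<close> and carry different norms on overlapping
  subspaces of the tempered distributions, so they cannot be instances of
  \<^class>\<open>real_normed_vector\<close>. A normed space is therefore a carrier together with a norm.
\<close>

instantiation "fun" :: (type, real_vector) real_vector
begin

definition scaleR_fun :: "real \<Rightarrow> ('a \<Rightarrow> 'b) \<Rightarrow> 'a \<Rightarrow> 'b"
  where "scaleR_fun c f = (\<lambda>x. c *\<^sub>R f x)"

instance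
  by standard
    (auto simp: scaleR_fun_def fun_eq_iff scaleR_right_distrib scaleR_left_distrib)

end

record 'a nspace =
  vecs :: "'a set"
  nrm :: "'a \<Rightarrow> real"

definition prod_space :: "'a nspace \<Rightarrow> 'b nspace \<Rightarrow> ('a \<times> 'b) nspace"  (infixr "\<times>\<^sub>N" 80)
  where "X \<times>\<^sub>N Y = \<lparr>vecs = vecs X \<times> vecs Y,
     nrm = (\<lambda>(x, y). sqrt ((nrm X x)\<^sup>2 + (nrm Y y)\<^sup>2))\<rparr>"

definition unit_ball :: "'a nspace \<Rightarrow> 'a set"
  where "unit_ball X = {x \<in> vecs X. nrm X x < 1}"

definition continuous_map_on ::
  "'a::real_vector nspace \<Rightarrow> 'b::real_vector nspace \<Rightarrow> 'a set \<Rightarrow> ('a \<Rightarrow> 'b) \<Rightarrow> bool"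
  where "continuous_map_on X Y U f \<longleftrightarrow> f \<in> U \<rightarrow> vecs Y \<and>
    (\<forall>x\<in>U. \<forall>e>0. \<exists>d>0. \<forall>y\<in>U. nrm X (y - x) < d \<longrightarrow> nrm Y (f y - f x) < e)"

text \<open>
  Bounded real-linear maps, set to \<open>0\<close> outside the carrier so that they are determined by
  their values on it. The norm is the operator norm, written as in \<^const>\<open>onorm\<close>.
\<close>

definition blin_space ::
  "'a::real_vector nspace \<Rightarrow> 'b::real_vector nspace \<Rightarrow> ('a \<Rightarrow> 'b) nspace"
  where "blin_space X Y = \<lparr>vecs = {A. A \<in> vecs X \<rightarrow> vecs Y \<and> (\<forall>x. x \<notin> vecs X \<longrightarrow> A x = 0) \<and>
       (\<forall>x\<in>vecs X. \<forall>y\<in>vecs X. A (x + y) = A x + A y) \<and>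
       (\<forall>c. \<forall>x\<in>vecs X. A (c *\<^sub>R x) = c *\<^sub>R A x) \<and>
       (\<exists>K. \<forall>x\<in>vecs X. nrm Y (A x) \<le> K * nrm X x)},
     nrm = (\<lambda>A. SUP x\<in>vecs X. nrm Y (A x) / nrm X x)\<rparr>"

definition has_frechet_derivative_at ::
  "'a::real_vector nspace \<Rightarrow> 'b::real_vector nspace \<Rightarrow> 'a set \<Rightarrow> ('a \<Rightarrow> 'b) \<Rightarrow> ('a \<Rightarrow> 'b) \<Rightarrow> 'a \<Rightarrow> bool"
  where "has_frechet_derivative_at X Y U f A x \<longleftrightarrow> A \<in> vecs (blin_space X Y) \<and>
    (\<forall>e>0. \<exists>d>0. \<forall>y\<in>U. nrm X (y - x) < d \<longrightarrow>
       nrm Y (f y - f x - A (y - x)) \<le> e * nrm X (y - x))"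

definition C1_on ::
  "'a::real_vector nspace \<Rightarrow> 'b::real_vector nspace \<Rightarrow> 'a set \<Rightarrow> ('a \<Rightarrow> 'b) \<Rightarrow> bool"
  where "C1_on X Y U f \<longleftrightarrow> f \<in> U \<rightarrow> vecs Y \<and>
    (\<exists>D. (\<forall>x\<in>U. has_frechet_derivative_at X Y U f (D x) x) \<and>
         continuous_map_on X (blin_space X Y) U D)"

definition C2_on ::
  "'a::real_vector nspace \<Rightarrow> 'b::real_vector nspace \<Rightarrow> 'a set \<Rightarrow> ('a \<Rightarrow> 'b) \<Rightarrow> bool"
  where "C2_on X Y U f \<longleftrightarrow> f \<in> U \<rightarrow> vecs Y \<and>
    (\<exists>D. (\<forall>x\<in>U. has_frechet_derivative_at X Y U f (D x) x) \<and>
         C1_on X (blin_space X Y) U D)"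

text \<open>
  \<open>C([0,T];X)\<close> with the supremum norm; paths are set to \<open>0\<close> outside \<open>[0,T]\<close>.
\<close>

definition path_space :: "real \<Rightarrow> 'a::real_vector nspace \<Rightarrow> (real \<Rightarrow> 'a) nspace"
  where "path_space T X = \<lparr>vecs = {f. f \<in> {0..T} \<rightarrow> vecs X \<and> (\<forall>t. t \<notin> {0..T} \<longrightarrow> f t = 0) \<and>
       (\<forall>t\<in>{0..T}. \<forall>e>0. \<exists>d>0. \<forall>r\<in>{0..T}. \<bar>r - t\<bar> < d \<longrightarrow> nrm X (f r - f t) < e)},
     nrm = (\<lambda>f. SUP t\<in>{0..T}. nrm X (f t))\<rparr>"

section \<open>Tempered distributions on the real line\<close>

definition vderiv :: "nat \<Rightarrow> (real \<Rightarrow> complex) \<Rightarrow> real \<Rightarrow> complex"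
  where "vderiv b \<phi> = ((\<lambda>g x. vector_derivative g (at x)) ^^ b) \<phi>"

definition schwartz :: "(real \<Rightarrow> complex) set"
  where "schwartz = {\<phi>. (\<forall>b x. vderiv b \<phi> differentiable at x) \<and>
    (\<forall>a b. bdd_above (range (\<lambda>x. \<bar>x\<bar> ^ a * cmod (vderiv b \<phi> x))))}"

definition schwartz_seminorm :: "nat \<Rightarrow> nat \<Rightarrow> (real \<Rightarrow> complex) \<Rightarrow> real"
  where "schwartz_seminorm a b \<phi> = (SUP x. \<bar>x\<bar> ^ a * cmod (vderiv b \<phi> x))"

type_synonym distr = "(real \<Rightarrow> complex) \<Rightarrow> complex"

text \<open>Functionals are set to \<open>0\<close> outside the Schwartz space.\<close>

definition tempered :: "distr set"
  where "tempered = {\<Lambda>. (\<forall>\<phi>. \<phi> \<notin> schwartz \<longrightarrow> \<Lambda> \<phi> = 0) \<and>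
    (\<forall>\<phi>\<in>schwartz. \<forall>\<psi>\<in>schwartz. \<Lambda> (\<lambda>x. \<phi> x + \<psi> x) = \<Lambda> \<phi> + \<Lambda> \<psi>) \<and>
    (\<forall>c. \<forall>\<phi>\<in>schwartz. \<Lambda> (\<lambda>x. c * \<phi> x) = c * \<Lambda> \<phi>) \<and>
    (\<exists>C N. \<forall>\<phi>\<in>schwartz. cmod (\<Lambda> \<phi>) \<le> C * (\<Sum>a\<le>N. \<Sum>b\<le>N. schwartz_seminorm a b \<phi>))}"

text \<open>The distribution \<open>\<Lambda>\<close> is the function \<open>g\<close>.\<close>

definition is_function :: "distr \<Rightarrow> (real \<Rightarrow> complex) \<Rightarrow> bool"
  where "is_function \<Lambda> g \<longleftrightarrow> g \<in> borel_measurable lborel \<and>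
    (\<forall>\<phi>\<in>schwartz. integrable lborel (\<lambda>x. g x * \<phi> x) \<and> \<Lambda> \<phi> = (LINT x|lborel. g x * \<phi> x))"

definition real_valued :: "distr \<Rightarrow> bool"
  where "real_valued \<Lambda> \<longleftrightarrow> (\<forall>\<phi>\<in>schwartz. range \<phi> \<subseteq> \<real> \<longrightarrow> \<Lambda> \<phi> \<in> \<real>)"

definition fourier :: "(real \<Rightarrow> complex) \<Rightarrow> real \<Rightarrow> complex"
  where "fourier \<phi> \<xi> = (LINT x|lborel. exp (- \<i> * complex_of_real (\<xi> * x)) * \<phi> x)"

definition distr_fourier :: "distr \<Rightarrow> distr"
  where "distr_fourier \<Lambda> = (\<lambda>\<phi>. if \<phi> \<in> schwartz then \<Lambda> (fourier \<phi>) else 0)"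

section \<open>Sobolev spaces\<close>

definition japanese_bracket :: "real \<Rightarrow> real"
  where "japanese_bracket \<xi> = sqrt (1 + \<bar>\<xi>\<bar>\<^sup>2)"

text \<open>
  The function representing the Fourier transform is unique only almost everywhere, so
  \<open>sobolev_norm\<close> picks one; the integral does not depend on the choice.
\<close>

definition sobolev_norm :: "real \<Rightarrow> distr \<Rightarrow> real"
  where "sobolev_norm s \<Lambda> = (let g = (SOME g. is_function (distr_fourier \<Lambda>) g) in
    (LINT \<xi>|lborel. japanese_bracket \<xi> powr (2 * s) * (cmod (g \<xi>))\<^sup>2) powr (1 / 2))"

definition sobolev :: "real \<Rightarrow> distr nspace"
  where "sobolev s = \<lparr>vecs = {\<Lambda>\<in>tempered. \<exists>g. is_function (distr_fourier \<Lambda>) g \<and>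
       integrable lborel (\<lambda>\<xi>. japanese_bracket \<xi> powr (2 * s) * (cmod (g \<xi>))\<^sup>2)},
     nrm = sobolev_norm s\<rparr>"

definition real_sobolev :: "real \<Rightarrow> distr nspace"
  where "real_sobolev s = \<lparr>vecs = {\<Lambda>\<in>vecs (sobolev s). real_valued \<Lambda>}, nrm = sobolev_norm s\<rparr>"

section \<open>The one-dimensional Zakharov system\<close>

definition data_space :: "real \<Rightarrow> real \<Rightarrow> (distr \<times> distr \<times> distr) nspace"
  where "data_space k s = sobolev k \<times>\<^sub>N real_sobolev s \<times>\<^sub>N real_sobolev (s - 1)"

definition solution_space ::
  "real \<Rightarrow> real \<Rightarrow> real \<Rightarrow> ((real \<Rightarrow> distr) \<times> (real \<Rightarrow> distr) \<times> (real \<Rightarrow> distr)) nspace"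
  where "solution_space T k s = path_space T (sobolev k) \<times>\<^sub>N
    path_space T (real_sobolev s) \<times>\<^sub>N path_space T (real_sobolev (s - 1))"

definition smooth_data :: "(distr \<times> distr \<times> distr) set"
  where "smooth_data = (\<Inter>m::nat. vecs (sobolev m)) \<times> (\<Inter>m::nat. vecs (real_sobolev m)) \<times>
    (\<Inter>m::nat. vecs (real_sobolev m))"

definition has_second_derivative_at ::
  "(real \<Rightarrow> 'a::real_normed_vector) \<Rightarrow> 'a \<Rightarrow> real \<Rightarrow> real set \<Rightarrow> bool"
  where "has_second_derivative_at f d x S \<longleftrightarrow>
    (\<exists>f'. (\<forall>y\<in>S. (f has_vector_derivative f' y) (at y within S)) \<and>
      (f' has_vector_derivative d) (at x within S))"

text \<open>
  The system holds pointwise for functions \<open>u x t\<close> and \<open>n x t\<close> on \<open>\<real> \<times> [0,T]\<close>,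
  with time derivatives one-sided at \<open>0\<close> and \<open>T\<close>.
\<close>

definition classical_zakharov ::
  "real \<Rightarrow> (real \<Rightarrow> real \<Rightarrow> complex) \<Rightarrow> (real \<Rightarrow> real \<Rightarrow> real) \<Rightarrow> bool"
  where "classical_zakharov T u n \<longleftrightarrow> (\<forall>x. \<forall>t\<in>{0..T}.
    (\<exists>ut uxx. ((\<lambda>r. u x r) has_vector_derivative ut) (at t within {0..T}) \<and>
       has_second_derivative_at (\<lambda>y. u y t) uxx x UNIV \<and>
       \<i> * ut + uxx = complex_of_real (n x t) * u x t) \<and>
    (\<exists>ntt nxx pxx. has_second_derivative_at (\<lambda>r. n x r) ntt t {0..T} \<and>
       has_second_derivative_at (\<lambda>y. n y t) nxx x UNIV \<and>
       has_second_derivative_at (\<lambda>y. (cmod (u y t))\<^sup>2) pxx x UNIV \<and>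
       ntt - nxx = pxx))"

definition zakharov_solution ::
  "real \<Rightarrow> distr \<times> distr \<times> distr \<Rightarrow> (real \<Rightarrow> distr) \<times> (real \<Rightarrow> distr) \<times> (real \<Rightarrow> distr) \<Rightarrow> bool"
  where "zakharov_solution T = (\<lambda>(u\<^sub>0, n\<^sub>0, n\<^sub>1) (U, N, V).
    (\<forall>m::nat. U \<in> vecs (path_space T (sobolev m)) \<and> N \<in> vecs (path_space T (real_sobolev m)) \<and>
       V \<in> vecs (path_space T (real_sobolev (real m - 1)))) \<and>
    U 0 = u\<^sub>0 \<and> N 0 = n\<^sub>0 \<and> V 0 = n\<^sub>1 \<and>
    (\<exists>u n nt. classical_zakharov T u n \<and>
      (\<forall>x. \<forall>t\<in>{0..T}. ((\<lambda>r. n x r) has_vector_derivative nt x t) (at t within {0..T})) \<and>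
      (\<forall>t\<in>{0..T}. is_function (U t) (\<lambda>x. u x t) \<and>
         is_function (N t) (\<lambda>x. complex_of_real (n x t)) \<and>
         is_function (V t) (\<lambda>x. complex_of_real (nt x t)))))"

end

theory Submission
  imports Defs "HOL-Probability.Probability" "HOL-Real_Asymp.Real_Asymp"
begin

text \<open>
  If the solution map \<open>F\<close> were \<open>C\<^sup>2\<close>, the second difference \<open>F (x + y) - F x - F y + F 0\<close> would be at most
  \<open>C \<epsilon>\<^sup>2\<close> for data of norm \<open>\<epsilon>\<close>. Let \<open>x\<close> have a Gaussian packet of width \<open>\<sigma>\<close> and frequency \<open>- N\<close> as
  Schroedinger datum, and \<open>y\<close> one of frequency \<open>2 N + 1\<close> as wave datum. Since
  \<open>(N + 1)\<^sup>2 - N\<^sup>2 = 2 N + 1\<close>, the product of the two free evolutions stays in phase with the free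
  evolution of a packet of frequency \<open>N + 1\<close>, so the \<open>\<epsilon>\<^sup>2\<close> part of the second difference at time \<open>T\<close>,
  paired with that packet, has relative size at least a constant times \<open>T\<close> up to a dispersion error \<open>N / \<sigma>\<close>.
  Comparing the norms gives \<open>T \<le> C (N / \<sigma> + \<sigma>\<^bsup>1/2\<^esup> N\<^sup>s)\<close>, and \<open>\<sigma> = N\<^bsup>1/2 - s\<^esup>\<close> makes the
  right-hand side tend to \<open>0\<close> exactly when \<open>s < - 1/2\<close>. The terms of order \<open>\<epsilon>\<^sup>3\<close> are controlled, for the
  fixed \<open>N\<close> and \<open>\<sigma>\<close>, by the conservation of mass and energy.
\<close>

section \<open>Second differences of twice differentiable maps\<close>

text \<open>No well-posedness theory enters: the solution is whatever \<open>F\<close> returns at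
  smooth data, so every bound is an a priori bound for that solution. Integrability of the densities
  over the line is not part of the input; hence integrals run over \<open>[-R, R]\<close>, and the
  boundary fluxes, which vanish as R grows, are carried along. Duhamel's formula is replaced by L2
  balance laws and by pairing with an approximate solution of the adjoint equation. The packets are
  frozen in space and only their phases move. A packet of frequency about N drifts by a distance of
  order N T, whereas the wave packet has speed one and drifts only by T; the former is the source of
  the dispersion error. Gaussians are used because their derivatives, Fourier transforms and
  weighted norms are explicit. The wave datum is real, so it carries both signs of the frequency and
  both directions of travel. One of the four combinations is resonant; the others are averaged out.
  A vanishing Schroedinger datum keeps u = 0, so only two of the four terms of the second difference
  survive.\<close>

definition normed :: "'a::real_vector nspace \<Rightarrow> bool"
  where "normed X \<longleftrightarrow> 0 \<in> vecs X \<and> nrm X 0 = 0 \<and>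
    (\<forall>x\<in>vecs X. 0 \<le> nrm X x) \<and>
    (\<forall>x\<in>vecs X. \<forall>y\<in>vecs X. x + y \<in> vecs X \<and> nrm X (x + y) \<le> nrm X x + nrm X y) \<and>
    (\<forall>c. \<forall>x\<in>vecs X. c *\<^sub>R x \<in> vecs X \<and> nrm X (c *\<^sub>R x) = \<bar>c\<bar> * nrm X x)"

lemma normedI:
  assumes "0 \<in> vecs X"
    and "\<And>x. x \<in> vecs X \<Longrightarrow> 0 \<le> nrm X x"
    and "\<And>x y. x \<in> vecs X \<Longrightarrow> y \<in> vecs X \<Longrightarrow> x + y \<in> vecs X"
    and "\<And>x y. x \<in> vecs X \<Longrightarrow> y \<in> vecs X \<Longrightarrow> nrm X (x + y) \<le> nrm X x + nrm X y"
    and "\<And>c x. x \<in> vecs X \<Longrightarrow> c *\<^sub>R x \<in> vecs X"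
    and "\<And>c x. x \<in> vecs X \<Longrightarrow> nrm X (c *\<^sub>R x) = \<bar>c\<bar> * nrm X x"
  shows "normed X"
proof -
  have "nrm X 0 = 0" using assms(6)[OF assms(1), of 0] by simp
  with assms show ?thesis by (simp add: normed_def)
qed

lemma normedD:
  assumes "normed X"
  shows normed_zero_mem: "0 \<in> vecs X"
    and normed_zero: "nrm X 0 = 0"
    and normed_nonneg: "\<And>x. x \<in> vecs X \<Longrightarrow> 0 \<le> nrm X x"
    and normed_add_mem: "\<And>x y. x \<in> vecs X \<Longrightarrow> y \<in> vecs X \<Longrightarrow> x + y \<in> vecs X"
    and normed_triangle: "\<And>x y. x \<in> vecs X \<Longrightarrow> y \<in> vecs X \<Longrightarrow> nrm X (x + y) \<le> nrm X x + nrm X y"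
    and normed_scale_mem: "\<And>c x. x \<in> vecs X \<Longrightarrow> c *\<^sub>R x \<in> vecs X"
    and normed_scale: "\<And>c x. x \<in> vecs X \<Longrightarrow> nrm X (c *\<^sub>R x) = \<bar>c\<bar> * nrm X x"
  using assms by (simp_all add: normed_def)

lemma normed_diff:
  assumes "normed X" "x \<in> vecs X" "y \<in> vecs X"
  shows "x - y \<in> vecs X" "nrm X (x - y) \<le> nrm X x + nrm X y"
proof -
  have *: "x - y = x + (-1) *\<^sub>R y" by simp
  show "x - y \<in> vecs X" unfolding * using assms by (intro normed_add_mem normed_scale_mem) auto
  show "nrm X (x - y) \<le> nrm X x + nrm X y"
    unfolding * using normed_triangle[OF assms(1,2), of "(-1) *\<^sub>R y"] normed_scale_mem[OF assms(1,3), of "-1"]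
      normed_scale[OF assms(1,3), of "-1"] by simp
qed

section \<open>Product spaces and spaces of continuous paths\<close>

lemma normed_prod_space:
  assumes X: "normed X" and Y: "normed Y"
  shows "normed (X \<times>\<^sub>N Y)"
proof (rule normedI)
  show "0 \<in> vecs (X \<times>\<^sub>N Y)"
    using normed_zero_mem[OF X] normed_zero_mem[OF Y] by (simp add: prod_space_def zero_prod_def)
next
  fix x assume "x \<in> vecs (X \<times>\<^sub>N Y)"
  then show "0 \<le> nrm (X \<times>\<^sub>N Y) x" by (cases x) (simp add: prod_space_def)
next
  fix x y assume "x \<in> vecs (X \<times>\<^sub>N Y)" "y \<in> vecs (X \<times>\<^sub>N Y)"
  then show "x + y \<in> vecs (X \<times>\<^sub>N Y)"
    using normed_add_mem[OF X] normed_add_mem[OF Y] by (cases x, cases y) (simp add: prod_space_def)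
next
  fix x y assume xy: "x \<in> vecs (X \<times>\<^sub>N Y)" "y \<in> vecs (X \<times>\<^sub>N Y)"
  obtain a b c d where [simp]: "x = (a, b)" "y = (c, d)" by (cases x, cases y)
  have m: "a \<in> vecs X" "b \<in> vecs Y" "c \<in> vecs X" "d \<in> vecs Y"
    using xy by (auto simp: prod_space_def)
  have "sqrt ((nrm X (a + c))\<^sup>2 + (nrm Y (b + d))\<^sup>2)
      \<le> sqrt ((nrm X a + nrm X c)\<^sup>2 + (nrm Y b + nrm Y d)\<^sup>2)"
    using m normed_nonneg[OF X] normed_nonneg[OF Y]
      normed_add_mem[OF X] normed_add_mem[OF Y]
    by (intro real_sqrt_le_mono add_mono power_mono normed_triangle X Y) auto
  also have "\<dots> \<le> sqrt ((nrm X a)\<^sup>2 + (nrm Y b)\<^sup>2) + sqrt ((nrm X c)\<^sup>2 + (nrm Y d)\<^sup>2)"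
    by (rule real_sqrt_sum_squares_triangle_ineq)
  finally show "nrm (X \<times>\<^sub>N Y) (x + y) \<le> nrm (X \<times>\<^sub>N Y) x + nrm (X \<times>\<^sub>N Y) y"
    by (simp add: prod_space_def)
next
  fix c :: real and x assume "x \<in> vecs (X \<times>\<^sub>N Y)"
  then show "c *\<^sub>R x \<in> vecs (X \<times>\<^sub>N Y)"
    using normed_scale_mem[OF X] normed_scale_mem[OF Y] by (cases x) (simp add: prod_space_def)
next
  fix c :: real and x assume x: "x \<in> vecs (X \<times>\<^sub>N Y)"
  obtain a b where [simp]: "x = (a, b)" by (cases x)
  have m: "a \<in> vecs X" "b \<in> vecs Y" using x by (auto simp: prod_space_def)
  have "(nrm X (c *\<^sub>R a))\<^sup>2 + (nrm Y (c *\<^sub>R b))\<^sup>2 = c\<^sup>2 * ((nrm X a)\<^sup>2 + (nrm Y b)\<^sup>2)"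
    using m by (simp add: normed_scale[OF X] normed_scale[OF Y] power_mult_distrib algebra_simps)
  then show "nrm (X \<times>\<^sub>N Y) (c *\<^sub>R x) = \<bar>c\<bar> * nrm (X \<times>\<^sub>N Y) x"
    by (simp add: prod_space_def real_sqrt_mult)
qed

lemma prod_space_nrm_ge:
  "nrm X (fst p) \<le> nrm (X \<times>\<^sub>N Y) p" "nrm Y (snd p) \<le> nrm (X \<times>\<^sub>N Y) p"
  unfolding prod_space_def by (simp_all add: case_prod_unfold real_le_rsqrt)

lemma path_space_cont:
  assumes "f \<in> vecs (path_space T X)" "t \<in> {0..T}" "0 < e"
  shows "\<exists>d>0. \<forall>r\<in>{0..T}. \<bar>r - t\<bar> < d \<longrightarrow> nrm X (f r - f t) < e"
  using assms unfolding path_space_def by simp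

lemma path_space_mem: "f \<in> vecs (path_space T X) \<Longrightarrow> t \<in> {0..T} \<Longrightarrow> f t \<in> vecs X"
  unfolding path_space_def by auto

text \<open>The norm of a path is a real \<open>SUP\<close>, which says something only for a bounded
  family. By the reverse triangle inequality the norm is continuous along a continuous path, and
  \<open>{0..T}\<close> is compact.\<close>

lemma path_space_bdd:
  assumes X: "normed X" and f: "f \<in> vecs (path_space T X)"
  shows "bdd_above ((\<lambda>t. nrm X (f t)) ` {0..T})"
proof -
  have m: "f t \<in> vecs X" if "t \<in> {0..T}" for t using f that by (auto simp: path_space_def)
  have "continuous_on {0..T} (\<lambda>t. nrm X (f t))"
    unfolding continuous_on_iff
  proof (intro ballI allI impI)
    fix t e :: real assume t: "t \<in> {0..T}" and "0 < e"
    then obtain d where d: "d > 0" "\<And>r. r \<in> {0..T} \<Longrightarrow> \<bar>r - t\<bar> < d \<Longrightarrow> nrm X (f r - f t) < e"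
      using path_space_cont[OF f] by blast
    have "dist (nrm X (f r)) (nrm X (f t)) < e" if r: "r \<in> {0..T}" "dist r t < d" for r
    proof -
      have "nrm X (f r - f t) < e" using d r by (simp add: dist_real_def)
      moreover have "nrm X (f r) \<le> nrm X (f t) + nrm X (f r - f t)"
        using normed_triangle[OF X m[OF t] normed_diff(1)[OF X m[OF r(1)] m[OF t]]] by simp
      moreover have "nrm X (f t - f r) = nrm X (f r - f t)"
        using normed_scale[OF X normed_diff(1)[OF X m[OF r(1)] m[OF t]], of "-1"] by simp
      moreover have "nrm X (f t) \<le> nrm X (f r) + nrm X (f t - f r)"
        using normed_triangle[OF X m[OF r(1)] normed_diff(1)[OF X m[OF t] m[OF r(1)]]] by simp
      ultimately show ?thesis by (simp add: dist_real_def)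
    qed
    with d(1) show "\<exists>d>0. \<forall>x'\<in>{0..T}. dist x' t < d \<longrightarrow> dist (nrm X (f x')) (nrm X (f t)) < e"
      by blast
  qed
  then have "compact ((\<lambda>t. nrm X (f t)) ` {0..T})"
    by (intro compact_continuous_image) auto
  then show ?thesis by (intro bounded_imp_bdd_above compact_imp_bounded)
qed

lemma path_space_nrm_ge:
  assumes "normed X" "f \<in> vecs (path_space T X)" "t \<in> {0..T}"
  shows "nrm X (f t) \<le> nrm (path_space T X) f"
  using cSUP_upper[OF assms(3) path_space_bdd[OF assms(1,2)]] by (simp add: path_space_def)

lemma normed_path_space:
  assumes X: "normed X" and T: "0 \<le> (T::real)"
  shows "normed (path_space T X)"
proof -
  let ?P = "path_space T X"
  have mem: "f t \<in> vecs X" if "f \<in> vecs ?P" "t \<in> {0..T}" for f t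
    using that by (auto simp: path_space_def)
  have ne: "{0..T} \<noteq> {}" using T by auto
  have nP: "nrm ?P f = (SUP t\<in>{0..T}. nrm X (f t))" for f by (simp add: path_space_def)
  show ?thesis
  proof (rule normedI)
    show "0 \<in> vecs ?P" using normed_zero_mem[OF X] normed_zero[OF X]
      by (auto simp: path_space_def intro!: exI[of _ 1])
  next
    fix f assume f: "f \<in> vecs ?P"
    have "0 \<le> nrm X (f 0)" using normed_nonneg[OF X mem[OF f]] T by simp
    also have "\<dots> \<le> nrm ?P f" using path_space_nrm_ge[OF X f] T by simp
    finally show "0 \<le> nrm ?P f" .
  next
    fix f g assume f: "f \<in> vecs ?P" and g: "g \<in> vecs ?P"
    show "f + g \<in> vecs ?P"
      unfolding path_space_def
    proof (simp, intro conjI allI impI ballI)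
      show "f + g \<in> {0..T} \<rightarrow> vecs X" using mem[OF f] mem[OF g] normed_add_mem[OF X] by auto
      show "f t + g t = 0" if "0 \<le> t \<longrightarrow> \<not> t \<le> T" for t
        using f g that by (auto simp: path_space_def)
      fix t e :: real assume t: "t \<in> {0..T}" and "0 < e"
      then have e: "0 < e / 2" by simp
      obtain d where d: "d > 0" "\<And>r. r \<in> {0..T} \<Longrightarrow> \<bar>r - t\<bar> < d \<Longrightarrow> nrm X (f r - f t) < e / 2"
        using path_space_cont[OF f t e] by blast
      obtain d' where d': "d' > 0" "\<And>r. r \<in> {0..T} \<Longrightarrow> \<bar>r - t\<bar> < d' \<Longrightarrow> nrm X (g r - g t) < e / 2"
        using path_space_cont[OF g t e] by blast
      show "\<exists>d>0. \<forall>r\<in>{0..T}. \<bar>r - t\<bar> < d \<longrightarrow> nrm X (f r + g r - (f t + g t)) < e"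
      proof (intro exI[of _ "min d d'"] conjI ballI impI)
        fix r assume r: "r \<in> {0..T}" "\<bar>r - t\<bar> < min d d'"
        have "nrm X (f r + g r - (f t + g t)) = nrm X ((f r - f t) + (g r - g t))"
          by (simp add: algebra_simps)
        also have "\<dots> \<le> nrm X (f r - f t) + nrm X (g r - g t)"
          using r t by (intro normed_triangle normed_diff X mem f g) auto
        also have "\<dots> < e" using d(2)[OF r(1)] d'(2)[OF r(1)] r(2) by simp
        finally show "nrm X (f r + g r - (f t + g t)) < e" .
      qed (use d d' in auto)
    qed
  next
    fix f g assume f: "f \<in> vecs ?P" and g: "g \<in> vecs ?P"
    have "nrm X ((f + g) t) \<le> nrm ?P f + nrm ?P g" if "t \<in> {0..T}" for t
      using normed_triangle[OF X mem[OF f that] mem[OF g that]]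
        path_space_nrm_ge[OF X f that] path_space_nrm_ge[OF X g that] by simp
    then show "nrm ?P (f + g) \<le> nrm ?P f + nrm ?P g"
      unfolding nP[of "f + g"] by (intro cSUP_least ne) auto
  next
    fix c :: real and f assume f: "f \<in> vecs ?P"
    show "c *\<^sub>R f \<in> vecs ?P"
      unfolding path_space_def
    proof (simp add: scaleR_fun_def, intro conjI allI impI ballI)
      show "(\<lambda>x. c *\<^sub>R f x) \<in> {0..T} \<rightarrow> vecs X" using mem[OF f] normed_scale_mem[OF X] by auto
      show "c = 0 \<or> f t = 0" if "0 \<le> t \<longrightarrow> \<not> t \<le> T" for t
        using f that by (auto simp: path_space_def)
      fix t e :: real assume t: "t \<in> {0..T}" and "0 < e"
      \<comment> \<open>The added 1 keeps the quotient meaningful for \<open>c = 0\<close>.\<close>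
      then have e: "0 < e / (\<bar>c\<bar> + 1)" by simp
      obtain d where d: "d > 0" "\<And>r. r \<in> {0..T} \<Longrightarrow> \<bar>r - t\<bar> < d \<Longrightarrow> nrm X (f r - f t) < e / (\<bar>c\<bar> + 1)"
        using path_space_cont[OF f t e] by blast
      show "\<exists>d>0. \<forall>r\<in>{0..T}. \<bar>r - t\<bar> < d \<longrightarrow> nrm X (c *\<^sub>R f r - c *\<^sub>R f t) < e"
      proof (intro exI[of _ d] conjI ballI impI)
        fix r assume r: "r \<in> {0..T}" "\<bar>r - t\<bar> < d"
        have "nrm X (c *\<^sub>R f r - c *\<^sub>R f t) = \<bar>c\<bar> * nrm X (f r - f t)"
          using normed_scale[OF X normed_diff(1)[OF X mem[OF f r(1)] mem[OF f t]], of c]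
          by (simp add: scaleR_diff_right)
        also have "\<dots> \<le> (\<bar>c\<bar> + 1) * nrm X (f r - f t)"
          using normed_nonneg[OF X normed_diff(1)[OF X mem[OF f r(1)] mem[OF f t]]]
          by (intro mult_right_mono) auto
        also have "\<dots> < (\<bar>c\<bar> + 1) * (e / (\<bar>c\<bar> + 1))"
          using d(2)[OF r] by (intro mult_strict_left_mono) auto
        also have "\<dots> = e" by simp
        finally show "nrm X (c *\<^sub>R f r - c *\<^sub>R f t) < e" .
      qed (use d in auto)
    qed
  next
    fix c :: real and f assume f: "f \<in> vecs ?P"
    have "nrm ?P (c *\<^sub>R f) = (SUP t\<in>{0..T}. \<bar>c\<bar> * nrm X (f t))"
      unfolding nP using normed_scale[OF X mem[OF f]]
      by (intro SUP_cong) (auto simp: scaleR_fun_def)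
    \<comment> \<open>Multiplication by a nonnegative constant is monotone and continuous, hence
      commutes with the supremum of a bounded nonempty set.\<close>
    also have "\<dots> = \<bar>c\<bar> * nrm ?P f"
      using continuous_at_Sup_mono[of "\<lambda>x. \<bar>c\<bar> * x" "(\<lambda>t. nrm X (f t)) ` {0..T}"]
        path_space_bdd[OF X f] ne
      by (simp add: nP image_comp comp_def mono_def mult_left_mono continuous_intros)
    finally show "nrm ?P (c *\<^sub>R f) = \<bar>c\<bar> * nrm ?P f" .
  qed
qed

section \<open>Bounded linear maps and second differences\<close>

lemma blin_spaceD:
  assumes "A \<in> vecs (blin_space X Y)"
  shows "\<And>x. x \<in> vecs X \<Longrightarrow> A x \<in> vecs Y"
    and "\<And>x y. x \<in> vecs X \<Longrightarrow> y \<in> vecs X \<Longrightarrow> A (x + y) = A x + A y"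
    and "\<And>c x. x \<in> vecs X \<Longrightarrow> A (c *\<^sub>R x) = c *\<^sub>R A x"
    and "\<exists>K. \<forall>x\<in>vecs X. nrm Y (A x) \<le> K * nrm X x"
  using assms unfolding blin_space_def by auto

text \<open>Division by zero gives 0, so the quotients in the operator norm ignore vectors of norm
  zero; there the boundedness constant K gives the inequality. Elsewhere it is the definition of the
  supremum, which is finite because \<open>\<bar>K\<bar>\<close> bounds all quotients.\<close>

lemma blin_space_nrm_ge:
  assumes X: "normed X" and A: "A \<in> vecs (blin_space X Y)" and x: "x \<in> vecs X"
  shows "nrm Y (A x) \<le> nrm (blin_space X Y) A * nrm X x"
proof -
  obtain K where K: "\<And>x. x \<in> vecs X \<Longrightarrow> nrm Y (A x) \<le> K * nrm X x"
    using blin_spaceD(4)[OF A] by auto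
  have q: "nrm Y (A z) / nrm X z \<le> \<bar>K\<bar>" if z: "z \<in> vecs X" for z
  proof (cases "nrm X z = 0")
    case False
    then have "nrm X z > 0" using normed_nonneg[OF X z] by linarith
    then have "nrm Y (A z) / nrm X z \<le> K" using K[OF z] by (simp add: pos_divide_le_eq)
    then show ?thesis by linarith
  qed simp
  have bdd: "bdd_above ((\<lambda>z. nrm Y (A z) / nrm X z) ` vecs X)"
    using q by (intro bdd_aboveI[of _ "\<bar>K\<bar>"]) auto
  show ?thesis
  proof (cases "nrm X x = 0")
    case True then show ?thesis using K[OF x] by simp
  next
    case False
    then have p: "nrm X x > 0" using normed_nonneg[OF X x] by linarith
    have "nrm Y (A x) / nrm X x \<le> nrm (blin_space X Y) A"
      using cSUP_upper[OF x bdd] by (simp add: blin_space_def)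
    then show ?thesis using p by (simp add: pos_divide_le_eq)
  qed
qed

lemma blin_space_diff:
  assumes X: "normed X" and Y: "normed Y"
    and A: "A \<in> vecs (blin_space X Y)" and B: "B \<in> vecs (blin_space X Y)"
  shows "A - B \<in> vecs (blin_space X Y)"
proof -
  obtain K L where K: "\<And>x. x \<in> vecs X \<Longrightarrow> nrm Y (A x) \<le> K * nrm X x"
    and L: "\<And>x. x \<in> vecs X \<Longrightarrow> nrm Y (B x) \<le> L * nrm X x"
    using blin_spaceD(4)[OF A] blin_spaceD(4)[OF B] by auto
  have z: "\<forall>x. x \<notin> vecs X \<longrightarrow> A x = 0" "\<forall>x. x \<notin> vecs X \<longrightarrow> B x = 0"
    using A B by (auto simp: blin_space_def)
  have "nrm Y (A x - B x) \<le> (K + L) * nrm X x" if "x \<in> vecs X" for x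
    using normed_diff(2)[OF Y blin_spaceD(1)[OF A that] blin_spaceD(1)[OF B that]] K[OF that] L[OF that]
    by (simp add: algebra_simps)
  then show ?thesis
    using z blin_spaceD[OF A] blin_spaceD[OF B] normed_diff(1)[OF Y]
    unfolding blin_space_def by (auto simp: scaleR_diff_right)
qed

text \<open>
  Only the differentiability of the derivative at the origin enters: it makes the derivative
  Lipschitz at the origin, and the mean value theorem then bounds the second difference.
\<close>

lemma C2_second_difference:
  fixes X :: "'a::real_vector nspace" and Y :: "'b::real_vector nspace"
  assumes X: "normed X" and Y: "normed Y" and C2: "C2_on X Y (unit_ball X) F"
  shows "\<exists>C\<ge>0. \<exists>r>0. \<forall>l K x y e. (\<forall>y y'. l (y - y') = l y - (l y' :: complex)) \<longrightarrow>
     (\<forall>c y. l (c *\<^sub>R y) = c *\<^sub>R l y) \<longrightarrow>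
     (\<forall>y\<in>vecs Y. cmod (l y) \<le> K * nrm Y y) \<longrightarrow> 0 \<le> K \<longrightarrow> x \<in> vecs X \<longrightarrow> y \<in> vecs X \<longrightarrow>
     nrm X x \<le> e \<longrightarrow> nrm X y \<le> e \<longrightarrow> e < r \<longrightarrow>
     cmod (l (F (x + y)) - l (F x) - l (F y) + l (F 0)) \<le> C * K * e\<^sup>2"
proof -
  let ?U = "unit_ball X" and ?Z = "blin_space X Y"
  obtain D where D: "\<And>x. x \<in> ?U \<Longrightarrow> has_frechet_derivative_at X Y ?U F (D x) x"
    and C1: "C1_on X ?Z ?U D" and FU: "F \<in> ?U \<rightarrow> vecs Y"
    using C2 unfolding C2_on_def by auto
  obtain E where E: "\<And>x. x \<in> ?U \<Longrightarrow> has_frechet_derivative_at X ?Z ?U D (E x) x"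
    using C1 unfolding C1_on_def by auto
  have z0: "0 \<in> ?U" using normed_zero_mem[OF X] normed_zero[OF X] by (simp add: unit_ball_def)
  have DU: "D x \<in> vecs ?Z" if "x \<in> ?U" for x
    using D[OF that] unfolding has_frechet_derivative_at_def by auto
  have E0: "E 0 \<in> vecs (blin_space X ?Z)"
    using E[OF z0] unfolding has_frechet_derivative_at_def by auto
  obtain M where M: "\<And>x. x \<in> vecs X \<Longrightarrow> nrm ?Z (E 0 x) \<le> M * nrm X x"
    using blin_spaceD(4)[OF E0] by auto
  \<comment> \<open>Differentiability of D at 0 with error quotient 1: near the origin D differs
    from its affine part by at most the norm of the argument.\<close>
  obtain d where d: "d > 0" "\<And>y. y \<in> ?U \<Longrightarrow> nrm X y < d \<Longrightarrow> nrm ?Z (D y - D 0 - E 0 y) \<le> nrm X y"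
    using E[OF z0] unfolding has_frechet_derivative_at_def by (auto dest!: spec[of _ "1::real"])
  \<comment> \<open>\<open>\<bar>M\<bar>\<close> bounds the second derivative at 0 and the 1 is the
    remainder: D is Lipschitz at the origin with constant C.\<close>
  define C where "C = \<bar>M\<bar> + 1"
  have "C \<ge> 0" by (simp add: C_def)
  \<comment> \<open>Halved radii: a sum of two vectors of norm at most e has to stay below both 1
    and d.\<close>
  define r where "r = min (1/2) (d/2)"
  have r: "r > 0" using d by (simp add: r_def)
  have DL: "nrm Y (D z x - D 0 x) \<le> C * nrm X z * nrm X x"
    if z: "z \<in> ?U" "nrm X z < d" and x: "x \<in> vecs X" for z x
  proof -
    have zX: "z \<in> vecs X" using z by (simp add: unit_ball_def)
    have nn: "0 \<le> nrm X z" "0 \<le> nrm X x" using normed_nonneg[OF X] zX x by auto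
    have Ez: "E 0 z \<in> vecs ?Z" using blin_spaceD(1)[OF E0 zX] .
    let ?B = "D z - D 0 - E 0 z"
    have B: "?B \<in> vecs ?Z" by (intro blin_space_diff X Y DU z z0 Ez)
    have "nrm Y (?B x) \<le> nrm ?Z ?B * nrm X x" by (rule blin_space_nrm_ge[OF X B x])
    also have "\<dots> \<le> nrm X z * nrm X x" using d(2)[OF z] nn by (intro mult_right_mono) auto
    finally have 1: "nrm Y (?B x) \<le> nrm X z * nrm X x" .
    have "nrm Y (E 0 z x) \<le> nrm ?Z (E 0 z) * nrm X x" by (rule blin_space_nrm_ge[OF X Ez x])
    also have "\<dots> \<le> (\<bar>M\<bar> * nrm X z) * nrm X x" using M[OF zX] nn
      by (intro mult_right_mono) (auto intro: order_trans[OF _ mult_right_mono[OF abs_ge_self]])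
    finally have 2: "nrm Y (E 0 z x) \<le> \<bar>M\<bar> * nrm X z * nrm X x" .
    have "nrm Y (D z x - D 0 x) = nrm Y (?B x + E 0 z x)" by simp
    also have "\<dots> \<le> nrm Y (?B x) + nrm Y (E 0 z x)"
      by (intro normed_triangle Y blin_spaceD(1)[OF B x] blin_spaceD(1)[OF Ez x])
    also have "\<dots> \<le> C * nrm X z * nrm X x" using 1 2 by (simp add: C_def algebra_simps)
    finally show ?thesis .
  qed
  show ?thesis
  proof (rule exI[of _ "3 * C"], rule conjI, use \<open>C \<ge> 0\<close> in simp, rule exI[of _ r], rule conjI, rule r, intro allI impI)
    fix l :: "'b \<Rightarrow> complex" and K :: real and x y :: 'a and e :: real
    assume l_diff: "\<forall>y y'. l (y - y') = l y - l y'" and l_scale: "\<forall>c y. l (c *\<^sub>R y) = c *\<^sub>R l y"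
      and lK: "\<forall>y\<in>vecs Y. cmod (l y) \<le> K * nrm Y y" and K: "0 \<le> K"
      and x: "x \<in> vecs X" and y: "y \<in> vecs X" and xe: "nrm X x \<le> e" and ye: "nrm X y \<le> e" and er: "e < r"
    have e0: "0 \<le> e" using normed_nonneg[OF X x] xe by linarith
    have ball: "a *\<^sub>R x + w \<in> ?U \<and> nrm X (a *\<^sub>R x + w) < d \<and> a *\<^sub>R x + w \<in> vecs X
        \<and> nrm X (a *\<^sub>R x + w) \<le> e + nrm X w"
      if a: "a \<in> {0..1}" and w: "w \<in> {0, y}" for a w
    proof -
      have wX: "w \<in> vecs X" "nrm X w \<le> e" using w y ye normed_zero_mem[OF X] normed_zero[OF X] e0 by auto
      have ax: "a *\<^sub>R x \<in> vecs X" by (rule normed_scale_mem[OF X x])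
      have "nrm X (a *\<^sub>R x) \<le> 1 * e" using a normed_scale[OF X x, of a] normed_nonneg[OF X x] xe
          mult_mono[of a 1 "nrm X x" e] by auto
      then have "nrm X (a *\<^sub>R x + w) \<le> e + nrm X w"
        using normed_triangle[OF X ax wX(1)] by linarith
      moreover have "2 * e < 1" "2 * e < d" using er by (auto simp: r_def)
      ultimately show ?thesis using wX normed_add_mem[OF X ax wX(1)] by (auto simp: unit_ball_def)
    qed
    \<comment> \<open>The increment of \<open>H y - H 0\<close> from a = 0 to a = 1 is the second
      difference. Its derivative at a is l applied to \<open>D (a x + y) x - D (a x) x\<close>, a
      difference of two values of D near the origin.\<close>
    define H where "H = (\<lambda>w a. l (F (a *\<^sub>R x + w)))"
    have der: "(H w has_vector_derivative l (D (a *\<^sub>R x + w) x)) (at a within {0..1})"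
      if a: "a \<in> {0..1}" and w: "w \<in> {0, y}" for a w
      unfolding has_vector_derivative_def has_derivative_within_alt2
    proof (intro conjI allI impI)
      show "bounded_linear (\<lambda>h. h *\<^sub>R l (D (a *\<^sub>R x + w) x))"
        by (intro bounded_linear_scaleR_const bounded_linear_ident)
      fix \<epsilon> :: real assume eps: "\<epsilon> > 0"
      let ?z = "a *\<^sub>R x + w"
      have zU: "?z \<in> ?U" "?z \<in> vecs X" using ball[OF a w] by auto
      \<comment> \<open>Chosen so that its product with K and the norm of x stays below \<epsilon>;
        the two additions of 1 cover K = 0 and x of norm 0.\<close>
      define \<eta> where "\<eta> = \<epsilon> / ((K + 1) * (nrm X x + 1))"
      have nx: "nrm X x \<ge> 0" by (rule normed_nonneg[OF X x])
      have eta: "\<eta> > 0" using eps K nx by (simp add: \<eta>_def)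
      obtain \<delta> where \<delta>: "\<delta> > 0" "\<And>v. v \<in> ?U \<Longrightarrow> nrm X (v - ?z) < \<delta> \<Longrightarrow>
         nrm Y (F v - F ?z - D ?z (v - ?z)) \<le> \<eta> * nrm X (v - ?z)"
        using D[OF zU(1)] eta unfolding has_frechet_derivative_at_def by blast
      have "\<forall>b\<in>{0..1}. \<bar>b - a\<bar> < \<delta> / (nrm X x + 1) \<longrightarrow>
         norm (H w b - H w a - (b - a) *\<^sub>R l (D ?z x)) \<le> \<epsilon> * norm (b - a)"
      proof (intro ballI impI)
        fix b :: real assume b: "b \<in> {0..1}" and ba: "\<bar>b - a\<bar> < \<delta> / (nrm X x + 1)"
        let ?v = "b *\<^sub>R x + w"
        have vz: "?v - ?z = (b - a) *\<^sub>R x" by (simp add: algebra_simps)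
        have nvz: "nrm X (?v - ?z) = \<bar>b - a\<bar> * nrm X x" unfolding vz by (rule normed_scale[OF X x])
        have vU: "?v \<in> ?U" using ball[OF b w] by auto
        have "\<bar>b - a\<bar> * nrm X x \<le> \<bar>b - a\<bar> * (nrm X x + 1)" by (intro mult_left_mono) auto
        also have "\<dots> < \<delta>" using ba nx by (simp add: pos_less_divide_eq)
        finally have "nrm X (?v - ?z) < \<delta>" unfolding nvz .
        then have 1: "nrm Y (F ?v - F ?z - D ?z (?v - ?z)) \<le> \<eta> * (\<bar>b - a\<bar> * nrm X x)"
          using \<delta>(2)[OF vU] unfolding nvz by blast
        have Dv: "D ?z (?v - ?z) = (b - a) *\<^sub>R D ?z x"
          unfolding vz by (rule blin_spaceD(3)[OF DU[OF zU(1)] x])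
        have "F ?v - F ?z - D ?z (?v - ?z) \<in> vecs Y"
          using FU vU zU normed_diff(1)[OF Y] normed_scale_mem[OF Y] blin_spaceD(1)[OF DU[OF zU(1)] x]
          unfolding Dv by (auto intro!: normed_diff(1)[OF Y])
        then have "cmod (l (F ?v - F ?z - D ?z (?v - ?z))) \<le> K * (\<eta> * (\<bar>b - a\<bar> * nrm X x))"
          using lK 1 K by (meson mult_left_mono order_trans)
        also have "l (F ?v - F ?z - D ?z (?v - ?z)) = H w b - H w a - (b - a) *\<^sub>R l (D ?z x)"
          unfolding Dv H_def using l_diff l_scale by simp
        also have "K * (\<eta> * (\<bar>b - a\<bar> * nrm X x)) \<le> (K + 1) * (\<eta> * (\<bar>b - a\<bar> * (nrm X x + 1)))"
          using K eta nx by (intro mult_mono) auto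
        also have "\<dots> = \<epsilon> * \<bar>b - a\<bar>" using K nx by (simp add: \<eta>_def divide_simps)
        finally show "norm (H w b - H w a - (b - a) *\<^sub>R l (D ?z x)) \<le> \<epsilon> * norm (b - a)" by simp
      qed
      then show "\<forall>\<^sub>F b in at a within {0..1}. norm (H w b - H w a - (b - a) *\<^sub>R l (D ?z x)) \<le> \<epsilon> * norm (b - a)"
        unfolding eventually_at using \<delta>(1) nx
        by (intro exI[of _ "\<delta> / (nrm X x + 1)"]) (auto simp: dist_real_def)
    qed
    have bnd: "cmod (l (D (a *\<^sub>R x + w) x) - l (D 0 x)) \<le> K * (C * (e + nrm X w) * e)"
      if a: "a \<in> {0..1}" and w: "w \<in> {0, y}" for a w
    proof -
      let ?z = "a *\<^sub>R x + w"
      have zU: "?z \<in> ?U" "nrm X ?z < d" "?z \<in> vecs X" "nrm X ?z \<le> e + nrm X w" using ball[OF a w] by auto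
      have "nrm Y (D ?z x - D 0 x) \<le> C * nrm X ?z * nrm X x" by (rule DL[OF zU(1,2) x])
      also have "\<dots> \<le> C * (e + nrm X w) * e"
        using zU xe e0 \<open>C \<ge> 0\<close> normed_nonneg[OF X] x w y normed_zero[OF X]
        by (intro mult_mono mult_nonneg_nonneg) auto
      finally have "nrm Y (D ?z x - D 0 x) \<le> C * (e + nrm X w) * e" .
      moreover have "D ?z x - D 0 x \<in> vecs Y"
        by (intro normed_diff(1)[OF Y] blin_spaceD(1)[OF DU] zU z0 x)
      ultimately have "cmod (l (D ?z x - D 0 x)) \<le> K * (C * (e + nrm X w) * e)"
        using lK K by (meson mult_left_mono order_trans)
      then show ?thesis using l_diff by simp
    qed
    \<comment> \<open>The 3 counts e + e for the point \<open>a x + y\<close> and e for the point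
      \<open>a x\<close>, both compared with the derivative at 0.\<close>
    have "norm ((H y 1 - H 0 1) - (H y 0 - H 0 0)) \<le> (3 * C * K * e\<^sup>2) * norm (1 - 0 :: real)"
    proof (rule differentiable_bound[where S = "{0..1}" and
          f = "\<lambda>a. H y a - H 0 a" and f' = "\<lambda>a h. h *\<^sub>R (l (D (a *\<^sub>R x + y) x) - l (D (a *\<^sub>R x + 0) x))"])
      fix a :: real assume a: "a \<in> {0..1}"
      show "((\<lambda>a. H y a - H 0 a) has_derivative (\<lambda>h. h *\<^sub>R (l (D (a *\<^sub>R x + y) x) - l (D (a *\<^sub>R x + 0) x)))) (at a within {0..1})"
        using has_vector_derivative_diff[OF der[OF a, of y] der[OF a, of 0]]
        by (simp add: has_vector_derivative_def)
      have "cmod (l (D (a *\<^sub>R x + y) x) - l (D (a *\<^sub>R x + 0) x)) \<le>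
         cmod (l (D (a *\<^sub>R x + y) x) - l (D 0 x)) + cmod (l (D (a *\<^sub>R x + 0) x) - l (D 0 x))"
        using norm_triangle_ineq4[of "l (D (a *\<^sub>R x + y) x) - l (D 0 x)" "l (D (a *\<^sub>R x + 0) x) - l (D 0 x)"] by simp
      also have "\<dots> \<le> K * (C * (e + e) * e) + K * (C * (e + 0) * e)"
      proof (rule add_mono)
        have "K * (C * (e + nrm X y) * e) \<le> K * (C * (e + e) * e)"
          using ye K e0 \<open>C \<ge> 0\<close> by (intro mult_left_mono mult_right_mono add_left_mono) auto
        then show "cmod (l (D (a *\<^sub>R x + y) x) - l (D 0 x)) \<le> K * (C * (e + e) * e)"
          using bnd[OF a, of y] by simp
        show "cmod (l (D (a *\<^sub>R x + 0) x) - l (D 0 x)) \<le> K * (C * (e + 0) * e)"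
          using bnd[OF a, of 0] normed_zero[OF X] by simp
      qed
      also have "\<dots> = 3 * C * K * e\<^sup>2" by (simp add: power2_eq_square algebra_simps)
      finally show "onorm (\<lambda>h. h *\<^sub>R (l (D (a *\<^sub>R x + y) x) - l (D (a *\<^sub>R x + 0) x))) \<le> 3 * C * K * e\<^sup>2"
        by (intro onorm_le) (simp add: mult.commute mult_left_mono)
    qed auto
    then show "cmod (l (F (x + y)) - l (F x) - l (F y) + l (F 0)) \<le> 3 * C * K * e\<^sup>2"
      by (simp add: H_def algebra_simps)
  qed
qed

section \<open>Schwartz functions and Gaussians\<close>

lemma vderiv_Suc: "vderiv (Suc b) \<phi> = (\<lambda>x. vector_derivative (vderiv b \<phi>) (at x))"
  by (simp add: vderiv_def)

text \<open>Lets an explicit sequence of successive derivatives be recognised as the iterated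
  \<open>vector_derivative\<close>, so that Schwartz membership can be proved from closed
  formulas.\<close>

lemma vderiv_eqI:
  assumes "\<And>j x. (f j has_vector_derivative f (Suc j) x) (at x)"
  shows "vderiv b (f 0) = f b"
proof (induction b)
  case (Suc b)
  then show ?case using vector_derivative_at[OF assms[of b]] by (auto simp: vderiv_Suc)
qed (simp add: vderiv_def)

lemma schwartzI:
  assumes "\<And>j x. (f j has_vector_derivative f (Suc j) x) (at x)"
    and "\<And>a j. \<exists>C. \<forall>x. \<bar>x\<bar> ^ a * cmod (f j x) \<le> C"
  shows "f 0 \<in> schwartz"
proof -
  have *: "vderiv b (f 0) = f b" for b using assms(1) by (rule vderiv_eqI)
  have "\<forall>b x. f b differentiable at x"
    using assms(1) by (auto intro: differentiableI_vector)
  moreover have "\<forall>a b. bdd_above (range (\<lambda>x. \<bar>x\<bar> ^ a * cmod (f b x)))"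
    using assms(2) unfolding bdd_above_def by auto
  ultimately show ?thesis by (simp add: schwartz_def *)
qed

lemma schwartzD:
  assumes "\<phi> \<in> schwartz"
  shows schwartz_deriv: "(vderiv b \<phi> has_vector_derivative vderiv (Suc b) \<phi> x) (at x)"
    and schwartz_bdd: "bdd_above (range (\<lambda>x. \<bar>x\<bar> ^ a * cmod (vderiv b \<phi> x)))"
    and schwartz_bound: "\<exists>C. \<forall>x. \<bar>x\<bar> ^ a * cmod (vderiv b \<phi> x) \<le> C"
proof -
  show "(vderiv b \<phi> has_vector_derivative vderiv (Suc b) \<phi> x) (at x)"
    using assms unfolding schwartz_def vderiv_Suc by (auto simp: vector_derivative_works)
  show bdd: "bdd_above (range (\<lambda>x. \<bar>x\<bar> ^ a * cmod (vderiv b \<phi> x)))"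
    using assms unfolding schwartz_def by auto
  then show "\<exists>C. \<forall>x. \<bar>x\<bar> ^ a * cmod (vderiv b \<phi> x) \<le> C"
    unfolding bdd_above_def by auto
qed

lemma vderiv_0 [simp]: "vderiv 0 \<phi> = \<phi>" by (simp add: vderiv_def)

lemma schwartz_vderiv: "\<phi> \<in> schwartz \<Longrightarrow> vderiv b \<phi> \<in> schwartz"
  using schwartzI[of "\<lambda>j. vderiv (j + b) \<phi>"] schwartzD[of \<phi>] by simp

lemma vderiv_vderiv: "vderiv a (vderiv b \<phi>) = vderiv (a + b) \<phi>"
  by (simp add: vderiv_def funpow_add)

lemma schwartz_continuous: "\<phi> \<in> schwartz \<Longrightarrow> continuous_on A \<phi>"
  using schwartz_deriv[of \<phi> 0]
  by (auto intro!: continuous_at_imp_continuous_on has_vector_derivative_continuous)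

lemma schwartz_measurable: "\<phi> \<in> schwartz \<Longrightarrow> \<phi> \<in> borel_measurable borel"
  by (intro borel_measurable_continuous_onI schwartz_continuous)

section \<open>Integrability and stability of Schwartz functions\<close>

lemma integrable_inverse_one_plus_square: "integrable lborel (\<lambda>x::real. inverse (1 + x\<^sup>2))"
proof -
  have "set_integrable lborel (einterval (-\<infinity>) \<infinity>) (\<lambda>x. inverse (1 + x\<^sup>2))"
    by (rule integrable_inverse_1_plus_square)
  then show ?thesis by (simp add: set_integrable_def einterval_def)
qed

text \<open>The moments of order 0 and 2 add up to a bound on
  \<open>(1 + x^2) * cmod (\<phi> x)\<close>, and the majorant obtained in this way is
  integrable.\<close>

lemma schwartz_decay:
  assumes "\<phi> \<in> schwartz"
  shows "\<exists>C. \<forall>x. cmod (\<phi> x) \<le> C * inverse (1 + x\<^sup>2)"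
proof -
  obtain C0 C2 where C: "\<And>x. \<bar>x\<bar> ^ 0 * cmod (vderiv 0 \<phi> x) \<le> C0" "\<And>x. \<bar>x\<bar> ^ 2 * cmod (vderiv 0 \<phi> x) \<le> C2"
    using schwartz_bound[OF assms, of 0 0] schwartz_bound[OF assms, of 2 0] by blast
  have "cmod (\<phi> x) \<le> (C0 + C2) * inverse (1 + x\<^sup>2)" for x
  proof -
    have "0 < 1 + x\<^sup>2" by (rule add_pos_nonneg) auto
    then show ?thesis using C[of x] by (simp add: field_simps)
  qed
  then show ?thesis by blast
qed

lemma integrable_decay:
  assumes "f \<in> borel_measurable borel" "\<And>x::real. norm (f x :: complex) \<le> C * inverse (1 + x\<^sup>2)"
  shows "integrable lborel f"
proof (rule Bochner_Integration.integrable_bound)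
  show "integrable lborel (\<lambda>x::real. C * inverse (1 + x\<^sup>2))"
    using integrable_inverse_one_plus_square by simp
  show "AE x in lborel. norm (f x) \<le> norm (C * inverse (1 + x\<^sup>2))"
    using assms(2) by (auto intro: order_trans[OF _ abs_ge_self])
qed (use assms in simp)

lemma schwartz_integrable: "\<phi> \<in> schwartz \<Longrightarrow> integrable lborel \<phi>"
  using schwartz_decay integrable_decay schwartz_measurable by blast

lemma schwartz_add:
  assumes "\<phi> \<in> schwartz" "\<psi> \<in> schwartz"
  shows "(\<lambda>x. \<phi> x + \<psi> x) \<in> schwartz"
proof -
  have "(\<lambda>x. vderiv 0 \<phi> x + vderiv 0 \<psi> x) \<in> schwartz"
  proof (rule schwartzI)
    fix j x
    show "((\<lambda>x. vderiv j \<phi> x + vderiv j \<psi> x) has_vector_derivative vderiv (Suc j) \<phi> x + vderiv (Suc j) \<psi> x) (at x)"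
      by (intro has_vector_derivative_add schwartz_deriv assms)
  next
    fix a j
    obtain C D where "\<And>x. \<bar>x\<bar> ^ a * cmod (vderiv j \<phi> x) \<le> C" "\<And>x. \<bar>x\<bar> ^ a * cmod (vderiv j \<psi> x) \<le> D"
      using schwartz_bound[OF assms(1)] schwartz_bound[OF assms(2)] by blast
    then have "\<bar>x\<bar> ^ a * cmod (vderiv j \<phi> x + vderiv j \<psi> x) \<le> C + D" for x
      using mult_left_mono[OF norm_triangle_ineq[of "vderiv j \<phi> x" "vderiv j \<psi> x"], of "\<bar>x\<bar> ^ a"]
      by (simp add: distrib_left) (smt (verit))
    then show "\<exists>C. \<forall>x. \<bar>x\<bar> ^ a * cmod (vderiv j \<phi> x + vderiv j \<psi> x) \<le> C" by blast
  qed
  then show ?thesis by simp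
qed

lemma schwartz_cmult:
  assumes "\<phi> \<in> schwartz"
  shows "(\<lambda>x. c * \<phi> x) \<in> schwartz"
proof -
  have "(\<lambda>x. c * vderiv 0 \<phi> x) \<in> schwartz"
  proof (rule schwartzI)
    fix j x
    show "((\<lambda>x. c * vderiv j \<phi> x) has_vector_derivative c * vderiv (Suc j) \<phi> x) (at x)"
      by (intro has_vector_derivative_mult_right schwartz_deriv assms)
  next
    fix a j
    obtain C where "\<And>x. \<bar>x\<bar> ^ a * cmod (vderiv j \<phi> x) \<le> C"
      using schwartz_bound[OF assms(1)] by blast
    then have "\<bar>x\<bar> ^ a * cmod (c * vderiv j \<phi> x) \<le> cmod c * C" for x
      using mult_left_mono[of "\<bar>x\<bar> ^ a * cmod (vderiv j \<phi> x)" C "cmod c"] by (simp add: norm_mult mult_ac)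
    then show "\<exists>C. \<forall>x. \<bar>x\<bar> ^ a * cmod (c * vderiv j \<phi> x) \<le> C" by blast
  qed
  then show ?thesis by simp
qed

lemma schwartz_mult_x:
  assumes "\<phi> \<in> schwartz"
  shows "(\<lambda>x. complex_of_real x * \<phi> x) \<in> schwartz"
proof -
  \<comment> \<open>Leibniz: the j-th derivative of \<open>x * \<phi> x\<close> has the extra term j
    times the derivative of order j - 1. For j = 0 the truncated \<open>j - 1\<close> is 0, but the
    factor j removes that term.\<close>
  let ?f = "\<lambda>j x. complex_of_real x * vderiv j \<phi> x + of_nat j * vderiv (j - 1) \<phi> x"
  have "?f 0 \<in> schwartz"
  proof (rule schwartzI)
    fix j x
    have 1: "((\<lambda>x. complex_of_real x * vderiv j \<phi> x) has_vector_derivative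
       (complex_of_real x * vderiv (Suc j) \<phi> x + 1 * vderiv j \<phi> x)) (at x)"
      by (intro has_vector_derivative_mult schwartz_deriv assms
          has_vector_derivative_of_real[OF DERIV_ident, simplified])
    have 2: "((\<lambda>x. of_nat j * vderiv (j - 1) \<phi> x) has_vector_derivative of_nat j * vderiv j \<phi> x) (at x)"
    proof (cases j)
      case (Suc i)
      then show ?thesis using has_vector_derivative_mult_right[OF schwartz_deriv[OF assms, of i x], of "of_nat j"] by simp
    qed simp
    show "(?f j has_vector_derivative ?f (Suc j) x) (at x)"
      using has_vector_derivative_add[OF 1 2] by (simp add: algebra_simps)
  next
    fix a j
    obtain C D where CD: "\<And>x. \<bar>x\<bar> ^ Suc a * cmod (vderiv j \<phi> x) \<le> C" "\<And>x. \<bar>x\<bar> ^ a * cmod (vderiv (j - 1) \<phi> x) \<le> D"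
      using schwartz_bound[OF assms(1)] by meson
    have "\<bar>x\<bar> ^ a * cmod (?f j x) \<le> C + of_nat j * D" for x
    proof -
      have "\<bar>x\<bar> ^ a * cmod (?f j x) \<le> \<bar>x\<bar> ^ a * (cmod (complex_of_real x * vderiv j \<phi> x) + cmod (of_nat j * vderiv (j - 1) \<phi> x))"
        by (intro mult_left_mono norm_triangle_ineq) auto
      also have "\<dots> = \<bar>x\<bar> ^ Suc a * cmod (vderiv j \<phi> x) + of_nat j * (\<bar>x\<bar> ^ a * cmod (vderiv (j - 1) \<phi> x))"
        by (simp add: norm_mult algebra_simps)
      also have "\<dots> \<le> C + of_nat j * D" by (intro add_mono mult_left_mono CD) auto
      finally show ?thesis .
    qed
    then show "\<exists>C. \<forall>x. \<bar>x\<bar> ^ a * cmod (?f j x) \<le> C" by blast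
  qed
  then show ?thesis by simp
qed

lemma schwartz_mult_power:
  assumes "\<phi> \<in> schwartz"
  shows "(\<lambda>x. (c * complex_of_real x) ^ j * \<phi> x) \<in> schwartz"
proof (induction j)
  case (Suc j)
  then show ?case using schwartz_cmult[OF schwartz_mult_x[OF Suc], of c] by (simp add: mult_ac)
qed (use assms in simp)

lemma schwartz_tendsto_0:
  assumes "\<phi> \<in> schwartz"
  shows "(\<phi> \<longlongrightarrow> 0) at_top" "(\<phi> \<longlongrightarrow> 0) at_bot"
proof -
  obtain C where C: "\<And>x. cmod (\<phi> x) \<le> C * inverse (1 + x\<^sup>2)" using schwartz_decay[OF assms] by blast
  have 1: "((\<lambda>x::real. C * inverse (1 + x\<^sup>2)) \<longlongrightarrow> 0) at_top" by real_asymp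
  have 2: "((\<lambda>x::real. C * inverse (1 + x\<^sup>2)) \<longlongrightarrow> 0) at_bot" by real_asymp
  show "(\<phi> \<longlongrightarrow> 0) at_top" by (rule Lim_null_comparison[OF always_eventually 1]) (use C in auto)
  show "(\<phi> \<longlongrightarrow> 0) at_bot" by (rule Lim_null_comparison[OF always_eventually 2]) (use C in auto)
qed

section \<open>The Fourier transform on Schwartz functions\<close>

lemma cmod_exp_mult_ii [simp]: "cmod (exp (- (\<i> * complex_of_real y))) = 1" "cmod (exp (\<i> * complex_of_real y)) = 1"
  by (simp_all add: norm_exp_eq_Re)

lemma integrable_phase:
  assumes "integrable lborel (\<phi> :: real \<Rightarrow> complex)"
  shows "integrable lborel (\<lambda>x. exp (- \<i> * complex_of_real (\<xi> * x)) * \<phi> x)"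
    "integrable lborel (\<lambda>x. exp (\<i> * complex_of_real (\<xi> * x)) * \<phi> x)"
proof -
  have [measurable]: "\<phi> \<in> borel_measurable lborel" using assms by auto
  show "integrable lborel (\<lambda>x. exp (- \<i> * complex_of_real (\<xi> * x)) * \<phi> x)"
    by (rule Bochner_Integration.integrable_bound[OF assms]) (simp_all add: norm_mult)
  show "integrable lborel (\<lambda>x. exp (\<i> * complex_of_real (\<xi> * x)) * \<phi> x)"
    by (rule Bochner_Integration.integrable_bound[OF assms]) (simp_all add: norm_mult)
qed

text \<open>Differentiation under the integral by dominated convergence. The Taylor remainder r of
  the exponential is bounded in two ways: linearly in x, which gives an integrable majorant from the
  first moment alone, and by \<open>|y - \<xi>| x^2\<close>, which is used only for the pointwise
  limit 0.\<close>

lemma fourier_vector_derivative: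
  assumes i1: "integrable lborel \<phi>" and i2: "integrable lborel (\<lambda>x. complex_of_real x * \<phi> x)"
  shows "(fourier \<phi> has_vector_derivative fourier (\<lambda>x. - \<i> * complex_of_real x * \<phi> x) \<xi>) (at \<xi>)"
proof -
  let ?e = "\<lambda>\<xi> x. exp (- \<i> * complex_of_real (\<xi> * x))"
  define L where "L = fourier (\<lambda>x. - \<i> * complex_of_real x * \<phi> x) \<xi>"
  have m: "\<phi> \<in> borel_measurable borel" using i1 by auto
  have i3: "integrable lborel (\<lambda>x. - \<i> * complex_of_real x * \<phi> x)"
    using integrable_mult_right[OF i2, of "- \<i>"] by (simp add: mult_ac)
  define r where "r = (\<lambda>y x. cmod (exp (\<i> * complex_of_real (- (y - \<xi>) * x)) - 1 - \<i> * complex_of_real (- (y - \<xi>) * x)) / \<bar>y - \<xi>\<bar> * cmod (\<phi> x))"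
  have r2: "r y x \<le> 2 * cmod (complex_of_real x * \<phi> x)" if "y \<noteq> \<xi>" for y x
  proof -
    have "cmod (exp (\<i> * complex_of_real (- (y - \<xi>) * x)) - 1 - \<i> * complex_of_real (- (y - \<xi>) * x)) \<le> 2 * \<bar>y - \<xi>\<bar> * \<bar>x\<bar>"
      using iexp_approx2[of "- (y - \<xi>) * x" 1] by (simp add: diff_diff_eq abs_mult abs_minus_commute)
    then have "cmod (exp (\<i> * complex_of_real (- (y - \<xi>) * x)) - 1 - \<i> * complex_of_real (- (y - \<xi>) * x)) / \<bar>y - \<xi>\<bar> \<le> 2 * \<bar>x\<bar>"
      using that by (simp add: pos_divide_le_eq mult_ac)
    from mult_right_mono[OF this, of "cmod (\<phi> x)"] show ?thesis by (simp add: r_def norm_mult)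
  qed
  have r1: "r y x \<le> \<bar>y - \<xi>\<bar> * (x\<^sup>2 * cmod (\<phi> x))" if "y \<noteq> \<xi>" for y x
  proof -
    have "cmod (exp (\<i> * complex_of_real (- (y - \<xi>) * x)) - 1 - \<i> * complex_of_real (- (y - \<xi>) * x)) \<le> \<bar>(y - \<xi>) * x\<bar>\<^sup>2 / 2"
      using iexp_approx1[of "- (y - \<xi>) * x" 1]
      by (simp only: sum.atMost_Suc atMost_0 One_nat_def) (simp add: diff_diff_eq abs_mult power2_eq_square abs_minus_commute)
    also have "\<dots> \<le> \<bar>y - \<xi>\<bar>\<^sup>2 * x\<^sup>2" by (simp add: power_mult_distrib)
    finally have "cmod (exp (\<i> * complex_of_real (- (y - \<xi>) * x)) - 1 - \<i> * complex_of_real (- (y - \<xi>) * x)) / \<bar>y - \<xi>\<bar> \<le> \<bar>y - \<xi>\<bar> * x\<^sup>2"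
      using that by (simp add: pos_divide_le_eq power2_eq_square mult_ac)
    from mult_right_mono[OF this, of "cmod (\<phi> x)"] show ?thesis by (simp add: r_def mult_ac)
  qed
  have r0: "0 \<le> r y x" for y x by (simp add: r_def)
  have rm: "r y \<in> borel_measurable lborel" for y
    using m unfolding r_def by measurable
  have ri: "integrable lborel (r y)" if "y \<noteq> \<xi>" for y
    by (rule Bochner_Integration.integrable_bound[where f = "\<lambda>x. 2 * cmod (complex_of_real x * \<phi> x)"])
      (use i2 rm r2[OF that] r0 in auto)
  have main: "norm (fourier \<phi> y - fourier \<phi> \<xi> - (y - \<xi>) *\<^sub>R L) / norm (y - \<xi>) \<le> (LINT x|lborel. r y x)"
    if y: "y \<noteq> \<xi>" for y
  proof -
    have "fourier \<phi> y - fourier \<phi> \<xi> - (y - \<xi>) *\<^sub>R L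
      = (LINT x|lborel. ?e y x * \<phi> x - ?e \<xi> x * \<phi> x - (y - \<xi>) *\<^sub>R (?e \<xi> x * (- \<i> * complex_of_real x * \<phi> x)))"
      unfolding fourier_def L_def
      by (simp only: Bochner_Integration.integral_diff[OF Bochner_Integration.integrable_diff[OF integrable_phase(1)[OF i1] integrable_phase(1)[OF i1]] integrable_scaleR_right[OF integrable_phase(1)[OF i3]]]
          Bochner_Integration.integral_diff[OF integrable_phase(1)[OF i1] integrable_phase(1)[OF i1]] integral_scaleR_right)
    also have "norm \<dots> \<le> (LINT x|lborel. \<bar>y - \<xi>\<bar> * r y x)"
    proof (rule order_trans[OF integral_norm_bound], rule integral_mono_AE')
      show "integrable lborel (\<lambda>x. \<bar>y - \<xi>\<bar> * r y x)" using ri[OF y] by simp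
      show "AE x in lborel. cmod (?e y x * \<phi> x - ?e \<xi> x * \<phi> x - (y - \<xi>) *\<^sub>R (?e \<xi> x * (- \<i> * complex_of_real x * \<phi> x))) \<le> \<bar>y - \<xi>\<bar> * r y x"
      proof (intro AE_I2)
        fix x
        have "?e y x = ?e \<xi> x * exp (\<i> * complex_of_real (- (y - \<xi>) * x))"
          unfolding exp_add[symmetric] by (simp add: algebra_simps)
        then have "?e y x * \<phi> x - ?e \<xi> x * \<phi> x - (y - \<xi>) *\<^sub>R (?e \<xi> x * (- \<i> * complex_of_real x * \<phi> x))
           = ?e \<xi> x * (exp (\<i> * complex_of_real (- (y - \<xi>) * x)) - 1 - \<i> * complex_of_real (- (y - \<xi>) * x)) * \<phi> x"
          by (simp add: scaleR_conv_of_real algebra_simps)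
        then show "cmod (?e y x * \<phi> x - ?e \<xi> x * \<phi> x - (y - \<xi>) *\<^sub>R (?e \<xi> x * (- \<i> * complex_of_real x * \<phi> x))) \<le> \<bar>y - \<xi>\<bar> * r y x"
          using y by (simp add: norm_mult r_def)
      qed
    qed (use r0 in auto)
    also have "\<dots> = \<bar>y - \<xi>\<bar> * (LINT x|lborel. r y x)" by simp
    finally show ?thesis using y by (simp add: pos_divide_le_eq mult.commute)
  qed
  have lim: "((\<lambda>y. LINT x|lborel. r y x) \<longlongrightarrow> 0) (at \<xi>)"
    unfolding tendsto_at_iff_sequentially comp_def
  proof (intro allI impI)
    fix Y assume Y: "\<forall>i. Y i \<in> UNIV - {\<xi>}" "Y \<longlonglongrightarrow> \<xi>"
    have "(\<lambda>i. LINT x|lborel. r (Y i) x) \<longlonglongrightarrow> (LINT x|(lborel::real measure). 0)"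
    proof (rule integral_dominated_convergence[where s = "\<lambda>i. r (Y i)" and f = "\<lambda>x. 0" and w = "\<lambda>x. 2 * cmod (complex_of_real x * \<phi> x)"])
      show "integrable lborel (\<lambda>x. 2 * cmod (complex_of_real x * \<phi> x))" using i2 by simp
      show "AE x in lborel. norm (r (Y i) x) \<le> 2 * cmod (complex_of_real x * \<phi> x)" for i
        using r2[of "Y i"] r0 Y(1) by auto
      show "AE x in lborel. (\<lambda>i. r (Y i) x) \<longlonglongrightarrow> 0"
      proof (intro AE_I2, rule Lim_null_comparison)
        fix x
        show "\<forall>\<^sub>F i in sequentially. norm (r (Y i) x) \<le> \<bar>Y i - \<xi>\<bar> * (x\<^sup>2 * cmod (\<phi> x))"
          using r1[of _ x] r0 Y(1) by (intro always_eventually) auto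
        have "(\<lambda>i. \<bar>Y i - \<xi>\<bar> * (x\<^sup>2 * cmod (\<phi> x))) \<longlonglongrightarrow> \<bar>\<xi> - \<xi>\<bar> * (x\<^sup>2 * cmod (\<phi> x))"
          by (intro tendsto_intros Y)
        then show "(\<lambda>i. \<bar>Y i - \<xi>\<bar> * (x\<^sup>2 * cmod (\<phi> x))) \<longlonglongrightarrow> 0" by simp
      qed
    qed (use rm in auto)
    then show "(\<lambda>i. LINT x|lborel. r (Y i) x) \<longlonglongrightarrow> 0" by simp
  qed
  have "((\<lambda>y. norm (fourier \<phi> y - fourier \<phi> \<xi> - (y - \<xi>) *\<^sub>R L) / norm (y - \<xi>)) \<longlongrightarrow> 0) (at \<xi>)"
    by (rule Lim_null_comparison[OF _ lim]) (use main in \<open>auto simp: eventually_at intro!: exI[of _ 1]\<close>)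
  then show ?thesis
    unfolding L_def[symmetric] has_vector_derivative_def has_derivative_iff_norm
    by (auto intro: bounded_linear_scaleR_left)
qed

lemma exp_vector_derivative:
  "((\<lambda>x. exp (c * complex_of_real x)) has_vector_derivative c * exp (c * complex_of_real x)) (at x)"
proof -
  have "((\<lambda>z. exp (c * z)) has_field_derivative c * exp (c * complex_of_real x)) (at (complex_of_real x))"
    by (auto intro!: derivative_eq_intros)
  then show ?thesis by (rule has_vector_derivative_real_field)
qed

text \<open>Integration by parts on the whole line, in the form of the fundamental theorem for the
  product of \<open>\<phi>\<close> with the exponential, which vanishes at both ends.\<close>

lemma fourier_vderiv:
  assumes "\<phi> \<in> schwartz"
  shows "fourier (vderiv (Suc 0) \<phi>) \<xi> = \<i> * complex_of_real \<xi> * fourier \<phi> \<xi>"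
proof -
  let ?e = "\<lambda>x. exp (- \<i> * complex_of_real (\<xi> * x))"
  let ?F = "\<lambda>x. ?e x * \<phi> x"
  let ?f = "\<lambda>x. ?e x * vderiv (Suc 0) \<phi> x + - \<i> * complex_of_real \<xi> * (?e x * \<phi> x)"
  have i: "integrable lborel \<phi>" "integrable lborel (vderiv (Suc 0) \<phi>)"
    by (intro schwartz_integrable schwartz_vderiv assms)+
  have int: "integrable lborel ?f"
    using integrable_phase(1)[OF i(1), of \<xi>] integrable_phase(1)[OF i(2), of \<xi>]
    by (intro Bochner_Integration.integrable_add integrable_mult_right) auto
  have F0: "(?F \<longlongrightarrow> 0) at_top" "(?F \<longlongrightarrow> 0) at_bot"
  proof -
    have n: "norm (?F x) = norm (\<phi> x)" for x by (simp add: norm_mult)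
    show "(?F \<longlongrightarrow> 0) at_top" "(?F \<longlongrightarrow> 0) at_bot"
      by (rule tendsto_norm_zero_cancel, unfold n, intro tendsto_norm_zero schwartz_tendsto_0 assms)+
  qed
  have "(LBINT x=-\<infinity>..\<infinity>. ?f x) = 0 - 0"
  proof (rule interval_integral_FTC_integrable[where F = ?F])
    fix x :: real
    have "(\<phi> has_vector_derivative vderiv (Suc 0) \<phi> x) (at x)" using schwartz_deriv[OF assms, of 0 x] by simp
    have "(?e has_vector_derivative - \<i> * complex_of_real \<xi> * ?e x) (at x)"
      using exp_vector_derivative[of "- \<i> * complex_of_real \<xi>" x] by (simp add: mult.assoc)
    from has_vector_derivative_mult[OF this \<open>(\<phi> has_vector_derivative vderiv (Suc 0) \<phi> x) (at x)\<close>]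
    show "(?F has_vector_derivative ?f x) (at x)" by (simp add: mult.assoc)
    have "continuous_on UNIV ?f"
      by (intro continuous_intros schwartz_continuous schwartz_vderiv assms)
    then show "isCont ?f x" by (simp add: continuous_on_eq_continuous_at)
  next
    show "set_integrable lborel (einterval (-\<infinity>) \<infinity>) ?f" using int by (simp add: set_integrable_def einterval_def)
  qed (use F0 in \<open>simp_all add: ereal_tendsto_simps\<close>)
  then have "(LINT x|lborel. ?f x) = 0"
    by (simp add: interval_lebesgue_integral_def einterval_def set_lebesgue_integral_def)
  then show ?thesis
    using integrable_phase(1)[OF i(1), of \<xi>] integrable_phase(1)[OF i(2), of \<xi>]
    unfolding fourier_def by simp
qed

lemma fourier_bound:
  assumes "integrable lborel \<phi>"
  shows "cmod (fourier \<phi> \<xi>) \<le> (LINT x|lborel. cmod (\<phi> x))"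
  unfolding fourier_def using integral_norm_bound[of lborel "\<lambda>x. exp (- \<i> * complex_of_real (\<xi> * x)) * \<phi> x"]
  by (simp add: norm_mult)

lemma fourier_vderiv_power:
  assumes "\<phi> \<in> schwartz"
  shows "fourier (vderiv a \<phi>) \<xi> = (\<i> * complex_of_real \<xi>) ^ a * fourier \<phi> \<xi>"
proof (induction a)
  case (Suc a)
  then show ?case using fourier_vderiv[OF schwartz_vderiv[OF assms, of a], of \<xi>]
    by (simp add: vderiv_vderiv)
qed simp

text \<open>Derivatives in frequency are transforms of \<open>(- i x)^j \<phi>\<close>, and powers
  of the frequency are transforms of derivatives; each seminorm is thus at most the L1 norm of a
  Schwartz function.\<close>

lemma fourier_schwartz:
  assumes "\<phi> \<in> schwartz"
  shows "fourier \<phi> \<in> schwartz"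
proof -
  let ?m = "\<lambda>j x. (- \<i> * complex_of_real x) ^ j * \<phi> x"
  have m: "?m j \<in> schwartz" for j by (rule schwartz_mult_power[OF assms])
  have "fourier (?m 0) \<in> schwartz"
  proof (rule schwartzI[where f = "\<lambda>j. fourier (?m j)"])
    fix j \<xi>
    show "(fourier (?m j) has_vector_derivative fourier (?m (Suc j)) \<xi>) (at \<xi>)"
      using fourier_vector_derivative[OF schwartz_integrable[OF m[of j]] schwartz_integrable[OF schwartz_mult_x[OF m[of j]]], of \<xi>]
      by (simp add: mult_ac)
  next
    fix a j
    have "\<bar>\<xi>\<bar> ^ a * cmod (fourier (?m j) \<xi>) \<le> (LINT x|lborel. cmod (vderiv a (?m j) x))" for \<xi>
    proof -
      have "\<bar>\<xi>\<bar> ^ a * cmod (fourier (?m j) \<xi>) = cmod (fourier (vderiv a (?m j)) \<xi>)"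
        unfolding fourier_vderiv_power[OF m] by (simp add: norm_mult norm_power)
      also have "\<dots> \<le> (LINT x|lborel. cmod (vderiv a (?m j) x))"
        by (intro fourier_bound schwartz_integrable schwartz_vderiv m)
      finally show ?thesis .
    qed
    then show "\<exists>C. \<forall>\<xi>. \<bar>\<xi>\<bar> ^ a * cmod (fourier (?m j) \<xi>) \<le> C" by blast
  qed
  then show ?thesis by simp
qed

section \<open>Gaussians with a complex linear exponent\<close>

definition gauss :: "complex \<Rightarrow> real \<Rightarrow> real \<Rightarrow> complex"
  where "gauss a b x = exp (a * complex_of_real x - complex_of_real (b * x\<^sup>2))"

lemma cmod_gauss: "cmod (gauss a b x) = exp (Re a * x - b * x\<^sup>2)"
  by (simp add: gauss_def norm_exp_eq_Re)

lemma gauss_vector_derivative: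
  "(gauss a b has_vector_derivative (a - 2 * complex_of_real b * complex_of_real x) * gauss a b x) (at x)"
proof -
  have "((\<lambda>z. exp (a * z - complex_of_real b * z\<^sup>2)) has_field_derivative
      (a - 2 * complex_of_real b * complex_of_real x) * exp (a * complex_of_real x - complex_of_real b * (complex_of_real x)\<^sup>2)) (at (complex_of_real x))"
    by (auto intro!: derivative_eq_intros simp: algebra_simps)
  from has_vector_derivative_real_field[OF this] show ?thesis unfolding gauss_def[abs_def] by simp
qed

lemma power_le_exp: fixes y :: real assumes "0 \<le> y" shows "y ^ n \<le> fact n * exp y"
proof -
  have "(\<Sum>k\<in>{n}. inverse (fact k) * y ^ k) \<le> (\<Sum>k. inverse (fact k) * y ^ k)"
    by (rule sum_le_suminf) (use assms summable_exp[of y] in auto)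
  then have "inverse (fact n) * y ^ n \<le> exp y" by (simp add: exp_def scaleR_conv_of_real)
  then show ?thesis by (simp add: field_simps)
qed

lemma power_gauss_bound:
  fixes b c :: real
  assumes "b > 0"
  shows "\<exists>C. \<forall>x. \<bar>x\<bar> ^ n * exp (c * x - b * x\<^sup>2) \<le> C"
proof -
  \<comment> \<open>The power is dominated by the exponential of |x|, which raises the linear
    coefficient to |c| + 1; completing the square bounds the rest.\<close>
  have "\<bar>x\<bar> ^ n * exp (c * x - b * x\<^sup>2) \<le> fact n * exp ((\<bar>c\<bar> + 1)\<^sup>2 / (4 * b))" for x
  proof -
    have "4 * b * (d * y - b * y\<^sup>2) = d\<^sup>2 - (2 * b * y - d)\<^sup>2" for d y :: real
      by (simp add: power2_eq_square algebra_simps)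
    from this[of "\<bar>c\<bar> + 1" "\<bar>x\<bar>"]
    have "4 * b * ((\<bar>c\<bar> + 1) * \<bar>x\<bar> - b * x\<^sup>2) \<le> (\<bar>c\<bar> + 1)\<^sup>2" by simp
    then have "(\<bar>c\<bar> + 1) * \<bar>x\<bar> - b * x\<^sup>2 \<le> (\<bar>c\<bar> + 1)\<^sup>2 / (4 * b)"
      using assms by (simp add: pos_le_divide_eq mult.commute)
    moreover have "c * x \<le> \<bar>c\<bar> * \<bar>x\<bar>" by (metis abs_ge_self abs_mult)
    ultimately have "\<bar>x\<bar> + (c * x - b * x\<^sup>2) \<le> (\<bar>c\<bar> + 1)\<^sup>2 / (4 * b)"
      by (simp add: distrib_right)
    then have e: "exp \<bar>x\<bar> * exp (c * x - b * x\<^sup>2) \<le> exp ((\<bar>c\<bar> + 1)\<^sup>2 / (4 * b))"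
      unfolding exp_add[symmetric] by simp
    have "\<bar>x\<bar> ^ n * exp (c * x - b * x\<^sup>2) \<le> fact n * exp \<bar>x\<bar> * exp (c * x - b * x\<^sup>2)"
      by (intro mult_right_mono power_le_exp) auto
    also have "\<dots> \<le> fact n * exp ((\<bar>c\<bar> + 1)\<^sup>2 / (4 * b))"
      unfolding mult.assoc by (intro mult_left_mono e) auto
    finally show ?thesis .
  qed
  then show ?thesis by blast
qed

lemma poly_gauss_bound:
  assumes "b > 0"
  shows "\<exists>C. \<forall>x. \<bar>x\<bar> ^ n * cmod (poly p (complex_of_real x) * gauss a b x) \<le> C"
proof (induction p arbitrary: n)
  case (pCons c p)
  obtain C where C: "\<And>x. \<bar>x\<bar> ^ Suc n * cmod (poly p (complex_of_real x) * gauss a b x) \<le> C"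
    using pCons.IH[of "Suc n"] by blast
  obtain D where D: "\<And>x. \<bar>x\<bar> ^ n * exp (Re a * x - b * x\<^sup>2) \<le> D" using power_gauss_bound[OF assms] by blast
  have "\<bar>x\<bar> ^ n * cmod (poly (pCons c p) (complex_of_real x) * gauss a b x) \<le> cmod c * D + C" for x
  proof -
    have "\<bar>x\<bar> ^ n * cmod (poly (pCons c p) (complex_of_real x) * gauss a b x)
       \<le> \<bar>x\<bar> ^ n * (cmod (c * gauss a b x) + cmod (complex_of_real x * poly p (complex_of_real x) * gauss a b x))"
      by (intro mult_left_mono) (auto simp: distrib_right intro: norm_triangle_ineq)
    also have "\<dots> = cmod c * (\<bar>x\<bar> ^ n * exp (Re a * x - b * x\<^sup>2)) + \<bar>x\<bar> ^ Suc n * cmod (poly p (complex_of_real x) * gauss a b x)"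
      by (simp add: norm_mult cmod_gauss algebra_simps)
    also have "\<dots> \<le> cmod c * D + C" by (intro add_mono mult_left_mono C D) auto
    finally show ?thesis .
  qed
  then show ?case by blast
qed (auto intro: exI[of _ 0])

lemma gauss_schwartz:
  assumes "b > 0"
  shows "gauss a b \<in> schwartz"
proof -
  \<comment> \<open>Every derivative is a polynomial times the Gaussian. The recursion adds the
    derivative of the polynomial to its product with the logarithmic derivative a - 2 b x.\<close>
  define p where "p = rec_nat 1 (\<lambda>_ p. pderiv p + [:a, - 2 * complex_of_real b:] * p)"
  have p: "p 0 = 1" "p (Suc j) = pderiv (p j) + [:a, - 2 * complex_of_real b:] * p j" for j
    by (simp_all add: p_def)
  have "(\<lambda>x. poly (p 0) (complex_of_real x) * gauss a b x) \<in> schwartz"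
  proof (rule schwartzI[where f = "\<lambda>j x. poly (p j) (complex_of_real x) * gauss a b x"])
    fix j x
    have "((\<lambda>x. poly (p j) (complex_of_real x)) has_vector_derivative poly (pderiv (p j)) (complex_of_real x)) (at x)"
      by (rule has_vector_derivative_real_field[OF poly_DERIV])
    from has_vector_derivative_mult[OF this gauss_vector_derivative[of a b x]]
    have "((\<lambda>x. poly (p j) (complex_of_real x) * gauss a b x) has_vector_derivative
        poly (p j) (complex_of_real x) * ((a - 2 * complex_of_real b * complex_of_real x) * gauss a b x)
        + poly (pderiv (p j)) (complex_of_real x) * gauss a b x) (at x)" .
    moreover have "poly (p j) (complex_of_real x) * ((a - 2 * complex_of_real b * complex_of_real x) * gauss a b x)
        + poly (pderiv (p j)) (complex_of_real x) * gauss a b x = poly (p (Suc j)) (complex_of_real x) * gauss a b x"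
    proof -
      have "poly [:a, - 2 * complex_of_real b:] (complex_of_real x) = a - 2 * complex_of_real b * complex_of_real x"
        by simp
      then show ?thesis
        by (subst p(2), subst poly_add, subst poly_mult) (simp only: distrib_left distrib_right mult_ac add_ac)
    qed
    ultimately show "((\<lambda>x. poly (p j) (complex_of_real x) * gauss a b x) has_vector_derivative poly (p (Suc j)) (complex_of_real x) * gauss a b x) (at x)"
      by simp
  qed (rule poly_gauss_bound[OF assms])
  then show ?thesis by (simp add: p)
qed

text \<open>A complex z is handled without shifting a contour: its real part moves the peak to p /
  (2 b), which a real substitution undoes, and its imaginary part, divided by sqrt (2 b), is the
  argument of the characteristic function of the standard normal law.\<close>

lemma gauss_integral:
  assumes b: "b > 0"
  shows "(LINT x|lborel. gauss z b x) = complex_of_real (sqrt (pi / b)) * exp (z\<^sup>2 / (4 * complex_of_real b))"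
proof -
  define p q where "p = Re z" and "q = Im z"
  define c where "c = sqrt (2 * b)"
  have c: "c > 0" "c\<^sup>2 = 2 * b" using b by (auto simp: c_def)
  have z: "z = complex_of_real p + \<i> * complex_of_real q" by (simp add: p_def q_def complex_eq)
  have std: "(LINT y|lborel. exp (\<i> * complex_of_real (t * y)) * complex_of_real (exp (- y\<^sup>2 / 2))) = complex_of_real (sqrt (2 * pi) * exp (- t\<^sup>2 / 2))" for t
  proof -
    have "complex_of_real (exp (- (t\<^sup>2) / 2)) = char std_normal_distribution t"
      by (simp add: char_std_normal_distribution)
    also have "\<dots> = (LINT y|lborel. std_normal_density y *\<^sub>R exp (\<i> * complex_of_real (t * y)))"
      unfolding char_def by (subst integral_density) auto
    also have "\<dots> = (LINT y|lborel. complex_of_real (1 / sqrt (2 * pi)) * (exp (\<i> * complex_of_real (t * y)) * complex_of_real (exp (- y\<^sup>2 / 2))))"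
      by (intro Bochner_Integration.integral_cong) (auto simp: normal_density_def scaleR_conv_of_real)
    also have "\<dots> = complex_of_real (1 / sqrt (2 * pi)) * (LINT y|lborel. exp (\<i> * complex_of_real (t * y)) * complex_of_real (exp (- y\<^sup>2 / 2)))"
      by simp
    finally show ?thesis by (simp add: field_simps)
  qed
  have "(LINT x|lborel. gauss z b x) = \<bar>1 / c\<bar> *\<^sub>R (LINT y|lborel. gauss z b (p / (2 * b) + (1 / c) * y))"
    using c by (intro lborel_integral_real_affine) auto
  also have "(\<lambda>y. gauss z b (p / (2 * b) + (1 / c) * y)) = (\<lambda>y. exp (complex_of_real (p\<^sup>2 / (4 * b)) + \<i> * complex_of_real (p * q / (2 * b))) *
      (exp (\<i> * complex_of_real (q / c * y)) * complex_of_real (exp (- y\<^sup>2 / 2))))"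
  proof
    fix y
    let ?x = "p / (2 * b) + (1 / c) * y"
    have w: "b * (1 / c * y)\<^sup>2 = y\<^sup>2 / 2" using b c by (simp add: power_mult_distrib power_divide)
    have A: "p = 2 * b * (p / (2 * b))" "p\<^sup>2 / (4 * b) = b * (p / (2 * b))\<^sup>2"
      using b by (simp_all add: power2_eq_square)
    have "2 * b * A * (A + v) - b * (A + v)\<^sup>2 = b * A\<^sup>2 - b * v\<^sup>2" for A v :: real
      by (simp add: power2_eq_square algebra_simps)
    from this[of "p / (2 * b)" "1 / c * y"]
    have r: "p * ?x - b * ?x\<^sup>2 = p\<^sup>2 / (4 * b) - y\<^sup>2 / 2" unfolding w A(2) A(1)[symmetric] .
    have "z * complex_of_real ?x - complex_of_real (b * ?x\<^sup>2) = complex_of_real (p * ?x - b * ?x\<^sup>2) + \<i> * complex_of_real (q * ?x)"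
      by (rule complex_eqI) (simp_all add: p_def q_def)
    also have "\<dots> = complex_of_real (p\<^sup>2 / (4 * b)) + \<i> * complex_of_real (p * q / (2 * b)) + (\<i> * complex_of_real (q / c * y) + complex_of_real (- y\<^sup>2 / 2))"
      unfolding r by (simp add: algebra_simps)
    finally show "gauss z b ?x = exp (complex_of_real (p\<^sup>2 / (4 * b)) + \<i> * complex_of_real (p * q / (2 * b))) *
      (exp (\<i> * complex_of_real (q / c * y)) * complex_of_real (exp (- y\<^sup>2 / 2)))"
      unfolding gauss_def by (simp only: exp_add exp_of_real)
  qed
  also have "\<bar>1 / c\<bar> *\<^sub>R (LINT y|lborel. exp (complex_of_real (p\<^sup>2 / (4 * b)) + \<i> * complex_of_real (p * q / (2 * b))) *
      (exp (\<i> * complex_of_real (q / c * y)) * complex_of_real (exp (- y\<^sup>2 / 2))))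
     = (1 / c) *\<^sub>R (exp (complex_of_real (p\<^sup>2 / (4 * b)) + \<i> * complex_of_real (p * q / (2 * b))) * complex_of_real (sqrt (2 * pi) * exp (- (q / c)\<^sup>2 / 2)))"
    using c by (simp only: integral_mult_right_zero std) simp
  also have "\<dots> = complex_of_real (sqrt (2 * pi) / c) * (exp (complex_of_real (p\<^sup>2 / (4 * b)) + \<i> * complex_of_real (p * q / (2 * b))) * exp (complex_of_real (- (q / c)\<^sup>2 / 2)))"
    unfolding exp_of_real by (simp add: scaleR_conv_of_real)
  also have "sqrt (2 * pi) / c = sqrt (pi / b)" using b by (simp add: c_def real_sqrt_mult real_sqrt_divide)
  also have "exp (complex_of_real (p\<^sup>2 / (4 * b)) + \<i> * complex_of_real (p * q / (2 * b))) * exp (complex_of_real (- (q / c)\<^sup>2 / 2)) = exp (z\<^sup>2 / (4 * complex_of_real b))"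
  proof -
    have "(q / c)\<^sup>2 / 2 = q\<^sup>2 / (4 * b)" using c by (simp add: power_divide)
    then have "complex_of_real (p\<^sup>2 / (4 * b)) + \<i> * complex_of_real (p * q / (2 * b)) + complex_of_real (- (q / c)\<^sup>2 / 2) = z\<^sup>2 / (4 * complex_of_real b)"
    proof -
      have "z\<^sup>2 = complex_of_real (p\<^sup>2 - q\<^sup>2) + \<i> * complex_of_real (2 * p * q)"
        by (rule complex_eqI) (simp_all add: p_def q_def power2_eq_square)
      then have "z\<^sup>2 / (4 * complex_of_real b) = complex_of_real ((p\<^sup>2 - q\<^sup>2) / (4 * b)) + \<i> * complex_of_real (2 * p * q / (4 * b))"
        by (simp add: add_divide_distrib)
      moreover have "(p\<^sup>2 - q\<^sup>2) / (4 * b) = p\<^sup>2 / (4 * b) + (- (q / c)\<^sup>2 / 2)" "2 * p * q / (4 * b) = p * q / (2 * b)"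
        using \<open>(q / c)\<^sup>2 / 2 = q\<^sup>2 / (4 * b)\<close> by (simp_all add: diff_divide_distrib)
      ultimately show ?thesis by (simp only: of_real_add add_ac)
    qed
    then show ?thesis unfolding exp_add[symmetric] by simp
  qed
  finally show ?thesis .
qed

lemma fourier_gauss:
  assumes "b > 0"
  shows "fourier (gauss a b) \<xi> = complex_of_real (sqrt (pi / b)) * exp ((a - \<i> * complex_of_real \<xi>)\<^sup>2 / (4 * complex_of_real b))"
proof -
  have "exp (- \<i> * complex_of_real (\<xi> * x)) * gauss a b x = gauss (a - \<i> * complex_of_real \<xi>) b x" for x
    unfolding gauss_def exp_add[symmetric] by (simp add: algebra_simps)
  then show ?thesis unfolding fourier_def by (simp add: gauss_integral[OF assms])
qed

text \<open>Positive and negative part have the same mass, by t = 0, and the same transform. Unless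
  the mass is zero, normalising makes them densities of probability laws with equal characteristic
  functions, and Levy's uniqueness theorem identifies them.\<close>

lemma real_iexp_unique:
  fixes h :: "real \<Rightarrow> real"
  assumes h: "integrable lborel h"
    and eq: "\<And>t. (LINT x|lborel. complex_of_real (h x) * exp (\<i> * complex_of_real (t * x))) = 0"
  shows "AE x in lborel. h x = 0"
proof -
  define P Q where "P = (\<lambda>x. max (h x) 0)" and "Q = (\<lambda>x. max (- h x) 0)"
  have PQ: "h x = P x - Q x" "0 \<le> P x" "0 \<le> Q x" for x by (auto simp: P_def Q_def)
  have hm [measurable]: "h \<in> borel_measurable borel" using h by auto
  have P [measurable]: "integrable lborel P" "P \<in> borel_measurable borel"
    and Q [measurable]: "integrable lborel Q" "Q \<in> borel_measurable borel"
    unfolding P_def Q_def using h by (auto intro!: integrable_max)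
  have eP: "integrable lborel (\<lambda>x. complex_of_real (P x) * exp (\<i> * complex_of_real (t * x)))" for t
    using integrable_phase(2)[of "\<lambda>x. complex_of_real (P x)" t] P(1) by (simp add: mult.commute)
  have eQ: "integrable lborel (\<lambda>x. complex_of_real (Q x) * exp (\<i> * complex_of_real (t * x)))" for t
    using integrable_phase(2)[of "\<lambda>x. complex_of_real (Q x)" t] Q(1) by (simp add: mult.commute)
  have eq': "(LINT x|lborel. complex_of_real (P x) * exp (\<i> * complex_of_real (t * x)))
      = (LINT x|lborel. complex_of_real (Q x) * exp (\<i> * complex_of_real (t * x)))" for t
    using eq[of t] Bochner_Integration.integral_diff[OF eP[of t] eQ[of t]] by (simp add: PQ(1) left_diff_distrib)
  define m where "m = (LINT x|lborel. P x)"
  have "complex_of_real m = complex_of_real (LINT x|lborel. Q x)"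
    using eq'[of 0] by (simp add: m_def)
  then have mQ: "m = (LINT x|lborel. Q x)" unfolding of_real_eq_iff .
  have m0: "0 \<le> m" unfolding m_def by (intro Bochner_Integration.integral_nonneg PQ)
  show ?thesis
  proof (cases "m = 0")
    case True
    have "AE x in lborel. P x = 0" "AE x in lborel. Q x = 0"
      using integral_nonneg_eq_0_iff_AE[OF P(1)] integral_nonneg_eq_0_iff_AE[OF Q(1)] PQ(2,3) True mQ m_def by auto
    then show ?thesis by eventually_elim (simp add: PQ(1))
  next
    case False
    with m0 have m: "m > 0" by simp
    have dist: "real_distribution (density lborel (\<lambda>x. ennreal (R x / m)))"
      if R: "integrable lborel R" "\<And>x. 0 \<le> R x" "(LINT x|lborel. R x) = m" for R :: "real \<Rightarrow> real"
    proof -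
      have [measurable]: "R \<in> borel_measurable borel" using R(1) by auto
      have "(\<integral>\<^sup>+x. ennreal (R x / m) \<partial>lborel) = ennreal (LINT x|lborel. R x / m)"
        using R m by (intro nn_integral_eq_integral) auto
      then have "prob_space (density lborel (\<lambda>x. ennreal (R x / m)))"
        using R m by (intro prob_spaceI) (simp add: emeasure_density)
      then show ?thesis by (simp add: real_distribution_def real_distribution_axioms_def)
    qed
    have ch: "char (density lborel (\<lambda>x. ennreal (R x / m))) t = (LINT x|lborel. complex_of_real (R x) * exp (\<i> * complex_of_real (t * x))) / complex_of_real m"
      if R: "integrable lborel R" "\<And>x. 0 \<le> R x" for R :: "real \<Rightarrow> real" and t
    proof -
      have [measurable]: "R \<in> borel_measurable borel" using R(1) by auto
      have "char (density lborel (\<lambda>x. ennreal (R x / m))) t = (LINT x|lborel. (R x / m) *\<^sub>R exp (\<i> * complex_of_real (t * x)))"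
        unfolding char_def using R m by (subst integral_density) auto
      also have "\<dots> = (LINT x|lborel. complex_of_real (R x) * exp (\<i> * complex_of_real (t * x)) / complex_of_real m)"
        by (intro Bochner_Integration.integral_cong) (auto simp: scaleR_conv_of_real)
      finally show ?thesis by simp
    qed
    have "density lborel (\<lambda>x. ennreal (P x / m)) = density lborel (\<lambda>x. ennreal (Q x / m))"
      by (rule Levy_uniqueness) (use dist P Q PQ mQ m_def ch eq' in \<open>auto simp: fun_eq_iff\<close>)
    then have "AE x in lborel. ennreal (P x / m) = ennreal (Q x / m)"
      by (subst (asm) sigma_finite_measure.density_unique_iff[OF sigma_finite_lborel]) auto
    then show ?thesis by eventually_elim (use m PQ in auto)
  qed
qed

text \<open>Conjugating the relation at - t gives it for the conjugate of h, hence for the real and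
  the imaginary part separately.\<close>

lemma iexp_unique:
  fixes h :: "real \<Rightarrow> complex"
  assumes h: "integrable lborel h"
    and eq: "\<And>t. (LINT x|lborel. h x * exp (\<i> * complex_of_real (t * x))) = 0"
  shows "AE x in lborel. h x = 0"
proof -
  have e: "integrable lborel (\<lambda>x. h x * exp (\<i> * complex_of_real (t * x)))" for t
    using integrable_phase(2)[OF h, of t] by (simp add: mult.commute)
  have eq2: "(LINT x|lborel. cnj (h x) * exp (\<i> * complex_of_real (t * x))) = 0" for t
  proof -
    have "(LINT x|lborel. cnj (h x) * exp (\<i> * complex_of_real (t * x)))
        = (LINT x|lborel. cnj (h x * exp (\<i> * complex_of_real (- t * x))))"
      by (intro Bochner_Integration.integral_cong) (auto simp: exp_cnj)
    also have "\<dots> = cnj (LINT x|lborel. h x * exp (\<i> * complex_of_real (- t * x)))"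
      by (rule Bochner_Integration.integral_cnj)
    also have "\<dots> = 0" unfolding eq by simp
    finally show ?thesis .
  qed
  have e2: "integrable lborel (\<lambda>x. cnj (h x) * exp (\<i> * complex_of_real (t * x)))" for t
    using integrable_phase(2)[of "\<lambda>x. cnj (h x)" t] h by (simp add: mult.commute)
  have "AE x in lborel. Re (h x) = 0"
  proof (rule real_iexp_unique)
    show "(LINT x|lborel. complex_of_real (Re (h x)) * exp (\<i> * complex_of_real (t * x))) = 0" for t
    proof -
      have "complex_of_real (Re (h x)) * exp (\<i> * complex_of_real (t * x))
          = (h x * exp (\<i> * complex_of_real (t * x)) + cnj (h x) * exp (\<i> * complex_of_real (t * x))) / 2" for x
        unfolding distrib_right[symmetric] complex_add_cnj by simp
      note 1 = this
      show ?thesis unfolding 1 using Bochner_Integration.integral_add[OF e e2, of t t]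
        by (simp only: eq eq2 integral_divide_zero) simp
    qed
  qed (use h in simp)
  moreover have "AE x in lborel. Im (h x) = 0"
  proof (rule real_iexp_unique)
    show "(LINT x|lborel. complex_of_real (Im (h x)) * exp (\<i> * complex_of_real (t * x))) = 0" for t
    proof -
      have "complex_of_real (Im (h x)) * exp (\<i> * complex_of_real (t * x))
          = (h x * exp (\<i> * complex_of_real (t * x)) - cnj (h x) * exp (\<i> * complex_of_real (t * x))) / (2 * \<i>)" for x
        unfolding left_diff_distrib[symmetric] complex_diff_cnj by (simp add: field_simps)
      note 1 = this
      show ?thesis unfolding 1 using Bochner_Integration.integral_diff[OF e e2, of t t]
        by (simp only: eq eq2 integral_divide_zero) simp
    qed
  qed (use h in simp)
  ultimately show ?thesis by eventually_elim (simp add: complex_eq_iff)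
qed

section \<open>Modulated Gaussians as a separating family of test functions\<close>

lemma gauss_phase: "gauss (\<i> * complex_of_real t) b x = gauss 0 b x * exp (\<i> * complex_of_real (t * x))"
  unfolding gauss_def exp_add[symmetric] by (simp add: mult.assoc)

text \<open>The product of \<open>g - g'\<close> with one fixed Gaussian is integrable and has
  vanishing Fourier transform, and the Gaussian has no zero.\<close>

lemma gauss_test_unique:
  assumes [measurable]: "g \<in> borel_measurable lborel" "g' \<in> borel_measurable lborel"
    and i: "integrable lborel (\<lambda>x. g x * gauss 0 (1/2) x)" "integrable lborel (\<lambda>x. g' x * gauss 0 (1/2) x)"
    and eq: "\<And>t. (LINT x|lborel. g x * gauss (\<i> * complex_of_real t) (1/2) x) = (LINT x|lborel. g' x * gauss (\<i> * complex_of_real t) (1/2) x)"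
  shows "AE x in lborel. g x = g' x"
proof -
  have ip: "integrable lborel (\<lambda>x. g x * gauss (\<i> * complex_of_real t) (1/2) x)" "integrable lborel (\<lambda>x. g' x * gauss (\<i> * complex_of_real t) (1/2) x)" for t
    using integrable_phase(2)[OF i(1), of t] integrable_phase(2)[OF i(2), of t] by (simp_all add: gauss_phase mult_ac)
  have "AE x in lborel. (g x - g' x) * gauss 0 (1/2) x = 0"
  proof (rule iexp_unique)
    show "integrable lborel (\<lambda>x. (g x - g' x) * gauss 0 (1 / 2) x)"
      using Bochner_Integration.integrable_diff[OF i] by (simp add: left_diff_distrib)
    show "(LINT x|lborel. (g x - g' x) * gauss 0 (1 / 2) x * exp (\<i> * complex_of_real (t * x))) = 0" for t
      using Bochner_Integration.integral_diff[OF ip[of t]] eq[of t] by (simp add: left_diff_distrib gauss_phase mult.assoc)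
  qed
  then show ?thesis by eventually_elim (simp add: gauss_def)
qed

text \<open>Makes the choice of a representative in \<open>sobolev_norm\<close> immaterial.\<close>

lemma is_function_unique:
  assumes "is_function \<Lambda> g" "is_function \<Lambda> g'"
  shows "AE x in lborel. g x = g' x"
  using assms gauss_schwartz[of "1/2"] unfolding is_function_def
  by (intro gauss_test_unique) auto

section \<open>Sobolev spaces\<close>

lemma L2_integrable_mult:
  fixes f g :: "'a \<Rightarrow> real"
  assumes [measurable]: "f \<in> borel_measurable M" "g \<in> borel_measurable M"
    and "integrable M (\<lambda>x. (f x)\<^sup>2)" "integrable M (\<lambda>x. (g x)\<^sup>2)"
  shows "integrable M (\<lambda>x. f x * g x)"
proof (rule Bochner_Integration.integrable_bound)
  show "integrable M (\<lambda>x. (f x)\<^sup>2 + (g x)\<^sup>2)" using assms by simp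
  have "\<bar>f x * g x\<bar> \<le> (f x)\<^sup>2 + (g x)\<^sup>2" for x
  proof -
    have "2 * (\<bar>f x\<bar> * \<bar>g x\<bar>) \<le> (f x)\<^sup>2 + (g x)\<^sup>2" using sum_squares_bound[of "\<bar>f x\<bar>" "\<bar>g x\<bar>"] by simp
    moreover have "0 \<le> \<bar>f x\<bar> * \<bar>g x\<bar>" by simp
    ultimately show ?thesis unfolding abs_mult by linarith
  qed
  then show "AE x in M. norm (f x * g x) \<le> norm ((f x)\<^sup>2 + (g x)\<^sup>2)" by simp
qed simp

lemma L2_Cauchy_Schwarz:
  fixes f g :: "'a \<Rightarrow> real"
  assumes [measurable]: "f \<in> borel_measurable M" "g \<in> borel_measurable M"
    and i: "integrable M (\<lambda>x. (f x)\<^sup>2)" "integrable M (\<lambda>x. (g x)\<^sup>2)"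
  shows "(LINT x|M. f x * g x) \<le> sqrt (LINT x|M. (f x)\<^sup>2) * sqrt (LINT x|M. (g x)\<^sup>2)"
proof -
  define A B C where "A = (LINT x|M. (f x)\<^sup>2)" and "B = (LINT x|M. f x * g x)" and "C = (LINT x|M. (g x)\<^sup>2)"
  have fg: "integrable M (\<lambda>x. f x * g x)" by (rule L2_integrable_mult[OF assms])
  have q: "0 \<le> A - 2 * t * B + t\<^sup>2 * C" for t
  proof -
    have "0 \<le> (LINT x|M. (f x - t * g x)\<^sup>2)" by (intro Bochner_Integration.integral_nonneg) simp
    also have "\<dots> = (LINT x|M. (f x)\<^sup>2 - 2 * t * (f x * g x) + t\<^sup>2 * (g x)\<^sup>2)"
      by (intro Bochner_Integration.integral_cong) (auto simp: power2_eq_square algebra_simps)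
    also have "\<dots> = A - 2 * t * B + t\<^sup>2 * C" using i fg by (simp add: A_def B_def C_def)
    finally show ?thesis .
  qed
  have C0: "0 \<le> C" unfolding C_def by (intro Bochner_Integration.integral_nonneg) simp
  have "B\<^sup>2 \<le> A * C"
  proof (cases "C = 0")
    case True
    have "B = 0"
    proof (rule ccontr)
      assume "B \<noteq> 0"
      \<comment> \<open>With C = 0 the quadratic is affine in t and takes the value - 1 at this
        point.\<close>
      then show False using q[of "(A + 1) / (2 * B)"] True by simp
    qed
    then show ?thesis using True by simp
  next
    case False
    then have "0 \<le> (A - 2 * (B / C) * B + (B / C)\<^sup>2 * C) * C" using q[of "B / C"] C0 by (intro mult_nonneg_nonneg) auto
    also have "\<dots> = A * C - B\<^sup>2" using False by (simp add: field_simps power2_eq_square)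
    finally show ?thesis by simp
  qed
  then have "\<bar>B\<bar> \<le> sqrt (A * C)" using real_sqrt_le_mono by fastforce
  then show ?thesis by (simp add: A_def B_def C_def real_sqrt_mult)
qed

lemma L2_triangle:
  fixes f g :: "'a \<Rightarrow> complex"
  assumes [measurable]: "f \<in> borel_measurable M" "g \<in> borel_measurable M"
    and i: "integrable M (\<lambda>x. (cmod (f x))\<^sup>2)" "integrable M (\<lambda>x. (cmod (g x))\<^sup>2)"
  shows "integrable M (\<lambda>x. (cmod (f x + g x))\<^sup>2)"
    and "sqrt (LINT x|M. (cmod (f x + g x))\<^sup>2) \<le> sqrt (LINT x|M. (cmod (f x))\<^sup>2) + sqrt (LINT x|M. (cmod (g x))\<^sup>2)"
proof -
  have fg: "integrable M (\<lambda>x. cmod (f x) * cmod (g x))" by (rule L2_integrable_mult) (use i in auto)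
  have i2: "integrable M (\<lambda>x. (cmod (f x))\<^sup>2 + 2 * (cmod (f x) * cmod (g x)) + (cmod (g x))\<^sup>2)"
    using fg i by simp
  have le: "(cmod (f x + g x))\<^sup>2 \<le> (cmod (f x))\<^sup>2 + 2 * (cmod (f x) * cmod (g x)) + (cmod (g x))\<^sup>2" for x
    using power_mono[OF norm_triangle_ineq[of "f x" "g x"], of 2] by (simp add: power2_sum)
  show int: "integrable M (\<lambda>x. (cmod (f x + g x))\<^sup>2)"
    by (rule Bochner_Integration.integrable_bound[OF i2]) (use le in \<open>auto intro: order_trans[OF _ abs_ge_self]\<close>)
  have "(LINT x|M. (cmod (f x + g x))\<^sup>2) \<le> (LINT x|M. (cmod (f x))\<^sup>2 + 2 * (cmod (f x) * cmod (g x)) + (cmod (g x))\<^sup>2)"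
    by (rule integral_mono[OF int i2 le])
  also have "\<dots> = (LINT x|M. (cmod (f x))\<^sup>2) + 2 * (LINT x|M. cmod (f x) * cmod (g x)) + (LINT x|M. (cmod (g x))\<^sup>2)"
    using fg i by simp
  also have "\<dots> \<le> (sqrt (LINT x|M. (cmod (f x))\<^sup>2) + sqrt (LINT x|M. (cmod (g x))\<^sup>2))\<^sup>2"
    using L2_Cauchy_Schwarz[of "\<lambda>x. cmod (f x)" M "\<lambda>x. cmod (g x)"] i by (simp add: power2_sum)
  finally show "sqrt (LINT x|M. (cmod (f x + g x))\<^sup>2) \<le> sqrt (LINT x|M. (cmod (f x))\<^sup>2) + sqrt (LINT x|M. (cmod (g x))\<^sup>2)"
    by (intro real_le_lsqrt) (auto simp: Bochner_Integration.integral_nonneg)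
qed

section \<open>Tempered distributions as a vector space, and the Sobolev norms on it\<close>

lemma schwartz_seminorm_nonneg: "\<phi> \<in> schwartz \<Longrightarrow> 0 \<le> schwartz_seminorm a b \<phi>"
  unfolding schwartz_seminorm_def
  by (rule order_trans[OF _ cSUP_upper[OF UNIV_I schwartz_bdd]]) auto

lemma tempered_bound:
  "A \<in> tempered \<Longrightarrow> \<exists>C N. \<forall>\<phi>\<in>schwartz. cmod (A \<phi>) \<le> C * (\<Sum>a\<le>N. \<Sum>b\<le>N. schwartz_seminorm a b \<phi>)"
  unfolding tempered_def by simp

lemma tempered_zero: "0 \<in> tempered"
  unfolding tempered_def by (auto intro!: exI[of _ 0])

lemma tempered_add:
  assumes "A \<in> tempered" "B \<in> tempered"
  shows "A + B \<in> tempered"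
proof -
  obtain C N where C: "\<And>\<phi>. \<phi> \<in> schwartz \<Longrightarrow> cmod (A \<phi>) \<le> C * (\<Sum>a\<le>N. \<Sum>b\<le>N. schwartz_seminorm a b \<phi>)"
    using tempered_bound[OF assms(1)] by blast
  obtain D L where D: "\<And>\<phi>. \<phi> \<in> schwartz \<Longrightarrow> cmod (B \<phi>) \<le> D * (\<Sum>a\<le>L. \<Sum>b\<le>L. schwartz_seminorm a b \<phi>)"
    using tempered_bound[OF assms(2)] by blast
  let ?S = "\<lambda>N \<phi>. \<Sum>a\<le>(N::nat). \<Sum>b\<le>N. schwartz_seminorm a b \<phi>"
  have mono: "E * ?S K \<phi> \<le> \<bar>E\<bar> * ?S (max N L) \<phi>" if "\<phi> \<in> schwartz" "K \<le> max N L" for E K \<phi>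
  proof -
    have "?S K \<phi> \<le> (\<Sum>a\<le>max N L. \<Sum>b\<le>K. schwartz_seminorm a b \<phi>)"
      using that by (intro sum_mono2) (auto intro!: sum_nonneg schwartz_seminorm_nonneg)
    also have "\<dots> \<le> ?S (max N L) \<phi>"
      using that by (intro sum_mono sum_mono2) (auto intro!: schwartz_seminorm_nonneg)
    finally have "?S K \<phi> \<le> ?S (max N L) \<phi>" .
    moreover have "0 \<le> ?S K \<phi>" using that by (intro sum_nonneg schwartz_seminorm_nonneg)
    ultimately show ?thesis by (intro mult_mono) auto
  qed
  have "cmod ((A + B) \<phi>) \<le> (\<bar>C\<bar> + \<bar>D\<bar>) * ?S (max N L) \<phi>" if "\<phi> \<in> schwartz" for \<phi>
    using norm_triangle_ineq[of "A \<phi>" "B \<phi>"] C[OF that] D[OF that] mono[OF that, of N C] mono[OF that, of L D]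
    by (simp add: distrib_right)
  then have "\<exists>C N. \<forall>\<phi>\<in>schwartz. cmod ((A + B) \<phi>) \<le> C * ?S N \<phi>" by blast
  then show ?thesis using assms unfolding tempered_def by (simp add: distrib_left)
qed

lemma tempered_scale:
  assumes "A \<in> tempered"
  shows "c *\<^sub>R A \<in> tempered"
proof -
  obtain C N where C: "\<And>\<phi>. \<phi> \<in> schwartz \<Longrightarrow> cmod (A \<phi>) \<le> C * (\<Sum>a\<le>N. \<Sum>b\<le>N. schwartz_seminorm a b \<phi>)"
    using tempered_bound[OF assms(1)] by blast
  have "cmod ((c *\<^sub>R A) \<phi>) \<le> (\<bar>c\<bar> * C) * (\<Sum>a\<le>N. \<Sum>b\<le>N. schwartz_seminorm a b \<phi>)" if "\<phi> \<in> schwartz" for \<phi>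
    using mult_left_mono[OF C[OF that], of "\<bar>c\<bar>"] by (simp add: scaleR_fun_def mult.assoc)
  then have "\<exists>C N. \<forall>\<phi>\<in>schwartz. cmod ((c *\<^sub>R A) \<phi>) \<le> C * (\<Sum>a\<le>N. \<Sum>b\<le>N. schwartz_seminorm a b \<phi>)" by blast
  then show ?thesis using assms unfolding tempered_def by (simp add: scaleR_fun_def scaleR_right_distrib)
qed

lemma is_function_add:
  assumes "is_function A f" "is_function B g"
  shows "is_function (A + B) (\<lambda>x. f x + g x)"
  using assms unfolding is_function_def by (auto simp: distrib_right)

lemma is_function_scale:
  assumes "is_function A f"
  shows "is_function (c *\<^sub>R A) (\<lambda>x. c *\<^sub>R f x)"
  using assms unfolding is_function_def by (auto simp: scaleR_fun_def)

lemma distr_fourier_add: "distr_fourier (A + B) = distr_fourier A + distr_fourier B"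
  by (auto simp: distr_fourier_def fun_eq_iff)

lemma distr_fourier_scale: "distr_fourier (c *\<^sub>R A) = c *\<^sub>R distr_fourier A"
  by (auto simp: distr_fourier_def fun_eq_iff scaleR_fun_def)

text \<open>The weight in the squared norm: s is the Sobolev index itself, so the Japanese bracket
  occurs with exponent 2 s.\<close>

definition sobolev_weight :: "real \<Rightarrow> real \<Rightarrow> real"
  where "sobolev_weight s \<xi> = (1 + \<xi>\<^sup>2) powr s"

lemma japanese_bracket_powr: "japanese_bracket \<xi> powr (2 * s) = sobolev_weight s \<xi>"
proof -
  have "0 < 1 + \<xi>\<^sup>2" by (rule add_pos_nonneg) auto
  then have "japanese_bracket \<xi> = (1 + \<xi>\<^sup>2) powr (1 / 2)"
    by (simp add: japanese_bracket_def powr_half_sqrt)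
  then show ?thesis by (simp add: powr_powr sobolev_weight_def)
qed

lemma sobolev_weight_pos: "0 < sobolev_weight s \<xi>"
proof -
  have "0 < 1 + \<xi>\<^sup>2" by (rule add_pos_nonneg) auto
  then show ?thesis by (simp add: sobolev_weight_def)
qed

lemma sobolev_weight_measurable [measurable]: "sobolev_weight s \<in> borel_measurable borel"
  unfolding sobolev_weight_def[abs_def] by measurable

lemma sobolev_vecs:
  "vecs (sobolev s) = {\<Lambda>\<in>tempered. \<exists>g. is_function (distr_fourier \<Lambda>) g \<and>
     integrable lborel (\<lambda>\<xi>. sobolev_weight s \<xi> * (cmod (g \<xi>))\<^sup>2)}"
  by (simp add: sobolev_def japanese_bracket_powr)

lemma sobolev_nrm [simp]: "nrm (sobolev s) = sobolev_norm s" "nrm (real_sobolev s) = sobolev_norm s"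
  by (simp_all add: sobolev_def real_sobolev_def)

lemma is_function_measurable: "is_function A f \<Longrightarrow> f \<in> borel_measurable borel"
  by (simp add: is_function_def)

lemma sobolev_norm_eq:
  assumes g: "is_function (distr_fourier \<Lambda>) g"
  shows "sobolev_norm s \<Lambda> = sqrt (LINT \<xi>|lborel. sobolev_weight s \<xi> * (cmod (g \<xi>))\<^sup>2)"
proof -
  define g' where "g' = (SOME g. is_function (distr_fourier \<Lambda>) g)"
  have g': "is_function (distr_fourier \<Lambda>) g'" unfolding g'_def by (rule someI[of _ g]) (rule g)
  have [measurable]: "g \<in> borel_measurable borel" "g' \<in> borel_measurable borel"
    using is_function_measurable g g' by auto
  have "sobolev_norm s \<Lambda> = (LINT \<xi>|lborel. sobolev_weight s \<xi> * (cmod (g' \<xi>))\<^sup>2) powr (1 / 2)"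
    unfolding sobolev_norm_def japanese_bracket_powr g'_def[symmetric] Let_def ..
  also have "(LINT \<xi>|lborel. sobolev_weight s \<xi> * (cmod (g' \<xi>))\<^sup>2) = (LINT \<xi>|lborel. sobolev_weight s \<xi> * (cmod (g \<xi>))\<^sup>2)"
    by (intro integral_cong_AE) (use is_function_unique[OF g g'] in auto)
  finally show ?thesis
    by (simp add: powr_half_sqrt Bochner_Integration.integral_nonneg sobolev_weight_pos less_imp_le)
qed

lemma sobolevE:
  assumes "\<Lambda> \<in> vecs (sobolev s)"
  obtains g where "is_function (distr_fourier \<Lambda>) g" "integrable lborel (\<lambda>\<xi>. sobolev_weight s \<xi> * (cmod (g \<xi>))\<^sup>2)"
    "sobolev_norm s \<Lambda> = sqrt (LINT \<xi>|lborel. sobolev_weight s \<xi> * (cmod (g \<xi>))\<^sup>2)"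
  using assms sobolev_norm_eq unfolding sobolev_vecs by blast

lemma sobolev_integrable:
  assumes "\<Lambda> \<in> vecs (sobolev s)" "is_function (distr_fourier \<Lambda>) g"
  shows "integrable lborel (\<lambda>\<xi>. sobolev_weight s \<xi> * (cmod (g \<xi>))\<^sup>2)"
proof -
  obtain g' where g': "is_function (distr_fourier \<Lambda>) g'" "integrable lborel (\<lambda>\<xi>. sobolev_weight s \<xi> * (cmod (g' \<xi>))\<^sup>2)"
    using sobolevE[OF assms(1)] by metis
  have [measurable]: "g \<in> borel_measurable borel" "g' \<in> borel_measurable borel"
    using is_function_measurable assms g' by auto
  show ?thesis
    by (rule integrable_cong_AE_imp[OF g'(2)]) (use is_function_unique[OF assms(2) g'(1)] in auto)
qed

lemma weight_cmod_sq:
  "sobolev_weight s \<xi> * (cmod z)\<^sup>2 = (cmod (complex_of_real (sqrt (sobolev_weight s \<xi>)) * z))\<^sup>2"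
  using sobolev_weight_pos[of s \<xi>] by (simp add: norm_mult power_mult_distrib)

text \<open>The square root of the weight is absorbed into the transform, after which the triangle
  inequality is that of unweighted L2.\<close>

lemma normed_sobolev: "normed (sobolev s)"
proof (rule normedI)
  have "is_function (distr_fourier 0) (\<lambda>_. 0)" by (auto simp: is_function_def distr_fourier_def)
  then show "0 \<in> vecs (sobolev s)" unfolding sobolev_vecs using tempered_zero by (auto intro!: exI[of _ "\<lambda>_. 0"])
next
  fix x assume "x \<in> vecs (sobolev s)"
  then show "0 \<le> nrm (sobolev s) x"
    by (elim sobolevE) (simp add: Bochner_Integration.integral_nonneg sobolev_weight_pos less_imp_le)
next
  fix A B assume A: "A \<in> vecs (sobolev s)" and B: "B \<in> vecs (sobolev s)"
  obtain f where f: "is_function (distr_fourier A) f" "integrable lborel (\<lambda>\<xi>. sobolev_weight s \<xi> * (cmod (f \<xi>))\<^sup>2)"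
    "sobolev_norm s A = sqrt (LINT \<xi>|lborel. sobolev_weight s \<xi> * (cmod (f \<xi>))\<^sup>2)" using sobolevE[OF A] .
  obtain g where g: "is_function (distr_fourier B) g" "integrable lborel (\<lambda>\<xi>. sobolev_weight s \<xi> * (cmod (g \<xi>))\<^sup>2)"
    "sobolev_norm s B = sqrt (LINT \<xi>|lborel. sobolev_weight s \<xi> * (cmod (g \<xi>))\<^sup>2)" using sobolevE[OF B] .
  have [measurable]: "f \<in> borel_measurable borel" "g \<in> borel_measurable borel"
    using is_function_measurable f g by auto
  have fg: "is_function (distr_fourier (A + B)) (\<lambda>x. f x + g x)"
    unfolding distr_fourier_add by (rule is_function_add[OF f(1) g(1)])
  note i = f(2)[unfolded weight_cmod_sq] g(2)[unfolded weight_cmod_sq]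
  have "integrable lborel (\<lambda>\<xi>. sobolev_weight s \<xi> * (cmod (f \<xi> + g \<xi>))\<^sup>2)"
    unfolding weight_cmod_sq distrib_left by (rule L2_triangle(1)[OF _ _ i]) measurable
  then show "A + B \<in> vecs (sobolev s)"
    using A B fg tempered_add unfolding sobolev_vecs by blast
  show "nrm (sobolev s) (A + B) \<le> nrm (sobolev s) A + nrm (sobolev s) B"
    unfolding sobolev_nrm sobolev_norm_eq[OF fg] f(3) g(3) weight_cmod_sq distrib_left
    by (rule L2_triangle(2)[OF _ _ i]) measurable
next
  fix c :: real and A assume A: "A \<in> vecs (sobolev s)"
  obtain f where f: "is_function (distr_fourier A) f" "integrable lborel (\<lambda>\<xi>. sobolev_weight s \<xi> * (cmod (f \<xi>))\<^sup>2)"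
    "sobolev_norm s A = sqrt (LINT \<xi>|lborel. sobolev_weight s \<xi> * (cmod (f \<xi>))\<^sup>2)" using sobolevE[OF A] .
  have cf: "is_function (distr_fourier (c *\<^sub>R A)) (\<lambda>x. c *\<^sub>R f x)"
    unfolding distr_fourier_scale by (rule is_function_scale[OF f(1)])
  have eq: "sobolev_weight s \<xi> * (cmod (c *\<^sub>R f \<xi>))\<^sup>2 = c\<^sup>2 * (sobolev_weight s \<xi> * (cmod (f \<xi>))\<^sup>2)" for \<xi>
    by (simp add: power_mult_distrib mult_ac)
  have "integrable lborel (\<lambda>\<xi>. sobolev_weight s \<xi> * (cmod (c *\<^sub>R f \<xi>))\<^sup>2)"
    unfolding eq using f(2) by simp
  then show "c *\<^sub>R A \<in> vecs (sobolev s)"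
    using A cf tempered_scale unfolding sobolev_vecs by blast
  show "nrm (sobolev s) (c *\<^sub>R A) = \<bar>c\<bar> * nrm (sobolev s) A"
    unfolding sobolev_nrm sobolev_norm_eq[OF cf] eq f(3) by (simp add: real_sqrt_mult)
qed

lemma real_sobolev_vecs: "vecs (real_sobolev s) = {\<Lambda>\<in>vecs (sobolev s). real_valued \<Lambda>}"
  by (simp add: real_sobolev_def)

lemma normed_real_sobolev: "normed (real_sobolev s)"
proof -
  note N = normedD[OF normed_sobolev[of s], unfolded sobolev_nrm]
  have r: "real_valued 0" "real_valued A \<Longrightarrow> real_valued B \<Longrightarrow> real_valued (A + B)"
    "real_valued A \<Longrightarrow> real_valued (c *\<^sub>R A)" for A B c
    by (auto simp: real_valued_def scaleR_fun_def scaleR_conv_of_real intro: Reals_add Reals_mult)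
  show ?thesis
    by (rule normedI) (simp_all add: real_sobolev_vecs N r)
qed

text \<open>Duality of H^k and H^(-k). The test function is given as a Fourier transform so that the
  pairing becomes an integral over frequencies; then Cauchy-Schwarz applies with two weights whose
  product is 1.\<close>

lemma sobolev_pairing:
  assumes L: "\<Lambda> \<in> vecs (sobolev k)" and phi: "\<phi> \<in> schwartz"
    and i: "integrable lborel (\<lambda>\<xi>. sobolev_weight (- k) \<xi> * (cmod (\<phi> \<xi>))\<^sup>2)"
  shows "cmod (\<Lambda> (fourier \<phi>)) \<le> sqrt (LINT \<xi>|lborel. sobolev_weight (- k) \<xi> * (cmod (\<phi> \<xi>))\<^sup>2) * sobolev_norm k \<Lambda>"
proof -
  obtain g where g: "is_function (distr_fourier \<Lambda>) g" "integrable lborel (\<lambda>\<xi>. sobolev_weight k \<xi> * (cmod (g \<xi>))\<^sup>2)"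
    "sobolev_norm k \<Lambda> = sqrt (LINT \<xi>|lborel. sobolev_weight k \<xi> * (cmod (g \<xi>))\<^sup>2)" using sobolevE[OF L] .
  have [measurable]: "g \<in> borel_measurable borel" "\<phi> \<in> borel_measurable borel"
    using is_function_measurable g schwartz_measurable[OF phi] by auto
  let ?a = "\<lambda>\<xi>. sqrt (sobolev_weight (- k) \<xi>) * cmod (\<phi> \<xi>)"
  let ?b = "\<lambda>\<xi>. sqrt (sobolev_weight k \<xi>) * cmod (g \<xi>)"
  have sq: "(?a \<xi>)\<^sup>2 = sobolev_weight (- k) \<xi> * (cmod (\<phi> \<xi>))\<^sup>2" "(?b \<xi>)\<^sup>2 = sobolev_weight k \<xi> * (cmod (g \<xi>))\<^sup>2" for \<xi>
    using sobolev_weight_pos by (simp_all add: power_mult_distrib less_imp_le)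
  have one: "sqrt (sobolev_weight (- k) \<xi>) * sqrt (sobolev_weight k \<xi>) = 1" for \<xi>
  proof -
    have "0 < 1 + \<xi>\<^sup>2" by (rule add_pos_nonneg) auto
    then show ?thesis by (simp add: sobolev_weight_def real_sqrt_mult[symmetric] powr_add[symmetric])
  qed
  have ab: "?a \<xi> * ?b \<xi> = cmod (g \<xi> * \<phi> \<xi>)" for \<xi>
  proof -
    have "?a \<xi> * ?b \<xi> = (sqrt (sobolev_weight (- k) \<xi>) * sqrt (sobolev_weight k \<xi>)) * (cmod (g \<xi>) * cmod (\<phi> \<xi>))"
      by (simp only: mult_ac)
    then show ?thesis unfolding one by (simp add: norm_mult)
  qed
  have "\<Lambda> (fourier \<phi>) = (LINT \<xi>|lborel. g \<xi> * \<phi> \<xi>)"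
    using g(1) phi by (simp add: is_function_def distr_fourier_def)
  also have "cmod \<dots> \<le> (LINT \<xi>|lborel. ?a \<xi> * ?b \<xi>)"
    unfolding ab by (rule integral_norm_bound)
  also have "\<dots> \<le> sqrt (LINT \<xi>|lborel. (?a \<xi>)\<^sup>2) * sqrt (LINT \<xi>|lborel. (?b \<xi>)\<^sup>2)"
    by (rule L2_Cauchy_Schwarz) (use i g(2) sq in simp_all)
  finally show ?thesis unfolding sq g(3) .
qed

section \<open>Schwartz functions as elements of every Sobolev space\<close>

lemma schwartz_mult_weight:
  assumes "\<phi> \<in> schwartz"
  shows "(\<lambda>x. complex_of_real ((1 + x\<^sup>2) ^ n) * \<phi> x) \<in> schwartz"
proof (induction n)
  case (Suc n)
  from schwartz_add[OF Suc schwartz_mult_x[OF schwartz_mult_x[OF Suc]]]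
  show ?case by (simp add: power2_eq_square algebra_simps)
qed (use assms in simp)

text \<open>A real exponent is majorised by a natural power of \<open>1 + \<xi>^2\<close>, and
  polynomial factors keep a function Schwartz.\<close>

lemma schwartz_weight_integrable:
  assumes "\<phi> \<in> schwartz"
  shows "integrable lborel (\<lambda>\<xi>. sobolev_weight s \<xi> * (cmod (\<phi> \<xi>))\<^sup>2)"
proof -
  obtain n :: nat where n: "s \<le> real n" using real_arch_simple by blast
  obtain C where C: "\<And>x. cmod (complex_of_real ((1 + x\<^sup>2) ^ n) * \<phi> x) \<le> C * inverse (1 + x\<^sup>2)"
    using schwartz_decay[OF schwartz_mult_weight[OF assms]] by blast
  obtain D where D: "\<And>x. \<bar>x\<bar> ^ 0 * cmod (vderiv 0 \<phi> x) \<le> D" using schwartz_bound[OF assms] by blast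
  have [measurable]: "\<phi> \<in> borel_measurable borel" by (rule schwartz_measurable[OF assms])
  have i: "integrable lborel (\<lambda>x::real. C * D * inverse (1 + x\<^sup>2))"
    using integrable_inverse_one_plus_square by simp
  show ?thesis
  proof (rule Bochner_Integration.integrable_bound[OF i])
    have "sobolev_weight s x * (cmod (\<phi> x))\<^sup>2 \<le> C * D * inverse (1 + x\<^sup>2)" for x
    proof -
      have p: "1 \<le> 1 + x\<^sup>2" by simp
      then have "sobolev_weight s x \<le> (1 + x\<^sup>2) ^ n"
        unfolding sobolev_weight_def using powr_mono[OF n p] p by (simp add: powr_realpow add_pos_nonneg)
      then have "sobolev_weight s x * (cmod (\<phi> x))\<^sup>2 \<le> ((1 + x\<^sup>2) ^ n * cmod (\<phi> x)) * cmod (\<phi> x)"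
        by (simp add: power2_eq_square mult.assoc[symmetric] mult_right_mono)
      also have "(1 + x\<^sup>2) ^ n * cmod (\<phi> x) = cmod (complex_of_real ((1 + x\<^sup>2) ^ n) * \<phi> x)"
        using p by (simp only: norm_mult norm_of_real) simp
      also have "\<dots> * cmod (\<phi> x) \<le> (C * inverse (1 + x\<^sup>2)) * D"
        using C[of x] D[of x] by (intro mult_mono) (auto intro: order_trans[OF norm_ge_zero])
      finally show ?thesis by (simp add: mult_ac)
    qed
    moreover have "0 \<le> sobolev_weight s x * (cmod (\<phi> x))\<^sup>2" for x
      by (intro mult_nonneg_nonneg less_imp_le[OF sobolev_weight_pos]) auto
    ultimately have "norm (sobolev_weight s x * (cmod (\<phi> x))\<^sup>2) \<le> norm (C * D * inverse (1 + x\<^sup>2))" for x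
    proof -
      assume a: "\<And>x. sobolev_weight s x * (cmod (\<phi> x))\<^sup>2 \<le> C * D * inverse (1 + x\<^sup>2)"
        and b: "\<And>x. 0 \<le> sobolev_weight s x * (cmod (\<phi> x))\<^sup>2"
      show ?thesis unfolding real_norm_def abs_of_nonneg[OF b] by (rule order_trans[OF a abs_ge_self])
    qed
    then show "AE x in lborel. norm (sobolev_weight s x * (cmod (\<phi> x))\<^sup>2) \<le> norm (C * D * inverse (1 + x\<^sup>2))"
      by (intro AE_I2)
  qed simp
qed

definition distr_of :: "(real \<Rightarrow> complex) \<Rightarrow> distr"
  where "distr_of f = (\<lambda>\<phi>. if \<phi> \<in> schwartz then (LINT x|lborel. f x * \<phi> x) else 0)"

lemma schwartz_integrable_mult:
  assumes "integrable lborel f" "\<phi> \<in> schwartz"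
  shows "integrable lborel (\<lambda>x. f x * \<phi> x)"
    and "cmod (LINT x|lborel. f x * \<phi> x) \<le> (LINT x|lborel. cmod (f x)) * schwartz_seminorm 0 0 \<phi>"
proof -
  have [measurable]: "f \<in> borel_measurable borel" "\<phi> \<in> borel_measurable borel"
    using assms schwartz_measurable by auto
  have b: "cmod (\<phi> x) \<le> schwartz_seminorm 0 0 \<phi>" for x
    using cSUP_upper[OF UNIV_I schwartz_bdd[OF assms(2)], of x 0 0] by (simp add: schwartz_seminorm_def)
  have i: "integrable lborel (\<lambda>x. cmod (f x) * schwartz_seminorm 0 0 \<phi>)" using assms(1) by simp
  have le: "cmod (f x * \<phi> x) \<le> cmod (f x) * schwartz_seminorm 0 0 \<phi>" for x
    unfolding norm_mult by (intro mult_left_mono b) auto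
  show "integrable lborel (\<lambda>x. f x * \<phi> x)"
    by (rule Bochner_Integration.integrable_bound[OF i]) (use le in \<open>auto intro: order_trans[OF _ abs_ge_self]\<close>)
  have "cmod (LINT x|lborel. f x * \<phi> x) \<le> (LINT x|lborel. cmod (f x) * schwartz_seminorm 0 0 \<phi>)"
    by (rule order_trans[OF integral_norm_bound])
      (rule integral_mono_AE', use i le in \<open>auto intro: order_trans[OF norm_ge_zero]\<close>)
  then show "cmod (LINT x|lborel. f x * \<phi> x) \<le> (LINT x|lborel. cmod (f x)) * schwartz_seminorm 0 0 \<phi>" by simp
qed

lemma distr_of_tempered:
  assumes "integrable lborel f"
  shows "distr_of f \<in> tempered"
proof -
  note i = schwartz_integrable_mult[OF assms]
  have "\<exists>C N. \<forall>\<phi>\<in>schwartz. cmod (distr_of f \<phi>) \<le> C * (\<Sum>a\<le>N. \<Sum>b\<le>N. schwartz_seminorm a b \<phi>)"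
    by (rule exI[of _ "LINT x|lborel. cmod (f x)"], rule exI[of _ 0]) (use i(2) in \<open>auto simp: distr_of_def\<close>)
  then show ?thesis
    unfolding tempered_def using i(1) schwartz_add schwartz_cmult
    by (auto simp: distr_of_def distrib_left mult.left_commute)
qed

lemma is_function_distr_of:
  assumes "integrable lborel f"
  shows "is_function (distr_of f) f"
  using assms schwartz_integrable_mult(1)[OF assms] by (auto simp: is_function_def distr_of_def)

text \<open>The multiplication formula, by Fubini. It shows that the distributional transform of a
  Schwartz function is the classical one, and later it serves for Fourier inversion.\<close>

lemma fourier_swap:
  assumes f: "integrable lborel f" and g: "integrable lborel g"
  shows "(LINT x|lborel. f x * fourier g x) = (LINT x|lborel. fourier f x * g x)"
proof -
  let ?h = "\<lambda>x y. f x * exp (- \<i> * complex_of_real (x * y)) * g y"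
  have [measurable]: "f \<in> borel_measurable borel" "g \<in> borel_measurable borel" using f g by auto
  have n: "cmod (?h x y) = cmod (f x) * cmod (g y)" for x y by (simp add: norm_mult)
  have int: "integrable (lborel \<Otimes>\<^sub>M lborel) (\<lambda>p. ?h (fst p) (snd p))"
  proof (rule lborel_pair.Fubini_integrable)
    show "(\<lambda>p. ?h (fst p) (snd p)) \<in> borel_measurable (lborel \<Otimes>\<^sub>M lborel)" by measurable
    show "integrable lborel (\<lambda>x. LINT y|lborel. norm (?h (fst (x, y)) (snd (x, y))))"
      unfolding fst_conv snd_conv n using f by simp
    show "AE x in lborel. integrable lborel (\<lambda>y. ?h (fst (x, y)) (snd (x, y)))"
    proof (intro AE_I2)
      fix x
      show "integrable lborel (\<lambda>y. ?h (fst (x, y)) (snd (x, y)))"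
        using integrable_mult_right[OF integrable_phase(1)[OF g, of x], of "f x"] by (simp add: mult.assoc)
    qed
  qed
  then have "(LINT y|lborel. LINT x|lborel. ?h x y) = (LINT x|lborel. LINT y|lborel. ?h x y)"
    by (intro lborel_pair.Fubini_integral) (simp add: case_prod_unfold)
  moreover have "(LINT x|lborel. ?h x y) = fourier f y * g y" for y
    unfolding fourier_def integral_mult_left_zero[symmetric]
    by (intro Bochner_Integration.integral_cong) (simp_all add: mult_ac)
  moreover have "(LINT y|lborel. ?h x y) = f x * fourier g x" for x
    unfolding fourier_def integral_mult_right_zero[symmetric]
    by (intro Bochner_Integration.integral_cong) (simp_all add: mult_ac)
  ultimately show ?thesis by (simp only:)
qed

lemma is_function_distr_fourier:
  assumes "f \<in> schwartz"
  shows "is_function (distr_fourier (distr_of f)) (fourier f)"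
proof -
  note i = schwartz_integrable[OF assms] schwartz_integrable[OF fourier_schwartz[OF assms]]
  show ?thesis
    using is_function_distr_of[OF i(2)] fourier_swap[OF i(1) schwartz_integrable]
    by (auto simp: is_function_def distr_fourier_def distr_of_def fourier_schwartz)
qed

lemma schwartz_sobolev:
  assumes "f \<in> schwartz"
  shows "distr_of f \<in> vecs (sobolev s)"
  using distr_of_tempered[OF schwartz_integrable[OF assms]] is_function_distr_fourier[OF assms]
    schwartz_weight_integrable[OF fourier_schwartz[OF assms]] unfolding sobolev_vecs by blast

lemma real_valued_distr_of:
  assumes "integrable lborel f" "\<And>x. f x \<in> \<real>"
  shows "real_valued (distr_of f)"
  unfolding real_valued_def
proof (intro ballI impI)
  fix \<phi> assume phi: "\<phi> \<in> schwartz" "range \<phi> \<subseteq> \<real>"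
  have "f x * \<phi> x = complex_of_real (Re (f x * \<phi> x))" for x
    using phi(2) assms(2)[of x] by (intro of_real_Re[symmetric]) (auto intro: Reals_mult)
  then have "(LINT x|lborel. f x * \<phi> x) = (LINT x|lborel. complex_of_real (Re (f x * \<phi> x)))" by simp
  also have "\<dots> \<in> \<real>" by (simp only: integral_complex_of_real Reals_of_real)
  finally show "distr_of f \<phi> \<in> \<real>" using phi(1) by (simp add: distr_of_def)
qed

text \<open>Peetre's inequality. For negative s the base inequality is used with the two frequencies
  exchanged and the factors are moved across.\<close>

lemma sobolev_weight_Peetre:
  "sobolev_weight s \<xi> \<le> 2 powr \<bar>s\<bar> * sobolev_weight s \<omega> * sobolev_weight \<bar>s\<bar> (\<xi> - \<omega>)"
proof -
  have pos: "0 < 1 + x\<^sup>2" for x :: real by (rule add_pos_nonneg) auto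
  have P: "1 + x\<^sup>2 \<le> 2 * (1 + y\<^sup>2) * (1 + (x - y)\<^sup>2)" for x y :: real
  proof -
    \<comment> \<open>The difference of the two sides is 1 plus the first square plus twice the
      second.\<close>
    have "0 \<le> (x - 2 * y)\<^sup>2" "0 \<le> y\<^sup>2 * (x - y)\<^sup>2" by auto
    then show ?thesis by (simp add: power2_eq_square algebra_simps)
  qed
  have e: "(2 * a * b) powr s = 2 powr s * a powr s * b powr s" if "0 < a" "0 < b" for a b :: real
    using that by (simp add: powr_mult less_imp_le)
  show ?thesis
  proof (cases "0 \<le> s")
    case True
    have "(1 + \<xi>\<^sup>2) powr s \<le> (2 * (1 + \<omega>\<^sup>2) * (1 + (\<xi> - \<omega>)\<^sup>2)) powr s"
      using pos[of \<xi>] True by (intro powr_mono2 P) auto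
    then show ?thesis unfolding e[OF pos pos] using True by (simp add: sobolev_weight_def)
  next
    case False
    have "(2 * (1 + \<xi>\<^sup>2) * (1 + (\<omega> - \<xi>)\<^sup>2)) powr s \<le> (1 + \<omega>\<^sup>2) powr s"
      using pos[of \<omega>] False by (intro powr_mono2' P) auto
    then have "2 powr s * (1 + \<xi>\<^sup>2) powr s * (1 + (\<xi> - \<omega>)\<^sup>2) powr s \<le> (1 + \<omega>\<^sup>2) powr s"
      unfolding e[OF pos pos] by (simp only: power2_commute)
    from mult_right_mono[OF this, of "2 powr (- s) * (1 + (\<xi> - \<omega>)\<^sup>2) powr (- s)"]
    have "(1 + \<xi>\<^sup>2) powr s * (2 powr s * 2 powr (- s)) * ((1 + (\<xi> - \<omega>)\<^sup>2) powr s * (1 + (\<xi> - \<omega>)\<^sup>2) powr (- s))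
       \<le> 2 powr (- s) * (1 + \<omega>\<^sup>2) powr s * (1 + (\<xi> - \<omega>)\<^sup>2) powr (- s)"
      by (simp only: mult_ac) simp
    moreover have "x powr s * x powr (- s) = 1" if "x > 0" for x :: real
      using that by (simp add: powr_add[symmetric])
    ultimately show ?thesis using False pos[of "\<xi> - \<omega>"] by (simp add: sobolev_weight_def)
  qed
qed

text \<open>Peetre's factor times a Gaussian moment at scale 1; by rescaling it serves all widths
  and all frequencies.\<close>

definition weight_const :: "real \<Rightarrow> real"
  where "weight_const s = 2 powr \<bar>s\<bar> * (LINT y|lborel. sobolev_weight \<bar>s\<bar> y * exp (- y\<^sup>2))"

lemma weight_const_nonneg: "0 \<le> weight_const s"
  unfolding weight_const_def
  by (intro mult_nonneg_nonneg Bochner_Integration.integral_nonneg less_imp_le[OF sobolev_weight_pos]) auto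

text \<open>Peetre's inequality moves the weight to the centre of the Gaussian. Rescaling by
  \<sigma> leaves a weight at y / \<sigma>, which for \<sigma> at least 1 is at most the weight at
  y; so the constant depends neither on \<sigma> nor on \<omega>.\<close>

lemma gauss_weight:
  assumes sg: "\<sigma> \<ge> 1"
  shows "integrable lborel (\<lambda>\<xi>. sobolev_weight s \<xi> * exp (- (\<sigma>\<^sup>2 * (\<xi> - \<omega>)\<^sup>2)))"
    and "(LINT \<xi>|lborel. sobolev_weight s \<xi> * exp (- (\<sigma>\<^sup>2 * (\<xi> - \<omega>)\<^sup>2))) \<le> weight_const s * sobolev_weight s \<omega> / \<sigma>"
proof -
  let ?B = "\<lambda>\<xi>. 2 powr \<bar>s\<bar> * sobolev_weight s \<omega> * (sobolev_weight \<bar>s\<bar> (\<xi> - \<omega>) * exp (- (\<sigma>\<^sup>2 * (\<xi> - \<omega>)\<^sup>2)))"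
  have w: "cmod (gauss 0 (c / 2) y)^2 = exp (- (c * y\<^sup>2))" for c y
    by (simp add: cmod_gauss exp_double[symmetric] flip: exp_of_nat_mult)
  have i0: "integrable lborel (\<lambda>y. sobolev_weight \<bar>s\<bar> y * exp (- (c * y\<^sup>2)))" if "c > 0" for c
    using schwartz_weight_integrable[OF gauss_schwartz[of "c / 2" 0], of "\<bar>s\<bar>"] that by (simp add: w)
  have iB: "integrable lborel ?B"
    by (rule integrable_mult_right) (use lborel_integrable_real_affine[OF i0[of "\<sigma>\<^sup>2"], of 1 "- \<omega>"] sg in simp)
  have le: "sobolev_weight s \<xi> * exp (- (\<sigma>\<^sup>2 * (\<xi> - \<omega>)\<^sup>2)) \<le> ?B \<xi>" for \<xi>
    using mult_right_mono[OF sobolev_weight_Peetre[of s \<xi> \<omega>], of "exp (- (\<sigma>\<^sup>2 * (\<xi> - \<omega>)\<^sup>2))"] by (simp add: mult_ac)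
  have n: "0 \<le> sobolev_weight s \<xi> * exp (- (\<sigma>\<^sup>2 * (\<xi> - \<omega>)\<^sup>2))" for \<xi>
    using sobolev_weight_pos[of s \<xi>] by simp
  show int: "integrable lborel (\<lambda>\<xi>. sobolev_weight s \<xi> * exp (- (\<sigma>\<^sup>2 * (\<xi> - \<omega>)\<^sup>2)))"
  proof (rule Bochner_Integration.integrable_bound[OF iB])
    show "AE \<xi> in lborel. norm (sobolev_weight s \<xi> * exp (- (\<sigma>\<^sup>2 * (\<xi> - \<omega>)\<^sup>2))) \<le> norm (?B \<xi>)"
      unfolding real_norm_def abs_of_nonneg[OF n] by (intro AE_I2 order_trans[OF le abs_ge_self])
  qed simp
  have "(LINT \<xi>|lborel. sobolev_weight s \<xi> * exp (- (\<sigma>\<^sup>2 * (\<xi> - \<omega>)\<^sup>2))) \<le> (LINT \<xi>|lborel. ?B \<xi>)"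
    by (rule integral_mono[OF int iB le])
  also have "\<dots> = 2 powr \<bar>s\<bar> * sobolev_weight s \<omega> * (LINT \<xi>|lborel. sobolev_weight \<bar>s\<bar> (\<xi> - \<omega>) * exp (- (\<sigma>\<^sup>2 * (\<xi> - \<omega>)\<^sup>2)))"
    by simp
  also have "(LINT \<xi>|lborel. sobolev_weight \<bar>s\<bar> (\<xi> - \<omega>) * exp (- (\<sigma>\<^sup>2 * (\<xi> - \<omega>)\<^sup>2)))
     = (1 / \<sigma>) * (LINT y|lborel. sobolev_weight \<bar>s\<bar> (y / \<sigma>) * exp (- y\<^sup>2))"
    using sg by (subst lborel_integral_real_affine[of "1 / \<sigma>" _ \<omega>]) (simp_all add: power_divide)
  also have "(LINT y|lborel. sobolev_weight \<bar>s\<bar> (y / \<sigma>) * exp (- y\<^sup>2)) \<le> (LINT y|lborel. sobolev_weight \<bar>s\<bar> y * exp (- y\<^sup>2))"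
  proof (rule integral_mono_AE')
    show "integrable lborel (\<lambda>y. sobolev_weight \<bar>s\<bar> y * exp (- y\<^sup>2))" using i0[of 1] by simp
    have "sobolev_weight \<bar>s\<bar> (y / \<sigma>) \<le> sobolev_weight \<bar>s\<bar> y" for y
    proof -
      have "(y / \<sigma>)\<^sup>2 \<le> y\<^sup>2"
        unfolding power_divide using sg by (simp add: pos_divide_le_eq mult_le_cancel_left1 one_le_power)
      then show ?thesis unfolding sobolev_weight_def by (intro powr_mono2) (auto simp: add_nonneg_nonneg)
    qed
    then show "AE y in lborel. sobolev_weight \<bar>s\<bar> (y / \<sigma>) * exp (- y\<^sup>2) \<le> sobolev_weight \<bar>s\<bar> y * exp (- y\<^sup>2)"
      by simp
    show "AE y in lborel. 0 \<le> sobolev_weight \<bar>s\<bar> y * exp (- y\<^sup>2)"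
      using sobolev_weight_pos by (simp add: less_imp_le)
  qed
  finally show "(LINT \<xi>|lborel. sobolev_weight s \<xi> * exp (- (\<sigma>\<^sup>2 * (\<xi> - \<omega>)\<^sup>2))) \<le> weight_const s * sobolev_weight s \<omega> / \<sigma>"
    using sg sobolev_weight_pos[of s \<omega>] by (simp add: weight_const_def mult_ac divide_right_mono mult_left_mono)
qed

section \<open>Gaussian wave packets\<close>

definition packet :: "real \<Rightarrow> real \<Rightarrow> real \<Rightarrow> complex"
  where "packet \<sigma> \<omega> = gauss (\<i> * complex_of_real \<omega>) (1 / (2 * \<sigma>\<^sup>2))"

lemma packet_eq: "packet \<sigma> \<omega> x = exp (\<i> * complex_of_real (\<omega> * x)) * complex_of_real (exp (- x\<^sup>2 / (2 * \<sigma>\<^sup>2)))"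
  unfolding packet_def gauss_phase by (simp add: gauss_def exp_of_real[symmetric])

lemma packet_schwartz: "\<sigma> \<ge> 1 \<Longrightarrow> packet \<sigma> \<omega> \<in> schwartz"
  unfolding packet_def by (intro gauss_schwartz) auto

lemma cmod_fourier_packet:
  assumes "\<sigma> \<ge> 1"
  shows "(cmod (fourier (packet \<sigma> \<omega>) \<xi>))\<^sup>2 = 2 * pi * \<sigma>\<^sup>2 * exp (- (\<sigma>\<^sup>2 * (\<xi> - \<omega>)\<^sup>2))"
proof -
  have "(\<i> * complex_of_real \<omega> - \<i> * complex_of_real \<xi>)\<^sup>2 = complex_of_real (- (\<xi> - \<omega>)\<^sup>2)"
    by (simp add: power2_eq_square algebra_simps)
  then have "fourier (packet \<sigma> \<omega>) \<xi> = complex_of_real (sqrt (2 * pi * \<sigma>\<^sup>2)) * exp (complex_of_real (- (\<sigma>\<^sup>2 * (\<xi> - \<omega>)\<^sup>2 / 2)))"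
    unfolding packet_def using assms by (subst fourier_gauss) (simp_all add: mult_ac)
  then have "cmod (fourier (packet \<sigma> \<omega>) \<xi>) = sqrt (2 * pi * \<sigma>\<^sup>2) * exp (- (\<sigma>\<^sup>2 * (\<xi> - \<omega>)\<^sup>2 / 2))"
    unfolding exp_of_real by (simp add: norm_mult)
  moreover have "(exp (- (\<sigma>\<^sup>2 * (\<xi> - \<omega>)\<^sup>2 / 2)))\<^sup>2 = exp (- (\<sigma>\<^sup>2 * (\<xi> - \<omega>)\<^sup>2))"
    by (simp flip: exp_of_nat_mult)
  ultimately show ?thesis by (simp add: power_mult_distrib)
qed

text \<open>The order is the L2 norm of an envelope of width \<sigma>, that is sqrt \<sigma>, times
  the weight at the carrier frequency, because the transform is concentrated within 1 / \<sigma> of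
  \<omega>.\<close>

lemma packet_sobolev_norm:
  assumes "\<sigma> \<ge> 1"
  shows "sobolev_norm s (distr_of (packet \<sigma> \<omega>)) \<le> sqrt (2 * pi * weight_const s * \<sigma> * sobolev_weight s \<omega>)"
proof -
  have eq: "sobolev_weight s \<xi> * (cmod (fourier (packet \<sigma> \<omega>) \<xi>))\<^sup>2
      = 2 * pi * \<sigma>\<^sup>2 * (sobolev_weight s \<xi> * exp (- (\<sigma>\<^sup>2 * (\<xi> - \<omega>)\<^sup>2)))" for \<xi>
    by (simp add: cmod_fourier_packet[OF assms])
  have "(LINT \<xi>|lborel. sobolev_weight s \<xi> * (cmod (fourier (packet \<sigma> \<omega>) \<xi>))\<^sup>2)
      = 2 * pi * \<sigma>\<^sup>2 * (LINT \<xi>|lborel. sobolev_weight s \<xi> * exp (- (\<sigma>\<^sup>2 * (\<xi> - \<omega>)\<^sup>2)))"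
    unfolding eq by simp
  also have "\<dots> \<le> 2 * pi * \<sigma>\<^sup>2 * (weight_const s * sobolev_weight s \<omega> / \<sigma>)"
    by (intro mult_left_mono gauss_weight assms) auto
  also have "\<dots> = 2 * pi * weight_const s * \<sigma> * sobolev_weight s \<omega>"
    using assms by (simp add: power2_eq_square)
  finally show ?thesis
    unfolding sobolev_norm_eq[OF is_function_distr_fourier[OF packet_schwartz[OF assms]]] by simp
qed

section \<open>Smooth representatives\<close>

lemma fourier_add:
  assumes "integrable lborel f" "integrable lborel g"
  shows "fourier (\<lambda>x. f x + g x) \<xi> = fourier f \<xi> + fourier g \<xi>"
  unfolding fourier_def using integrable_phase(1)[OF assms(1), of \<xi>] integrable_phase(1)[OF assms(2), of \<xi>]
  by (simp add: distrib_left)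

lemma fourier_diff:
  assumes "integrable lborel f" "integrable lborel g"
  shows "fourier (\<lambda>x. f x - g x) \<xi> = fourier f \<xi> - fourier g \<xi>"
  unfolding fourier_def using integrable_phase(1)[OF assms(1), of \<xi>] integrable_phase(1)[OF assms(2), of \<xi>]
  by (simp add: right_diff_distrib)

lemma fourier_cmult: "fourier (\<lambda>x. f x * c) \<xi> = fourier f \<xi> * c"
  unfolding fourier_def by (simp add: mult.assoc[symmetric])

text \<open>The L1 distance bounds the distance of the transforms uniformly, so decay at infinity
  passes to dominated limits. The factor 2 in the domination is the one supplied by
  \<open>integrable_induct\<close>.\<close>

lemma fourier_tendsto_0_limit:
  assumes s: "\<And>i. integrable lborel (s i)" "\<And>i. (fourier (s i) \<longlongrightarrow> 0) F"
    and lim: "\<And>x. (\<lambda>i. s i x) \<longlonglongrightarrow> f x" and le: "\<And>i x. cmod (s i x) \<le> 2 * cmod (f x)"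
    and f: "integrable lborel f"
  shows "(fourier f \<longlongrightarrow> 0) F"
proof (rule tendstoI)
  fix e :: real assume e: "e > 0"
  have m: "s i \<in> borel_measurable lborel" "f \<in> borel_measurable lborel" for i using s f by auto
  have "(\<lambda>i. LINT x|lborel. cmod (s i x - f x)) \<longlonglongrightarrow> (LINT x|(lborel::real measure). 0)"
  proof (rule integral_dominated_convergence[where w = "\<lambda>x. 3 * cmod (f x)"])
    have "(\<lambda>i. cmod (s i x - f x)) \<longlonglongrightarrow> cmod (f x - f x)" for x by (intro tendsto_intros lim)
    then show "AE x in lborel. (\<lambda>i. cmod (s i x - f x)) \<longlonglongrightarrow> 0" by simp
    have "cmod (s i x - f x) \<le> 3 * cmod (f x)" for i x
      using norm_triangle_ineq4[of "s i x" "f x"] le[of i x] by simp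
    then show "AE x in lborel. norm (cmod (s i x - f x)) \<le> 3 * cmod (f x)" for i by simp
  qed (use f m in auto)
  then have "\<forall>\<^sub>F i in sequentially. (LINT x|lborel. cmod (s i x - f x)) < e / 2"
    using e order_tendstoD(2)[of _ "0::real" sequentially "e / 2"] by simp
  then obtain i where i: "(LINT x|lborel. cmod (s i x - f x)) < e / 2"
    by (auto simp: eventually_sequentially)
  have "\<forall>\<^sub>F \<xi> in F. dist (fourier (s i) \<xi>) 0 < e / 2" using tendstoD[OF s(2)[of i], of "e / 2"] e by simp
  then show "\<forall>\<^sub>F \<xi> in F. dist (fourier f \<xi>) 0 < e"
  proof eventually_elim
    case (elim \<xi>)
    have "cmod (fourier (s i) \<xi> - fourier f \<xi>) \<le> (LINT x|lborel. cmod (s i x - f x))"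
      unfolding fourier_diff[OF s(1) f, symmetric] by (rule fourier_bound) (use s f in simp)
    then show ?case using elim i norm_triangle_ineq4[of "fourier (s i) \<xi>" "fourier (s i) \<xi> - fourier f \<xi>"]
      by (simp add: dist_norm)
  qed
qed

lemma cmod_fourier_indicator_Icc:
  assumes "a \<le> b" "\<xi> \<noteq> 0"
  shows "cmod (fourier (indicator {a..b}) \<xi>) \<le> 2 / \<bar>\<xi>\<bar>"
proof -
  let ?e = "\<lambda>x. exp (- \<i> * complex_of_real \<xi> * complex_of_real x)"
  let ?F = "\<lambda>x. \<i> / complex_of_real \<xi> * ?e x"
  have "fourier (indicator {a..b}) \<xi> = (LINT x|lborel. indicator {a..b} x *\<^sub>R ?e x)"
    unfolding fourier_def by (intro Bochner_Integration.integral_cong) (auto simp: indicator_def mult.assoc)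
  also have "\<dots> = ?F b - ?F a"
  proof (rule integral_FTC_atLeastAtMost[OF assms(1)])
    fix x
    show "(?F has_vector_derivative ?e x) (at x within {a..b})"
      using has_vector_derivative_mult_right[OF exp_vector_derivative[of "- \<i> * complex_of_real \<xi>" x], of "\<i> / complex_of_real \<xi>"] assms(2)
      by (auto intro: has_vector_derivative_at_within)
  qed (intro continuous_intros)
  also have "cmod \<dots> \<le> cmod (?F b) + cmod (?F a)" by (rule norm_triangle_ineq4)
  also have "\<dots> = 2 / \<bar>\<xi>\<bar>" unfolding norm_mult norm_exp_eq_Re by (simp add: norm_divide)
  finally show ?thesis .
qed

text \<open>Explicit for intervals, extended from half lines to Borel sets by a Dynkin system
  argument, and to integrable functions by linear combinations and dominated limits. The filter is
  abstract so that both ends of the line are covered.\<close>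

lemma Riemann_Lebesgue:
  assumes f: "integrable lborel f" and F: "((\<lambda>\<xi>::real. 2 / \<bar>\<xi>\<bar>) \<longlongrightarrow> 0) F" "\<forall>\<^sub>F \<xi> in F. \<xi> \<noteq> 0"
  shows "(fourier f \<longlongrightarrow> 0) F"
proof -
  have ind: "integrable lborel (\<lambda>x. indicator A x :: complex)" if "A \<in> sets borel" "emeasure lborel A < \<infinity>" for A
  proof -
    have "integrable lborel (\<lambda>x. complex_of_real (indicator A x))"
      using that by (intro integrable_of_real integrable_real_indicator) auto
    then show ?thesis by (simp add: of_real_indicator)
  qed
  have fin: "emeasure lborel (A \<inter> {- real n..real n}) < \<infinity>" if "A \<in> sets borel" for A n
  proof -
    have "emeasure lborel (A \<inter> {- real n..real n}) \<le> emeasure lborel {- real n..real n}"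
      by (intro emeasure_mono) auto
    then show ?thesis by (simp add: le_less_trans)
  qed
  \<comment> \<open>Truncation to \<open>[-n, n]\<close> keeps the measure finite, as taking
    complements requires.\<close>
  have step: "(fourier (indicator (A \<inter> {- real n..real n})) \<longlongrightarrow> 0) F" if "A \<in> sets borel" for A n
  proof -
    let ?I = "{- real n..real n}"
    have "A \<in> sigma_sets UNIV (range (\<lambda>a::real. {..a}))" using that by (simp add: borel_eq_atMost)
    have "Int_stable (range (\<lambda>a::real. {..a}))" by (auto simp: Int_stable_def)
    moreover have "range (\<lambda>a::real. {..a}) \<subseteq> Pow UNIV" by simp
    moreover note \<open>A \<in> sigma_sets UNIV (range (\<lambda>a::real. {..a}))\<close>
    ultimately show ?thesis
    proof (induction rule: sigma_sets_induct_disjoint)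
      fix A :: "real set" assume "A \<in> range (\<lambda>a. {..a})"
      then obtain a where A: "A = {..a}" by auto
      show "(fourier (indicator (A \<inter> ?I)) \<longlongrightarrow> 0) F"
      proof (cases "- real n \<le> min a (real n)")
        case True
        have eq: "A \<inter> ?I = {- real n..min a (real n)}" using A by auto
        show ?thesis unfolding eq
          by (rule Lim_null_comparison[OF eventually_mono[OF F(2)] F(1)]) (rule cmod_fourier_indicator_Icc[OF True])
      next
        case False
        then have "A \<inter> ?I = {}" using A by auto
        then show ?thesis by (simp add: fourier_def[abs_def])
      qed
    next
      show "(fourier (indicator ({} \<inter> ?I)) \<longlongrightarrow> 0) F" by (simp add: fourier_def[abs_def])
    next
      fix A assume A: "A \<in> sigma_sets UNIV (range (\<lambda>a::real. {..a}))" "(fourier (indicator (A \<inter> ?I)) \<longlongrightarrow> 0) F"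
      then have Ab: "A \<in> sets borel" by (simp add: borel_eq_atMost)
      have eq: "indicator ((UNIV - A) \<inter> ?I) = (\<lambda>x. indicator ?I x - indicator (A \<inter> ?I) x :: complex)"
        by (auto simp: indicator_def fun_eq_iff)
      have "(fourier (indicator ?I) \<longlongrightarrow> 0) F"
        by (rule Lim_null_comparison[OF eventually_mono[OF F(2)] F(1)]) (rule cmod_fourier_indicator_Icc, simp)
      from tendsto_diff[OF this A(2)]
      have "((\<lambda>\<xi>. fourier (indicator ?I) \<xi> - fourier (indicator (A \<inter> ?I)) \<xi>) \<longlongrightarrow> 0) F" by simp
      moreover have "integrable lborel (\<lambda>x. indicator (UNIV \<inter> ?I) x :: complex)" by (intro ind fin sets.Int) auto
      moreover have "integrable lborel (\<lambda>x. indicator (A \<inter> ?I) x :: complex)" by (intro ind fin sets.Int Ab) auto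
      ultimately have "fourier (\<lambda>x. indicator ?I x - indicator (A \<inter> ?I) x) = (\<lambda>\<xi>. fourier (indicator ?I) \<xi> - fourier (indicator (A \<inter> ?I)) \<xi>)"
        using fourier_diff[of "indicator ?I" "indicator (A \<inter> ?I)"] by (simp add: fun_eq_iff)
      with \<open>((\<lambda>\<xi>. fourier (indicator ?I) \<xi> - fourier (indicator (A \<inter> ?I)) \<xi>) \<longlongrightarrow> 0) F\<close>
      show "(fourier (indicator ((UNIV - A) \<inter> ?I)) \<longlongrightarrow> 0) F" unfolding eq by simp
    next
      fix A :: "nat \<Rightarrow> real set"
      assume A: "disjoint_family A" "range A \<subseteq> sigma_sets UNIV (range (\<lambda>a::real. {..a}))"
        "\<And>i. (fourier (indicator (A i \<inter> ?I)) \<longlongrightarrow> 0) F"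
      then have Ab: "A i \<in> sets borel" for i by (auto simp: borel_eq_atMost)
      have fs: "integrable lborel (\<lambda>x. indicator ((\<Union>i<m. A i) \<inter> ?I) x :: complex) \<and> (fourier (indicator ((\<Union>i<m. A i) \<inter> ?I)) \<longlongrightarrow> 0) F" for m
      proof (induction m)
        case 0 then show ?case by (simp add: fourier_def[abs_def])
      next
        case (Suc m)
        have eq: "indicator ((\<Union>i<Suc m. A i) \<inter> ?I) = (\<lambda>x. indicator ((\<Union>i<m. A i) \<inter> ?I) x + indicator (A m \<inter> ?I) x :: complex)"
        proof
          fix x
          have d: "x \<notin> A i" if "x \<in> A m" "i < m" for i
            using disjoint_family_onD[OF A(1), of i m] that by auto
          have u: "x \<in> (\<Union>i<Suc m. A i) \<longleftrightarrow> x \<in> (\<Union>i<m. A i) \<or> x \<in> A m"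
            by (simp only: lessThan_Suc UN_insert Un_iff disj_commute)
          show "indicator ((\<Union>i<Suc m. A i) \<inter> ?I) x = (indicator ((\<Union>i<m. A i) \<inter> ?I) x + indicator (A m \<inter> ?I) x :: complex)"
          proof (cases "x \<in> A m")
            case True
            then have "x \<notin> (\<Union>i<m. A i)" using d by blast
            then show ?thesis unfolding indicator_def Int_iff u using True by simp
          next
            case False
            then show ?thesis unfolding indicator_def Int_iff u by simp
          qed
        qed
        have i: "integrable lborel (\<lambda>x. indicator (A m \<inter> ?I) x :: complex)" by (intro ind fin Ab sets.Int) auto
        have "fourier (\<lambda>x. indicator ((\<Union>i<m. A i) \<inter> ?I) x + indicator (A m \<inter> ?I) x) = (\<lambda>\<xi>. fourier (indicator ((\<Union>i<m. A i) \<inter> ?I)) \<xi> + fourier (indicator (A m \<inter> ?I)) \<xi>)"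
          using fourier_add[OF conjunct1[OF Suc] i] by (simp add: fun_eq_iff)
        moreover have "((\<lambda>\<xi>. fourier (indicator ((\<Union>i<m. A i) \<inter> ?I)) \<xi> + fourier (indicator (A m \<inter> ?I)) \<xi>) \<longlongrightarrow> 0 + 0) F"
          by (intro tendsto_add conjunct2[OF Suc] A(3))
        ultimately show ?case unfolding eq using conjunct1[OF Suc] i by simp
      qed
      show "(fourier (indicator ((\<Union>i. A i) \<inter> ?I)) \<longlongrightarrow> 0) F"
      proof (rule fourier_tendsto_0_limit[where s = "\<lambda>m. indicator ((\<Union>i<m. A i) \<inter> ?I)"])
        show "(\<lambda>m. indicator ((\<Union>i<m. A i) \<inter> ?I) x :: complex) \<longlonglongrightarrow> indicator ((\<Union>i. A i) \<inter> ?I) x" for x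
        proof (cases "x \<in> (\<Union>i. A i) \<inter> ?I")
          case True
          then obtain j where "x \<in> A j" "x \<in> ?I" by auto
          then have "\<forall>\<^sub>F m in sequentially. (indicator ((\<Union>i<m. A i) \<inter> ?I) x :: complex) = indicator ((\<Union>i. A i) \<inter> ?I) x"
          proof (intro eventually_sequentiallyI[of "Suc j"])
            fix m assume "Suc j \<le> m"
            then have "x \<in> (\<Union>i<m. A i) \<inter> ?I" using \<open>x \<in> A j\<close> \<open>x \<in> ?I\<close> by (intro IntI UN_I[of j]) simp_all
            then show "(indicator ((\<Union>i<m. A i) \<inter> ?I) x :: complex) = indicator ((\<Union>i. A i) \<inter> ?I) x"
              unfolding indicator_simps(1)[OF True] by (rule indicator_simps(1))
          qed
          then show ?thesis by (rule tendsto_eventually)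
        next
          case False
          then have "x \<notin> (\<Union>i<m. A i) \<inter> ?I" for m by blast
          then have "(\<lambda>m. indicator ((\<Union>i<m. A i) \<inter> ?I) x :: complex) = (\<lambda>m. 0)"
            by (intro ext indicator_simps(2))
          then show ?thesis unfolding indicator_simps(2)[OF False] by (simp only: tendsto_const)
        qed
        show "integrable lborel (indicator ((\<Union>i. A i) \<inter> ?I) :: real \<Rightarrow> complex)"
        proof -
          have "(\<Union>i. A i) \<in> sets borel" using Ab by blast
          then show ?thesis by (intro ind fin sets.Int) auto
        qed
        show "cmod (indicator ((\<Union>i<m. A i) \<inter> ?I) x) \<le> 2 * cmod (indicator ((\<Union>i. A i) \<inter> ?I) x)" for m x
        proof (cases "x \<in> (\<Union>i<m. A i) \<inter> ?I")
          case True
          then have "x \<in> (\<Union>i. A i) \<inter> ?I" by auto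
          then show ?thesis unfolding indicator_simps(1)[OF True] by (simp only: indicator_simps(1)) simp
        next
          case False
          then show ?thesis unfolding indicator_simps(2)[OF False] by simp
        qed
        show "integrable lborel (indicator ((\<Union>i<m. A i) \<inter> ?I) :: real \<Rightarrow> complex)" for m using fs[of m] by (rule conjunct1)
        show "(fourier (indicator ((\<Union>i<m. A i) \<inter> ?I)) \<longlongrightarrow> 0) F" for m using fs[of m] by (rule conjunct2)
      qed
    qed
  qed
  from f show ?thesis
  proof (induction rule: integrable_induct)
    case (base A c)
    have "(fourier (indicator A) \<longlongrightarrow> 0) F"
    proof (rule fourier_tendsto_0_limit[where s = "\<lambda>n. indicator (A \<inter> {- real n..real n})"])
      show "(\<lambda>n. indicator (A \<inter> {- real n..real n}) x :: complex) \<longlonglongrightarrow> indicator A x" for x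
      proof -
        obtain N where "\<bar>x\<bar> \<le> real N" using real_arch_simple by blast
        then have "\<forall>\<^sub>F n in sequentially. (indicator (A \<inter> {- real n..real n}) x :: complex) = indicator A x"
          by (intro eventually_sequentiallyI[of N]) (auto simp: indicator_def)
        then show ?thesis by (rule tendsto_eventually)
      qed
      show "cmod (indicator (A \<inter> {- real n..real n}) x) \<le> 2 * cmod (indicator A x)" for n x
        by (auto simp: indicator_def)
      show "integrable lborel (indicator (A \<inter> {- real n..real n}) :: real \<Rightarrow> complex)" for n
        using base by (intro ind fin) auto
      show "integrable lborel (indicator A :: real \<Rightarrow> complex)" using base by (intro ind) auto
      show "(fourier (indicator (A \<inter> {- real n..real n})) \<longlongrightarrow> 0) F" for n using base by (intro step) auto
    qed
    from tendsto_mult_right[OF this, of c]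
    have "((\<lambda>\<xi>. fourier (indicator A) \<xi> * c) \<longlongrightarrow> 0) F" by simp
    moreover have "fourier (\<lambda>x. indicator A x *\<^sub>R c) = (\<lambda>\<xi>. fourier (indicator A) \<xi> * c)"
    proof
      fix \<xi>
      have "(\<lambda>x. indicator A x *\<^sub>R c) = (\<lambda>x. indicator A x * c)" by (rule ext) (simp add: indicator_def)
      then show "fourier (\<lambda>x. indicator A x *\<^sub>R c) \<xi> = fourier (indicator A) \<xi> * c"
        by (simp only: fourier_cmult)
    qed
    ultimately show ?case by simp
  next
    case (add f g)
    have "fourier (\<lambda>x. f x + g x) = (\<lambda>\<xi>. fourier f \<xi> + fourier g \<xi>)"
      using fourier_add[OF add.hyps(1,2)] by auto
    then show ?case using tendsto_add[OF add.IH] by simp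
  next
    case (lim f s)
    show ?case by (rule fourier_tendsto_0_limit[of s]) (use lim in simp_all)
  qed
qed

section \<open>Fourier inversion and classical derivatives\<close>

definition ft :: "distr \<Rightarrow> real \<Rightarrow> complex"
  where "ft \<Lambda> = (SOME g. is_function (distr_fourier \<Lambda>) g)"

lemma is_function_ft: "\<Lambda> \<in> vecs (sobolev s) \<Longrightarrow> is_function (distr_fourier \<Lambda>) (ft \<Lambda>)"
  unfolding ft_def by (erule sobolevE) (rule someI[of "is_function (distr_fourier \<Lambda>)"])

text \<open>The L2 norm of the reciprocal Japanese bracket, which is the constant in the embedding
  of H^1 into the bounded functions.\<close>

definition sobolev_const :: real
  where "sobolev_const = sqrt (LINT x|lborel. inverse (1 + x\<^sup>2))"

lemma sobolev_const_nonneg: "0 \<le> sobolev_const"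
  unfolding sobolev_const_def by (intro real_sqrt_ge_zero Bochner_Integration.integral_nonneg) simp

text \<open>One power of the Japanese bracket is spent on square integrability in Cauchy-Schwarz,
  hence H^(j+1) for the moment of order j.\<close>

lemma ft_moment:
  assumes L: "\<Lambda> \<in> vecs (sobolev (real (Suc j)))"
  shows "integrable lborel (\<lambda>\<xi>. (\<i> * complex_of_real \<xi>) ^ j * ft \<Lambda> \<xi>)"
    and "(LINT \<xi>|lborel. cmod ((\<i> * complex_of_real \<xi>) ^ j * ft \<Lambda> \<xi>)) \<le> sobolev_const * sobolev_norm (real (Suc j)) \<Lambda>"
proof -
  let ?g = "ft \<Lambda>"
  let ?a = "\<lambda>\<xi>::real. sqrt (inverse (1 + \<xi>\<^sup>2))"
  let ?b = "\<lambda>\<xi>. sqrt (sobolev_weight (real (Suc j)) \<xi>) * cmod (?g \<xi>)"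
  have g: "is_function (distr_fourier \<Lambda>) ?g" by (rule is_function_ft[OF L])
  have [measurable]: "?g \<in> borel_measurable borel" by (rule is_function_measurable[OF g])
  have pos: "0 < 1 + x\<^sup>2" for x :: real by (rule add_pos_nonneg) auto
  have sq: "(?a \<xi>)\<^sup>2 = inverse (1 + \<xi>\<^sup>2)" "(?b \<xi>)\<^sup>2 = sobolev_weight (real (Suc j)) \<xi> * (cmod (?g \<xi>))\<^sup>2" for \<xi>
    using sobolev_weight_pos[of "real (Suc j)" \<xi>] pos[of \<xi>] by (simp_all only: power_mult_distrib real_sqrt_pow2 less_imp_le inverse_nonnegative_iff_nonnegative)
  have i: "integrable lborel (\<lambda>\<xi>. (?a \<xi>)\<^sup>2)" "integrable lborel (\<lambda>\<xi>. (?b \<xi>)\<^sup>2)"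
    unfolding sq by (rule integrable_inverse_one_plus_square, rule sobolev_integrable[OF L g])
  have ab: "integrable lborel (\<lambda>\<xi>. ?a \<xi> * ?b \<xi>)" by (rule L2_integrable_mult[OF _ _ i]) measurable
  have le: "cmod ((\<i> * complex_of_real \<xi>) ^ j * ?g \<xi>) \<le> ?a \<xi> * ?b \<xi>" for \<xi>
  proof -
    have "sobolev_weight (real (Suc j)) \<xi> = (1 + \<xi>\<^sup>2) ^ Suc j"
      unfolding sobolev_weight_def by (rule powr_realpow[OF pos])
    then have "?a \<xi> * sqrt (sobolev_weight (real (Suc j)) \<xi>) = sqrt (inverse (1 + \<xi>\<^sup>2) * (1 + \<xi>\<^sup>2) ^ Suc j)"
      by (simp only: real_sqrt_mult)
    also have "inverse (1 + \<xi>\<^sup>2) * (1 + \<xi>\<^sup>2) ^ Suc j = (1 + \<xi>\<^sup>2) ^ j" using pos[of \<xi>] by simp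
    finally have e: "?a \<xi> * sqrt (sobolev_weight (real (Suc j)) \<xi>) = sqrt ((1 + \<xi>\<^sup>2) ^ j)" .
    have "(\<bar>\<xi>\<bar> ^ j)\<^sup>2 = (\<bar>\<xi>\<bar>\<^sup>2) ^ j" by (simp only: power_mult[symmetric] mult.commute)
    also have "\<dots> = (\<xi>\<^sup>2) ^ j" by simp
    also have "\<dots> \<le> (1 + \<xi>\<^sup>2) ^ j" by (intro power_mono) auto
    finally have "\<bar>\<xi>\<bar> ^ j \<le> sqrt ((1 + \<xi>\<^sup>2) ^ j)" by (rule real_le_rsqrt)
    from mult_right_mono[OF this, of "cmod (?g \<xi>)"]
    have "\<bar>\<xi>\<bar> ^ j * cmod (?g \<xi>) \<le> ?a \<xi> * ?b \<xi>" unfolding mult.assoc[symmetric] e by simp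
    then show ?thesis by (simp add: norm_mult norm_power)
  qed
  show int: "integrable lborel (\<lambda>\<xi>. (\<i> * complex_of_real \<xi>) ^ j * ft \<Lambda> \<xi>)"
  proof (rule Bochner_Integration.integrable_bound[OF ab])
    show "AE \<xi> in lborel. norm ((\<i> * complex_of_real \<xi>) ^ j * ft \<Lambda> \<xi>) \<le> norm (?a \<xi> * ?b \<xi>)"
      unfolding real_norm_def by (intro AE_I2 order_trans[OF le abs_ge_self])
  qed measurable
  have "(LINT \<xi>|lborel. cmod ((\<i> * complex_of_real \<xi>) ^ j * ft \<Lambda> \<xi>)) \<le> (LINT \<xi>|lborel. ?a \<xi> * ?b \<xi>)"
    by (rule integral_mono[OF integrable_norm[OF int] ab le])
  also have "\<dots> \<le> sqrt (LINT \<xi>|lborel. (?a \<xi>)\<^sup>2) * sqrt (LINT \<xi>|lborel. (?b \<xi>)\<^sup>2)"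
    by (rule L2_Cauchy_Schwarz[OF _ _ i]) measurable
  finally show "(LINT \<xi>|lborel. cmod ((\<i> * complex_of_real \<xi>) ^ j * ft \<Lambda> \<xi>)) \<le> sobolev_const * sobolev_norm (real (Suc j)) \<Lambda>"
    unfolding sq sobolev_norm_eq[OF g] sobolev_const_def .
qed

text \<open>The j-th classical derivative by Fourier inversion: the forward transform is taken at -
  x and divided by 2 pi.\<close>

definition xderiv :: "nat \<Rightarrow> distr \<Rightarrow> real \<Rightarrow> complex"
  where "xderiv j \<Lambda> x = fourier (\<lambda>\<xi>. (\<i> * complex_of_real \<xi>) ^ j * ft \<Lambda> \<xi>) (- x) / complex_of_real (2 * pi)"

definition sobolev_inf :: "distr set"
  where "sobolev_inf = (\<Inter>m::nat. vecs (sobolev (real m)))"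

lemma sobolev_infD: "\<Lambda> \<in> sobolev_inf \<Longrightarrow> \<Lambda> \<in> vecs (sobolev (real m))"
  by (auto simp: sobolev_inf_def)

lemma xderiv_vector_derivative:
  assumes "\<Lambda> \<in> sobolev_inf"
  shows "(xderiv j \<Lambda> has_vector_derivative xderiv (Suc j) \<Lambda> x) (at x)"
proof -
  let ?g = "\<lambda>j \<xi>. (\<i> * complex_of_real \<xi>) ^ j * ft \<Lambda> \<xi>"
  have i: "integrable lborel (?g j)" for j by (rule ft_moment(1)[OF sobolev_infD[OF assms]])
  have "integrable lborel (\<lambda>\<xi>. - \<i> * ?g (Suc j) \<xi>)" by (intro integrable_mult_right i)
  then have i2: "integrable lborel (\<lambda>\<xi>. complex_of_real \<xi> * ?g j \<xi>)" by (simp add: mult.assoc[symmetric])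
  have "((\<lambda>x. fourier (?g j) (- x)) has_vector_derivative (- 1) *\<^sub>R fourier (\<lambda>\<xi>. - \<i> * complex_of_real \<xi> * ?g j \<xi>) (- x)) (at x)"
    using vector_diff_chain_at[of uminus "- 1" x "fourier (?g j)"] fourier_vector_derivative[OF i i2, of "- x"]
    by (simp add: comp_def has_vector_derivative_minus)
  also have "(\<lambda>\<xi>. - \<i> * complex_of_real \<xi> * ?g j \<xi>) = (\<lambda>\<xi>. ?g (Suc j) \<xi> * (- 1))"
    by (simp add: fun_eq_iff mult_ac)
  also have "(- 1) *\<^sub>R fourier (\<lambda>\<xi>. ?g (Suc j) \<xi> * (- 1)) (- x) = fourier (?g (Suc j)) (- x)"
    by (simp only: fourier_cmult) simp
  finally show ?thesis
    unfolding xderiv_def[abs_def] by (intro has_vector_derivative_divide)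
qed

lemma xderiv_bound:
  assumes "\<Lambda> \<in> sobolev_inf"
  shows "cmod (xderiv j \<Lambda> x) \<le> sobolev_const * sobolev_norm (real (Suc j)) \<Lambda>"
proof -
  let ?f = "\<lambda>\<xi>. (\<i> * complex_of_real \<xi>) ^ j * ft \<Lambda> \<xi>"
  have "cmod (fourier ?f (- x)) \<le> sobolev_const * sobolev_norm (real (Suc j)) \<Lambda>"
    using fourier_bound[OF ft_moment(1)[OF sobolev_infD[OF assms]], of j "- x"] ft_moment(2)[OF sobolev_infD[OF assms], of j]
    by (rule order_trans)
  moreover have "cmod (xderiv j \<Lambda> x) \<le> cmod (fourier ?f (- x)) / 1"
    unfolding xderiv_def norm_divide using pi_gt3 by (intro divide_left_mono) auto
  ultimately show ?thesis by simp
qed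

text \<open>Riemann-Lebesgue on the frequency side. This decay is what makes the boundary fluxes of
  the conservation laws disappear in the limit.\<close>

lemma xderiv_tendsto_0:
  assumes "\<Lambda> \<in> sobolev_inf"
  shows "(xderiv j \<Lambda> \<longlongrightarrow> 0) at_top" "(xderiv j \<Lambda> \<longlongrightarrow> 0) at_bot"
proof -
  let ?f = "\<lambda>\<xi>. (\<i> * complex_of_real \<xi>) ^ j * ft \<Lambda> \<xi>"
  have i: "integrable lborel ?f" by (rule ft_moment(1)[OF sobolev_infD[OF assms]])
  have l: "((\<lambda>\<xi>::real. 2 / \<bar>\<xi>\<bar>) \<longlongrightarrow> 0) at_top" "((\<lambda>\<xi>::real. 2 / \<bar>\<xi>\<bar>) \<longlongrightarrow> 0) at_bot" by real_asymp+
  have "(fourier ?f \<longlongrightarrow> 0) at_top" "(fourier ?f \<longlongrightarrow> 0) at_bot"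
  proof -
    have "\<forall>\<^sub>F \<xi> in at_top. \<xi> \<noteq> (0::real)" using eventually_gt_at_top[of "0::real"] by eventually_elim simp
    then show "(fourier ?f \<longlongrightarrow> 0) at_top" by (rule Riemann_Lebesgue[OF i l(1)])
    have "\<forall>\<^sub>F \<xi> in at_bot. \<xi> \<noteq> (0::real)" using eventually_gt_at_bot[of "0::real"] by eventually_elim simp
    then show "(fourier ?f \<longlongrightarrow> 0) at_bot" by (rule Riemann_Lebesgue[OF i l(2)])
  qed
  then have "((\<lambda>x. fourier ?f (- x)) \<longlongrightarrow> 0) at_top" "((\<lambda>x. fourier ?f (- x)) \<longlongrightarrow> 0) at_bot"
    by (auto intro: filterlim_compose[OF _ filterlim_uminus_at_bot_at_top] filterlim_compose[OF _ filterlim_uminus_at_top_at_bot])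
  from tendsto_divide[OF this(1) tendsto_const, of "complex_of_real (2 * pi)"] tendsto_divide[OF this(2) tendsto_const, of "complex_of_real (2 * pi)"]
  show "(xderiv j \<Lambda> \<longlongrightarrow> 0) at_top" "(xderiv j \<Lambda> \<longlongrightarrow> 0) at_bot"
    unfolding xderiv_def[abs_def] by simp_all
qed

lemma sobolev_inf_diff:
  "A \<in> sobolev_inf \<Longrightarrow> B \<in> sobolev_inf \<Longrightarrow> A - B \<in> sobolev_inf"
  unfolding sobolev_inf_def by (auto intro: normed_diff(1)[OF normed_sobolev])

text \<open>\<open>ft\<close> is a choice, hence additive only almost everywhere; the integral does
  not see the difference.\<close>

lemma xderiv_diff:
  assumes A: "A \<in> sobolev_inf" and B: "B \<in> sobolev_inf"
  shows "xderiv j (A - B) x = xderiv j A x - xderiv j B x"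
proof -
  let ?m = "\<lambda>\<xi>. (\<i> * complex_of_real \<xi>) ^ j"
  note AB = sobolev_inf_diff[OF A B]
  note f = is_function_ft[OF sobolev_infD[OF A]] is_function_ft[OF sobolev_infD[OF B]]
    is_function_ft[OF sobolev_infD[OF AB]]
  have [measurable]: "ft A \<in> borel_measurable borel" "ft B \<in> borel_measurable borel" "ft (A - B) \<in> borel_measurable borel"
    by (rule is_function_measurable, rule f)+
  have "distr_fourier (A - B) = distr_fourier A + (-1) *\<^sub>R distr_fourier B"
    by (auto simp: distr_fourier_def fun_eq_iff scaleR_fun_def)
  then have "is_function (distr_fourier (A - B)) (\<lambda>x. ft A x + (-1) *\<^sub>R ft B x)"
    by (simp only:) (intro is_function_add is_function_scale f)
  from is_function_unique[OF f(3) this]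
  have ae: "AE \<xi> in lborel. ft (A - B) \<xi> = ft A \<xi> - ft B \<xi>" by simp
  have i: "integrable lborel (\<lambda>\<xi>. ?m \<xi> * ft A \<xi>)" "integrable lborel (\<lambda>\<xi>. ?m \<xi> * ft B \<xi>)"
    by (rule ft_moment(1)[OF sobolev_infD], rule A, rule ft_moment(1)[OF sobolev_infD], rule B)
  have "fourier (\<lambda>\<xi>. ?m \<xi> * ft (A - B) \<xi>) (- x) = fourier (\<lambda>\<xi>. ?m \<xi> * ft A \<xi> - ?m \<xi> * ft B \<xi>) (- x)"
    unfolding fourier_def
  proof (rule integral_cong_AE)
    show "AE y in lborel. exp (- \<i> * complex_of_real (- x * y)) * (?m y * ft (A - B) y) =
        exp (- \<i> * complex_of_real (- x * y)) * (?m y * ft A y - ?m y * ft B y)"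
      using ae by eventually_elim (simp only: right_diff_distrib)
  qed measurable
  also have "\<dots> = fourier (\<lambda>\<xi>. ?m \<xi> * ft A \<xi>) (- x) - fourier (\<lambda>\<xi>. ?m \<xi> * ft B \<xi>) (- x)"
    by (rule fourier_diff[OF i])
  finally show ?thesis unfolding xderiv_def by (simp only: diff_divide_distrib)
qed

text \<open>The set where the functions differ is open, and a nonempty open set has positive
  measure.\<close>

lemma continuous_AE_eq:
  fixes f g :: "real \<Rightarrow> complex"
  assumes "continuous_on UNIV f" "continuous_on UNIV g" "AE x in lborel. f x = g x"
  shows "f x = g x"
proof -
  let ?N = "{x. f x \<noteq> g x}"
  have op: "open ?N" using open_Collect_neq[OF assms(1,2)] by simp
  have "AE x in lborel. x \<notin> ?N" using assms(3) by simp
  then have "?N \<in> null_sets lborel" using op by (subst AE_iff_null_sets) auto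
  then have "negligible ?N" unfolding negligible_iff_null_sets by (rule null_sets_completionI)
  then have "?N = {}" using open_not_negligible[OF op] by blast
  then show ?thesis by blast
qed

text \<open>Weak Fourier inversion. Both sides are tested on modulated Gaussians. Each of these is
  the transform of a Gaussian with real linear exponent, so the pairing with h becomes an integral
  against \<open>ft\<close>, and the multiplication formula brings it back to x-space.\<close>

lemma sobolev_representation:
  assumes L: "\<Lambda> \<in> sobolev_inf" and h: "is_function \<Lambda> h" "continuous_on UNIV h"
  shows "h = xderiv 0 \<Lambda>"
proof
  fix x
  let ?g = "ft \<Lambda>"
  note g = is_function_ft[OF sobolev_infD[OF L]]
  have gi: "integrable lborel ?g" using ft_moment(1)[OF sobolev_infD[OF L], of 0] by simp
  have xd: "xderiv 0 \<Lambda> y = fourier ?g (- y) / complex_of_real (2 * pi)" for y by (simp add: xderiv_def)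
  have c: "continuous_on UNIV (xderiv 0 \<Lambda>)"
    by (intro continuous_at_imp_continuous_on ballI has_vector_derivative_continuous[OF xderiv_vector_derivative[OF L]])
  have [measurable]: "xderiv 0 \<Lambda> \<in> borel_measurable borel" by (rule borel_measurable_continuous_onI[OF c])
  have sch: "gauss a (1/2) \<in> schwartz" for a by (rule gauss_schwartz) simp
  have int: "integrable lborel (\<lambda>x. xderiv 0 \<Lambda> x * gauss a (1/2) x)" for a
  proof (rule Bochner_Integration.integrable_bound)
    show "integrable lborel (\<lambda>x. (sobolev_const * sobolev_norm (real (Suc 0)) \<Lambda>) * cmod (gauss a (1/2) x))"
      using schwartz_integrable[OF sch] by (intro integrable_mult_right integrable_norm)
    show "AE x in lborel. norm (xderiv 0 \<Lambda> x * gauss a (1/2) x) \<le> norm ((sobolev_const * sobolev_norm (real (Suc 0)) \<Lambda>) * cmod (gauss a (1/2) x))"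
    proof (intro AE_I2)
      fix x
      have "norm (xderiv 0 \<Lambda> x * gauss a (1/2) x) \<le> (sobolev_const * sobolev_norm (real (Suc 0)) \<Lambda>) * cmod (gauss a (1/2) x)"
        unfolding norm_mult by (intro mult_right_mono xderiv_bound[OF L]) auto
      then show "norm (xderiv 0 \<Lambda> x * gauss a (1/2) x) \<le> norm ((sobolev_const * sobolev_norm (real (Suc 0)) \<Lambda>) * cmod (gauss a (1/2) x))"
        unfolding real_norm_def by (rule order_trans[OF _ abs_ge_self])
    qed
  qed (use schwartz_measurable[OF sch] in measurable)
  have "AE x in lborel. h x = xderiv 0 \<Lambda> x"
  proof (rule gauss_test_unique)
    fix t
    define S where "S = complex_of_real (sqrt (2 * pi))"
    have S: "S \<noteq> 0" "S * S = complex_of_real (2 * pi)"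
      by (simp_all add: S_def flip: of_real_mult)
    define E where "E = exp (complex_of_real (- t\<^sup>2 / 2))"
    \<comment> \<open>Chosen so that the transform of \<open>c * gauss (- t)\<close> is the Gaussian
      modulated by t; transforming the one modulated by - t returns 2 pi times the same
      function.\<close>
    define c where "c = E / S"
    let ?\<phi> = "\<lambda>x. c * gauss (- complex_of_real t) (1/2) x"
    have phi: "?\<phi> \<in> schwartz" by (intro schwartz_cmult sch)
    have FG: "fourier (gauss a (1/2)) y = S * exp ((a - \<i> * complex_of_real y)\<^sup>2 / 2)" for a y
      by (subst fourier_gauss) (simp_all add: S_def mult.commute)
    have f1: "fourier ?\<phi> = gauss (\<i> * complex_of_real t) (1/2)"
    proof
      fix y
      have sq: "(- complex_of_real t - \<i> * complex_of_real y)\<^sup>2 / 2 = complex_of_real (t\<^sup>2 / 2) + (\<i> * complex_of_real t * complex_of_real y - complex_of_real (1/2 * y\<^sup>2))"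
        by (simp add: power2_eq_square algebra_simps add_divide_distrib diff_divide_distrib)
      have cancel: "S * exp (P + Q) * (E / S) = (exp P * E) * exp Q" for P Q
        using S by (simp add: exp_add)
      have "fourier ?\<phi> y = fourier (\<lambda>x. gauss (- complex_of_real t) (1/2) x * c) y" by (simp only: mult.commute)
      also have "\<dots> = (exp (complex_of_real (t\<^sup>2 / 2)) * E) * gauss (\<i> * complex_of_real t) (1/2) y"
        unfolding fourier_cmult FG sq c_def cancel by (simp only: gauss_def)
      also have "exp (complex_of_real (t\<^sup>2 / 2)) * E = 1"
        unfolding E_def exp_add[symmetric] by simp
      finally show "fourier ?\<phi> y = gauss (\<i> * complex_of_real t) (1/2) y" by (simp only: mult_1_left)
    qed
    have f2: "fourier (gauss (\<i> * complex_of_real (- t)) (1/2)) y = complex_of_real (2 * pi) * ?\<phi> y" for y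
    proof -
      have sq: "(\<i> * complex_of_real (- t) - \<i> * complex_of_real y)\<^sup>2 / 2 = complex_of_real (- t\<^sup>2 / 2) + (- complex_of_real t * complex_of_real y - complex_of_real (1/2 * y\<^sup>2))"
        by (simp add: power2_eq_square algebra_simps add_divide_distrib diff_divide_distrib)
      have "fourier (gauss (\<i> * complex_of_real (- t)) (1/2)) y = S * (E * gauss (- complex_of_real t) (1/2) y)"
        unfolding FG sq exp_add E_def by (simp only: gauss_def)
      also have "\<dots> = complex_of_real (2 * pi) * ?\<phi> y"
        unfolding S(2)[symmetric] c_def using S(1) by simp
      finally show ?thesis .
    qed
    have "(LINT x|lborel. h x * gauss (\<i> * complex_of_real t) (1/2) x) = \<Lambda> (fourier ?\<phi>)"
      unfolding f1 using h(1) sch by (simp add: is_function_def)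
    also have "\<dots> = (LINT \<xi>|lborel. ?g \<xi> * ?\<phi> \<xi>)"
      using g phi by (simp add: is_function_def distr_fourier_def)
    also have "\<dots> = (LINT \<xi>|lborel. ?g \<xi> * fourier (gauss (\<i> * complex_of_real (- t)) (1/2)) \<xi> / complex_of_real (2 * pi))"
      unfolding f2 by simp
    also have "\<dots> = (LINT y|lborel. fourier ?g y * gauss (\<i> * complex_of_real (- t)) (1/2) y) / complex_of_real (2 * pi)"
      by (simp only: integral_divide_zero fourier_swap[OF gi schwartz_integrable[OF sch]])
    \<comment> \<open>The reflection of y produces the argument - x of \<open>xderiv\<close> and
      restores the modulation t.\<close>
    also have "(LINT y|lborel. fourier ?g y * gauss (\<i> * complex_of_real (- t)) (1/2) y)
        = (LINT y|lborel. fourier ?g (- y) * gauss (\<i> * complex_of_real t) (1/2) y)"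
      by (subst lborel_integral_real_affine[of "- 1" _ 0]) (simp_all add: gauss_def)
    also have "\<dots> / complex_of_real (2 * pi) = (LINT x|lborel. xderiv 0 \<Lambda> x * gauss (\<i> * complex_of_real t) (1/2) x)"
      unfolding xd times_divide_eq_left integral_divide_zero ..
    finally show "(LINT x|lborel. h x * gauss (\<i> * complex_of_real t) (1/2) x) = (LINT x|lborel. xderiv 0 \<Lambda> x * gauss (\<i> * complex_of_real t) (1/2) x)" .
  qed (use h int sch in \<open>auto simp: is_function_def\<close>)
  then show "h x = xderiv 0 \<Lambda> x" by (rule continuous_AE_eq[OF h(2) c])
qed

section \<open>Conservation laws\<close>

text \<open>The class in which balance laws are computed. It asks for decay at both ends of the line
  at each fixed time, with no rate, and is an algebra stable under integration in time, so that
  nonlinear expressions in a smooth solution belong to it at once.\<close>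

definition nice :: "real \<Rightarrow> (real \<Rightarrow> real \<Rightarrow> 'a::real_normed_vector) \<Rightarrow> bool"
  where "nice T f \<longleftrightarrow> continuous_on (UNIV \<times> {0..T}) (\<lambda>p. f (fst p) (snd p)) \<and>
    (\<exists>B. \<forall>x. \<forall>t\<in>{0..T}. norm (f x t) \<le> B) \<and>
    (\<forall>t\<in>{0..T}. ((\<lambda>x. f x t) \<longlongrightarrow> 0) at_top \<and> ((\<lambda>x. f x t) \<longlongrightarrow> 0) at_bot)"

lemma niceI:
  assumes "continuous_on (UNIV \<times> {0..T}) (\<lambda>p. f (fst p) (snd p))"
    and "\<And>x t. t \<in> {0..T} \<Longrightarrow> norm (f x t) \<le> B"
    and "\<And>t. t \<in> {0..T} \<Longrightarrow> ((\<lambda>x. f x t) \<longlongrightarrow> 0) at_top"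
    and "\<And>t. t \<in> {0..T} \<Longrightarrow> ((\<lambda>x. f x t) \<longlongrightarrow> 0) at_bot"
  shows "nice T f"
  using assms unfolding nice_def by blast

lemma nice_cont: "nice T f \<Longrightarrow> continuous_on (UNIV \<times> {0..T}) (\<lambda>p. f (fst p) (snd p))"
  and nice_bounded: "nice T f \<Longrightarrow> \<exists>B. \<forall>x. \<forall>t\<in>{0..T}. norm (f x t) \<le> B"
  and nice_top: "nice T f \<Longrightarrow> t \<in> {0..T} \<Longrightarrow> ((\<lambda>x. f x t) \<longlongrightarrow> 0) at_top"
  and nice_bot: "nice T f \<Longrightarrow> t \<in> {0..T} \<Longrightarrow> ((\<lambda>x. f x t) \<longlongrightarrow> 0) at_bot"
  unfolding nice_def by simp_all

lemma nice_boundE: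
  assumes "nice T f"
  obtains B where "0 \<le> B" "\<And>x t. t \<in> {0..T} \<Longrightarrow> norm (f x t) \<le> B"
proof -
  obtain B where B: "\<forall>x. \<forall>t\<in>{0..T}. norm (f x t) \<le> B" using nice_bounded[OF assms] by blast
  show thesis
  proof (rule that[of "max B 0"])
    show "norm (f x t) \<le> max B 0" if "t \<in> {0..T}" for x t using B that by (simp add: le_max_iff_disj)
  qed simp
qed

lemma nice_cont_x:
  assumes "nice T f" "t \<in> {0..T}"
  shows "continuous_on A (\<lambda>x. f x t)"
proof -
  have "continuous_on A (\<lambda>x. (x, t))" by (intro continuous_intros)
  moreover have "(\<lambda>x. (x, t)) ` A \<subseteq> UNIV \<times> {0..T}" using assms(2) by auto
  ultimately show ?thesis using continuous_on_compose2[OF nice_cont[OF assms(1)], of A "\<lambda>x. (x, t)"] by simp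
qed

lemma nice_cont_t:
  assumes "nice T f" "A \<subseteq> {0..T}"
  shows "continuous_on A (\<lambda>t. f x t)"
proof -
  have "continuous_on A (\<lambda>t. (x, t))" by (intro continuous_intros)
  moreover have "(\<lambda>t. (x, t)) ` A \<subseteq> UNIV \<times> {0..T}" using assms(2) by auto
  ultimately show ?thesis using continuous_on_compose2[OF nice_cont[OF assms(1)], of A "\<lambda>t. (x, t)"] by simp
qed

lemma nice_cont_prod:
  assumes "nice T f" "S \<subseteq> {0..T}"
  shows "continuous_on (A \<times> S) (\<lambda>(x, t). f x t)"
  unfolding case_prod_unfold
  by (rule continuous_on_subset[OF nice_cont[OF assms(1)]]) (use assms(2) in auto)

lemma nice_cont_swap:
  assumes "nice T f" "S \<subseteq> {0..T}"
  shows "continuous_on (S \<times> A) (\<lambda>(t, x). f x t)"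
proof -
  have "continuous_on (S \<times> A) (\<lambda>p. (snd p, fst p))" by (intro continuous_intros)
  moreover have "(\<lambda>p. (snd p, fst p)) ` (S \<times> A) \<subseteq> UNIV \<times> {0..T}" using assms(2) by auto
  ultimately show ?thesis
    using continuous_on_compose2[OF nice_cont[OF assms(1)], of "S \<times> A" "\<lambda>p. (snd p, fst p)"] by (simp add: case_prod_unfold)
qed

lemma nice_zero: "nice T (\<lambda>x t. 0)"
  by (rule niceI[where B = 0]) auto

lemma nice_add:
  assumes f: "nice T f" and g: "nice T g"
  shows "nice T (\<lambda>x t. f x t + g x t)"
proof -
  obtain B where B: "\<And>x t. t \<in> {0..T} \<Longrightarrow> norm (f x t) \<le> B" using nice_boundE[OF f] by metis
  obtain C where C: "\<And>x t. t \<in> {0..T} \<Longrightarrow> norm (g x t) \<le> C" using nice_boundE[OF g] by metis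
  show ?thesis
  proof (rule niceI)
    show "norm (f x t + g x t) \<le> B + C" if "t \<in> {0..T}" for x t by (intro norm_add_rule_thm B C that)
    show "continuous_on (UNIV \<times> {0..T}) (\<lambda>p. f (fst p) (snd p) + g (fst p) (snd p))"
      by (intro continuous_on_add nice_cont f g)
    show "((\<lambda>x. f x t + g x t) \<longlongrightarrow> 0) at_top" if "t \<in> {0..T}" for t
      using tendsto_add[OF nice_top[OF f that] nice_top[OF g that]] by simp
    show "((\<lambda>x. f x t + g x t) \<longlongrightarrow> 0) at_bot" if "t \<in> {0..T}" for t
      using tendsto_add[OF nice_bot[OF f that] nice_bot[OF g that]] by simp
  qed
qed

lemma nice_bounded_linear:
  assumes h: "bounded_linear h" and f: "nice T f"
  shows "nice T (\<lambda>x t. h (f x t))"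
proof -
  interpret bounded_linear h by (rule h)
  obtain B where B: "\<And>x t. t \<in> {0..T} \<Longrightarrow> norm (f x t) \<le> B" using nice_boundE[OF f] by metis
  obtain K where K: "\<And>x. norm (h x) \<le> norm x * K" "0 \<le> K" using nonneg_bounded by blast
  show ?thesis
  proof (rule niceI)
    show "norm (h (f x t)) \<le> B * K" if "t \<in> {0..T}" for x t
      using K(1) mult_right_mono[OF B[OF that] K(2)] by (rule order_trans)
    show "continuous_on (UNIV \<times> {0..T}) (\<lambda>p. h (f (fst p) (snd p)))" by (intro continuous_on nice_cont f)
    show "((\<lambda>x. h (f x t)) \<longlongrightarrow> 0) at_top" if "t \<in> {0..T}" for t by (rule tendsto_zero[OF nice_top[OF f that]])
    show "((\<lambda>x. h (f x t)) \<longlongrightarrow> 0) at_bot" if "t \<in> {0..T}" for t by (rule tendsto_zero[OF nice_bot[OF f that]])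
  qed
qed

lemma nice_mult:
  fixes f g :: "real \<Rightarrow> real \<Rightarrow> 'a::real_normed_algebra"
  assumes f: "nice T f" and g: "nice T g"
  shows "nice T (\<lambda>x t. f x t * g x t)"
proof -
  obtain B where B: "0 \<le> B" "\<And>x t. t \<in> {0..T} \<Longrightarrow> norm (f x t) \<le> B" using nice_boundE[OF f] by metis
  obtain C where C: "\<And>x t. t \<in> {0..T} \<Longrightarrow> norm (g x t) \<le> C" using nice_boundE[OF g] by metis
  show ?thesis
  proof (rule niceI)
    show "norm (f x t * g x t) \<le> B * C" if "t \<in> {0..T}" for x t
      using norm_mult_ineq[of "f x t" "g x t"] mult_mono[OF B(2)[OF that] C[OF that] B(1) norm_ge_zero] by (rule order_trans)
    show "continuous_on (UNIV \<times> {0..T}) (\<lambda>p. f (fst p) (snd p) * g (fst p) (snd p))"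
      by (intro continuous_on_mult nice_cont f g)
    show "((\<lambda>x. f x t * g x t) \<longlongrightarrow> 0) at_top" if "t \<in> {0..T}" for t
      by (rule tendsto_mult_zero[OF nice_top[OF f that] nice_top[OF g that]])
    show "((\<lambda>x. f x t * g x t) \<longlongrightarrow> 0) at_bot" if "t \<in> {0..T}" for t
      by (rule tendsto_mult_zero[OF nice_bot[OF f that] nice_bot[OF g that]])
  qed
qed

lemma nice_cmult: "nice T f \<Longrightarrow> nice T (\<lambda>x t. (c::'a::real_normed_algebra) * f x t)"
  by (rule nice_bounded_linear[OF bounded_linear_mult_right])

lemma nice_minus: "nice T f \<Longrightarrow> nice T (\<lambda>x t. - f x t)"
  by (rule nice_bounded_linear[OF bounded_linear_minus[OF bounded_linear_ident]])

lemma nice_diff: "nice T f \<Longrightarrow> nice T g \<Longrightarrow> nice T (\<lambda>x t. f x t - g x t)"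
  using nice_add[OF _ nice_minus, of T f g] by simp

lemma nice_Re: "nice T f \<Longrightarrow> nice T (\<lambda>x t. Re (f x t))"
  by (rule nice_bounded_linear[OF bounded_linear_Re])

lemma nice_Im: "nice T f \<Longrightarrow> nice T (\<lambda>x t. Im (f x t))"
  by (rule nice_bounded_linear[OF bounded_linear_Im])

lemma nice_cnj: "nice T f \<Longrightarrow> nice T (\<lambda>x t. cnj (f x t))"
  by (rule nice_bounded_linear[OF bounded_linear_cnj])

lemma nice_of_real: "nice T f \<Longrightarrow> nice T (\<lambda>x t. complex_of_real (f x t))"
  by (rule nice_bounded_linear[OF bounded_linear_of_real])

lemma nice_power2: "nice T f \<Longrightarrow> nice T (\<lambda>x t. (f x t :: 'a::real_normed_algebra_1)\<^sup>2)"
  unfolding power2_eq_square by (rule nice_mult)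

lemma nice_cmod_power2: "nice T f \<Longrightarrow> nice T (\<lambda>x t. (cmod (f x t))\<^sup>2)"
  unfolding cmod_power2 by (intro nice_add nice_power2 nice_Re nice_Im)

lemmas nice_intros = nice_zero nice_add nice_diff nice_minus nice_mult nice_cmult nice_Re nice_Im nice_cnj
  nice_of_real nice_power2 nice_cmod_power2

lemma joint_continuity:
  fixes F :: "real \<Rightarrow> real \<Rightarrow> 'a::real_normed_vector"
  assumes x: "\<And>t. t \<in> S \<Longrightarrow> continuous_on UNIV (\<lambda>x. F x t)"
    and t: "\<And>t e. t \<in> S \<Longrightarrow> 0 < e \<Longrightarrow> \<exists>d>0. \<forall>r\<in>S. \<bar>r - t\<bar> < d \<longrightarrow> (\<forall>x. norm (F x r - F x t) < e)"
  shows "continuous_on (UNIV \<times> S) (\<lambda>p. F (fst p) (snd p))"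
  unfolding continuous_on_iff
proof (intro ballI allI impI)
  fix p :: "real \<times> real" and e :: real assume p: "p \<in> UNIV \<times> S" and e: "0 < e"
  obtain a b where [simp]: "p = (a, b)" and b: "b \<in> S" using p by auto
  obtain d where d: "d > 0" "\<And>r x. r \<in> S \<Longrightarrow> \<bar>r - b\<bar> < d \<Longrightarrow> norm (F x r - F x b) < e / 2"
    using t[OF b, of "e / 2"] e by auto
  obtain d' where d': "d' > 0" "\<And>y. dist y a < d' \<Longrightarrow> dist (F y b) (F a b) < e / 2"
    using x[OF b, unfolded continuous_on_iff, rule_format, of a "e / 2"] e by auto
  show "\<exists>d>0. \<forall>q\<in>UNIV \<times> S. dist q p < d \<longrightarrow> dist (F (fst q) (snd q)) (F (fst p) (snd p)) < e"
  proof (intro exI[of _ "min d d'"] conjI ballI impI)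
    fix q assume q: "q \<in> UNIV \<times> S" "dist q p < min d d'"
    have 1: "dist (fst q) a < d'" using q(2) dist_fst_le[of q p] by simp
    have 2: "\<bar>snd q - b\<bar> < d" using q(2) dist_snd_le[of q p] by (simp add: dist_real_def)
    have "dist (F (fst q) (snd q)) (F a b) \<le> dist (F (fst q) (snd q)) (F (fst q) b) + dist (F (fst q) b) (F a b)"
      by (rule dist_triangle)
    also have "\<dots> < e / 2 + e / 2"
      using d(2)[OF _ 2, of "fst q"] d'(2)[OF 1] q(1) by (intro add_strict_mono) (auto simp: dist_norm)
    finally show "dist (F (fst q) (snd q)) (F (fst p) (snd p)) < e" by simp
  qed (use d d' in simp)
qed

text \<open>Decay is only pointwise in time; the uniform bound and dominated convergence on a
  bounded time interval make up for it.\<close>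

lemma nice_integral_tendsto:
  fixes f :: "real \<Rightarrow> real \<Rightarrow> 'a::euclidean_space"
  assumes f: "nice T f" and t: "t \<in> {0..T}" and X: "filterlim X F sequentially" "F = at_top \<or> F = at_bot"
  shows "(\<lambda>k. integral {0..t} (f (X k))) \<longlonglongrightarrow> 0"
proof -
  obtain B where B: "\<And>x t. t \<in> {0..T} \<Longrightarrow> norm (f x t) \<le> B" using nice_boundE[OF f] by metis
  have "(\<lambda>k. integral {0..t} (f (X k))) \<longlonglongrightarrow> integral {0..t} (\<lambda>r. 0)"
  proof (rule dominated_convergence(2)[where h = "\<lambda>_. B"])
    show "f (X k) integrable_on {0..t}" for k
      using t by (intro integrable_continuous_real nice_cont_t[OF f]) auto
    show "norm (f (X k) r) \<le> B" if "r \<in> {0..t}" for k r using B that t by auto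
    show "(\<lambda>k. f (X k) r) \<longlonglongrightarrow> 0" if "r \<in> {0..t}" for r
    proof -
      have r: "r \<in> {0..T}" using that t by auto
      have "((\<lambda>x. f x r) \<longlongrightarrow> 0) F" using X(2) nice_top[OF f r] nice_bot[OF f r] by blast
      then show ?thesis using X(1) by (rule filterlim_compose)
    qed
  qed (rule integrable_const_ivl)
  then show ?thesis by simp
qed

text \<open>The integral is Lipschitz in t uniformly in x, with the bound of f as constant.
  Velocities and potentials are obtained from such time integrals.\<close>

lemma nice_integral:
  fixes f :: "real \<Rightarrow> real \<Rightarrow> 'a::euclidean_space"
  assumes f: "nice T f"
  shows "nice T (\<lambda>x t. integral {0..t} (f x))"
proof -
  obtain B where B: "0 \<le> B" "\<And>x t. t \<in> {0..T} \<Longrightarrow> norm (f x t) \<le> B" using nice_boundE[OF f] by metis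
  have ci: "f x integrable_on {a..b}" if "{a..b} \<subseteq> {0..T}" for x a b
    by (intro integrable_continuous_real nice_cont_t[OF f] that)
  have d: "norm (integral {0..b} (f x) - integral {0..a} (f x)) \<le> B * (b - a)" if "0 \<le> a" "a \<le> b" "b \<le> T" for x a b
  proof -
    have "integral {0..a} (f x) + integral {a..b} (f x) = integral {0..b} (f x)"
      using that by (intro Henstock_Kurzweil_Integration.integral_combine ci) auto
    then have "integral {0..b} (f x) - integral {0..a} (f x) = integral {a..b} (f x)" by (simp add: algebra_simps)
    also have "norm \<dots> \<le> B * (b - a)"
      using that by (intro integral_bound nice_cont_t[OF f] B) auto
    finally show ?thesis .
  qed
  have d2: "norm (integral {0..b} (f x) - integral {0..a} (f x)) \<le> B * \<bar>b - a\<bar>" if "a \<in> {0..T}" "b \<in> {0..T}" for x a b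
    using d[of a b x] d[of b a x] that by (cases "a \<le> b") (auto simp: norm_minus_commute)
  show ?thesis
  proof (rule niceI)
    show "continuous_on (UNIV \<times> {0..T}) (\<lambda>p. integral {0..snd p} (f (fst p)))"
    proof (rule joint_continuity)
      fix t assume t: "t \<in> {0..T}"
      show "continuous_on UNIV (\<lambda>x. integral {0..t} (f x))"
        using integral_continuous_on_param[of UNIV 0 t f] nice_cont_prod[OF f, of "{0..t}" UNIV] t by simp
      fix e :: real assume e: "e > 0"
      show "\<exists>d>0. \<forall>r\<in>{0..T}. \<bar>r - t\<bar> < d \<longrightarrow> (\<forall>x. norm (integral {0..r} (f x) - integral {0..t} (f x)) < e)"
      proof (intro exI[of _ "e / (B + 1)"] conjI ballI impI allI)
        fix r x assume r: "r \<in> {0..T}" "\<bar>r - t\<bar> < e / (B + 1)"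
        have "norm (integral {0..r} (f x) - integral {0..t} (f x)) \<le> B * \<bar>r - t\<bar>" by (rule d2[OF t r(1)])
        also have "\<dots> \<le> (B + 1) * \<bar>r - t\<bar>" by (intro mult_right_mono) auto
        also have "\<dots> < (B + 1) * (e / (B + 1))" using r(2) B(1) by (intro mult_strict_left_mono) auto
        also have "\<dots> = e" using B(1) by simp
        finally show "norm (integral {0..r} (f x) - integral {0..t} (f x)) < e" .
      qed (use e B(1) in simp)
    qed
    show "norm (integral {0..t} (f x)) \<le> B * T" if "t \<in> {0..T}" for x t
      using d[of 0 t x] that mult_left_mono[of t T B] B(1) by simp
    show "((\<lambda>x. integral {0..t} (f x)) \<longlongrightarrow> 0) at_top" if "t \<in> {0..T}" for t
      by (rule tendsto_at_topI_sequentially) (rule nice_integral_tendsto[OF f that], auto)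
    show "((\<lambda>x. integral {0..t} (f x)) \<longlongrightarrow> 0) at_bot" if "t \<in> {0..T}" for t
      unfolding filterlim_at_bot_mirror
    proof (rule tendsto_at_topI_sequentially)
      fix X :: "nat \<Rightarrow> real" assume "filterlim X at_top sequentially"
      then have "filterlim (\<lambda>k. - X k) at_bot sequentially" by (simp add: filterlim_uminus_at_top)
      then show "(\<lambda>k. integral {0..t} (f (- X k))) \<longlonglongrightarrow> 0" by (rule nice_integral_tendsto[OF f that]) simp
    qed
  qed
qed

section \<open>Local balance laws and energy estimates\<close>

lemma integral_vector_derivative_param:
  fixes f f' :: "real \<Rightarrow> real \<Rightarrow> 'a::euclidean_space"
  assumes f: "nice T f" "nice T f'" and t: "t \<in> {0..T}"
    and d: "\<And>x r. r \<in> {0..T} \<Longrightarrow> ((\<lambda>y. f y r) has_vector_derivative f' x r) (at x)"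
  shows "((\<lambda>y. integral {0..t} (f y)) has_vector_derivative integral {0..t} (f' x)) (at x)"
proof -
  have "((\<lambda>y. integral (cbox 0 t) (f y)) has_vector_derivative integral (cbox 0 t) (f' x)) (at x within UNIV)"
  proof (rule leibniz_rule_vector_derivative)
    show "((\<lambda>x. f x r) has_vector_derivative f' x r) (at x within UNIV)" if "r \<in> cbox 0 t" for x r
      using d that t by auto
    show "f x integrable_on cbox 0 t" for x
      using integrable_continuous_real[OF nice_cont_t[OF f(1)], of 0 t x] t by auto
    show "continuous_on (UNIV \<times> cbox 0 t) (\<lambda>(x, t). f' x t)"
      using t by (intro nice_cont_prod[OF f(2)]) auto
  qed auto
  then show ?thesis by simp
qed

lemma FTC_time:
  fixes f g :: "real \<Rightarrow> 'a::euclidean_space"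
  assumes "\<And>r. r \<in> {0..T} \<Longrightarrow> (f has_vector_derivative g r) (at r within {0..T})" "t \<in> {0..T}"
  shows "f t = f 0 + integral {0..t} g"
proof -
  have "(g has_integral (f t - f 0)) {0..t}"
  proof (rule fundamental_theorem_of_calculus)
    show "(f has_vector_derivative g x) (at x within {0..t})" if "x \<in> {0..t}" for x
    proof (rule has_vector_derivative_within_subset)
      show "(f has_vector_derivative g x) (at x within {0..T})" using that assms(2) by (intro assms(1)) auto
      show "{0..t} \<subseteq> {0..T}" using assms(2) by auto
    qed
  qed (use assms in auto)
  then show ?thesis by (simp add: integral_unique)
qed

text \<open>
  The boundary flux is kept, because integrability over the real line is not known in advance.
\<close>

lemma balance:
  fixes \<rho> q J S :: "real \<Rightarrow> real \<Rightarrow> 'a::euclidean_space"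
  assumes rho: "\<And>x t. t \<in> {0..T} \<Longrightarrow> ((\<lambda>r. \<rho> x r) has_vector_derivative q x t) (at t within {0..T})"
    and J: "\<And>x t. t \<in> {0..T} \<Longrightarrow> ((\<lambda>y. J y t) has_vector_derivative (q x t - S x t)) (at x)"
    and n: "nice T \<rho>" "nice T q" "nice T J" "nice T S" and t: "t \<in> {0..T}" and R: "0 \<le> R"
  shows "integral {-R..R} (\<lambda>x. \<rho> x t) = integral {-R..R} (\<lambda>x. \<rho> x 0)
    + integral {0..t} (\<lambda>r. J R r - J (-R) r) + integral {0..t} (\<lambda>r. integral {-R..R} (\<lambda>x. S x r))"
proof -
  have sub: "{0..t} \<subseteq> {0..T}" and T0: "0 \<in> {0..T}" using t by auto
  have "integral {-R..R} (\<lambda>x. \<rho> x t) = integral {-R..R} (\<lambda>x. \<rho> x 0 + integral {0..t} (q x))"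
    by (rule Henstock_Kurzweil_Integration.integral_cong) (rule FTC_time[OF rho t])
  also have "\<dots> = integral {-R..R} (\<lambda>x. \<rho> x 0) + integral {-R..R} (\<lambda>x. integral {0..t} (q x))"
    by (intro Henstock_Kurzweil_Integration.integral_add integrable_continuous_real nice_cont_x[OF n(1) T0]
        nice_cont_x[OF nice_integral[OF n(2)] t])
  \<comment> \<open>Fubini for continuous functions on a rectangle; at each fixed time q - S is an
    x-derivative and integrates to the flux.\<close>
  also have "integral {-R..R} (\<lambda>x. integral {0..t} (q x)) = integral {0..t} (\<lambda>r. integral {-R..R} (\<lambda>x. q x r))"
    using integral_swap_continuous[of "-R" 0 R t q] nice_cont_prod[OF n(2) sub, of "{-R..R}"]
    by (simp add: cbox_Pair_eq)
  also have "\<dots> = integral {0..t} (\<lambda>r. (J R r - J (-R) r) + integral {-R..R} (\<lambda>x. S x r))"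
  proof (intro Henstock_Kurzweil_Integration.integral_cong)
    fix r assume "r \<in> {0..t}"
    then have r: "r \<in> {0..T}" using sub by auto
    have "((\<lambda>x. q x r - S x r) has_integral (J R r - J (-R) r)) {-R..R}"
    proof (rule fundamental_theorem_of_calculus)
      show "((\<lambda>y. J y r) has_vector_derivative q x r - S x r) (at x within {-R..R})" for x
        by (rule has_vector_derivative_at_within[OF J[OF r]])
    qed (use R in simp)
    then have "integral {-R..R} (\<lambda>x. q x r - S x r) = J R r - J (-R) r" by (rule integral_unique)
    then show "integral {-R..R} (\<lambda>x. q x r) = (J R r - J (-R) r) + integral {-R..R} (\<lambda>x. S x r)"
      using Henstock_Kurzweil_Integration.integral_diff[OF integrable_continuous_real[OF nice_cont_x[OF n(2) r]] integrable_continuous_real[OF nice_cont_x[OF n(4) r]], of "-R" R]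
      by (simp add: algebra_simps)
  qed
  also have "\<dots> = integral {0..t} (\<lambda>r. J R r - J (-R) r) + integral {0..t} (\<lambda>r. integral {-R..R} (\<lambda>x. S x r))"
  proof (intro Henstock_Kurzweil_Integration.integral_add integrable_continuous_real)
    show "continuous_on {0..t} (\<lambda>r. J R r - J (-R) r)" by (intro continuous_on_diff nice_cont_t[OF n(3) sub])
    show "continuous_on {0..t} (\<lambda>r. integral {-R..R} (\<lambda>x. S x r))"
      using integral_continuous_on_param[of "{0..t}" "-R" R "\<lambda>r x. S x r"] nice_cont_swap[OF n(4) sub, of "{-R..R}"] by simp
  qed
  finally show ?thesis by (simp add: add.assoc)
qed

lemma flux_tendsto_0:
  fixes J :: "real \<Rightarrow> real \<Rightarrow> 'a::euclidean_space"
  assumes J: "nice T J" and t: "t \<in> {0..T}"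
  shows "(\<lambda>k. integral {0..t} (\<lambda>r. J (real k) r - J (- real k) r)) \<longlonglongrightarrow> 0"
proof -
  have "filterlim (\<lambda>k. - real k) at_bot sequentially"
    using filterlim_real_sequentially by (simp add: filterlim_uminus_at_top)
  from tendsto_diff[OF nice_integral_tendsto[OF J t filterlim_real_sequentially] nice_integral_tendsto[OF J t this]]
  have "(\<lambda>k. integral {0..t} (J (real k)) - integral {0..t} (J (- real k))) \<longlonglongrightarrow> 0" by simp
  moreover have "integral {0..t} (J (real k)) - integral {0..t} (J (- real k)) = integral {0..t} (\<lambda>r. J (real k) r - J (- real k) r)" for k
    using t by (intro Henstock_Kurzweil_Integration.integral_diff[symmetric] integrable_continuous_real nice_cont_t[OF J]) auto
  ultimately show ?thesis by simp
qed

lemma nice_norm: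
  assumes f: "nice T f"
  shows "nice T (\<lambda>x t. norm (f x t))"
proof -
  obtain B where B: "\<And>x t. t \<in> {0..T} \<Longrightarrow> norm (f x t) \<le> B" using nice_boundE[OF f] by metis
  show ?thesis
    by (rule niceI[where B = B])
      (simp_all only: real_norm_def abs_norm_cancel B continuous_on_norm[OF nice_cont[OF f]] tendsto_norm_zero[OF nice_top[OF f]] tendsto_norm_zero[OF nice_bot[OF f]])
qed

lemma integrable_nice: "nice T f \<Longrightarrow> t \<in> {0..T} \<Longrightarrow> (\<lambda>x. f x t :: 'a::euclidean_space) integrable_on {a..b}"
  by (intro integrable_continuous_real nice_cont_x)

lemma continuous_on_integral_nice:
  fixes f :: "real \<Rightarrow> real \<Rightarrow> 'a::euclidean_space"
  assumes "nice T f" "S \<subseteq> {0..T}"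
  shows "continuous_on S (\<lambda>t. integral {a..b} (\<lambda>x. f x t))"
  using integral_continuous_on_param[of S a b "\<lambda>t x. f x t"] nice_cont_swap[OF assms, of "{a..b}"] by simp

text \<open>One null sequence for all times is needed because the energy estimate evaluates the flux
  at a time that depends on the truncation k.\<close>

lemma flux_uniform:
  fixes J :: "real \<Rightarrow> real \<Rightarrow> real"
  assumes J: "nice T J" and T: "0 \<le> T"
  shows "\<exists>\<delta>. \<delta> \<longlonglongrightarrow> 0 \<and> (\<forall>k. \<forall>t\<in>{0..T}. integral {0..t} (\<lambda>r. J (real k) r - J (- real k) r) \<le> \<delta> k)"
proof -
  note A = nice_norm[OF J]
  have T': "T \<in> {0..T}" using T by simp
  have "filterlim (\<lambda>k. - real k) at_bot sequentially"
    using filterlim_real_sequentially by (simp add: filterlim_uminus_at_top)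
  from tendsto_add[OF nice_integral_tendsto[OF A T' filterlim_real_sequentially] nice_integral_tendsto[OF A T' this]]
  have lim: "(\<lambda>k. integral {0..T} (\<lambda>r. norm (J (real k) r)) + integral {0..T} (\<lambda>r. norm (J (- real k) r))) \<longlonglongrightarrow> 0" by simp
  have "integral {0..t} (\<lambda>r. J (real k) r - J (- real k) r) \<le> integral {0..T} (\<lambda>r. norm (J (real k) r)) + integral {0..T} (\<lambda>r. norm (J (- real k) r))"
    if t: "t \<in> {0..T}" for k t
  proof -
    have sub: "{0..t} \<subseteq> {0..T}" using t by auto
    have i: "(\<lambda>r. norm (J x r)) integrable_on {0..T}" "(\<lambda>r. norm (J x r)) integrable_on {0..t}" "(\<lambda>r. J x r) integrable_on {0..t}" for x
      by (intro integrable_continuous_real nice_cont_t[OF A] nice_cont_t[OF J] sub order_refl)+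
    have "integral {0..t} (\<lambda>r. J (real k) r - J (- real k) r) \<le> integral {0..t} (\<lambda>r. norm (J (real k) r) + norm (J (- real k) r))"
      by (intro Henstock_Kurzweil_Integration.integral_le Henstock_Kurzweil_Integration.integrable_diff Henstock_Kurzweil_Integration.integrable_add i) auto
    also have "\<dots> = integral {0..t} (\<lambda>r. norm (J (real k) r)) + integral {0..t} (\<lambda>r. norm (J (- real k) r))"
      by (intro Henstock_Kurzweil_Integration.integral_add i)
    also have "\<dots> \<le> integral {0..T} (\<lambda>r. norm (J (real k) r)) + integral {0..T} (\<lambda>r. norm (J (- real k) r))"
      using sub by (intro add_mono integral_subset_le i) auto
    finally show ?thesis .
  qed
  with lim show ?thesis by (intro exI[of _ "\<lambda>k. integral {0..T} (\<lambda>r. norm (J (real k) r)) + integral {0..T} (\<lambda>r. norm (J (- real k) r))"]) simp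
qed

lemma integral_symmetric_mono:
  fixes f :: "real \<Rightarrow> real"
  assumes "continuous_on UNIV f" "\<And>x. 0 \<le> f x" "R \<le> R'"
  shows "integral {-R..R} f \<le> integral {-R'..R'} f"
  using assms by (intro integral_subset_le integrable_continuous_real continuous_on_subset[OF assms(1)]) auto

text \<open>Absorption in place of Gronwall. At the time s where the truncated integral of
  \<open>\<rho>\<close> is largest, the source contributes at most half of that maximum, since s /
  (2 T) is at most 1 / 2; moving this half to the left doubles M and turns 2 T^2 into 4 T^2. The
  maximum exists because the truncated integral is finite and continuous in time, and the limit in k
  is taken afterwards.\<close>

lemma energy_estimate:
  fixes \<rho> q J S H :: "real \<Rightarrow> real \<Rightarrow> real"
  assumes T: "0 < T"
    and rho: "\<And>x t. t \<in> {0..T} \<Longrightarrow> ((\<lambda>r. \<rho> x r) has_vector_derivative q x t) (at t within {0..T})"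
    and J: "\<And>x t. t \<in> {0..T} \<Longrightarrow> ((\<lambda>y. J y t) has_vector_derivative (q x t - S x t)) (at x)"
    and n: "nice T \<rho>" "nice T q" "nice T J" "nice T S" "nice T H"
    and pos: "\<And>x t. t \<in> {0..T} \<Longrightarrow> 0 \<le> \<rho> x t"
    and S: "\<And>x t. t \<in> {0..T} \<Longrightarrow> S x t \<le> \<rho> x t / (2 * T) + 2 * T * H x t"
    and H: "\<And>R t. 0 \<le> R \<Longrightarrow> t \<in> {0..T} \<Longrightarrow> integral {-R..R} (\<lambda>x. H x t) \<le> \<Gamma>"
    and M: "\<And>R. 0 \<le> R \<Longrightarrow> integral {-R..R} (\<lambda>x. \<rho> x 0) \<le> M"
    and t: "t \<in> {0..T}" and R: "0 \<le> R"
  shows "integral {-R..R} (\<lambda>x. \<rho> x t) \<le> 2 * M + 4 * T\<^sup>2 * \<Gamma>"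
proof -
  obtain \<delta> where d: "\<delta> \<longlonglongrightarrow> 0" "\<And>k t. t \<in> {0..T} \<Longrightarrow> integral {0..t} (\<lambda>r. J (real k) r - J (- real k) r) \<le> \<delta> k"
    using flux_uniform[OF n(3)] T by fastforce
  have G0: "0 \<le> \<Gamma>" using H[of 0 0] T by simp
  have bound: "integral {- real k..real k} (\<lambda>x. \<rho> x t) \<le> 2 * M + 2 * \<delta> k + 4 * T\<^sup>2 * \<Gamma>" for k
  proof -
    let ?m = "\<lambda>t. integral {- real k..real k} (\<lambda>x. \<rho> x t)"
    have "\<exists>s\<in>{0..T}. \<forall>t\<in>{0..T}. ?m t \<le> ?m s"
      using T by (intro continuous_attains_sup continuous_on_integral_nice[OF n(1)]) auto
    then obtain s where s: "s \<in> {0..T}" "\<And>t. t \<in> {0..T} \<Longrightarrow> ?m t \<le> ?m s" by blast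
    have m0: "0 \<le> ?m s" by (intro Henstock_Kurzweil_Integration.integral_nonneg integrable_nice[OF n(1) s(1)] pos s)
    have inner: "integral {- real k..real k} (\<lambda>x. S x r) \<le> ?m s / (2 * T) + 2 * T * \<Gamma>" if r: "r \<in> {0..T}" for r
    proof -
      note ir = integrable_nice[OF n(1) r] integrable_nice[OF n(5) r]
      have i1: "(\<lambda>x. \<rho> x r / (2 * T)) integrable_on {- real k..real k}"
        using integrable_on_cmult_left[OF ir(1), of "1 / (2 * T)"] by simp
      have i2: "(\<lambda>x. 2 * T * H x r) integrable_on {- real k..real k}"
        using integrable_on_cmult_left[OF ir(2), of "2 * T"] by simp
      have "integral {- real k..real k} (\<lambda>x. S x r) \<le> integral {- real k..real k} (\<lambda>x. \<rho> x r / (2 * T) + 2 * T * H x r)"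
        by (intro Henstock_Kurzweil_Integration.integral_le integrable_nice[OF n(4) r] S r
            Henstock_Kurzweil_Integration.integrable_add i1 i2)
      also have "\<dots> = ?m r / (2 * T) + 2 * T * integral {- real k..real k} (\<lambda>x. H x r)"
        using Henstock_Kurzweil_Integration.integral_add[OF i1 i2] by simp
      also have "\<dots> \<le> ?m s / (2 * T) + 2 * T * \<Gamma>"
        using T s(2)[OF r] H[OF _ r, of "real k"] by (intro add_mono divide_right_mono mult_left_mono) auto
      finally show ?thesis .
    qed
    have sub: "{0..s} \<subseteq> {0..T}" using s by auto
    have "?m s = integral {- real k..real k} (\<lambda>x. \<rho> x 0) + integral {0..s} (\<lambda>r. J (real k) r - J (- real k) r)
        + integral {0..s} (\<lambda>r. integral {- real k..real k} (\<lambda>x. S x r))"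
      by (rule balance[OF rho J n(1-4) s(1)]) auto
    also have "integral {0..s} (\<lambda>r. integral {- real k..real k} (\<lambda>x. S x r)) \<le> integral {0..s} (\<lambda>r. ?m s / (2 * T) + 2 * T * \<Gamma>)"
      using sub by (intro Henstock_Kurzweil_Integration.integral_le integrable_continuous_real continuous_on_integral_nice[OF n(4)] inner) auto
    also have "\<dots> = s * (?m s / (2 * T) + 2 * T * \<Gamma>)" using s by simp
    also have "\<dots> \<le> T * (?m s / (2 * T) + 2 * T * \<Gamma>)" using s(1) m0 T G0 by (intro mult_right_mono) auto
    also have "\<dots> = ?m s / 2 + 2 * T\<^sup>2 * \<Gamma>" using T by (simp add: distrib_left power2_eq_square)
    finally have "?m s \<le> M + \<delta> k + (?m s / 2 + 2 * T\<^sup>2 * \<Gamma>)"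
      using M[of "real k"] d(2)[OF s(1), of k] by simp
    then show ?thesis using s(2)[OF t] by simp
  qed
  have "(\<lambda>k. 2 * M + 2 * \<delta> k + 4 * T\<^sup>2 * \<Gamma>) \<longlonglongrightarrow> 2 * M + 2 * 0 + 4 * T\<^sup>2 * \<Gamma>" by (intro tendsto_intros d)
  moreover obtain K :: nat where K: "R \<le> real K" using real_arch_simple by blast
  have "integral {-R..R} (\<lambda>x. \<rho> x t) \<le> 2 * M + 2 * \<delta> k + 4 * T\<^sup>2 * \<Gamma>" if "K \<le> k" for k
  proof (rule order_trans[OF integral_symmetric_mono bound])
    show "R \<le> real k" using K that by simp
  qed (use nice_cont_x[OF n(1) t] pos[OF t] in auto)
  then have "\<forall>\<^sub>F k in sequentially. integral {-R..R} (\<lambda>x. \<rho> x t) \<le> 2 * M + 2 * \<delta> k + 4 * T\<^sup>2 * \<Gamma>"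
    by (rule eventually_sequentiallyI)
  ultimately have "integral {-R..R} (\<lambda>x. \<rho> x t) \<le> 2 * M + 2 * 0 + 4 * T\<^sup>2 * \<Gamma>"
    by (rule tendsto_lowerbound) simp
  then show ?thesis by simp
qed

section \<open>The L2 estimate for forced Schroedinger equations\<close>

lemma cmod_power2_vector_derivative:
  assumes "(f has_vector_derivative f') (at x within A)"
  shows "((\<lambda>x. (cmod (f x))\<^sup>2) has_vector_derivative 2 * Re (cnj (f x) * f')) (at x within A)"
proof -
  have "((\<lambda>x. cnj (f x)) has_vector_derivative cnj f') (at x within A)"
    by (rule bounded_linear.has_vector_derivative[OF bounded_linear_cnj assms])
  from bounded_linear.has_vector_derivative[OF bounded_linear_Re has_vector_derivative_mult[OF this assms]]
  have "((\<lambda>x. Re (cnj (f x) * f x)) has_vector_derivative Re (cnj (f x) * f' + cnj f' * f x)) (at x within A)" .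
  moreover have "Re (cnj z * z) = (cmod z)\<^sup>2" for z
    unfolding cmod_power2 by (simp add: power2_eq_square)
  moreover have "Re (cnj (f x) * f' + cnj f' * f x) = 2 * Re (cnj (f x) * f')" by (simp add: algebra_simps)
  ultimately show ?thesis by (simp only:)
qed

lemma Re_cnj_mult_vector_derivative:
  assumes "(f has_vector_derivative f') (at x within A)" "(g has_vector_derivative g') (at x within A)"
  shows "((\<lambda>x. Re (cnj (f x) * g x)) has_vector_derivative Re (cnj (f x) * g' + cnj f' * g x)) (at x within A)"
  by (rule bounded_linear.has_vector_derivative[OF bounded_linear_Re has_vector_derivative_mult[OF
    bounded_linear.has_vector_derivative[OF bounded_linear_cnj assms(1)] assms(2)]])

lemma young:
  fixes a b T :: real
  assumes "0 < T"
  shows "2 * (a * b) \<le> a\<^sup>2 / (2 * T) + 2 * T * b\<^sup>2"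
proof -
  have "0 \<le> (a - 2 * T * b)\<^sup>2 / (2 * T)" using assms by simp
  also have "(a - 2 * T * b)\<^sup>2 / (2 * T) = a\<^sup>2 / (2 * T) + 2 * T * b\<^sup>2 - 2 * (a * b)"
    using assms by (simp add: power2_eq_square field_simps)
  finally show ?thesis by simp
qed

text \<open>The equation is \<open>i r_t + r_xx = G\<close>. The dispersive term is the x-derivative
  of \<open>2 Re (cnj r * i r_x)\<close>, because \<open>Re (i |r_x|^2) = 0\<close>, and so
  contributes flux only. The condition on the source is abstract: \<open>cmod_young\<close> supplies
  it in general, and for a real potential its left-hand side is 0.\<close>

lemma schroedinger_estimate:
  fixes r0 r1 r2 G :: "real \<Rightarrow> real \<Rightarrow> complex" and H :: "real \<Rightarrow> real \<Rightarrow> real"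
  assumes T: "0 < T"
    and x: "\<And>x t. t \<in> {0..T} \<Longrightarrow> ((\<lambda>y. r0 y t) has_vector_derivative r1 x t) (at x)"
      "\<And>x t. t \<in> {0..T} \<Longrightarrow> ((\<lambda>y. r1 y t) has_vector_derivative r2 x t) (at x)"
    and t: "\<And>x t. t \<in> {0..T} \<Longrightarrow> ((\<lambda>r. r0 x r) has_vector_derivative (\<i> * r2 x t - \<i> * G x t)) (at t within {0..T})"
    and n: "nice T r0" "nice T r1" "nice T r2" "nice T G" "nice T H"
    and S: "\<And>x t. t \<in> {0..T} \<Longrightarrow> - (2 * Re (cnj (r0 x t) * (\<i> * G x t))) \<le> (cmod (r0 x t))\<^sup>2 / (2 * T) + 2 * T * H x t"
    and H: "\<And>R t. 0 \<le> R \<Longrightarrow> t \<in> {0..T} \<Longrightarrow> integral {-R..R} (\<lambda>x. H x t) \<le> \<Gamma>"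
    and M: "\<And>R. 0 \<le> R \<Longrightarrow> integral {-R..R} (\<lambda>x. (cmod (r0 x 0))\<^sup>2) \<le> M"
    and tR: "t \<in> {0..T}" "0 \<le> R"
  shows "integral {-R..R} (\<lambda>x. (cmod (r0 x t))\<^sup>2) \<le> 2 * M + 4 * T\<^sup>2 * \<Gamma>"
proof (rule energy_estimate[OF T _ _ _ _ _ _ n(5) _ S H M tR])
  show "((\<lambda>r. (cmod (r0 x r))\<^sup>2) has_vector_derivative 2 * Re (cnj (r0 x t) * (\<i> * r2 x t - \<i> * G x t))) (at t within {0..T})"
    if "t \<in> {0..T}" for x t
    by (rule cmod_power2_vector_derivative[OF t[OF that]])
  fix x t assume tt: "t \<in> {0..T}"
  have i: "((\<lambda>y. \<i> * r1 y t) has_vector_derivative \<i> * r2 x t) (at x)"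
    by (intro has_vector_derivative_mult_right x tt)
  have "((\<lambda>y. 2 * Re (cnj (r0 y t) * (\<i> * r1 y t))) has_vector_derivative 2 * Re (cnj (r0 x t) * (\<i> * r2 x t) + cnj (r1 x t) * (\<i> * r1 x t))) (at x)"
    by (intro has_vector_derivative_mult_right Re_cnj_mult_vector_derivative i x tt)
  moreover have "Re (cnj (r1 x t) * (\<i> * r1 x t)) = 0" by simp
  ultimately show "((\<lambda>y. 2 * Re (cnj (r0 y t) * (\<i> * r1 y t))) has_vector_derivative
      2 * Re (cnj (r0 x t) * (\<i> * r2 x t - \<i> * G x t)) - - (2 * Re (cnj (r0 x t) * (\<i> * G x t)))) (at x)"
    by (simp only: right_diff_distrib plus_complex.simps minus_complex.simps) (simp add: algebra_simps)
qed (auto intro!: nice_intros n)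

lemma cmod_young:
  assumes "0 < T"
  shows "- (2 * Re (cnj r * (\<i> * G))) \<le> (cmod r)\<^sup>2 / (2 * T) + 2 * T * (cmod G)\<^sup>2"
proof -
  have "- Re (cnj r * (\<i> * G)) \<le> cmod (cnj r * (\<i> * G))"
    using abs_Re_le_cmod[of "cnj r * (\<i> * G)"] by simp
  also have "\<dots> = cmod r * cmod G" by (simp add: norm_mult)
  finally show ?thesis using young[OF assms, of "cmod r" "cmod G"] by simp
qed

text \<open>Exchange of the x- and the t-derivative: f is its initial value plus the time integral
  of g, which may be differentiated in x under the integral; the result is again a primitive in
  time.\<close>

lemma mixed_derivative:
  fixes f f' g g' :: "real \<Rightarrow> real \<Rightarrow> 'a::euclidean_space"
  assumes x: "\<And>x t. t \<in> {0..T} \<Longrightarrow> ((\<lambda>y. f y t) has_vector_derivative f' x t) (at x)"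
      "\<And>x t. t \<in> {0..T} \<Longrightarrow> ((\<lambda>y. g y t) has_vector_derivative g' x t) (at x)"
    and t: "\<And>x t. t \<in> {0..T} \<Longrightarrow> ((\<lambda>r. f x r) has_vector_derivative g x t) (at t within {0..T})"
    and n: "nice T g" "nice T g'" and tt: "t \<in> {0..T}"
  shows "((\<lambda>r. f' x r) has_vector_derivative g' x t) (at t within {0..T})"
proof -
  have T0: "0 \<in> {0..T}" using tt by auto
  have eq: "f' x r = f' x 0 + integral {0..r} (g' x)" if r: "r \<in> {0..T}" for r
  proof -
    have "(\<lambda>y. f y r) = (\<lambda>y. f y 0 + integral {0..r} (g y))"
      by (rule ext) (rule FTC_time[OF t r])
    then have "((\<lambda>y. f y 0 + integral {0..r} (g y)) has_vector_derivative f' x r) (at x)" using x(1)[OF r, of x] by simp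
    moreover have "((\<lambda>y. f y 0 + integral {0..r} (g y)) has_vector_derivative f' x 0 + integral {0..r} (g' x)) (at x)"
      by (intro has_vector_derivative_add x(1)[OF T0] integral_vector_derivative_param[OF n r x(2)])
    ultimately show ?thesis by (rule vector_derivative_unique_at)
  qed
  have "((\<lambda>r. f' x 0 + integral {0..r} (g' x)) has_vector_derivative 0 + g' x t) (at t within {0..T})"
    by (intro has_vector_derivative_add has_vector_derivative_const integral_has_vector_derivative nice_cont_t[OF n(2)] tt order_refl)
  then have "((\<lambda>r. f' x 0 + integral {0..r} (g' x)) has_vector_derivative g' x t) (at t within {0..T})" by simp
  then show ?thesis by (rule has_vector_derivative_transform[OF tt eq, rotated]) 
qed

section \<open>Mass and energy of the Zakharov flow\<close>

lemma nice_cong: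
  assumes "nice T f" and eq: "\<And>x t. t \<in> {0..T} \<Longrightarrow> g x t = f x t"
  shows "nice T g"
proof -
  obtain B where B: "\<And>x t. t \<in> {0..T} \<Longrightarrow> norm (f x t) \<le> B" using nice_boundE[OF assms(1)] by metis
  show ?thesis
  proof (rule niceI)
    show "continuous_on (UNIV \<times> {0..T}) (\<lambda>p. g (fst p) (snd p))"
      by (rule continuous_on_eq[OF nice_cont[OF assms(1)]]) (auto simp: eq)
    show "norm (g x t) \<le> B" if "t \<in> {0..T}" for x t using B eq that by simp
    show "((\<lambda>x. g x t) \<longlongrightarrow> 0) at_top" if "t \<in> {0..T}" for t using nice_top[OF assms(1) that] by (simp add: eq[OF that])
    show "((\<lambda>x. g x t) \<longlongrightarrow> 0) at_bot" if "t \<in> {0..T}" for t using nice_bot[OF assms(1) that] by (simp add: eq[OF that])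
  qed
qed

text \<open>A smooth solution in coordinates: indices count x-derivatives, \<open>u0_t\<close> is
  the Schroedinger equation solved for the time derivative, and the second x-derivative of |u|^2 is
  written out in \<open>nt_t\<close>. Zero initial velocity provides a velocity potential that
  vanishes at time 0, without inverting d/dx on the data. \<open>u3\<close> enters through the time
  derivative of \<open>u1\<close>.\<close>

locale zakharov_flow =
  fixes T :: real and u0 u1 u2 u3 :: "real \<Rightarrow> real \<Rightarrow> complex" and n0 n1 n2 nt :: "real \<Rightarrow> real \<Rightarrow> real"
  assumes T: "0 < T"
    and u0_x: "\<And>x t. t \<in> {0..T} \<Longrightarrow> ((\<lambda>y. u0 y t) has_vector_derivative u1 x t) (at x)"
    and u1_x: "\<And>x t. t \<in> {0..T} \<Longrightarrow> ((\<lambda>y. u1 y t) has_vector_derivative u2 x t) (at x)"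
    and u2_x: "\<And>x t. t \<in> {0..T} \<Longrightarrow> ((\<lambda>y. u2 y t) has_vector_derivative u3 x t) (at x)"
    and n0_x: "\<And>x t. t \<in> {0..T} \<Longrightarrow> ((\<lambda>y. n0 y t) has_vector_derivative n1 x t) (at x)"
    and n1_x: "\<And>x t. t \<in> {0..T} \<Longrightarrow> ((\<lambda>y. n1 y t) has_vector_derivative n2 x t) (at x)"
    and nice_u: "nice T u0" "nice T u1" "nice T u2" "nice T u3"
    and nice_n: "nice T n0" "nice T n1" "nice T n2"
    and u0_t: "\<And>x t. t \<in> {0..T} \<Longrightarrow> ((\<lambda>r. u0 x r) has_vector_derivative
      (\<i> * u2 x t - \<i> * (complex_of_real (n0 x t) * u0 x t))) (at t within {0..T})"
    and n0_t: "\<And>x t. t \<in> {0..T} \<Longrightarrow> ((\<lambda>r. n0 x r) has_vector_derivative nt x t) (at t within {0..T})"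
    and nt_t: "\<And>x t. t \<in> {0..T} \<Longrightarrow> ((\<lambda>r. nt x r) has_vector_derivative
      (n2 x t + (2 * Re (cnj (u0 x t) * u2 x t) + 2 * (cmod (u1 x t))\<^sup>2))) (at t within {0..T})"
    and nt_0: "\<And>x. nt x 0 = 0"
begin

definition f0 where "f0 x t = (cmod (u0 x t))\<^sup>2"
definition f1 where "f1 x t = 2 * Re (cnj (u0 x t) * u1 x t)"
definition f2 where "f2 x t = 2 * Re (cnj (u0 x t) * u2 x t) + 2 * (cmod (u1 x t))\<^sup>2"

lemma nice_f: "nice T f0" "nice T f1" "nice T f2"
  unfolding f0_def[abs_def] f1_def[abs_def] f2_def[abs_def] by (intro nice_intros nice_u)+

lemma f0_x: "t \<in> {0..T} \<Longrightarrow> ((\<lambda>y. f0 y t) has_vector_derivative f1 x t) (at x)"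
  unfolding f0_def f1_def by (rule cmod_power2_vector_derivative[OF u0_x])

lemma f1_x: "t \<in> {0..T} \<Longrightarrow> ((\<lambda>y. f1 y t) has_vector_derivative f2 x t) (at x)"
proof -
  assume t: "t \<in> {0..T}"
  have "Re (cnj (u1 x t) * u1 x t) = (cmod (u1 x t))\<^sup>2"
    unfolding cmod_power2 by (simp add: power2_eq_square)
  then show ?thesis unfolding f1_def f2_def
    using has_vector_derivative_mult_right[OF Re_cnj_mult_vector_derivative[OF u0_x[OF t] u1_x[OF t], of x], of 2]
    by (simp only: plus_complex.simps distrib_left)
qed

text \<open>The velocity potential of the wave part: \<open>n\<^sub>t = - v\<^sub>x\<close> and \<open>v\<^sub>t = - (n + \<bar>u\<bar>\<^sup>2)\<^sub>x\<close>.\<close>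

definition v where "v x t = - integral {0..t} (\<lambda>r. n1 x r + f1 x r)"

lemma nice_v: "nice T v"
  unfolding v_def[abs_def] by (intro nice_minus nice_integral nice_add nice_n nice_f)

lemma v_0: "v x 0 = 0" by (simp add: v_def)

lemma nt_eq: "t \<in> {0..T} \<Longrightarrow> nt x t = integral {0..t} (\<lambda>r. n2 x r + f2 x r)"
  using FTC_time[OF nt_t, of t x] nt_0[of x] by (simp add: f2_def)

text \<open>Continuity, bounds and decay of the velocity come from the wave equation, integrated in
  time from rest.\<close>

lemma nice_nt: "nice T nt"
  by (rule nice_cong[OF nice_integral[OF nice_add[OF nice_n(3) nice_f(3)]] nt_eq])

lemma v_x: "t \<in> {0..T} \<Longrightarrow> ((\<lambda>y. v y t) has_vector_derivative - nt x t) (at x)"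
proof -
  assume t: "t \<in> {0..T}"
  have "((\<lambda>y. integral {0..t} (\<lambda>r. n1 y r + f1 y r)) has_vector_derivative integral {0..t} (\<lambda>r. n2 x r + f2 x r)) (at x)"
    by (rule integral_vector_derivative_param[where T = T])
      (intro nice_add nice_n nice_f t has_vector_derivative_add n1_x f1_x; assumption?)+
  then show ?thesis unfolding v_def nt_eq[OF t] by (rule has_vector_derivative_minus)
qed

lemma v_t: "t \<in> {0..T} \<Longrightarrow> ((\<lambda>r. v x r) has_vector_derivative - (n1 x t + f1 x t)) (at t within {0..T})"
  unfolding v_def
  by (intro has_vector_derivative_minus integral_has_vector_derivative nice_cont_t[OF nice_add[OF nice_n(2) nice_f(2)]] order_refl)

text \<open>The potential term is skew, \<open>Re (cnj u * (i n u)) = 0\<close>, so the source is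
  zero; the factor 2 is the one of the general L2 estimate.\<close>

lemma mass:
  assumes M: "\<And>R. 0 \<le> R \<Longrightarrow> integral {-R..R} (\<lambda>x. f0 x 0) \<le> M" and tR: "t \<in> {0..T}" "0 \<le> R"
  shows "integral {-R..R} (\<lambda>x. f0 x t) \<le> 2 * M"
proof -
  have "Re (cnj z * (\<i> * (complex_of_real a * z))) = 0" for z a by (simp add: algebra_simps)
  then have "integral {-R..R} (\<lambda>x. (cmod (u0 x t))\<^sup>2) \<le> 2 * M + 4 * T\<^sup>2 * 0"
    using M T unfolding f0_def
    by (intro schroedinger_estimate[OF T u0_x u1_x u0_t nice_u(1-3) _ nice_zero _ _ _ tR]) (auto intro!: nice_intros nice_u nice_n)
  then show ?thesis by (simp add: f0_def)
qed

text \<open>The Hamiltonian density of the system, in which the velocity potential v carries the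
  kinetic energy of the wave.\<close>

definition e where "e x t = (cmod (u1 x t))\<^sup>2 + (n0 x t)\<^sup>2 / 2 + (v x t)\<^sup>2 / 2 + n0 x t * f0 x t"

definition u0t where "u0t x t = \<i> * u2 x t - \<i> * (complex_of_real (n0 x t) * u0 x t)"
definition u1t where "u1t x t = \<i> * u3 x t - \<i> * (complex_of_real (n0 x t) * u1 x t + complex_of_real (n1 x t) * u0 x t)"

lemma u0t_x: "t \<in> {0..T} \<Longrightarrow> ((\<lambda>y. u0t y t) has_vector_derivative u1t x t) (at x)"
  unfolding u0t_def u1t_def
  by (intro has_vector_derivative_diff has_vector_derivative_mult_right has_vector_derivative_mult u2_x u0_x
      bounded_linear.has_vector_derivative[OF bounded_linear_of_real] n0_x)

lemma nice_ut: "nice T u0t" "nice T u1t"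
  unfolding u0t_def[abs_def] u1t_def[abs_def] by (intro nice_intros nice_u nice_n)+

lemma u1_t: "t \<in> {0..T} \<Longrightarrow> ((\<lambda>r. u1 x r) has_vector_derivative u1t x t) (at t within {0..T})"
  by (rule mixed_derivative[OF u0_x u0t_x _ nice_ut]) (simp_all add: u0t_def u0_t)

text \<open>The energy flux. Note that \<open>e_x\<close> is the x-derivative of this flux, not of
  \<open>e\<close>; by the equations it equals the t-derivative of \<open>e\<close>.\<close>

definition eflux where "eflux x t = 2 * Re (cnj (u1 x t) * u0t x t) - v x t * (n0 x t + f0 x t)"
definition e_x where "e_x x t = 2 * Re (cnj (u1 x t) * u1t x t + cnj (u2 x t) * u0t x t)
  - (v x t * (n1 x t + f1 x t) + - nt x t * (n0 x t + f0 x t))"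

lemma eflux_x: "t \<in> {0..T} \<Longrightarrow> ((\<lambda>y. eflux y t) has_vector_derivative e_x x t) (at x)"
  unfolding eflux_def e_x_def
  by (intro has_vector_derivative_diff has_vector_derivative_mult_right has_vector_derivative_mult
      Re_cnj_mult_vector_derivative has_vector_derivative_add u1_x u0t_x v_x n0_x f0_x)

lemma nice_e: "nice T e" "nice T eflux" "nice T e_x"
  unfolding e_def[abs_def] eflux_def[abs_def] e_x_def[abs_def] divide_inverse
  by (intro nice_intros nice_u nice_n nice_ut nice_v nice_nt nice_f nice_bounded_linear[OF bounded_linear_mult_left])+

lemma power2_vector_derivative:
  fixes f :: "real \<Rightarrow> real"
  assumes "(f has_vector_derivative f') (at x within A)"
  shows "((\<lambda>x. (f x)\<^sup>2) has_vector_derivative 2 * (f x * f')) (at x within A)"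
  using has_vector_derivative_mult[OF assms assms] by (simp add: power2_eq_square mult.commute)

lemma e_t: "t \<in> {0..T} \<Longrightarrow> ((\<lambda>r. e x r) has_vector_derivative e_x x t) (at t within {0..T})"
proof -
  assume t: "t \<in> {0..T}"
  have d: "((\<lambda>r. e x r) has_vector_derivative (2 * Re (cnj (u1 x t) * u1t x t) + 2 * (n0 x t * nt x t) / 2
     + 2 * (v x t * - (n1 x t + f1 x t)) / 2 + (n0 x t * (2 * Re (cnj (u0 x t) * u0t x t)) + nt x t * f0 x t))) (at t within {0..T})"
    unfolding e_def f0_def[of x]
    by (intro has_vector_derivative_add has_vector_derivative_mult has_vector_derivative_divide
        power2_vector_derivative cmod_power2_vector_derivative u1_t[OF t] n0_t[OF t] v_t[OF t] u0_t[OF t, folded u0t_def])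
  \<comment> \<open>Since \<open>n u = u_xx + i u_t\<close> and
    \<open>Re (cnj (i u_t) * u_t) = 0\<close>, the factor n u may be traded for u_xx. Together with
    the term from |u_x|^2 this becomes the x-derivative of
    \<open>2 Re (cnj u_x * u_t)\<close>.\<close>
  have "n0 x t * (2 * Re (cnj (u0 x t) * u0t x t)) = 2 * Re (cnj (u2 x t) * u0t x t)"
    unfolding u0t_def by (simp add: algebra_simps)
  then have "2 * Re (cnj (u1 x t) * u1t x t) + 2 * (n0 x t * nt x t) / 2
     + 2 * (v x t * - (n1 x t + f1 x t)) / 2 + (n0 x t * (2 * Re (cnj (u0 x t) * u0t x t)) + nt x t * f0 x t) = e_x x t"
    unfolding e_x_def plus_complex.simps by (simp add: field_simps)
  with d show ?thesis by (simp only:)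
qed

end

section \<open>Coercivity of the energy and the wave remainder\<close>

lemma integral_nonneg_subset:
  fixes f :: "real \<Rightarrow> real"
  assumes "continuous_on UNIV f" "\<And>x. 0 \<le> f x" "{c..d} \<subseteq> {a..b}"
  shows "integral {c..d} f \<le> integral {a..b} f"
  using assms by (intro integral_subset_le integrable_continuous_real continuous_on_subset[OF assms(1)]) auto

text \<open>Integration from x to the right end b; in the application f is |u|^2 and its value at b
  tends to 0 as the interval grows.\<close>

lemma sup_bound:
  fixes f f' g :: "real \<Rightarrow> real"
  assumes f: "\<And>x. (f has_vector_derivative f' x) (at x)"
    and g: "continuous_on UNIV g" "\<And>x. - f' x \<le> g x" "\<And>x. 0 \<le> g x"
    and f': "continuous_on UNIV f'" and x: "a \<le> x" "x \<le> b"
  shows "f x \<le> f b + integral {a..b} g"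
proof -
  have "(f' has_integral (f b - f x)) {x..b}"
    by (rule fundamental_theorem_of_calculus[OF x(2) has_vector_derivative_at_within[OF f]])
  then have e: "f x = f b - integral {x..b} f'" by (simp add: integral_unique)
  have "- integral {x..b} f' = integral {x..b} (\<lambda>x. - f' x)" by simp
  also have "\<dots> \<le> integral {x..b} g"
    by (intro Henstock_Kurzweil_Integration.integral_le integrable_continuous_real continuous_on_minus
        continuous_on_subset[OF f'] continuous_on_subset[OF g(1)] g(2)) auto
  also have "\<dots> \<le> integral {a..b} g" using x by (intro integral_nonneg_subset g) auto
  finally show ?thesis using e by simp
qed

lemma symmetric_limit_bound:
  fixes f :: "real \<Rightarrow> real"
  assumes f: "continuous_on UNIV f" "\<And>x. 0 \<le> f x"
    and le: "\<And>k. c * integral {- real k..real k} f \<le> E + \<delta> k"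
    and lim: "\<delta> \<longlonglongrightarrow> 0" and c: "0 < c"
  shows "c * integral {-R..R} f \<le> E"
proof -
  obtain K :: nat where K: "R \<le> real K" using real_arch_simple by blast
  have "c * integral {-R..R} f \<le> E + \<delta> k" if "K \<le> k" for k
  proof -
    have "R \<le> real k" using K that by linarith
    then have "{-R..R} \<subseteq> {- real k..real k}" by simp
    then have "integral {-R..R} f \<le> integral {- real k..real k} f" by (rule integral_nonneg_subset[OF f])
    then have "c * integral {-R..R} f \<le> c * integral {- real k..real k} f" using c by simp
    also note le[of k]
    finally show ?thesis .
  qed
  then have ev: "\<forall>\<^sub>F k in sequentially. c * integral {-R..R} f \<le> E + \<delta> k" by (rule eventually_sequentiallyI)
  have "(\<lambda>k. E + \<delta> k) \<longlonglongrightarrow> E + 0" by (rule tendsto_add[OF tendsto_const lim])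
  from tendsto_lowerbound[OF this ev] show ?thesis by simp
qed

context zakharov_flow
begin

text \<open>In one dimension the energy is coercive for any mass. The interaction is at least - n^2
  / 4 - |u|^4, the quartic integral is at most sup |u|^2 times the mass, and the supremum is
  controlled by u_x and the mass through the derivative of |u|^2. Half of the kinetic energy
  remains, at the cost 2 M^3. All this happens on \<open>[-k, k]\<close>, with the boundary errors
  collected in \<open>\<phi>\<close>.\<close>

lemma energy:
  assumes M: "0 < M" "\<And>R t. 0 \<le> R \<Longrightarrow> t \<in> {0..T} \<Longrightarrow> integral {-R..R} (\<lambda>x. f0 x t) \<le> M"
    and E: "\<And>R. 0 \<le> R \<Longrightarrow> integral {-R..R} (\<lambda>x. e x 0) \<le> E" and t: "t \<in> {0..T}"
  shows "integral {-R..R} (\<lambda>x. (cmod (u1 x t))\<^sup>2) \<le> 2 * (E + 2 * M ^ 3)"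
    and "integral {-R..R} (\<lambda>x. (n0 x t)\<^sup>2) \<le> 4 * (E + 2 * M ^ 3)"
    and "f0 x t \<le> M + 2 * (E + 2 * M ^ 3)"
proof -
  let ?E = "E + 2 * M ^ 3"
  have na: "nice T (\<lambda>x t. (cmod (u1 x t))\<^sup>2)" "nice T (\<lambda>x t. (n0 x t)\<^sup>2)" "nice T (\<lambda>x t. (f0 x t)\<^sup>2)"
    "nice T (\<lambda>x t. n0 x t * f0 x t)"
    by (intro nice_intros nice_u nice_n nice_f)+
  define A where "A k = integral {- real k..real k} (\<lambda>x. (cmod (u1 x t))\<^sup>2)" for k
  define N where "N k = integral {- real k..real k} (\<lambda>x. (n0 x t)\<^sup>2)" for k
  define \<phi> where "\<phi> k = integral {0..t} (\<lambda>r. eflux (real k) r - eflux (- real k) r) + M * f0 (real k) t" for k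
  have f0k: "(\<lambda>k. f0 (real k) t) \<longlonglongrightarrow> 0"
    by (rule filterlim_compose[OF nice_top[OF nice_f(1) t] filterlim_real_sequentially])
  have "\<phi> \<longlonglongrightarrow> 0 + M * 0"
    unfolding \<phi>_def by (intro tendsto_intros flux_tendsto_0[OF nice_e(2) t] f0k)
  then have phi: "\<phi> \<longlonglongrightarrow> 0" by simp
  \<comment> \<open>Young's inequality with a free parameter: c = M balances the quartic term, c = 1
    / 2 gives the final pointwise bound.\<close>
  have f1le: "- f1 x t \<le> inverse (2 * c) * (cmod (u1 x t))\<^sup>2 + 2 * c * f0 x t" if "0 < c" for c x
  proof -
    have "- Re (cnj (u0 x t) * u1 x t) \<le> cmod (cnj (u0 x t) * u1 x t)"
      by (rule order_trans[OF abs_ge_minus_self abs_Re_le_cmod])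
    also have "\<dots> = cmod (u1 x t) * cmod (u0 x t)" by (simp only: norm_mult complex_mod_cnj mult.commute)
    finally have "- f1 x t \<le> 2 * (cmod (u1 x t) * cmod (u0 x t))" unfolding f1_def by linarith
    also have "\<dots> \<le> (cmod (u1 x t))\<^sup>2 / (2 * c) + 2 * c * (cmod (u0 x t))\<^sup>2" by (rule young[OF that])
    finally have "- f1 x t \<le> (cmod (u1 x t))\<^sup>2 / (2 * c) + 2 * c * (cmod (u0 x t))\<^sup>2" .
    moreover have "(cmod (u1 x t))\<^sup>2 / (2 * c) = inverse (2 * c) * (cmod (u1 x t))\<^sup>2"
      by (simp only: divide_inverse mult.commute)
    ultimately show ?thesis unfolding f0_def by simp
  qed
  have sup: "f0 x t \<le> f0 (real k) t + A k / (2 * c) + 2 * c * M" if c: "0 < c" and x: "- real k \<le> x" "x \<le> real k" for c k x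
  proof -
    have ng: "nice T (\<lambda>x t. inverse (2 * c) * (cmod (u1 x t))\<^sup>2 + 2 * c * f0 x t)"
      by (intro nice_add nice_cmult na nice_f)
    have ig: "(\<lambda>x. inverse (2 * c) * (cmod (u1 x t))\<^sup>2) integrable_on {- real k..real k}" "(\<lambda>x. 2 * c * f0 x t) integrable_on {- real k..real k}"
      by (rule integrable_nice[OF nice_cmult[OF na(1)] t], rule integrable_nice[OF nice_cmult[OF nice_f(1)] t])
    have "f0 x t \<le> f0 (real k) t + integral {- real k..real k} (\<lambda>x. inverse (2 * c) * (cmod (u1 x t))\<^sup>2 + 2 * c * f0 x t)"
    proof (rule sup_bound[OF f0_x[OF t] nice_cont_x[OF ng t] _ _ nice_cont_x[OF nice_f(2) t] x])
      show "- f1 x t \<le> inverse (2 * c) * (cmod (u1 x t))\<^sup>2 + 2 * c * f0 x t" for x by (rule f1le[OF c])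
      show "0 \<le> inverse (2 * c) * (cmod (u1 x t))\<^sup>2 + 2 * c * f0 x t" for x
        unfolding f0_def using c by (intro add_nonneg_nonneg mult_nonneg_nonneg) auto
    qed
    moreover have "integral {- real k..real k} (\<lambda>x. inverse (2 * c) * (cmod (u1 x t))\<^sup>2 + 2 * c * f0 x t)
        = inverse (2 * c) * A k + 2 * c * integral {- real k..real k} (\<lambda>x. f0 x t)"
      unfolding Henstock_Kurzweil_Integration.integral_add[OF ig] by (simp add: A_def)
    moreover have "2 * c * integral {- real k..real k} (\<lambda>x. f0 x t) \<le> 2 * c * M"
      using M(2)[OF _ t, of "real k"] c by (intro mult_left_mono) auto
    moreover have "inverse (2 * c) * A k = A k / (2 * c)" by (simp only: divide_inverse mult.commute)
    ultimately show ?thesis by linarith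
  qed
  have main: "A k / 2 + N k / 4 \<le> ?E + \<phi> k" for k
  proof -
    define s where "s = f0 (real k) t + A k / (2 * M) + 2 * M * M"
    have k0: "0 \<le> real k" by simp
    have s0: "0 \<le> s"
    proof -
      have "0 \<le> A k" unfolding A_def by (intro Henstock_Kurzweil_Integration.integral_nonneg integrable_nice[OF na(1) t]) simp
      then show ?thesis using M(1) by (simp add: f0_def s_def)
    qed
    have "integral {- real k..real k} (\<lambda>x. (f0 x t)\<^sup>2) \<le> integral {- real k..real k} (\<lambda>x. s * f0 x t)"
    proof (rule Henstock_Kurzweil_Integration.integral_le)
      show "(\<lambda>x. (f0 x t)\<^sup>2) integrable_on {- real k..real k}" by (rule integrable_nice[OF na(3) t])
      show "(\<lambda>x. s * f0 x t) integrable_on {- real k..real k}" by (rule integrable_nice[OF nice_cmult[OF nice_f(1)] t])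
      fix x assume "x \<in> {- real k..real k}"
      then show "(f0 x t)\<^sup>2 \<le> s * f0 x t"
        using sup[OF M(1), of k x] unfolding power2_eq_square s_def[symmetric] by (intro mult_right_mono) (auto simp: f0_def)
    qed
    also have "\<dots> = s * integral {- real k..real k} (\<lambda>x. f0 x t)" by simp
    also have "\<dots> \<le> s * M" using M(2)[OF k0 t] s0 by (intro mult_left_mono)
    also have "\<dots> = M * f0 (real k) t + A k / 2 + 2 * M ^ 3" 
      unfolding s_def distrib_right power3_eq_cube using M(1) by simp
    finally have q: "integral {- real k..real k} (\<lambda>x. (f0 x t)\<^sup>2) \<le> M * f0 (real k) t + A k / 2 + 2 * M ^ 3" .
    have i: "(\<lambda>x. (cmod (u1 x t))\<^sup>2) integrable_on {- real k..real k}" "(\<lambda>x. 1/4 * (n0 x t)\<^sup>2) integrable_on {- real k..real k}"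
      "(\<lambda>x. (f0 x t)\<^sup>2) integrable_on {- real k..real k}"
      by (rule integrable_nice[OF na(1) t], rule integrable_nice[OF nice_cmult[OF na(2)] t], rule integrable_nice[OF na(3) t])
    have "A k + N k / 4 - integral {- real k..real k} (\<lambda>x. (f0 x t)\<^sup>2)
        = integral {- real k..real k} (\<lambda>x. ((cmod (u1 x t))\<^sup>2 + 1/4 * (n0 x t)\<^sup>2) - (f0 x t)\<^sup>2)"
      unfolding A_def N_def Henstock_Kurzweil_Integration.integral_diff[OF Henstock_Kurzweil_Integration.integrable_add[OF i(1,2)] i(3)]
        Henstock_Kurzweil_Integration.integral_add[OF i(1,2)] by simp
    also have "\<dots> \<le> integral {- real k..real k} (\<lambda>x. e x t)"
    proof (intro Henstock_Kurzweil_Integration.integral_le Henstock_Kurzweil_Integration.integrable_diff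
        Henstock_Kurzweil_Integration.integrable_add i integrable_nice[OF nice_e(1) t])
      fix x
      \<comment> \<open>Bounds the indefinite interaction from below by - n^2 / 4 - |u|^4, which
        leaves n^2 / 4 of the wave energy.\<close>
      have "0 \<le> (n0 x t / 2 + f0 x t)\<^sup>2" "0 \<le> (v x t)\<^sup>2" by simp_all
      moreover have "(n0 x t / 2 + f0 x t)\<^sup>2 = (n0 x t)\<^sup>2 / 4 + (f0 x t)\<^sup>2 + n0 x t * f0 x t"
        by (simp add: power2_sum power_divide)
      ultimately show "((cmod (u1 x t))\<^sup>2 + 1/4 * (n0 x t)\<^sup>2) - (f0 x t)\<^sup>2 \<le> e x t"
        unfolding e_def by linarith
    qed
    also have "\<dots> = integral {- real k..real k} (\<lambda>x. e x 0) + integral {0..t} (\<lambda>r. eflux (real k) r - eflux (- real k) r)"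
      using balance[OF e_t _ nice_e(1,3,2) nice_zero t k0] eflux_x by simp
    finally show ?thesis using q E[OF k0] unfolding \<phi>_def by linarith
  qed
  have A0: "0 \<le> A k" "0 \<le> N k" for k
    unfolding A_def N_def
    by (rule Henstock_Kurzweil_Integration.integral_nonneg[OF integrable_nice[OF na(1) t]], simp,
      rule Henstock_Kurzweil_Integration.integral_nonneg[OF integrable_nice[OF na(2) t]], simp)
  have half: "1 / 2 * integral {-R..R} (\<lambda>x. (cmod (u1 x t))\<^sup>2) \<le> ?E" for R
  proof (rule symmetric_limit_bound[OF nice_cont_x[OF na(1) t] _ _ phi])
    show "1 / 2 * integral {- real k..real k} (\<lambda>x. (cmod (u1 x t))\<^sup>2) \<le> ?E + \<phi> k" for k
      using main[of k] A0[of k] by (simp add: A_def)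
  qed auto
  have Ab: "integral {-R..R} (\<lambda>x. (cmod (u1 x t))\<^sup>2) \<le> 2 * ?E" for R using mult_left_mono[OF half, of 2 R] by simp
  show "integral {-R..R} (\<lambda>x. (cmod (u1 x t))\<^sup>2) \<le> 2 * ?E" by (rule Ab)
  have "1 / 4 * integral {-R..R} (\<lambda>x. (n0 x t)\<^sup>2) \<le> ?E"
  proof (rule symmetric_limit_bound[OF nice_cont_x[OF na(2) t] _ _ phi])
    show "1 / 4 * integral {- real k..real k} (\<lambda>x. (n0 x t)\<^sup>2) \<le> ?E + \<phi> k" for k
      using main[of k] A0[of k] by (simp add: N_def)
  qed auto
  then show "integral {-R..R} (\<lambda>x. (n0 x t)\<^sup>2) \<le> 4 * ?E" by simp
  obtain K :: nat where K: "\<bar>x\<bar> \<le> real K" using real_arch_simple by blast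
  have "f0 x t \<le> f0 (real k) t + (M + 2 * ?E)" if "K \<le> k" for k
  proof -
    have "real K \<le> real k" using that by simp
    then have "f0 x t \<le> f0 (real k) t + A k / (2 * (1 / 2)) + 2 * (1 / 2) * M"
      using K by (intro sup) linarith+
    then show ?thesis using Ab[of "real k"] by (simp add: A_def)
  qed
  then have "\<forall>\<^sub>F k in sequentially. f0 x t \<le> f0 (real k) t + (M + 2 * ?E)" by (rule eventually_sequentiallyI)
  moreover have "(\<lambda>k. f0 (real k) t + (M + 2 * ?E)) \<longlonglongrightarrow> 0 + (M + 2 * ?E)" by (intro tendsto_intros f0k)
  ultimately have "f0 x t \<le> 0 + (M + 2 * ?E)" by (intro tendsto_lowerbound[OF _ _ trivial_limit_sequentially])
  then show "f0 x t \<le> M + 2 * ?E" by simp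
qed

text \<open>As a first-order system for (n, v) the wave equation has |u|^2 differentiated once, not
  twice, in its source. The pair (l, m) solves the free system from the same initial state, so the
  energy of the difference is produced by that source alone.\<close>

lemma wave_remainder:
  fixes l0 l1 m0 m1 :: "real \<Rightarrow> real \<Rightarrow> real"
  assumes l_x: "\<And>x t. t \<in> {0..T} \<Longrightarrow> ((\<lambda>y. l0 y t) has_vector_derivative l1 x t) (at x)"
    and m_x: "\<And>x t. t \<in> {0..T} \<Longrightarrow> ((\<lambda>y. m0 y t) has_vector_derivative m1 x t) (at x)"
    and l_t: "\<And>x t. t \<in> {0..T} \<Longrightarrow> ((\<lambda>r. l0 x r) has_vector_derivative - m1 x t) (at t within {0..T})"
    and m_t: "\<And>x t. t \<in> {0..T} \<Longrightarrow> ((\<lambda>r. m0 x r) has_vector_derivative - l1 x t) (at t within {0..T})"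
    and nice: "nice T l0" "nice T l1" "nice T m0" "nice T m1"
    and init: "\<And>x. l0 x 0 = n0 x 0" "\<And>x. m0 x 0 = 0"
    and G: "\<And>R t. 0 \<le> R \<Longrightarrow> t \<in> {0..T} \<Longrightarrow> integral {-R..R} (\<lambda>x. (f1 x t)\<^sup>2) \<le> \<Gamma>"
    and tR: "t \<in> {0..T}" "0 \<le> R"
  shows "integral {-R..R} (\<lambda>x. (n0 x t - l0 x t)\<^sup>2) \<le> 4 * T\<^sup>2 * \<Gamma>"
proof -
  let ?\<rho> = "\<lambda>x t. (n0 x t - l0 x t)\<^sup>2 + (v x t - m0 x t)\<^sup>2"
  let ?J = "\<lambda>x t. - 2 * ((n0 x t - l0 x t) * (v x t - m0 x t))"
  let ?q = "\<lambda>x t. 2 * ((n0 x t - l0 x t) * (nt x t - - m1 x t)) + 2 * ((v x t - m0 x t) * (- (n1 x t + f1 x t) - - l1 x t))"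
  let ?S = "\<lambda>x t. - 2 * ((v x t - m0 x t) * f1 x t)"
  note na = nice_diff[OF nice_n(1) nice(1)] and nb = nice_diff[OF nice_v nice(3)]
    and nat = nice_diff[OF nice_nt nice_minus[OF nice(4)]]
    and nbt = nice_diff[OF nice_minus[OF nice_add[OF nice_n(2) nice_f(2)]] nice_minus[OF nice(2)]]
  have n\<rho>: "nice T ?\<rho>" by (rule nice_add[OF nice_power2[OF na] nice_power2[OF nb]])
  have "integral {-R..R} (\<lambda>x. ?\<rho> x t) \<le> 2 * 0 + 4 * T\<^sup>2 * \<Gamma>"
  proof (rule energy_estimate[OF T _ _ n\<rho> _ _ _ _ _ _ G _ tR])
    show "((\<lambda>r. ?\<rho> x r) has_vector_derivative ?q x t) (at t within {0..T})" if "t \<in> {0..T}" for x t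
      by (intro has_vector_derivative_add power2_vector_derivative has_vector_derivative_diff n0_t v_t l_t m_t that)
    show "((\<lambda>y. ?J y t) has_vector_derivative ?q x t - ?S x t) (at x)" if t: "t \<in> {0..T}" for x t
    proof -
      have "((\<lambda>y. ?J y t) has_vector_derivative - 2 * ((n0 x t - l0 x t) * (- nt x t - m1 x t) + (n1 x t - l1 x t) * (v x t - m0 x t))) (at x)"
        by (intro has_vector_derivative_mult_right has_vector_derivative_mult has_vector_derivative_diff n0_x v_x l_x m_x t)
      moreover have "- 2 * ((n0 x t - l0 x t) * (- nt x t - m1 x t) + (n1 x t - l1 x t) * (v x t - m0 x t)) = ?q x t - ?S x t"
        by (simp add: algebra_simps)
      ultimately show ?thesis by (simp only:)
    qed
    show "?S x t \<le> ?\<rho> x t / (2 * T) + 2 * T * (f1 x t)\<^sup>2" if "t \<in> {0..T}" for x t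
    proof -
      define p where "p = v x t - m0 x t"
      have "?S x t = 2 * (p * (- f1 x t))" unfolding p_def by simp
      also have "\<dots> \<le> p\<^sup>2 / (2 * T) + 2 * T * (- f1 x t)\<^sup>2" by (rule young[OF T])
      also have "\<dots> \<le> ((n0 x t - l0 x t)\<^sup>2 + p\<^sup>2) / (2 * T) + 2 * T * (f1 x t)\<^sup>2"
        unfolding power2_minus using T by (intro add_right_mono divide_right_mono) simp_all
      finally show ?thesis unfolding p_def .
    qed
    show "integral {-R..R} (\<lambda>x. ?\<rho> x 0) \<le> 0" for R by (simp add: init v_0)
    show "nice T ?q" by (rule nice_add[OF nice_cmult[OF nice_mult[OF na nat]] nice_cmult[OF nice_mult[OF nb nbt]]])
    show "nice T ?J" by (rule nice_cmult[OF nice_mult[OF na nb]])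
    show "nice T ?S" by (rule nice_cmult[OF nice_mult[OF nb nice_f(2)]])
    show "nice T (\<lambda>x t. (f1 x t)\<^sup>2)" by (rule nice_power2[OF nice_f(2)])
    show "0 \<le> ?\<rho> x t" for x t by simp
  qed
  moreover have "integral {-R..R} (\<lambda>x. (n0 x t - l0 x t)\<^sup>2) \<le> integral {-R..R} (\<lambda>x. ?\<rho> x t)"
  proof (rule Henstock_Kurzweil_Integration.integral_le)
    show "(\<lambda>x. ?\<rho> x t) integrable_on {-R..R}" by (rule integrable_nice[OF n\<rho> tR(1)])
    show "(\<lambda>x. (n0 x t - l0 x t)\<^sup>2) integrable_on {-R..R}"
      by (rule integrable_nice[OF nice_power2[OF nice_diff[OF nice_n(1) nice(1)]] tR(1)])
  qed simp
  ultimately show ?thesis by simp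
qed

lemma f1_square_bound:
  assumes s: "\<And>x. f0 x t \<le> s" and A: "integral {-R..R} (\<lambda>x. (cmod (u1 x t))\<^sup>2) \<le> A" and t: "t \<in> {0..T}"
  shows "integral {-R..R} (\<lambda>x. (f1 x t)\<^sup>2) \<le> 4 * s * A"
proof -
  have "0 \<le> f0 0 t" by (simp add: f0_def)
  then have s0: "0 \<le> s" using s[of 0] by linarith
  have "integral {-R..R} (\<lambda>x. (f1 x t)\<^sup>2) \<le> integral {-R..R} (\<lambda>x. (4 * s) * (cmod (u1 x t))\<^sup>2)"
  proof (rule Henstock_Kurzweil_Integration.integral_le)
    show "(\<lambda>x. (f1 x t)\<^sup>2) integrable_on {-R..R}" by (rule integrable_nice[OF nice_power2[OF nice_f(2)] t])
    show "(\<lambda>x. (4 * s) * (cmod (u1 x t))\<^sup>2) integrable_on {-R..R}"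
      by (rule integrable_nice[OF nice_cmult[OF nice_cmod_power2[OF nice_u(2)]] t])
    fix x
    have "\<bar>Re (cnj (u0 x t) * u1 x t)\<bar> \<le> cmod (cnj (u0 x t) * u1 x t)" by (rule abs_Re_le_cmod)
    also have "\<dots> = cmod (u0 x t) * cmod (u1 x t)" by (simp only: norm_mult complex_mod_cnj)
    finally have "\<bar>f1 x t\<bar> \<le> 2 * (cmod (u0 x t) * cmod (u1 x t))" unfolding f1_def abs_mult by simp
    then have "\<bar>f1 x t\<bar>\<^sup>2 \<le> (2 * (cmod (u0 x t) * cmod (u1 x t)))\<^sup>2" by (rule power_mono) (rule abs_ge_zero)
    also have "\<dots> = 4 * f0 x t * (cmod (u1 x t))\<^sup>2" by (simp add: f0_def power_mult_distrib)
    also have "\<dots> \<le> 4 * s * (cmod (u1 x t))\<^sup>2" using s[of x] by (intro mult_right_mono) auto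
    finally show "(f1 x t)\<^sup>2 \<le> (4 * s) * (cmod (u1 x t))\<^sup>2" by simp
  qed
  also have "\<dots> = 4 * s * integral {-R..R} (\<lambda>x. (cmod (u1 x t))\<^sup>2)" by simp
  also have "\<dots> \<le> 4 * s * A" using A s0 by (intro mult_left_mono) auto
  finally show ?thesis .
qed

end

section \<open>Smooth solutions as classical flows\<close>

lemma path_space_real_sobolev: "vecs (path_space T (real_sobolev s)) \<subseteq> vecs (path_space T (sobolev s))"
  by (auto simp: path_space_def real_sobolev_vecs)

lemma path_sobolev_inf:
  assumes "\<And>m::nat. U \<in> vecs (path_space T (sobolev (real m)))" "t \<in> {0..T}"
  shows "U t \<in> sobolev_inf"
  unfolding sobolev_inf_def using path_space_mem[OF assms] by blast

text \<open>The embedding of H^(j+1) turns continuity of the path into continuity in time uniformly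
  in x; with continuity in x this gives joint continuity.\<close>

lemma nice_xderiv:
  assumes U: "\<And>m::nat. U \<in> vecs (path_space T (sobolev (real m)))"
  shows "nice T (\<lambda>x t. xderiv j (U t) x)"
proof (rule niceI)
  note inf = path_sobolev_inf[OF U]
  show "continuous_on (UNIV \<times> {0..T}) (\<lambda>p. xderiv j (U (snd p)) (fst p))"
  proof (rule joint_continuity)
    fix t assume t: "t \<in> {0..T}"
    show "continuous_on UNIV (\<lambda>x. xderiv j (U t) x)"
      by (intro continuous_at_imp_continuous_on ballI has_vector_derivative_continuous[OF xderiv_vector_derivative[OF inf[OF t]]])
    fix e :: real assume e: "0 < e"
    let ?c = "sobolev_const + 1"
    have c: "0 < ?c" using sobolev_const_nonneg by simp
    then have "0 < e / ?c" using e by simp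
    from path_space_cont[OF U[of "Suc j"] t this]
    obtain d where d: "d > 0" "\<And>r. r \<in> {0..T} \<Longrightarrow> \<bar>r - t\<bar> < d \<Longrightarrow> sobolev_norm (real (Suc j)) (U r - U t) < e / ?c"
      unfolding sobolev_nrm by blast
    show "\<exists>d>0. \<forall>r\<in>{0..T}. \<bar>r - t\<bar> < d \<longrightarrow> (\<forall>x. norm (xderiv j (U r) x - xderiv j (U t) x) < e)"
    proof (intro exI[of _ d] conjI ballI impI allI d(1))
      fix r x assume r: "r \<in> {0..T}" "\<bar>r - t\<bar> < d"
      have D: "U r - U t \<in> sobolev_inf" by (rule sobolev_inf_diff[OF inf[OF r(1)] inf[OF t]])
      have n0: "0 \<le> sobolev_norm (real (Suc j)) (U r - U t)"
        using normed_nonneg[OF normed_sobolev sobolev_infD[OF D], of "Suc j"] by simp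
      have "norm (xderiv j (U r) x - xderiv j (U t) x) = norm (xderiv j (U r - U t) x)"
        by (simp only: xderiv_diff[OF inf[OF r(1)] inf[OF t]])
      also have "\<dots> \<le> sobolev_const * sobolev_norm (real (Suc j)) (U r - U t)" by (rule xderiv_bound[OF D])
      also have "\<dots> \<le> ?c * sobolev_norm (real (Suc j)) (U r - U t)" by (rule mult_right_mono[OF _ n0]) simp
      also have "\<dots> < ?c * (e / ?c)" by (rule mult_strict_left_mono[OF d(2)[OF r] c])
      also have "\<dots> = e" using c by simp
      finally show "norm (xderiv j (U r) x - xderiv j (U t) x) < e" .
    qed
  qed
  show "norm (xderiv j (U t) x) \<le> sobolev_const * nrm (path_space T (sobolev (real (Suc j)))) U" if t: "t \<in> {0..T}" for x t
    using path_space_nrm_ge[OF normed_sobolev U t, of "Suc j"] unfolding sobolev_nrm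
    by (intro order_trans[OF xderiv_bound[OF inf[OF t]]] mult_left_mono sobolev_const_nonneg)
  show "((\<lambda>x. xderiv j (U t) x) \<longlongrightarrow> 0) at_top" "((\<lambda>x. xderiv j (U t) x) \<longlongrightarrow> 0) at_bot" if "t \<in> {0..T}" for t
    by (rule xderiv_tendsto_0[OF inf[OF that]])+
qed

text \<open>\<open>has_second_derivative_at\<close> hides the first derivative behind an
  existential; uniqueness of derivatives identifies it with the known one.\<close>

lemma second_derivative_unique:
  assumes "has_second_derivative_at f d x UNIV" "\<And>y. (f has_vector_derivative f1 y) (at y)" "(f1 has_vector_derivative f2) (at x)"
  shows "d = f2"
proof -
  obtain f' where f': "\<forall>y\<in>UNIV. (f has_vector_derivative f' y) (at y within UNIV)" "(f' has_vector_derivative d) (at x within UNIV)"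
    using assms(1) unfolding has_second_derivative_at_def by blast
  have "f' = f1"
  proof
    fix y
    show "f' y = f1 y" using f'(1) by (intro vector_derivative_unique_at[OF _ assms(2)]) simp
  qed
  with f'(2) show ?thesis by (intro vector_derivative_unique_at[OF _ assms(3)]) simp
qed

lemma second_derivative_continuous:
  assumes "\<And>x. \<exists>d. has_second_derivative_at f d x UNIV"
  shows "continuous_on UNIV f"
proof (intro continuous_at_imp_continuous_on ballI)
  fix x
  obtain d f' where "\<forall>y\<in>UNIV. (f has_vector_derivative f' y) (at y within UNIV)"
    using assms[of x] unfolding has_second_derivative_at_def by blast
  then have "(f has_vector_derivative f' x) (at x)" by simp
  then show "isCont f x" by (rule has_vector_derivative_continuous)
qed

lemma second_time_derivative:
  assumes T: "0 < T" and t: "t \<in> {0..T}" and h: "has_second_derivative_at f d t {0..T}"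
    and f: "\<And>r. r \<in> {0..T} \<Longrightarrow> (f has_vector_derivative g r) (at r within {0..T})"
  shows "(g has_vector_derivative d) (at t within {0..T})"
proof -
  obtain f' where f': "\<And>r. r \<in> {0..T} \<Longrightarrow> (f has_vector_derivative f' r) (at r within {0..T})" "(f' has_vector_derivative d) (at t within {0..T})"
    using h unfolding has_second_derivative_at_def by blast
  have "g r = f' r" if "r \<in> {0..T}" for r
    using vector_derivative_unique_within_closed_interval[of 0 T r f "g r" "f' r"] T f[OF that] f'(1)[OF that] that by simp
  from has_vector_derivative_transform[OF t this f'(2)] show ?thesis .
qed

text \<open>The functions in the definition of a solution are tied to U, N and V only as
  distributions. Having x-derivatives, u and n are continuous in x and so coincide with the Fourier
  representatives, for which boundedness and decay are available.\<close>

lemma solution_flow: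
  assumes T: "0 < T" and sol: "zakharov_solution T (du, dn, 0) (U, N, V)"
  obtains nt where
    "zakharov_flow T (\<lambda>x t. xderiv 0 (U t) x) (\<lambda>x t. xderiv 1 (U t) x) (\<lambda>x t. xderiv 2 (U t) x) (\<lambda>x t. xderiv 3 (U t) x)
       (\<lambda>x t. Re (xderiv 0 (N t) x)) (\<lambda>x t. Re (xderiv 1 (N t) x)) (\<lambda>x t. Re (xderiv 2 (N t) x)) nt"
    "\<And>t. t \<in> {0..T} \<Longrightarrow> is_function (U t) (\<lambda>x. xderiv 0 (U t) x)"
    "\<And>t. t \<in> {0..T} \<Longrightarrow> is_function (N t) (\<lambda>x. complex_of_real (Re (xderiv 0 (N t) x)))"
    "U 0 = du" "N 0 = dn"
proof -
  have U: "U \<in> vecs (path_space T (sobolev (real m)))" and N': "N \<in> vecs (path_space T (real_sobolev (real m)))" for m :: nat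
    using sol unfolding zakharov_solution_def by auto
  have N: "N \<in> vecs (path_space T (sobolev (real m)))" for m :: nat using N' path_space_real_sobolev by blast
  have init: "U 0 = du" "N 0 = dn" "V 0 = 0" using sol unfolding zakharov_solution_def by auto
  have "\<exists>u n nt. classical_zakharov T u n \<and>
      (\<forall>x. \<forall>t\<in>{0..T}. ((\<lambda>r. n x r) has_vector_derivative nt x t) (at t within {0..T})) \<and>
      (\<forall>t\<in>{0..T}. is_function (U t) (\<lambda>x. u x t) \<and>
         is_function (N t) (\<lambda>x. complex_of_real (n x t)) \<and>
         is_function (V t) (\<lambda>x. complex_of_real (nt x t)))"
    using sol unfolding zakharov_solution_def by simp
  then obtain u n nt where cl: "classical_zakharov T u n"
    and nt: "\<And>x t. t \<in> {0..T} \<Longrightarrow> ((\<lambda>r. n x r) has_vector_derivative nt x t) (at t within {0..T})"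
    and fU: "\<And>t. t \<in> {0..T} \<Longrightarrow> is_function (U t) (\<lambda>x. u x t)"
    and fN: "\<And>t. t \<in> {0..T} \<Longrightarrow> is_function (N t) (\<lambda>x. complex_of_real (n x t))"
    and fV: "\<And>t. t \<in> {0..T} \<Longrightarrow> is_function (V t) (\<lambda>x. complex_of_real (nt x t))"
    by blast
  note Ui = path_sobolev_inf[OF U] and Ni = path_sobolev_inf[OF N]
  have c1: "\<exists>ut uxx. ((\<lambda>r. u x r) has_vector_derivative ut) (at t within {0..T}) \<and>
       has_second_derivative_at (\<lambda>y. u y t) uxx x UNIV \<and>
       \<i> * ut + uxx = complex_of_real (n x t) * u x t" if "t \<in> {0..T}" for x t
    using cl that unfolding classical_zakharov_def by blast
  have c2: "\<exists>ntt nxx pxx. has_second_derivative_at (\<lambda>r. n x r) ntt t {0..T} \<and>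
       has_second_derivative_at (\<lambda>y. n y t) nxx x UNIV \<and>
       has_second_derivative_at (\<lambda>y. (cmod (u y t))\<^sup>2) pxx x UNIV \<and>
       ntt - nxx = pxx" if "t \<in> {0..T}" for x t
    using cl that unfolding classical_zakharov_def by blast
  have ueq: "u x t = xderiv 0 (U t) x" if t: "t \<in> {0..T}" for x t
  proof -
    have "continuous_on UNIV (\<lambda>x. u x t)" using c1[OF t] by (intro second_derivative_continuous) blast
    from sobolev_representation[OF Ui[OF t] fU[OF t] this] show ?thesis by (rule fun_cong)
  qed
  have neq: "complex_of_real (n x t) = xderiv 0 (N t) x" if t: "t \<in> {0..T}" for x t
  proof -
    have "continuous_on UNIV (\<lambda>x. n x t)" using c2[OF t] by (intro second_derivative_continuous) blast
    then have "continuous_on UNIV (\<lambda>x. complex_of_real (n x t))" by (intro continuous_intros)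
    from sobolev_representation[OF Ni[OF t] fN[OF t] this] show ?thesis by (rule fun_cong)
  qed
  have neq': "n x t = Re (xderiv 0 (N t) x)" if "t \<in> {0..T}" for x t
    unfolding neq[OF that, symmetric] by simp
  have ux: "((\<lambda>y. xderiv j (U t) y) has_vector_derivative xderiv (Suc j) (U t) x) (at x)" if "t \<in> {0..T}" for j x t
    by (rule xderiv_vector_derivative[OF Ui[OF that]])
  have nx: "((\<lambda>y. Re (xderiv j (N t) y)) has_vector_derivative Re (xderiv (Suc j) (N t) x)) (at x)" if "t \<in> {0..T}" for j x t
    by (rule bounded_linear.has_vector_derivative[OF bounded_linear_Re xderiv_vector_derivative[OF Ni[OF that]]])
  have nu: "nice T (\<lambda>x t. xderiv j (U t) x)" and nn: "nice T (\<lambda>x t. Re (xderiv j (N t) x))" for j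
    by (rule nice_xderiv[OF U], rule nice_Re[OF nice_xderiv[OF N]])
  let ?f2 = "\<lambda>x t. 2 * Re (cnj (xderiv 0 (U t) x) * xderiv 2 (U t) x) + 2 * (cmod (xderiv 1 (U t) x))\<^sup>2"
  have ut: "((\<lambda>r. xderiv 0 (U r) x) has_vector_derivative
      \<i> * xderiv 2 (U t) x - \<i> * (complex_of_real (Re (xderiv 0 (N t) x)) * xderiv 0 (U t) x)) (at t within {0..T})"
    if t: "t \<in> {0..T}" for x t
  proof -
    obtain a b where ab: "((\<lambda>r. u x r) has_vector_derivative a) (at t within {0..T})"
      "has_second_derivative_at (\<lambda>y. u y t) b x UNIV" "\<i> * a + b = complex_of_real (n x t) * u x t"
      using c1[OF t] by blast
    have "has_second_derivative_at (xderiv 0 (U t)) b x UNIV" using ab(2) unfolding ueq[OF t] .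
    from second_derivative_unique[OF this ux[OF t, of 0] ux[OF t, of "Suc 0"]]
    have b: "b = xderiv 2 (U t) x" by (simp add: numeral_2_eq_2)
    have "a = - \<i> * (\<i> * a)" by simp
    also have "\<i> * a = complex_of_real (n x t) * u x t - b" using ab(3) by (simp add: algebra_simps)
    finally have "a = \<i> * xderiv 2 (U t) x - \<i> * (complex_of_real (Re (xderiv 0 (N t) x)) * xderiv 0 (U t) x)"
      unfolding b ueq[OF t] neq'[OF t] by (simp add: algebra_simps)
    then show ?thesis using has_vector_derivative_transform[OF t ueq[symmetric] ab(1)] by simp
  qed
  have ntt: "((\<lambda>r. nt x r) has_vector_derivative Re (xderiv 2 (N t) x) + ?f2 x t) (at t within {0..T})"
    if t: "t \<in> {0..T}" for x t
  proof -
    obtain a b c where abc: "has_second_derivative_at (\<lambda>r. n x r) a t {0..T}"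
      "has_second_derivative_at (\<lambda>y. n y t) b x UNIV" "has_second_derivative_at (\<lambda>y. (cmod (u y t))\<^sup>2) c x UNIV" "a - b = c"
      using c2[OF t] by blast
    have "has_second_derivative_at (\<lambda>y. Re (xderiv 0 (N t) y)) b x UNIV" using abc(2) unfolding neq'[OF t] .
    from second_derivative_unique[OF this nx[OF t, of 0] nx[OF t, of "Suc 0"]]
    have b: "b = Re (xderiv 2 (N t) x)" by (simp add: numeral_2_eq_2)
    have c3: "has_second_derivative_at (\<lambda>y. (cmod (xderiv 0 (U t) y))\<^sup>2) c x UNIV" using abc(3) unfolding ueq[OF t] .
    have "((\<lambda>y. 2 * Re (cnj (xderiv 0 (U t) y) * xderiv (Suc 0) (U t) y)) has_vector_derivative
        2 * Re (cnj (xderiv 0 (U t) x) * xderiv (Suc (Suc 0)) (U t) x + cnj (xderiv (Suc 0) (U t) x) * xderiv (Suc 0) (U t) x)) (at x)"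
      by (rule has_vector_derivative_mult_right[OF Re_cnj_mult_vector_derivative[OF ux[OF t] ux[OF t]]])
    from second_derivative_unique[OF c3 cmod_power2_vector_derivative[OF ux[OF t]] this]
    have c: "c = ?f2 x t"
      unfolding cmod_power2[of "xderiv 1 (U t) x"] by (simp add: numeral_2_eq_2 power2_eq_square distrib_left)
    have "a = Re (xderiv 2 (N t) x) + ?f2 x t" using abc(4) unfolding b c by linarith
    then show ?thesis using second_time_derivative[OF T t abc(1) nt] by simp
  qed
  \<comment> \<open>\<open>V 0 = 0\<close> gives the initial velocity only almost everywhere.
    Integrating the wave equation twice in time expresses \<open>nt y 0\<close> through n at the
    times 0 and T and a double integral, all continuous in y, so it vanishes everywhere.\<close>
  have nt0: "nt x 0 = 0" for x
  proof -
    have T0: "0 \<in> {0..T}" "T \<in> {0..T}" using T by auto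
    let ?W = "\<lambda>x t. integral {0..t} (\<lambda>r. Re (xderiv 2 (N r) x) + ?f2 x r)"
    have nW: "nice T ?W" by (intro nice_integral nice_add nn nice_cmult nice_Re nice_mult nice_cnj nu nice_cmod_power2)
    have w: "nt y t = nt y 0 + ?W y t" if "t \<in> {0..T}" for y t by (rule FTC_time[OF ntt that])
    have c: "nt y 0 = (Re (xderiv 0 (N T) y) - Re (xderiv 0 (N 0) y) - integral {0..T} (?W y)) / T" for y
    proof -
      have "n y T = n y 0 + integral {0..T} (nt y)" by (rule FTC_time[OF nt T0(2)])
      also have "integral {0..T} (nt y) = integral {0..T} (\<lambda>t. nt y 0 + ?W y t)"
        by (rule Henstock_Kurzweil_Integration.integral_cong) (rule w)
      also have "\<dots> = T * nt y 0 + integral {0..T} (?W y)"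
        using Henstock_Kurzweil_Integration.integral_add[OF integrable_const_ivl[of "nt y 0" 0 T] integrable_continuous_real[OF nice_cont_t[OF nW order_refl, of y]]] T
        by simp
      finally have "T * nt y 0 = n y T - n y 0 - integral {0..T} (?W y)" by simp
      then show ?thesis using T unfolding neq'[OF T0(1)] neq'[OF T0(2)] by (simp add: eq_divide_eq mult.commute)
    qed
    have "continuous_on UNIV (\<lambda>y. nt y 0)"
      unfolding c using T by (intro continuous_on_divide continuous_on_diff continuous_on_const
          nice_cont_x[OF nn T0(2)] nice_cont_x[OF nn T0(1)] nice_cont_x[OF nice_integral[OF nW] T0(2)]) auto
    then have 1: "continuous_on UNIV (\<lambda>y. complex_of_real (nt y 0))" by (intro continuous_intros)
    have "is_function 0 (\<lambda>y. complex_of_real (nt y 0))" using fV[OF T0(1)] init(3) by simp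
    moreover have "is_function 0 (\<lambda>y. 0)" by (simp add: is_function_def)
    ultimately have "AE y in lborel. complex_of_real (nt y 0) = 0" by (rule is_function_unique)
    from continuous_AE_eq[OF 1 continuous_on_const this] show ?thesis by simp
  qed
  have nt': "((\<lambda>r. Re (xderiv 0 (N r) x)) has_vector_derivative nt x t) (at t within {0..T})" if t: "t \<in> {0..T}" for x t
    by (rule has_vector_derivative_transform[OF t _ nt[OF t]]) (simp add: neq')
  have e: "1 = Suc 0" "2 = Suc (Suc 0)" "3 = Suc (Suc (Suc 0))" by simp_all
  show thesis
  proof (rule that[OF _ _ _ init(1,2)])
    show "zakharov_flow T (\<lambda>x t. xderiv 0 (U t) x) (\<lambda>x t. xderiv 1 (U t) x) (\<lambda>x t. xderiv 2 (U t) x) (\<lambda>x t. xderiv 3 (U t) x)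
       (\<lambda>x t. Re (xderiv 0 (N t) x)) (\<lambda>x t. Re (xderiv 1 (N t) x)) (\<lambda>x t. Re (xderiv 2 (N t) x)) nt"
    proof (rule zakharov_flow.intro[OF T])
      show "((\<lambda>y. xderiv 0 (U t) y) has_vector_derivative xderiv 1 (U t) x) (at x)"
        "((\<lambda>y. xderiv 1 (U t) y) has_vector_derivative xderiv 2 (U t) x) (at x)"
        "((\<lambda>y. xderiv 2 (U t) y) has_vector_derivative xderiv 3 (U t) x) (at x)"
        "((\<lambda>y. Re (xderiv 0 (N t) y)) has_vector_derivative Re (xderiv 1 (N t) x)) (at x)"
        "((\<lambda>y. Re (xderiv 1 (N t) y)) has_vector_derivative Re (xderiv 2 (N t) x)) (at x)"
        if "t \<in> {0..T}" for x t
        unfolding e by (rule ux[OF that] nx[OF that])+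
    qed (fact nu nn ut nt' ntt nt0)+
    show "is_function (U t) (\<lambda>x. xderiv 0 (U t) x)" if "t \<in> {0..T}" for t
      using fU[OF that] unfolding ueq[OF that] .
    show "is_function (N t) (\<lambda>x. complex_of_real (Re (xderiv 0 (N t) x)))" if "t \<in> {0..T}" for t
      using fN[OF that] unfolding neq'[OF that] .
  qed
qed

section \<open>Wave packets\<close>

lemma integral_Cauchy_Schwarz:
  fixes f g :: "real \<Rightarrow> complex"
  assumes f: "continuous_on UNIV f" and g: "continuous_on UNIV g"
    and a: "integral {-R..R} (\<lambda>x. (cmod (f x))\<^sup>2) \<le> a" and b: "integral {-R..R} (\<lambda>x. (cmod (g x))\<^sup>2) \<le> b"
  shows "cmod (integral {-R..R} (\<lambda>x. f x * g x)) \<le> sqrt a * sqrt b"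
proof -
  define A B C where "A = integral {-R..R} (\<lambda>x. (cmod (f x))\<^sup>2)" and "B = integral {-R..R} (\<lambda>x. cmod (f x) * cmod (g x))"
    and "C = integral {-R..R} (\<lambda>x. (cmod (g x))\<^sup>2)"
  have cf: "continuous_on {-R..R} f" and cg: "continuous_on {-R..R} g"
    by (rule continuous_on_subset[OF f], simp) (rule continuous_on_subset[OF g], simp)
  have i: "(\<lambda>x. (cmod (f x))\<^sup>2) integrable_on {-R..R}" "(\<lambda>x. cmod (f x) * cmod (g x)) integrable_on {-R..R}"
    "(\<lambda>x. (cmod (g x))\<^sup>2) integrable_on {-R..R}" "(\<lambda>x. f x * g x) integrable_on {-R..R}"
    by (rule integrable_continuous_real, intro continuous_intros cf cg)+
  have q: "0 \<le> A - 2 * t * B + t\<^sup>2 * C" for t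
  proof -
    have "(\<lambda>x. (cmod (f x) - t * cmod (g x))\<^sup>2) integrable_on {-R..R}"
      by (rule integrable_continuous_real, intro continuous_intros cf cg)
    then have "0 \<le> integral {-R..R} (\<lambda>x. (cmod (f x) - t * cmod (g x))\<^sup>2)"
      by (rule Henstock_Kurzweil_Integration.integral_nonneg) simp
    also have "\<dots> = integral {-R..R} (\<lambda>x. ((cmod (f x))\<^sup>2 - (2 * t) * (cmod (f x) * cmod (g x))) + t\<^sup>2 * (cmod (g x))\<^sup>2)"
      by (rule arg_cong[where f = "integral {-R..R}"], rule ext) (simp add: power2_eq_square algebra_simps)
    also have "\<dots> = A - 2 * t * B + t\<^sup>2 * C"
      unfolding A_def B_def C_def
      by (rule integral_unique[OF has_integral_add[OF has_integral_diff[OF integrable_integral[OF i(1)]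
          has_integral_mult_right[OF integrable_integral[OF i(2)]]] has_integral_mult_right[OF integrable_integral[OF i(3)]]]])
    finally show ?thesis .
  qed
  have C0: "0 \<le> C" unfolding C_def by (rule Henstock_Kurzweil_Integration.integral_nonneg[OF i(3)]) simp
  have A0: "0 \<le> A" unfolding A_def by (rule Henstock_Kurzweil_Integration.integral_nonneg[OF i(1)]) simp
  have "B\<^sup>2 \<le> A * C"
  proof (cases "C = 0")
    case True
    have "B = 0"
    proof (rule ccontr)
      assume "B \<noteq> 0"
      then show False using q[of "(A + 1) / (2 * B)"] True by simp
    qed
    then show ?thesis using True by simp
  next
    case False
    then have "0 \<le> (A - 2 * (B / C) * B + (B / C)\<^sup>2 * C) * C" using q[of "B / C"] C0 by (intro mult_nonneg_nonneg) auto
    also have "\<dots> = A * C - B\<^sup>2" using False by (simp add: field_simps power2_eq_square)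
    finally show ?thesis by simp
  qed
  also have "A * C \<le> a * b" using a b A0 C0 unfolding A_def[symmetric] C_def[symmetric] by (intro mult_mono) linarith+
  finally have "B \<le> sqrt (a * b)" by (rule real_le_rsqrt)
  moreover have "cmod (integral {-R..R} (\<lambda>x. f x * g x)) \<le> B"
    unfolding B_def by (rule integral_norm_bound_integral[OF i(4) i(2)]) (simp add: norm_mult)
  ultimately show ?thesis by (simp add: real_sqrt_mult)
qed

section \<open>The Gaussian envelope and the derivatives of a packet\<close>

definition bump :: "real \<Rightarrow> real \<Rightarrow> real"
  where "bump \<sigma> x = exp (- x\<^sup>2 / (2 * \<sigma>\<^sup>2))"

lemma bump_pos: "0 < bump \<sigma> x" and bump_le_1: "bump \<sigma> x \<le> 1"
  by (simp_all add: bump_def)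

lemma continuous_bump: "continuous_on A (bump \<sigma>)"
  unfolding bump_def[abs_def] divide_inverse by (intro continuous_intros)

text \<open>The envelope lies below \<open>2 / (1 + (x / \<sigma>)^2)\<close>, whose primitive is an
  arctangent; pi / 2 < 2 gives the 8.\<close>

lemma bump_integral:
  assumes s: "1 \<le> \<sigma>"
  shows "integral {-R..R} (bump \<sigma>) \<le> 8 * \<sigma>"
proof (cases "0 \<le> R")
  case True
  let ?f = "\<lambda>x. 2 * inverse (1 + (x / \<sigma>)\<^sup>2)"
  have le: "bump \<sigma> x \<le> ?f x" for x
  proof -
    define y where "y = (x / \<sigma>)\<^sup>2"
    have y: "0 \<le> y" by (simp add: y_def)
    have "(1 + y) / 2 \<le> 1 + y / 2" using y by simp
    also have "\<dots> \<le> exp (y / 2)" by (rule exp_ge_add_one_self)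
    finally have "inverse (exp (y / 2)) \<le> inverse ((1 + y) / 2)" using y by (intro le_imp_inverse_le) auto
    moreover have "bump \<sigma> x = inverse (exp (y / 2))"
      unfolding bump_def y_def exp_minus[symmetric] by (simp add: power_divide)
    ultimately show ?thesis unfolding y_def[symmetric] by (simp add: inverse_eq_divide)
  qed
  have "((\<lambda>x. 2 * \<sigma> * arctan (x / \<sigma>)) has_real_derivative 2 * \<sigma> * (inverse (1 + (x / \<sigma>)\<^sup>2) * (1 / \<sigma>))) (at x)" for x
    by (rule DERIV_cmult[OF DERIV_chain2[OF DERIV_arctan DERIV_cdivide[OF DERIV_ident]]])
  moreover have "2 * \<sigma> * (inverse (1 + (x / \<sigma>)\<^sup>2) * (1 / \<sigma>)) = ?f x" for x using s by simp
  ultimately have "((\<lambda>x. 2 * \<sigma> * arctan (x / \<sigma>)) has_real_derivative ?f x) (at x)" for x by (simp only:)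
  then have d: "((\<lambda>x. 2 * \<sigma> * arctan (x / \<sigma>)) has_vector_derivative ?f x) (at x within {-R..R})" for x
    by - (rule has_vector_derivative_at_within, simp add: has_real_derivative_iff_has_vector_derivative)
  have I: "(?f has_integral (2 * \<sigma> * arctan (R / \<sigma>) - 2 * \<sigma> * arctan (- R / \<sigma>))) {-R..R}"
    by (rule fundamental_theorem_of_calculus[OF _ d]) (use True in simp)
  have "integral {-R..R} (bump \<sigma>) \<le> integral {-R..R} ?f"
    by (rule Henstock_Kurzweil_Integration.integral_le[OF integrable_continuous_real[OF continuous_bump] has_integral_integrable[OF I] le])
  also have "\<dots> = 4 * \<sigma> * arctan (R / \<sigma>)" unfolding integral_unique[OF I] by (simp add: arctan_minus)
  also have "\<dots> \<le> 4 * \<sigma> * 2"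
    using s arctan_ubound[of "R / \<sigma>"] pi_less_4 by (intro mult_left_mono) auto
  finally show ?thesis by simp
next
  case False
  then show ?thesis using s by simp
qed

lemma packet_bump: "packet \<sigma> \<omega> x = exp (\<i> * complex_of_real (\<omega> * x)) * complex_of_real (bump \<sigma> x)"
  by (simp add: packet_eq bump_def)

lemma cmod_packet: "cmod (packet \<sigma> \<omega> x) = bump \<sigma> x"
  using bump_pos[of \<sigma> x] unfolding packet_bump norm_mult by simp

definition packet_x :: "real \<Rightarrow> real \<Rightarrow> real \<Rightarrow> complex"
  where "packet_x \<sigma> \<omega> x = (\<i> * complex_of_real \<omega> - complex_of_real (x / \<sigma>\<^sup>2)) * packet \<sigma> \<omega> x"

definition packet_error :: "real \<Rightarrow> real \<Rightarrow> real \<Rightarrow> complex"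
  where "packet_error \<sigma> \<omega> x =
    (complex_of_real (x\<^sup>2 / \<sigma> ^ 4 - 1 / \<sigma>\<^sup>2) - \<i> * complex_of_real (2 * \<omega> * x / \<sigma>\<^sup>2)) * packet \<sigma> \<omega> x"

definition packet_xx :: "real \<Rightarrow> real \<Rightarrow> real \<Rightarrow> complex"
  where "packet_xx \<sigma> \<omega> x = packet_error \<sigma> \<omega> x - complex_of_real (\<omega>\<^sup>2) * packet \<sigma> \<omega> x"

lemma packet_deriv: "(packet \<sigma> \<omega> has_vector_derivative packet_x \<sigma> \<omega> x) (at x)"
  using gauss_vector_derivative[of "\<i> * complex_of_real \<omega>" "1 / (2 * \<sigma>\<^sup>2)" x]
  by (simp add: packet_def packet_x_def)

lemma packet_x_deriv: "(packet_x \<sigma> \<omega> has_vector_derivative packet_xx \<sigma> \<omega> x) (at x)"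
proof -
  have "((\<lambda>x. complex_of_real (x * inverse (\<sigma>\<^sup>2))) has_vector_derivative complex_of_real (1 * inverse (\<sigma>\<^sup>2))) (at x)"
    by (intro bounded_linear.has_vector_derivative[OF bounded_linear_of_real] has_vector_derivative_mult_left has_vector_derivative_id)
  then have "((\<lambda>x. \<i> * complex_of_real \<omega> - complex_of_real (x * inverse (\<sigma>\<^sup>2))) has_vector_derivative 0 - complex_of_real (1 * inverse (\<sigma>\<^sup>2))) (at x)"
    by (intro has_vector_derivative_diff has_vector_derivative_const)
  from has_vector_derivative_mult[OF this packet_deriv]
  have "((\<lambda>x. (\<i> * complex_of_real \<omega> - complex_of_real (x / \<sigma>\<^sup>2)) * packet \<sigma> \<omega> x) has_vector_derivative
     (\<i> * complex_of_real \<omega> - complex_of_real (x / \<sigma>\<^sup>2)) * packet_x \<sigma> \<omega> x + - complex_of_real (1 / \<sigma>\<^sup>2) * packet \<sigma> \<omega> x) (at x)"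
    by (simp add: divide_inverse)
  moreover have "(\<i> * complex_of_real \<omega> - complex_of_real (x / \<sigma>\<^sup>2)) * packet_x \<sigma> \<omega> x + - complex_of_real (1 / \<sigma>\<^sup>2) * packet \<sigma> \<omega> x = packet_xx \<sigma> \<omega> x"
  proof -
    define y where "y = complex_of_real (x / \<sigma>\<^sup>2)"
    have y: "complex_of_real (x\<^sup>2 / \<sigma> ^ 4) = y\<^sup>2" "complex_of_real (2 * \<omega> * x / \<sigma>\<^sup>2) = 2 * complex_of_real \<omega> * y"
      unfolding y_def by (simp_all add: power_divide flip: power_mult)
    show ?thesis
      unfolding packet_xx_def packet_error_def packet_x_def of_real_diff y y_def[symmetric]
      by (simp add: power2_eq_square algebra_simps)
  qed
  ultimately show ?thesis unfolding packet_x_def[abs_def] by (simp only:)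
qed

lemma packet_derivs_schwartz:
  assumes "1 \<le> \<sigma>"
  shows "packet_x \<sigma> \<omega> \<in> schwartz" "packet_xx \<sigma> \<omega> \<in> schwartz" "packet_error \<sigma> \<omega> \<in> schwartz"
proof -
  note p = packet_schwartz[OF assms, of \<omega>]
  have e1: "vderiv (Suc 0) (packet \<sigma> \<omega>) = packet_x \<sigma> \<omega>"
    by (rule ext) (simp add: vderiv_Suc vector_derivative_at[OF packet_deriv])
  have e2: "vderiv (Suc (Suc 0)) (packet \<sigma> \<omega>) = packet_xx \<sigma> \<omega>"
    by (rule ext) (simp add: vderiv_Suc[of "Suc 0"] e1 vector_derivative_at[OF packet_x_deriv])
  show 1: "packet_x \<sigma> \<omega> \<in> schwartz" "packet_xx \<sigma> \<omega> \<in> schwartz"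
    using schwartz_vderiv[OF p] e1 e2 by metis+
  have "packet_error \<sigma> \<omega> = (\<lambda>x. packet_xx \<sigma> \<omega> x + complex_of_real (\<omega>\<^sup>2) * packet \<sigma> \<omega> x)"
    by (rule ext) (simp add: packet_xx_def)
  then show "packet_error \<sigma> \<omega> \<in> schwartz" using schwartz_add[OF 1(2) schwartz_cmult[OF p]] by simp
qed

lemma bump_power_bounds:
  assumes "1 \<le> \<sigma>"
  shows "(x / \<sigma>)\<^sup>2 * bump \<sigma> x \<le> 1" "(x / \<sigma>) ^ 4 * bump \<sigma> x \<le> 8"
proof -
  define y where "y = (x / \<sigma>)\<^sup>2 / 2"
  have y: "0 \<le> y" "bump \<sigma> x = exp (- y)" "(x / \<sigma>)\<^sup>2 = 2 * y" "(x / \<sigma>) ^ 4 = 4 * y\<^sup>2"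
    by (simp_all add: y_def bump_def power_divide flip: power_mult)
  have e: "exp y * exp (- y) = 1" by (rule exp_minus_inverse)
  have "2 * y \<le> exp y"
  proof -
    have "y ^ 2 \<le> fact 2 * exp y" "1 + y \<le> exp y" using power_le_exp[OF y(1), of 2] exp_ge_add_one_self[of y] by auto
    moreover have "1 + y + y\<^sup>2 / 2 \<le> exp y" using exp_lower_Taylor_quadratic[OF y(1)] by simp
    moreover have "0 \<le> (y - 1)\<^sup>2" by simp
    ultimately show ?thesis by (simp add: power2_diff)
  qed
  from mult_right_mono[OF this, of "exp (- y)"] show "(x / \<sigma>)\<^sup>2 * bump \<sigma> x \<le> 1" unfolding y e by simp
  have "4 * y\<^sup>2 \<le> 8 * exp y" using power_le_exp[OF y(1), of 2] by simp
  from mult_right_mono[OF this, of "exp (- y)"] show "(x / \<sigma>) ^ 4 * bump \<sigma> x \<le> 8" unfolding y using e by (simp add: mult.assoc)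
qed

text \<open>With y = x / \<sigma> the modulus is at most w times y^2 + 1 + |y| times the envelope.
  Of the two envelope factors in the square, one absorbs the powers of y, which gives 3 * (8 + 1 +
  1) = 30, and the other is kept for the integration in x.\<close>

lemma packet_error_bound:
  assumes s: "1 \<le> \<sigma>"
  shows "(cmod (packet_error \<sigma> \<omega> x))\<^sup>2 \<le> 30 * ((2 * \<bar>\<omega>\<bar> + 1) / \<sigma>)\<^sup>2 * bump \<sigma> x"
proof -
  define y where "y = x / \<sigma>"
  define b where "b = bump \<sigma> x"
  define w where "w = (2 * \<bar>\<omega>\<bar> + 1) / \<sigma>"
  have b: "0 < b" "b \<le> 1" "y\<^sup>2 * b \<le> 1" "y ^ 4 * b \<le> 8"
    using bump_pos bump_le_1 bump_power_bounds[OF s, of x] by (simp_all add: b_def y_def)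
  have "cmod (complex_of_real (x\<^sup>2 / \<sigma> ^ 4 - 1 / \<sigma>\<^sup>2) - \<i> * complex_of_real (2 * \<omega> * x / \<sigma>\<^sup>2))
      \<le> cmod (complex_of_real (x\<^sup>2 / \<sigma> ^ 4 - 1 / \<sigma>\<^sup>2)) + cmod (\<i> * complex_of_real (2 * \<omega> * x / \<sigma>\<^sup>2))"
    by (rule norm_triangle_ineq4)
  also have "\<dots> = \<bar>x\<^sup>2 / \<sigma> ^ 4 - 1 / \<sigma>\<^sup>2\<bar> + \<bar>2 * \<omega> * x / \<sigma>\<^sup>2\<bar>" by (simp only: norm_mult norm_of_real norm_ii mult_1_left)
  finally have 1: "cmod (complex_of_real (x\<^sup>2 / \<sigma> ^ 4 - 1 / \<sigma>\<^sup>2) - \<i> * complex_of_real (2 * \<omega> * x / \<sigma>\<^sup>2))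
    \<le> \<bar>x\<^sup>2 / \<sigma> ^ 4 - 1 / \<sigma>\<^sup>2\<bar> + \<bar>2 * \<omega> * x / \<sigma>\<^sup>2\<bar>" .
  have 2: "x\<^sup>2 / \<sigma> ^ 4 - 1 / \<sigma>\<^sup>2 = (y\<^sup>2 - 1) * (1 / \<sigma> * (1 / \<sigma>))"
    using s by (simp add: y_def power_divide field_simps power2_eq_square power4_eq_xxxx)
  have 3: "2 * \<omega> * x / \<sigma>\<^sup>2 = 2 * \<omega> * y * (1 / \<sigma>)" by (simp add: y_def power2_eq_square)
  have 4: "\<bar>(y\<^sup>2 - 1) * (1 / \<sigma> * (1 / \<sigma>))\<bar> + \<bar>2 * \<omega> * y * (1 / \<sigma>)\<bar> \<le> w * (y\<^sup>2 + 1 + \<bar>y\<bar>)"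
  proof -
    have "1 / \<sigma> * (1 / \<sigma>) \<le> w * 1"
      unfolding w_def using s by (intro mult_mono divide_right_mono) auto
    then have "\<bar>y\<^sup>2 - 1\<bar> * (1 / \<sigma> * (1 / \<sigma>)) \<le> (y\<^sup>2 + 1) * w"
      using s by (intro mult_mono) (auto simp: abs_le_iff)
    moreover have "2 * \<bar>\<omega>\<bar> * (1 / \<sigma>) \<le> w" unfolding w_def using s by (simp add: divide_right_mono)
    then have "\<bar>y\<bar> * (2 * \<bar>\<omega>\<bar> * (1 / \<sigma>)) \<le> \<bar>y\<bar> * w" by (rule mult_left_mono) simp
    moreover have "\<bar>(y\<^sup>2 - 1) * (1 / \<sigma> * (1 / \<sigma>))\<bar> = \<bar>y\<^sup>2 - 1\<bar> * (1 / \<sigma> * (1 / \<sigma>))" using s by (simp add: abs_mult)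
    moreover have "\<bar>2 * \<omega> * y * (1 / \<sigma>)\<bar> = \<bar>y\<bar> * (2 * \<bar>\<omega>\<bar> * (1 / \<sigma>))" using s by (simp add: abs_mult)
    ultimately show ?thesis by (simp add: algebra_simps)
  qed
  have "cmod (packet_error \<sigma> \<omega> x) \<le> w * (y\<^sup>2 + 1 + \<bar>y\<bar>) * b"
    unfolding packet_error_def norm_mult cmod_packet b_def[symmetric]
    by (rule mult_right_mono[OF order_trans[OF 1] less_imp_le[OF b(1)]]) (simp only: 2 3 4)
  then have "(cmod (packet_error \<sigma> \<omega> x))\<^sup>2 \<le> (w * (y\<^sup>2 + 1 + \<bar>y\<bar>) * b)\<^sup>2" by (rule power_mono) simp
  also have "\<dots> = w\<^sup>2 * ((y\<^sup>2 + 1 + \<bar>y\<bar>)\<^sup>2 * b) * b" by (simp only: power_mult_distrib power2_eq_square[of b] mult.assoc)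
  also have "\<dots> \<le> w\<^sup>2 * 30 * b"
  proof -
    have "(y\<^sup>2 + 1 + \<bar>y\<bar>)\<^sup>2 \<le> 3 * (y ^ 4 + 1 + y\<^sup>2)"
    proof -
      have t: "(p + q + r)\<^sup>2 \<le> 3 * (p\<^sup>2 + q\<^sup>2 + r\<^sup>2)" for p q r :: real
      proof -
        have "0 \<le> (p - q)\<^sup>2" "0 \<le> (q - r)\<^sup>2" "0 \<le> (p - r)\<^sup>2" by simp_all
        then show ?thesis by (simp add: power2_eq_square algebra_simps)
      qed
      have "(y\<^sup>2)\<^sup>2 = y ^ 4" by (simp flip: power_mult)
      then show ?thesis using t[of "y\<^sup>2" 1 "\<bar>y\<bar>"] by simp
    qed
    from mult_right_mono[OF this, of b] b have "(y\<^sup>2 + 1 + \<bar>y\<bar>)\<^sup>2 * b \<le> 3 * (y ^ 4 * b + b + y\<^sup>2 * b)"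
      by (simp add: algebra_simps)
    moreover have "y ^ 4 * b + b + y\<^sup>2 * b \<le> 8 + 1 + 1" by (intro add_mono b)
    then have "3 * (y ^ 4 * b + b + y\<^sup>2 * b) \<le> 3 * (8 + 1 + 1)" by (rule mult_left_mono) simp
    ultimately have "(y\<^sup>2 + 1 + \<bar>y\<bar>)\<^sup>2 * b \<le> 3 * (8 + 1 + 1)" by (rule order_trans)
    then have "(y\<^sup>2 + 1 + \<bar>y\<bar>)\<^sup>2 * b \<le> 30" by simp
    then show ?thesis using b(1) by (intro mult_right_mono mult_left_mono) auto
  qed
  finally show ?thesis unfolding w_def b_def by (simp only: mult_ac)
qed

lemma packet_x_bound:
  assumes s: "1 \<le> \<sigma>"
  shows "(cmod (packet_x \<sigma> \<omega> x))\<^sup>2 \<le> (\<omega>\<^sup>2 + 1) * bump \<sigma> x"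
proof -
  define b where "b = bump \<sigma> x"
  have b: "0 < b" "b \<le> 1" "(x / \<sigma>)\<^sup>2 * b \<le> 1"
    using bump_pos bump_le_1 bump_power_bounds[OF s, of x] by (simp_all add: b_def)
  have "(cmod (packet_x \<sigma> \<omega> x))\<^sup>2 = (\<omega>\<^sup>2 + (x / \<sigma>\<^sup>2)\<^sup>2) * b\<^sup>2"
    unfolding packet_x_def norm_mult power_mult_distrib cmod_packet b_def
    by (simp add: cmod_power2)
  also have "(x / \<sigma>\<^sup>2)\<^sup>2 \<le> (x / \<sigma>)\<^sup>2"
  proof -
    have "\<sigma>\<^sup>2 \<le> (\<sigma>\<^sup>2)\<^sup>2" using power_increasing[OF _ s, of 2 4] by simp
    then show ?thesis unfolding power_divide using s by (intro divide_left_mono) auto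
  qed
  then have "(\<omega>\<^sup>2 + (x / \<sigma>\<^sup>2)\<^sup>2) * b\<^sup>2 \<le> (\<omega>\<^sup>2 + (x / \<sigma>)\<^sup>2) * b\<^sup>2" by (intro mult_right_mono) auto
  also have "\<dots> = (\<omega>\<^sup>2 * b + (x / \<sigma>)\<^sup>2 * b) * b" by (simp add: power2_eq_square algebra_simps)
  also have "\<dots> \<le> (\<omega>\<^sup>2 * 1 + 1) * b" using b by (intro mult_right_mono add_mono mult_left_mono) auto
  finally show ?thesis by (simp add: b_def)
qed

lemma nice_phase:
  assumes "\<phi> \<in> schwartz"
  shows "nice T (\<lambda>x t. exp (\<i> * complex_of_real (c * t)) * \<phi> x)"
proof -
  obtain B where B: "\<And>x. \<bar>x\<bar> ^ 0 * cmod (vderiv 0 \<phi> x) \<le> B" using schwartz_bound[OF assms] by blast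
  show ?thesis
  proof (rule niceI)
    have "continuous_on (UNIV \<times> {0..T}) (\<lambda>p. \<phi> (fst p))"
      by (rule continuous_on_compose2[OF schwartz_continuous[OF assms, of UNIV]]) (auto intro: continuous_intros)
    then show "continuous_on (UNIV \<times> {0..T}) (\<lambda>p. exp (\<i> * complex_of_real (c * snd p)) * \<phi> (fst p))"
      by (intro continuous_intros)
    show "norm (exp (\<i> * complex_of_real (c * t)) * \<phi> x) \<le> B" for x t using B[of x] by (simp add: norm_mult)
    show "((\<lambda>x. exp (\<i> * complex_of_real (c * t)) * \<phi> x) \<longlongrightarrow> 0) at_top" for t
      by (rule tendsto_mult_right_zero[OF schwartz_tendsto_0(1)[OF assms]])
    show "((\<lambda>x. exp (\<i> * complex_of_real (c * t)) * \<phi> x) \<longlongrightarrow> 0) at_bot" for t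
      by (rule tendsto_mult_right_zero[OF schwartz_tendsto_0(2)[OF assms]])
  qed
qed

lemma nice_shift:
  assumes "\<phi> \<in> schwartz"
  shows "nice T (\<lambda>x t. \<phi> (x + c * t))"
proof -
  obtain B where B: "\<And>x. \<bar>x\<bar> ^ 0 * cmod (vderiv 0 \<phi> x) \<le> B" using schwartz_bound[OF assms] by blast
  have f: "filterlim (\<lambda>x::real. x + a) at_top at_top" "filterlim (\<lambda>x::real. x + a) at_bot at_bot" for a :: real
    by real_asymp+
  show ?thesis
  proof (rule niceI)
    have "continuous_on (UNIV \<times> {0..T}) (\<lambda>p. fst p + c * snd p)" by (intro continuous_intros)
    then show "continuous_on (UNIV \<times> {0..T}) (\<lambda>p. \<phi> (fst p + c * snd p))"
      by (rule continuous_on_compose2[OF schwartz_continuous[OF assms, of UNIV]]) auto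
    show "norm (\<phi> (x + c * t)) \<le> B" for x t using B[of "x + c * t"] by simp
    show "((\<lambda>x. \<phi> (x + c * t)) \<longlongrightarrow> 0) at_top" for t by (rule filterlim_compose[OF schwartz_tendsto_0(1)[OF assms] f(1)])
    show "((\<lambda>x. \<phi> (x + c * t)) \<longlongrightarrow> 0) at_bot" for t by (rule filterlim_compose[OF schwartz_tendsto_0(2)[OF assms] f(2)])
  qed
qed

lemma integral_cos_square:
  fixes \<kappa> a b :: real
  assumes "0 < \<kappa>" "a \<le> b"
  shows "(b - a) / 2 - 1 / (2 * \<kappa>) \<le> integral {a..b} (\<lambda>x. (cos (\<kappa> * x))\<^sup>2)"
proof -
  let ?F = "\<lambda>x. x / 2 + sin (2 * \<kappa> * x) / (4 * \<kappa>)"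
  have "(?F has_real_derivative (cos (\<kappa> * x))\<^sup>2) (at x)" for x
  proof -
    have "(?F has_real_derivative 1 / 2 + (cos (2 * \<kappa> * x) * (2 * \<kappa>)) / (4 * \<kappa>)) (at x)"
      using assms by (auto intro!: derivative_eq_intros)
    moreover have "1 / 2 + (cos (2 * \<kappa> * x) * (2 * \<kappa>)) / (4 * \<kappa>) = (cos (\<kappa> * x))\<^sup>2"
      using assms cos_double_cos[of "\<kappa> * x"] by (simp add: mult.assoc add_divide_distrib diff_divide_distrib)
    ultimately show ?thesis by simp
  qed
  then have "(?F has_vector_derivative (cos (\<kappa> * x))\<^sup>2) (at x within {a..b})" for x
    by - (rule has_vector_derivative_at_within, simp add: has_real_derivative_iff_has_vector_derivative)
  from fundamental_theorem_of_calculus[OF assms(2) this]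
  have "integral {a..b} (\<lambda>x. (cos (\<kappa> * x))\<^sup>2) = ?F b - ?F a" by (rule integral_unique)
  moreover have "\<bar>sin (2 * \<kappa> * x) / (4 * \<kappa>)\<bar> \<le> 1 / (4 * \<kappa>)" for x
    using assms by (simp add: abs_divide divide_right_mono)
  from this[of a] this[of b] have "sin (2 * \<kappa> * a) / (4 * \<kappa>) - sin (2 * \<kappa> * b) / (4 * \<kappa>) \<le> 1 / (4 * \<kappa>) + 1 / (4 * \<kappa>)"
    by linarith
  moreover have "1 / (4 * \<kappa>) + 1 / (4 * \<kappa>) = 1 / (2 * \<kappa>)" by simp
  ultimately show ?thesis by (simp add: diff_divide_distrib)
qed

section \<open>L2 bounds through truncated integrals\<close>

lemma integrable_on_real_cmult:
  fixes f :: "real \<Rightarrow> real"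
  shows "f integrable_on A \<Longrightarrow> (\<lambda>x. c * f x) integrable_on A"
  by (rule has_integral_integrable[OF has_integral_mult_right[OF integrable_integral]])

text \<open>An L2 bound on the whole line, expressed through symmetric truncations so that it
  follows directly from the balance laws.\<close>

definition square_bound :: "(real \<Rightarrow> complex) \<Rightarrow> real \<Rightarrow> bool"
  where "square_bound f a \<longleftrightarrow> 0 \<le> a \<and> continuous_on UNIV f \<and> (\<forall>R\<ge>0. integral {-R..R} (\<lambda>x. (cmod (f x))\<^sup>2) \<le> a\<^sup>2)"

lemma square_boundI:
  assumes "0 \<le> a" "continuous_on UNIV f" "\<And>R. 0 \<le> R \<Longrightarrow> integral {-R..R} (\<lambda>x. (cmod (f x))\<^sup>2) \<le> a\<^sup>2"
  shows "square_bound f a"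
  using assms by (simp add: square_bound_def)

lemma square_boundD:
  assumes "square_bound f a"
  shows "0 \<le> a" "continuous_on A f" "0 \<le> R \<Longrightarrow> integral {-R..R} (\<lambda>x. (cmod (f x))\<^sup>2) \<le> a\<^sup>2"
    "(\<lambda>x. (cmod (f x))\<^sup>2) integrable_on {-R..R}"
proof -
  have f: "continuous_on UNIV f" using assms by (simp add: square_bound_def)
  show c: "continuous_on A f" for A by (rule continuous_on_subset[OF f subset_UNIV])
  show "0 \<le> a" "0 \<le> R \<Longrightarrow> integral {-R..R} (\<lambda>x. (cmod (f x))\<^sup>2) \<le> a\<^sup>2" using assms by (simp_all add: square_bound_def)
  show "(\<lambda>x. (cmod (f x))\<^sup>2) integrable_on {-R..R}"
    by (rule integrable_continuous_real, intro continuous_intros c)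
qed

lemma square_bound_dominated:
  assumes f: "square_bound f a" and g: "continuous_on UNIV g" and m: "0 \<le> m"
    and le: "\<And>x. cmod (g x) \<le> m * cmod (f x)"
  shows "square_bound g (m * a)"
proof (rule square_boundI)
  show "0 \<le> m * a" using m square_boundD(1)[OF f] by simp
  fix R :: real assume R: "0 \<le> R"
  have cg: "continuous_on {-R..R} g" by (rule continuous_on_subset[OF g subset_UNIV])
  have "integral {-R..R} (\<lambda>x. (cmod (g x))\<^sup>2) \<le> integral {-R..R} (\<lambda>x. m\<^sup>2 * (cmod (f x))\<^sup>2)"
  proof (rule Henstock_Kurzweil_Integration.integral_le)
    show "(\<lambda>x. (cmod (g x))\<^sup>2) integrable_on {-R..R}" by (rule integrable_continuous_real, intro continuous_intros cg)
    show "(\<lambda>x. m\<^sup>2 * (cmod (f x))\<^sup>2) integrable_on {-R..R}" by (rule integrable_on_real_cmult[OF square_boundD(4)[OF f]])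
    show "(cmod (g x))\<^sup>2 \<le> m\<^sup>2 * (cmod (f x))\<^sup>2" for x
      using power_mono[OF le[of x], of 2] by (simp add: power_mult_distrib)
  qed
  also have "\<dots> \<le> m\<^sup>2 * a\<^sup>2" using square_boundD(3)[OF f R] by (simp add: mult_left_mono)
  finally show "integral {-R..R} (\<lambda>x. (cmod (g x))\<^sup>2) \<le> (m * a)\<^sup>2" by (simp add: power_mult_distrib)
qed (rule g)

lemma square_bound_cmult:
  assumes f: "square_bound f a"
  shows "square_bound (\<lambda>x. c * f x) (cmod c * a)"
proof (rule square_bound_dominated[OF f _ norm_ge_zero])
  show "continuous_on UNIV (\<lambda>x. c * f x)" by (intro continuous_intros square_boundD(2)[OF f])
  show "cmod (c * f x) \<le> cmod c * cmod (f x)" for x by (simp add: norm_mult)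
qed

lemma square_bound_minus: "square_bound f a \<Longrightarrow> square_bound (\<lambda>x. - f x) a"
  using square_bound_cmult[of f a "-1"] by simp

text \<open>The pointwise inequality \<open>|f + g|^2 \<le> 2 |f|^2 + 2 |g|^2\<close> costs a factor
  2. Below only the powers of N, s and \<epsilon> count.\<close>

lemma square_bound_add:
  assumes f: "square_bound f a" and g: "square_bound g b"
  shows "square_bound (\<lambda>x. f x + g x) (2 * a + 2 * b)"
proof (rule square_boundI)
  show "0 \<le> 2 * a + 2 * b" using square_boundD(1)[OF f] square_boundD(1)[OF g] by simp
  show "continuous_on UNIV (\<lambda>x. f x + g x)" by (intro continuous_intros square_boundD(2)[OF f] square_boundD(2)[OF g])
  fix R :: real assume R: "0 \<le> R"
  have I: "((\<lambda>x. 2 * (cmod (f x))\<^sup>2 + 2 * (cmod (g x))\<^sup>2) has_integral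
    2 * integral {-R..R} (\<lambda>x. (cmod (f x))\<^sup>2) + 2 * integral {-R..R} (\<lambda>x. (cmod (g x))\<^sup>2)) {-R..R}"
    by (rule has_integral_add[OF has_integral_mult_right[OF integrable_integral] has_integral_mult_right[OF integrable_integral]])
      (rule square_boundD(4)[OF f] square_boundD(4)[OF g])+
  have "integral {-R..R} (\<lambda>x. (cmod (f x + g x))\<^sup>2) \<le> integral {-R..R} (\<lambda>x. 2 * (cmod (f x))\<^sup>2 + 2 * (cmod (g x))\<^sup>2)"
  proof (rule Henstock_Kurzweil_Integration.integral_le)
    show "(\<lambda>x. (cmod (f x + g x))\<^sup>2) integrable_on {-R..R}"
      by (rule integrable_continuous_real, intro continuous_intros square_boundD(2)[OF f] square_boundD(2)[OF g])
    show "(\<lambda>x. 2 * (cmod (f x))\<^sup>2 + 2 * (cmod (g x))\<^sup>2) integrable_on {-R..R}" by (rule has_integral_integrable[OF I])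
    show "(cmod (f x + g x))\<^sup>2 \<le> 2 * (cmod (f x))\<^sup>2 + 2 * (cmod (g x))\<^sup>2" for x
    proof -
      have "(cmod (f x + g x))\<^sup>2 \<le> (cmod (f x) + cmod (g x))\<^sup>2" by (rule power_mono[OF norm_triangle_ineq norm_ge_zero])
      moreover have "0 \<le> (cmod (f x) - cmod (g x))\<^sup>2" by simp
      ultimately show ?thesis by (simp add: power2_eq_square algebra_simps)
    qed
  qed
  also have "\<dots> \<le> 2 * a\<^sup>2 + 2 * b\<^sup>2"
    unfolding integral_unique[OF I] using square_boundD(3)[OF f R] square_boundD(3)[OF g R] by linarith
  also have "\<dots> \<le> (2 * a + 2 * b)\<^sup>2"
  proof -
    have "0 \<le> a * b" "0 \<le> a\<^sup>2" "0 \<le> b\<^sup>2" using square_boundD(1)[OF f] square_boundD(1)[OF g] by simp_all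
    then show ?thesis unfolding power2_sum power_mult_distrib by simp
  qed
  finally show "integral {-R..R} (\<lambda>x. (cmod (f x + g x))\<^sup>2) \<le> (2 * a + 2 * b)\<^sup>2" .
qed

lemma square_bound_diff: "square_bound f a \<Longrightarrow> square_bound g b \<Longrightarrow> square_bound (\<lambda>x. f x - g x) (2 * a + 2 * b)"
  using square_bound_add[of f a "\<lambda>x. - g x" b] square_bound_minus[of g b] by simp

lemma square_bound_pairing:
  assumes "square_bound f a" "square_bound g b" "0 \<le> R"
  shows "cmod (integral {-R..R} (\<lambda>x. f x * g x)) \<le> a * b"
  using integral_Cauchy_Schwarz[OF square_boundD(2)[OF assms(1)] square_boundD(2)[OF assms(2)]
      square_boundD(3)[OF assms(1,3)] square_boundD(3)[OF assms(2,3)]]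
    square_boundD(1)[OF assms(1)] square_boundD(1)[OF assms(2)] by simp

text \<open>Here s is the square root of the width, not the Sobolev index, which keeps all norms
  rational in s: the packet has size s, its residual size |\<omega>| / s, a relative error
  |\<omega>| / s^2. The constants come from 8 < 9 and 30 * 8 < 256.\<close>

lemma packet_square_bound:
  assumes s: "1 \<le> s"
  shows "square_bound (packet (s\<^sup>2) \<omega>) (3 * s)"
    and "square_bound (packet_error (s\<^sup>2) \<omega>) (16 * (2 * \<bar>\<omega>\<bar> + 1) / s)"
proof -
  have s2: "1 \<le> s\<^sup>2" using one_le_power[OF s] by simp
  have bb: "(bump (s\<^sup>2) x)\<^sup>2 \<le> bump (s\<^sup>2) x" for x
    using mult_left_mono[OF bump_le_1, of "bump (s\<^sup>2) x" "s\<^sup>2" x] bump_pos[of "s\<^sup>2" x] by (simp add: power2_eq_square)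
  have ib: "bump (s\<^sup>2) integrable_on {-R..R}" for R by (rule integrable_continuous_real[OF continuous_bump])
  note cp = schwartz_continuous[OF packet_schwartz[OF s2]] and ce = schwartz_continuous[OF packet_derivs_schwartz(3)[OF s2]]
  show "square_bound (packet (s\<^sup>2) \<omega>) (3 * s)"
  proof (rule square_boundI[OF _ cp])
    fix R :: real
    have "integral {-R..R} (\<lambda>x. (cmod (packet (s\<^sup>2) \<omega> x))\<^sup>2) \<le> integral {-R..R} (bump (s\<^sup>2))"
      unfolding cmod_packet
      by (rule Henstock_Kurzweil_Integration.integral_le[OF integrable_continuous_real ib bb]) (intro continuous_intros continuous_bump)
    also have "\<dots> \<le> 8 * s\<^sup>2" by (rule bump_integral[OF s2])
    also have "\<dots> \<le> (3 * s)\<^sup>2" unfolding power_mult_distrib by simp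
    finally show "integral {-R..R} (\<lambda>x. (cmod (packet (s\<^sup>2) \<omega> x))\<^sup>2) \<le> (3 * s)\<^sup>2" .
  qed (use s in simp)
  show "square_bound (packet_error (s\<^sup>2) \<omega>) (16 * (2 * \<bar>\<omega>\<bar> + 1) / s)"
  proof (rule square_boundI[OF _ ce])
    fix R :: real
    let ?w = "((2 * \<bar>\<omega>\<bar> + 1) / s\<^sup>2)\<^sup>2"
    have "integral {-R..R} (\<lambda>x. (cmod (packet_error (s\<^sup>2) \<omega> x))\<^sup>2) \<le> integral {-R..R} (\<lambda>x. (30 * ?w) * bump (s\<^sup>2) x)"
      by (rule Henstock_Kurzweil_Integration.integral_le[OF integrable_continuous_real integrable_on_real_cmult[OF ib] packet_error_bound[OF s2]])
        (intro continuous_intros ce)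
    also have "\<dots> = (30 * ?w) * integral {-R..R} (bump (s\<^sup>2))" by simp
    also have "\<dots> \<le> (30 * ?w) * (8 * s\<^sup>2)" by (intro mult_left_mono bump_integral[OF s2]) simp
    also have "\<dots> = 240 * ((2 * \<bar>\<omega>\<bar> + 1) / s)\<^sup>2" using s by (simp add: power_divide power2_eq_square)
    also have "\<dots> \<le> 256 * ((2 * \<bar>\<omega>\<bar> + 1) / s)\<^sup>2" by simp
    also have "\<dots> = (16 * (2 * \<bar>\<omega>\<bar> + 1) / s)\<^sup>2" by (simp only: power_mult_distrib power_divide) simp
    finally show "integral {-R..R} (\<lambda>x. (cmod (packet_error (s\<^sup>2) \<omega> x))\<^sup>2) \<le> (16 * (2 * \<bar>\<omega>\<bar> + 1) / s)\<^sup>2" .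
  qed (use s in simp)
qed

text \<open>The slope is 1 / \<sigma> times |x| / \<sigma> times the envelope, and the last product
  is at most 1. It measures the cost of freezing an envelope that travels with unit speed.\<close>

lemma bump_Lipschitz:
  assumes s: "1 \<le> \<sigma>"
  shows "\<bar>bump \<sigma> x - bump \<sigma> y\<bar> \<le> \<bar>x - y\<bar> / \<sigma>"
proof -
  have d: "(bump \<sigma> has_field_derivative (- (z / \<sigma>\<^sup>2) * bump \<sigma> z)) (at z within UNIV)" for z
  proof -
    have "((\<lambda>x. exp (- x\<^sup>2 / (2 * \<sigma>\<^sup>2))) has_real_derivative exp (- z\<^sup>2 / (2 * \<sigma>\<^sup>2)) * (- (2 * z) / (2 * \<sigma>\<^sup>2))) (at z)"
      by (rule DERIV_chain2[OF DERIV_exp DERIV_cdivide]) (auto intro!: derivative_eq_intros)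
    then show ?thesis unfolding bump_def[abs_def] by (simp add: mult.commute)
  qed
  have b: "norm (- (z / \<sigma>\<^sup>2) * bump \<sigma> z) \<le> 1 / \<sigma>" for z
  proof -
    let ?b = "bump \<sigma> z"
    have "(\<bar>z / \<sigma>\<bar> * ?b)\<^sup>2 = ((z / \<sigma>)\<^sup>2 * ?b) * ?b" by (simp add: power2_eq_square)
    also have "\<dots> \<le> 1 * 1"
      using bump_power_bounds(1)[OF s, of z] bump_le_1[of \<sigma> z] bump_pos[of \<sigma> z] by (intro mult_mono) auto
    finally have "\<bar>z / \<sigma>\<bar> * ?b \<le> 1" unfolding mult_1_left abs_square_le_1 by (rule abs_le_D1)
    then have "(\<bar>z / \<sigma>\<bar> * ?b) / \<sigma> \<le> 1 / \<sigma>" using s by (intro divide_right_mono) auto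
    moreover have "norm (- (z / \<sigma>\<^sup>2) * ?b) = (\<bar>z / \<sigma>\<bar> * ?b) / \<sigma>"
      using s bump_pos[of \<sigma> z] by (simp add: abs_mult power2_eq_square)
    ultimately show ?thesis by simp
  qed
  show ?thesis using field_differentiable_bound[OF convex_UNIV d b UNIV_I UNIV_I, of x y] by simp
qed

section \<open>Solutions issuing from packets\<close>

lemma phase_vector_derivative:
  "((\<lambda>t. exp (\<i> * complex_of_real (c * t))) has_vector_derivative \<i> * complex_of_real c * exp (\<i> * complex_of_real (c * t))) (at t within A)"
  using has_vector_derivative_at_within[OF exp_vector_derivative[of "\<i> * complex_of_real c" t], of A]
  by (simp only: of_real_mult mult.assoc)

lemma Re_packet: "Re (packet \<sigma> \<kappa> x) = cos (\<kappa> * x) * bump \<sigma> x"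
  unfolding packet_bump by (simp add: Re_exp)

lemma shift_vector_derivative:
  shows "((\<lambda>y. Re (packet \<sigma> \<kappa> (y + c * t))) has_vector_derivative Re (packet_x \<sigma> \<kappa> (x + c * t))) (at x)"
    and "((\<lambda>r. Re (packet \<sigma> \<kappa> (x + c * r))) has_vector_derivative c * Re (packet_x \<sigma> \<kappa> (x + c * t))) (at t within A)"
proof -
  have "((\<lambda>y. y + c * t) has_real_derivative 1) (at x)" by (auto intro!: derivative_eq_intros)
  then have 1: "((\<lambda>y. y + c * t) has_vector_derivative 1) (at x)" by (simp add: has_real_derivative_iff_has_vector_derivative)
  have "((\<lambda>r. x + c * r) has_real_derivative c) (at t within A)" by (auto intro!: derivative_eq_intros)
  then have 2: "((\<lambda>r. x + c * r) has_vector_derivative c) (at t within A)" by (simp add: has_real_derivative_iff_has_vector_derivative)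
  show "((\<lambda>y. Re (packet \<sigma> \<kappa> (y + c * t))) has_vector_derivative Re (packet_x \<sigma> \<kappa> (x + c * t))) (at x)"
    using bounded_linear.has_vector_derivative[OF bounded_linear_Re vector_diff_chain_at[OF 1 packet_deriv[of \<sigma> \<kappa>]]]
    unfolding o_def scaleR_one .
  show "((\<lambda>r. Re (packet \<sigma> \<kappa> (x + c * r))) has_vector_derivative c * Re (packet_x \<sigma> \<kappa> (x + c * t))) (at t within A)"
    using bounded_linear.has_vector_derivative[OF bounded_linear_Re vector_diff_chain_within[OF 2 has_vector_derivative_at_within[OF packet_deriv[of \<sigma> \<kappa>]]]]
    unfolding o_def complex_scaleR real_scaleR_def scaleR_complex.simps .
qed

text \<open>The value 4 (M + E + 2 M^3) with M = 16 \<alpha>^2 s^2 and E the bound on the initial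
  energy, taken at \<epsilon> = 1; it is large enough for all three conclusions of
  \<open>energy\<close>. Its growth in N and s is harmless, since in the end it multiplies only
  \<epsilon>^3.\<close>

definition flow_const :: "real \<Rightarrow> real \<Rightarrow> real \<Rightarrow> real \<Rightarrow> real"
  where "flow_const s N \<alpha> \<beta> = 4 * (16 * \<alpha>\<^sup>2 * s\<^sup>2 + ((\<alpha>\<^sup>2 * (N\<^sup>2 + 1) + \<beta>\<^sup>2 + \<alpha> ^ 4) * (8 * s\<^sup>2) + 2 * (16 * \<alpha>\<^sup>2 * s\<^sup>2) ^ 3))"

text \<open>\<open>B\<close> is separate from \<beta> \<epsilon> so that the same constants serve
  the solution with the wave datum and the one without it.\<close>

locale packet_flow = zakharov_flow +
  fixes s N \<alpha> \<beta> \<epsilon> B k :: real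
  assumes s: "1 \<le> s" and N: "0 \<le> N" and \<alpha>: "0 < \<alpha>" and \<epsilon>: "0 < \<epsilon>" "\<epsilon> \<le> 1" and B: "0 \<le> B" "B \<le> \<beta> * \<epsilon>"
    and u_init: "\<And>x. u0 x 0 = complex_of_real (\<alpha> * \<epsilon>) * packet (s\<^sup>2) (- N) x"
    and n_init: "\<And>x. n0 x 0 = B * Re (packet (s\<^sup>2) (2 * N + 1) x)"
    and k: "0 \<le> k" "k\<^sup>2 = flow_const s N \<alpha> \<beta>"
begin

lemma s2: "1 \<le> s\<^sup>2"
  using one_le_power[OF s] by simp

lemma bump_square: "(bump \<sigma> x)\<^sup>2 \<le> bump \<sigma> x"
  using mult_left_mono[OF bump_le_1, of "bump \<sigma> x" \<sigma> x] bump_pos[of \<sigma> x] by (simp add: power2_eq_square)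

lemma f0_init: "f0 x 0 \<le> (\<alpha> * \<epsilon>)\<^sup>2 * bump (s\<^sup>2) x"
  unfolding f0_def u_init norm_mult norm_of_real cmod_packet power_mult_distrib power2_abs
  by (intro mult_left_mono bump_square) simp

lemma u1_init: "u1 x 0 = complex_of_real (\<alpha> * \<epsilon>) * packet_x (s\<^sup>2) (- N) x"
proof -
  have "((\<lambda>y. u0 y 0) has_vector_derivative complex_of_real (\<alpha> * \<epsilon>) * packet_x (s\<^sup>2) (- N) x) (at x)"
    unfolding u_init by (rule has_vector_derivative_mult_right[OF packet_deriv])
  with u0_x[of 0 x] T show ?thesis by (auto intro: vector_derivative_unique_at)
qed

text \<open>v vanishes at time 0, the interaction is split by Young's inequality, and \<epsilon>^4
  is at most \<epsilon>^2, so every term is quadratic in \<epsilon>.\<close>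

lemma e_init: "e x 0 \<le> \<epsilon>\<^sup>2 * (\<alpha>\<^sup>2 * (N\<^sup>2 + 1) + \<beta>\<^sup>2 + \<alpha> ^ 4) * bump (s\<^sup>2) x"
proof -
  let ?b = "bump (s\<^sup>2) x"
  have b: "0 < ?b" "?b \<le> 1" by (rule bump_pos bump_le_1)+
  have 1: "(cmod (u1 x 0))\<^sup>2 \<le> (\<alpha> * \<epsilon>)\<^sup>2 * ((N\<^sup>2 + 1) * ?b)"
    unfolding u1_init norm_mult norm_of_real power_mult_distrib power2_abs
    using packet_x_bound[OF s2, of "- N" x] by (intro mult_left_mono) auto
  have "\<bar>n0 x 0\<bar> = B * (\<bar>cos ((2 * N + 1) * x)\<bar> * ?b)" using b B by (simp add: n_init Re_packet abs_mult)
  also have "\<dots> \<le> (\<beta> * \<epsilon>) * (1 * ?b)" using b B order_trans[OF B] by (intro mult_mono) auto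
  finally have "\<bar>n0 x 0\<bar>\<^sup>2 \<le> (\<beta> * \<epsilon> * (1 * ?b))\<^sup>2" by (rule power_mono) simp
  also have "\<dots> = (\<beta> * \<epsilon>)\<^sup>2 * ?b\<^sup>2" by (simp add: power_mult_distrib)
  also have "\<dots> \<le> (\<beta> * \<epsilon>)\<^sup>2 * ?b" by (intro mult_left_mono bump_square) simp
  finally have 2: "(n0 x 0)\<^sup>2 \<le> (\<beta> * \<epsilon>)\<^sup>2 * ?b" by simp
  have "(f0 x 0)\<^sup>2 \<le> ((\<alpha> * \<epsilon>)\<^sup>2 * ?b)\<^sup>2" by (rule power_mono[OF f0_init]) (simp add: f0_def)
  also have "\<dots> = (\<alpha> * \<epsilon>) ^ 4 * ?b\<^sup>2" by (simp add: power_mult_distrib flip: power_mult)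
  also have "\<dots> \<le> (\<alpha> ^ 4 * \<epsilon>\<^sup>2) * ?b"
    unfolding power_mult_distrib using power_decreasing[of 2 4 \<epsilon>] \<epsilon> b by (intro mult_mono bump_square mult_left_mono) auto
  finally have 3: "(f0 x 0)\<^sup>2 \<le> (\<alpha> ^ 4 * \<epsilon>\<^sup>2) * ?b" .
  have "0 \<le> (n0 x 0 - f0 x 0)\<^sup>2" by simp
  then have "n0 x 0 * f0 x 0 \<le> (n0 x 0)\<^sup>2 / 2 + (f0 x 0)\<^sup>2" unfolding power2_diff using zero_le_power2[of "f0 x 0"] by linarith
  then have "e x 0 \<le> (\<alpha> * \<epsilon>)\<^sup>2 * ((N\<^sup>2 + 1) * ?b) + (\<beta> * \<epsilon>)\<^sup>2 * ?b + (\<alpha> ^ 4 * \<epsilon>\<^sup>2) * ?b"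
    unfolding e_def v_0 using 1 2 3 by simp
  also have "\<dots> = \<epsilon>\<^sup>2 * (\<alpha>\<^sup>2 * (N\<^sup>2 + 1) + \<beta>\<^sup>2 + \<alpha> ^ 4) * ?b" by (simp add: power_mult_distrib algebra_simps)
  finally show ?thesis .
qed

lemma integral_bump_le:
  assumes "\<And>x. f x \<le> c * bump (s\<^sup>2) x" "0 \<le> c" "continuous_on UNIV f"
  shows "integral {-R..R} f \<le> c * (8 * s\<^sup>2)"
proof -
  have "integral {-R..R} f \<le> integral {-R..R} (\<lambda>x. c * bump (s\<^sup>2) x)"
    by (rule Henstock_Kurzweil_Integration.integral_le[OF integrable_continuous_real[OF continuous_on_subset[OF assms(3) subset_UNIV]]
        integrable_on_real_cmult[OF integrable_continuous_real[OF continuous_bump]] assms(1)])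
  also have "\<dots> = c * integral {-R..R} (bump (s\<^sup>2))" by simp
  also have "\<dots> \<le> c * (8 * s\<^sup>2)" by (intro mult_left_mono bump_integral[OF s2] assms)
  finally show ?thesis .
qed

lemma zero_time: "0 \<in> {0..T}"
  using T by simp

lemma nice_e: "nice T e"
  unfolding e_def[abs_def] divide_inverse
  by (intro nice_add nice_cmod_power2 nice_u nice_bounded_linear[OF bounded_linear_mult_left] nice_power2 nice_n nice_v nice_mult nice_f)

lemma mass_bound: "t \<in> {0..T} \<Longrightarrow> square_bound (\<lambda>x. u0 x t) (4 * (\<alpha> * \<epsilon>) * s)"
proof (rule square_boundI)
  fix R :: real assume t: "t \<in> {0..T}" and R: "0 \<le> R"
  have "integral {-R..R} (\<lambda>x. f0 x t) \<le> 2 * ((\<alpha> * \<epsilon>)\<^sup>2 * (8 * s\<^sup>2))"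
    by (rule mass[OF integral_bump_le[OF f0_init] t R]) (simp, rule nice_cont_x[OF nice_f(1) zero_time])
  then show "integral {-R..R} (\<lambda>x. (cmod (u0 x t))\<^sup>2) \<le> (4 * (\<alpha> * \<epsilon>) * s)\<^sup>2" by (simp add: f0_def power_mult_distrib)
qed (use s \<alpha> \<epsilon> nice_cont_x[OF nice_u(1)] in auto)

text \<open>The initial mass and energy are of order \<epsilon>^2, and the cubic correction in the
  mass becomes \<epsilon>^6, which is at most \<epsilon>^2; so the solution stays of order
  \<epsilon> up to time T.\<close>

lemma flow_bounds:
  assumes t: "t \<in> {0..T}"
  shows "0 \<le> R \<Longrightarrow> integral {-R..R} (\<lambda>x. (cmod (u1 x t))\<^sup>2) \<le> k\<^sup>2 * \<epsilon>\<^sup>2"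
    and "0 \<le> R \<Longrightarrow> integral {-R..R} (\<lambda>x. (n0 x t)\<^sup>2) \<le> k\<^sup>2 * \<epsilon>\<^sup>2"
    and "f0 x t \<le> k\<^sup>2 * \<epsilon>\<^sup>2"
proof -
  define M where "M = 16 * \<alpha>\<^sup>2 * s\<^sup>2"
  define E where "E = (\<alpha>\<^sup>2 * (N\<^sup>2 + 1) + \<beta>\<^sup>2 + \<alpha> ^ 4) * (8 * s\<^sup>2)"
  have kk: "k\<^sup>2 = 4 * (M + (E + 2 * M ^ 3))" unfolding k(2) flow_const_def M_def E_def by simp
  have E0: "0 \<le> E" by (simp add: E_def)
  have M0: "0 < M" using \<alpha> s by (simp add: M_def)
  have m: "integral {-R..R} (\<lambda>x. f0 x t) \<le> M * \<epsilon>\<^sup>2" if "0 \<le> R" "t \<in> {0..T}" for R t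
    using square_boundD(3)[OF mass_bound[OF that(2)] that(1)] by (simp add: f0_def M_def power_mult_distrib mult_ac)
  have ei: "integral {-R..R} (\<lambda>x. e x 0) \<le> \<epsilon>\<^sup>2 * E" for R
    using integral_bump_le[OF e_init, of R] nice_cont_x[OF nice_e zero_time] by (simp add: E_def mult.assoc)
  have P: "\<epsilon>\<^sup>2 * E + 2 * (M * \<epsilon>\<^sup>2) ^ 3 \<le> (E + 2 * M ^ 3) * \<epsilon>\<^sup>2"
  proof -
    have "(\<epsilon>\<^sup>2) ^ 3 \<le> \<epsilon>\<^sup>2" using power_decreasing[of 2 6 \<epsilon>] \<epsilon> by (simp flip: power_mult)
    then have "M ^ 3 * (\<epsilon>\<^sup>2) ^ 3 \<le> M ^ 3 * \<epsilon>\<^sup>2" using M0 by (intro mult_left_mono) auto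
    then show ?thesis unfolding power_mult_distrib by (simp add: algebra_simps)
  qed
  have Me: "0 < M * \<epsilon>\<^sup>2" using M0 \<epsilon> by simp
  have q: "0 \<le> (E + 2 * M ^ 3) * \<epsilon>\<^sup>2" using E0 M0 by simp
  have kk': "k\<^sup>2 * \<epsilon>\<^sup>2 = 4 * (M * \<epsilon>\<^sup>2) + 4 * ((E + 2 * M ^ 3) * \<epsilon>\<^sup>2)" unfolding kk by (simp add: algebra_simps)
  show "integral {-R..R} (\<lambda>x. (cmod (u1 x t))\<^sup>2) \<le> k\<^sup>2 * \<epsilon>\<^sup>2" if "0 \<le> R"
    using energy(1)[OF Me _ ei t, of R, OF m] P Me q unfolding kk' by fastforce
  show "integral {-R..R} (\<lambda>x. (n0 x t)\<^sup>2) \<le> k\<^sup>2 * \<epsilon>\<^sup>2" if "0 \<le> R"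
    using energy(2)[OF Me _ ei t, of R, OF m] P Me q unfolding kk' by fastforce
  show "f0 x t \<le> k\<^sup>2 * \<epsilon>\<^sup>2" using energy(3)[OF Me _ ei t, of x, OF m] P Me q unfolding kk' by fastforce
qed

lemma u_bound: "t \<in> {0..T} \<Longrightarrow> cmod (u0 x t) \<le> k * \<epsilon>"
  using flow_bounds(3)[of t x] k(1) \<epsilon>(1) unfolding f0_def power_mult_distrib[symmetric]
  by (auto intro: power2_le_imp_le)

lemma n_square_bound: "t \<in> {0..T} \<Longrightarrow> square_bound (\<lambda>x. complex_of_real (n0 x t)) (k * \<epsilon>)"
  using flow_bounds(2)[of t] k(1) \<epsilon>(1)
  by (intro square_boundI) (auto simp: power_mult_distrib intro!: continuous_intros nice_cont_x[OF nice_n(1)])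

text \<open>D'Alembert's solution with zero initial velocity. The factors 1 and - 1 match the form
  of the shift lemmas.\<close>

definition l0 where "l0 x t = B / 2 * (Re (packet (s\<^sup>2) (2 * N + 1) (x + 1 * t)) + Re (packet (s\<^sup>2) (2 * N + 1) (x + - 1 * t)))"

lemma l0_bound: "\<bar>l0 x t\<bar> \<le> B"
proof -
  have b: "\<bar>Re (packet (s\<^sup>2) (2 * N + 1) y)\<bar> \<le> 1" for y
    using abs_Re_le_cmod[of "packet (s\<^sup>2) (2 * N + 1) y"] bump_le_1[of "s\<^sup>2" y] unfolding cmod_packet by linarith
  have "\<bar>l0 x t\<bar> \<le> B / 2 * (1 + 1)"
    unfolding l0_def abs_mult using B(1) b[of "x + 1 * t"] b[of "x + - 1 * t"]
    by (intro mult_mono order_trans[OF abs_triangle_ineq]) auto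
  then show ?thesis by simp
qed

text \<open>The product formula for cosines merges the two translated carriers into a standing wave;
  only the envelopes have to be moved back, and each costs at most T / s^2 by the Lipschitz
  bound.\<close>

lemma l0_approx:
  assumes t: "t \<in> {0..T}"
  shows "\<bar>l0 x t - B * (cos ((2 * N + 1) * x) * cos ((2 * N + 1) * t) * bump (s\<^sup>2) x)\<bar> \<le> B * (T / s\<^sup>2)"
proof -
  define c where "c y = cos ((2 * N + 1) * y)" for y
  define b where "b = bump (s\<^sup>2)"
  have "cos ((2 * N + 1) * x) * cos ((2 * N + 1) * t) = (c (x + - 1 * t) + c (x + 1 * t)) / 2"
    unfolding cos_times_cos c_def by (simp add: algebra_simps)
  then have "l0 x t - B * (cos ((2 * N + 1) * x) * cos ((2 * N + 1) * t) * b x)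
    = B / 2 * (c (x + 1 * t) * (b (x + 1 * t) - b x) + c (x + - 1 * t) * (b (x + - 1 * t) - b x))"
    unfolding l0_def Re_packet c_def[symmetric] b_def[symmetric] by (simp add: algebra_simps add_divide_distrib)
  moreover have "\<bar>c (x + d * t) * (b (x + d * t) - b x)\<bar> \<le> T / s\<^sup>2" if "\<bar>d\<bar> = 1" for d
  proof -
    have "\<bar>c (x + d * t) * (b (x + d * t) - b x)\<bar> \<le> 1 * (\<bar>x + d * t - x\<bar> / s\<^sup>2)"
      unfolding abs_mult b_def by (intro mult_mono bump_Lipschitz s2) (auto simp: c_def)
    also have "\<dots> \<le> T / s\<^sup>2" using t that by (simp add: abs_mult divide_right_mono)
    finally show ?thesis .
  qed
  from this[of 1] this[of "-1"] have "\<bar>c (x + 1 * t) * (b (x + 1 * t) - b x) + c (x + - 1 * t) * (b (x + - 1 * t) - b x)\<bar> \<le> T / s\<^sup>2 + T / s\<^sup>2"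
    by (intro order_trans[OF abs_triangle_ineq] add_mono) auto
  from mult_left_mono[OF this, of "B / 2"] B(1)
  have "\<bar>B / 2 * (c (x + 1 * t) * (b (x + 1 * t) - b x) + c (x + - 1 * t) * (b (x + - 1 * t) - b x))\<bar> \<le> B / 2 * (T / s\<^sup>2 + T / s\<^sup>2)"
    unfolding abs_mult[of "B / 2"] by simp
  ultimately have "\<bar>l0 x t - B * (cos ((2 * N + 1) * x) * cos ((2 * N + 1) * t) * b x)\<bar> \<le> B / 2 * (T / s\<^sup>2 + T / s\<^sup>2)"
    by (simp only:)
  then show ?thesis by (simp add: b_def)
qed

lemma nice_Re_packet: "nice T (\<lambda>x t. Re (packet (s\<^sup>2) \<omega> (x + c * t)))" "nice T (\<lambda>x t. Re (packet_x (s\<^sup>2) \<omega> (x + c * t)))"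
  by (rule nice_Re[OF nice_shift[OF packet_schwartz[OF s2]]] nice_Re[OF nice_shift[OF packet_derivs_schwartz(1)[OF s2]]])+

lemma nice_l0: "nice T l0"
  unfolding l0_def[abs_def] by (rule nice_cmult[OF nice_add[OF nice_Re_packet(1) nice_Re_packet(1)]])

text \<open>The wave generated by |u|^2 is of second order in \<epsilon>. In the first-order system
  the companion of \<open>l0\<close> is the half difference of the same two translates.\<close>

lemma wave_bound:
  assumes t: "t \<in> {0..T}"
  shows "square_bound (\<lambda>x. complex_of_real (n0 x t - l0 x t)) (4 * T * k\<^sup>2 * \<epsilon>\<^sup>2)"
proof (rule square_boundI)
  show "0 \<le> 4 * T * k\<^sup>2 * \<epsilon>\<^sup>2" using T by simp
  show "continuous_on UNIV (\<lambda>x. complex_of_real (n0 x t - l0 x t))"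
    by (rule nice_cont_x[OF nice_of_real[OF nice_diff[OF nice_n(1) nice_l0]] t])
  fix R :: real assume R: "0 \<le> R"
  let ?p = "\<lambda>c x t. Re (packet (s\<^sup>2) (2 * N + 1) (x + c * t))" and ?q = "\<lambda>c x t. Re (packet_x (s\<^sup>2) (2 * N + 1) (x + c * t))"
  have "integral {-R..R} (\<lambda>x. (n0 x t - l0 x t)\<^sup>2) \<le> 4 * T\<^sup>2 * (4 * (k\<^sup>2 * \<epsilon>\<^sup>2) * (k\<^sup>2 * \<epsilon>\<^sup>2))"
  proof (rule wave_remainder[where ?l1.0 = "\<lambda>x t. B / 2 * (?q 1 x t + ?q (-1) x t)" and ?m0.0 = "\<lambda>x t. B / 2 * (?p (-1) x t - ?p 1 x t)"
        and ?m1.0 = "\<lambda>x t. B / 2 * (?q (-1) x t - ?q 1 x t)", OF _ _ _ _ nice_l0 _ _ _ _ _ _ t R])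
    fix x t
    show "((\<lambda>y. l0 y t) has_vector_derivative B / 2 * (?q 1 x t + ?q (-1) x t)) (at x)"
      unfolding l0_def by (rule has_vector_derivative_mult_right[OF has_vector_derivative_add[OF shift_vector_derivative(1) shift_vector_derivative(1)]])
    show "((\<lambda>y. B / 2 * (?p (-1) y t - ?p 1 y t)) has_vector_derivative B / 2 * (?q (-1) x t - ?q 1 x t)) (at x)"
      by (rule has_vector_derivative_mult_right[OF has_vector_derivative_diff[OF shift_vector_derivative(1) shift_vector_derivative(1)]])
    have "((\<lambda>r. l0 x r) has_vector_derivative B / 2 * (1 * ?q 1 x t + - 1 * ?q (-1) x t)) (at t within {0..T})"
      unfolding l0_def by (rule has_vector_derivative_mult_right[OF has_vector_derivative_add[OF shift_vector_derivative(2) shift_vector_derivative(2)]])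
    moreover have "B / 2 * (1 * ?q 1 x t + - 1 * ?q (-1) x t) = - (B / 2 * (?q (-1) x t - ?q 1 x t))" by (simp add: algebra_simps)
    ultimately show "((\<lambda>r. l0 x r) has_vector_derivative - (B / 2 * (?q (-1) x t - ?q 1 x t))) (at t within {0..T})" by (simp only:)
    have "((\<lambda>r. B / 2 * (?p (-1) x r - ?p 1 x r)) has_vector_derivative B / 2 * (- 1 * ?q (-1) x t - 1 * ?q 1 x t)) (at t within {0..T})"
      by (rule has_vector_derivative_mult_right[OF has_vector_derivative_diff[OF shift_vector_derivative(2) shift_vector_derivative(2)]])
    moreover have "B / 2 * (- 1 * ?q (-1) x t - 1 * ?q 1 x t) = - (B / 2 * (?q 1 x t + ?q (-1) x t))" by (simp add: algebra_simps)
    ultimately show "((\<lambda>r. B / 2 * (?p (-1) x r - ?p 1 x r)) has_vector_derivative - (B / 2 * (?q 1 x t + ?q (-1) x t))) (at t within {0..T})"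
      by (simp only:)
    show "l0 x 0 = n0 x 0" by (simp add: l0_def n_init)
    show "B / 2 * (?p (-1) x 0 - ?p 1 x 0) = 0" by simp
  next
    show "nice T (\<lambda>x t. B / 2 * (?q 1 x t + ?q (-1) x t))" by (rule nice_cmult[OF nice_add[OF nice_Re_packet(2) nice_Re_packet(2)]])
    show "nice T (\<lambda>x t. B / 2 * (?p (-1) x t - ?p 1 x t))" by (rule nice_cmult[OF nice_diff[OF nice_Re_packet(1) nice_Re_packet(1)]])
    show "nice T (\<lambda>x t. B / 2 * (?q (-1) x t - ?q 1 x t))" by (rule nice_cmult[OF nice_diff[OF nice_Re_packet(2) nice_Re_packet(2)]])
    show "integral {-R..R} (\<lambda>x. (f1 x t)\<^sup>2) \<le> 4 * (k\<^sup>2 * \<epsilon>\<^sup>2) * (k\<^sup>2 * \<epsilon>\<^sup>2)" if "0 \<le> R" "t \<in> {0..T}" for R t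
      by (rule f1_square_bound[OF flow_bounds(3)[OF that(2)] flow_bounds(1)[OF that(2,1)] that(2)])
  qed
  then show "integral {-R..R} (\<lambda>x. (cmod (complex_of_real (n0 x t - l0 x t)))\<^sup>2) \<le> (4 * T * k\<^sup>2 * \<epsilon>\<^sup>2)\<^sup>2"
    unfolding norm_of_real power2_abs by (simp add: power_mult_distrib power2_eq_square mult_ac)
qed

text \<open>A frozen packet with the phase of the plane wave of frequency - N: the free evolution up
  to the residual \<open>packet_error\<close>.\<close>

definition ua where "ua x t = exp (\<i> * complex_of_real (- N\<^sup>2 * t)) * packet (s\<^sup>2) (- N) x"

lemma nice_ua: "nice T ua"
  unfolding ua_def[abs_def] by (rule nice_phase[OF packet_schwartz[OF s2]])

lemma cmod_ua: "cmod (ua x t) = cmod (packet (s\<^sup>2) (- N) x)"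
  by (simp add: ua_def norm_mult)

lemma ua_bound: "t \<in> {0..T} \<Longrightarrow> square_bound (\<lambda>x. ua x t) (3 * s)"
  using square_bound_dominated[OF packet_square_bound(1)[OF s, of "- N"] nice_cont_x[OF nice_ua, of t], of 1]
  by (simp add: cmod_ua)

lemma nu_bound:
  assumes t: "t \<in> {0..T}"
  shows "square_bound (\<lambda>x. complex_of_real (n0 x t) * u0 x t) (k * \<epsilon> * (k * \<epsilon>))"
proof (rule square_bound_dominated[OF n_square_bound[OF t]])
  show "continuous_on UNIV (\<lambda>x. complex_of_real (n0 x t) * u0 x t)"
    by (rule nice_cont_x[OF nice_mult[OF nice_of_real[OF nice_n(1)] nice_u(1)] t])
  show "0 \<le> k * \<epsilon>" using k \<epsilon> by simp
  show "cmod (complex_of_real (n0 x t) * u0 x t) \<le> k * \<epsilon> * cmod (complex_of_real (n0 x t))" for x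
    using mult_right_mono[OF u_bound[OF t, of x] norm_ge_zero[of "complex_of_real (n0 x t)"]] by (simp only: norm_mult mult.commute)
qed

lemma remainder_bound:
  assumes t: "t \<in> {0..T}"
  shows "square_bound (\<lambda>x. u0 x t - complex_of_real (\<alpha> * \<epsilon>) * ua x t)
    (2 * T * (2 * (k * \<epsilon> * (k * \<epsilon>)) + 2 * (\<alpha> * \<epsilon> * (16 * (2 * N + 1) / s))))"
proof (rule square_boundI)
  define A where "A = complex_of_real (\<alpha> * \<epsilon>)"
  let ?g = "2 * (k * \<epsilon> * (k * \<epsilon>)) + 2 * (\<alpha> * \<epsilon> * (16 * (2 * N + 1) / s))"
  have A: "cmod A = \<alpha> * \<epsilon>" using \<alpha> \<epsilon> unfolding A_def norm_of_real by simp
  define E where "E t = exp (\<i> * complex_of_real (- N\<^sup>2 * t))" for t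
  define G where "G x t = complex_of_real (n0 x t) * u0 x t - A * (E t * packet_error (s\<^sup>2) (- N) x)" for x t
  have E1: "cmod (E t) = 1" for t by (simp add: E_def)
  have nE: "nice T (\<lambda>x t. E t * packet_x (s\<^sup>2) (- N) x)" "nice T (\<lambda>x t. E t * packet_xx (s\<^sup>2) (- N) x)"
    "nice T (\<lambda>x t. E t * packet_error (s\<^sup>2) (- N) x)"
    unfolding E_def by (rule nice_phase packet_derivs_schwartz s2)+
  have nG: "nice T G" unfolding G_def[abs_def] by (rule nice_diff[OF nice_mult[OF nice_of_real[OF nice_n(1)] nice_u(1)] nice_cmult[OF nE(3)]])
  have nr: "nice T (\<lambda>x t. u0 x t - A * ua x t)" by (rule nice_diff[OF nice_u(1) nice_cmult[OF nice_ua]])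
  have g: "square_bound (\<lambda>x. G x t) ?g" if t: "t \<in> {0..T}" for t
    unfolding G_def
  proof (rule square_bound_diff[OF nu_bound[OF t]])
    have "square_bound (\<lambda>x. E t * packet_error (s\<^sup>2) (- N) x) (16 * (2 * N + 1) / s)"
      using square_bound_cmult[OF packet_square_bound(2)[OF s, of "- N"], of "E t"] N E1[of t] by simp
    from square_bound_cmult[OF this, of A] show "square_bound (\<lambda>x. A * (E t * packet_error (s\<^sup>2) (- N) x)) (\<alpha> * \<epsilon> * (16 * (2 * N + 1) / s))"
      unfolding A .
  qed
  fix R :: real assume R: "0 \<le> R"
  have "integral {-R..R} (\<lambda>x. (cmod (u0 x t - A * ua x t))\<^sup>2) \<le> 2 * 0 + 4 * T\<^sup>2 * ?g\<^sup>2"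
  proof (rule schroedinger_estimate[where G = G, OF T _ _ _ nr _ _ nG nice_cmod_power2[OF nG] cmod_young[OF T] square_boundD(3)[OF g] _ t R])
    fix x t assume t: "t \<in> {0..T}"
    show "((\<lambda>y. u0 y t - A * ua y t) has_vector_derivative u1 x t - A * (E t * packet_x (s\<^sup>2) (- N) x)) (at x)"
      unfolding ua_def E_def by (rule has_vector_derivative_diff[OF u0_x[OF t] has_vector_derivative_mult_right[OF has_vector_derivative_mult_right[OF packet_deriv]]])
    show "((\<lambda>y. u1 y t - A * (E t * packet_x (s\<^sup>2) (- N) y)) has_vector_derivative u2 x t - A * (E t * packet_xx (s\<^sup>2) (- N) x)) (at x)"
      by (rule has_vector_derivative_diff[OF u1_x[OF t] has_vector_derivative_mult_right[OF has_vector_derivative_mult_right[OF packet_x_deriv]]])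
    have e: "(E has_vector_derivative \<i> * complex_of_real (- N\<^sup>2) * E t) (at t within {0..T})"
      unfolding E_def by (rule phase_vector_derivative)
    have "((\<lambda>r. u0 x r - A * ua x r) has_vector_derivative (\<i> * u2 x t - \<i> * (complex_of_real (n0 x t) * u0 x t))
        - A * (\<i> * complex_of_real (- N\<^sup>2) * E t * packet (s\<^sup>2) (- N) x)) (at t within {0..T})"
      unfolding ua_def E_def[symmetric]
      by (rule has_vector_derivative_diff[OF u0_t[OF t] has_vector_derivative_mult_right[OF has_vector_derivative_mult_left[OF e]]])
    moreover have "(\<i> * u2 x t - \<i> * (complex_of_real (n0 x t) * u0 x t)) - A * (\<i> * complex_of_real (- N\<^sup>2) * E t * packet (s\<^sup>2) (- N) x)
      = \<i> * (u2 x t - A * (E t * packet_xx (s\<^sup>2) (- N) x)) - \<i> * G x t"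
      unfolding G_def packet_xx_def by (simp add: algebra_simps)
    ultimately show "((\<lambda>r. u0 x r - A * ua x r) has_vector_derivative \<i> * (u2 x t - A * (E t * packet_xx (s\<^sup>2) (- N) x)) - \<i> * G x t) (at t within {0..T})"
      by (simp only:)
  next
    show "nice T (\<lambda>x t. u1 x t - A * (E t * packet_x (s\<^sup>2) (- N) x))" "nice T (\<lambda>x t. u2 x t - A * (E t * packet_xx (s\<^sup>2) (- N) x))"
      by (rule nice_diff nice_u nice_cmult nE)+
    show "integral {-R..R} (\<lambda>x. (cmod (u0 x 0 - A * ua x 0))\<^sup>2) \<le> 0" for R
      by (simp add: u_init ua_def A_def)
  qed
  then show "integral {-R..R} (\<lambda>x. (cmod (u0 x t - complex_of_real (\<alpha> * \<epsilon>) * ua x t))\<^sup>2) \<le> (2 * T * ?g)\<^sup>2"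
    unfolding A_def[symmetric] power_mult_distrib[of "2 * T"] power_mult_distrib[of 2 T] by simp
next
  show "continuous_on UNIV (\<lambda>x. u0 x t - complex_of_real (\<alpha> * \<epsilon>) * ua x t)"
    by (rule nice_cont_x[OF nice_diff[OF nice_u(1) nice_cmult[OF nice_ua]] t])
qed (use T k \<alpha> \<epsilon> N s in simp)

end

section \<open>Resonant interaction\<close>

text \<open>Q starts from the same Schroedinger datum as P but without the wave packet, so the
  difference u - w isolates their interaction. \<open>TN\<close> makes the carrier oscillate enough
  during \<open>[0, T]\<close> for its time average to be visible.\<close>

locale packet_pair = P: packet_flow T u0 u1 u2 u3 n0 n1 n2 nt s N \<alpha> \<beta> \<epsilon> "\<beta> * \<epsilon>" k
  + Q: packet_flow T w0 w1 w2 w3 m0 m1 m2 mt s N \<alpha> \<beta> \<epsilon> 0 k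
  for T u0 u1 u2 u3 n0 n1 n2 nt w0 w1 w2 w3 m0 m1 m2 mt s N \<alpha> \<beta> \<epsilon> k +
  assumes TN: "2 \<le> T * (2 * N + 1)"
begin

definition phase where "phase t = exp (\<i> * complex_of_real ((N + 1)\<^sup>2 * t))"
definition d0 where "d0 x t = u0 x t - w0 x t"
definition d1 where "d1 x t = u1 x t - w1 x t"
definition d2 where "d2 x t = u2 x t - w2 x t"
definition \<psi>0 where "\<psi>0 x t = phase t * packet (s\<^sup>2) (- (N + 1)) x"
definition \<psi>1 where "\<psi>1 x t = phase t * packet_x (s\<^sup>2) (- (N + 1)) x"
definition \<eta> where "\<eta> x t = phase t * packet_error (s\<^sup>2) (- (N + 1)) x"
definition \<psi>2 where "\<psi>2 x t = \<eta> x t - complex_of_real ((N + 1)\<^sup>2) * \<psi>0 x t"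
definition G where "G x t = complex_of_real (n0 x t) * u0 x t - complex_of_real (m0 x t) * w0 x t"
text \<open>The part of G that is cubic in \<epsilon>: in the first product the free wave is
  removed, in the second there is none to remove.\<close>

definition X3 where "X3 x t = complex_of_real (n0 x t - P.l0 x t) * u0 x t - complex_of_real (m0 x t) * w0 x t"
definition J where "J x t = \<i> * (d1 x t * \<psi>0 x t - d0 x t * \<psi>1 x t)"
text \<open>The source of the density d0 \<psi>0: the forcing of d0 tested on \<psi>0, and d0 tested
  on the residual of \<psi>0.\<close>

definition S where "S x t = - \<i> * (G x t * \<psi>0 x t) + \<i> * (d0 x t * \<eta> x t)"

section \<open>The difference of the two solutions and its pairing with the test packet\<close>

lemma cmod_phase: "cmod (phase t) = 1"
  by (simp add: phase_def)

lemma nice_d: "nice T d0" "nice T d1" "nice T d2"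
  unfolding d0_def[abs_def] d1_def[abs_def] d2_def[abs_def] by (rule nice_diff P.nice_u Q.nice_u)+

lemma nice_\<psi>: "nice T \<psi>0" "nice T \<psi>1" "nice T \<eta>"
  unfolding \<psi>0_def[abs_def] \<psi>1_def[abs_def] \<eta>_def[abs_def] phase_def
  by (rule nice_phase packet_schwartz packet_derivs_schwartz P.s2)+

lemma nice_G: "nice T G"
  unfolding G_def[abs_def]
  by (rule nice_diff[OF nice_mult[OF nice_of_real[OF P.nice_n(1)] P.nice_u(1)] nice_mult[OF nice_of_real[OF Q.nice_n(1)] Q.nice_u(1)]])

lemma nice_J: "nice T J"
  unfolding J_def[abs_def] by (rule nice_cmult[OF nice_diff[OF nice_mult[OF nice_d(2) nice_\<psi>(1)] nice_mult[OF nice_d(1) nice_\<psi>(2)]]])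

lemma nice_S: "nice T S"
  unfolding S_def[abs_def] by (rule nice_add[OF nice_cmult[OF nice_mult[OF nice_G nice_\<psi>(1)]] nice_cmult[OF nice_mult[OF nice_d(1) nice_\<psi>(3)]]])

definition c3 where "c3 = 2 * (k * \<epsilon> * (4 * T * k\<^sup>2 * \<epsilon>\<^sup>2)) + 2 * (k * \<epsilon> * (4 * T * k\<^sup>2 * \<epsilon>\<^sup>2))"
definition g0 where "g0 = 2 * (\<beta> * \<epsilon> * (4 * (\<alpha> * \<epsilon>) * s)) + 2 * c3"

text \<open>Each product has a Schroedinger factor, pointwise at most k \<epsilon>, and a wave
  factor of second order in L2.\<close>

lemma X3_bound:
  assumes t: "t \<in> {0..T}"
  shows "square_bound (\<lambda>x. X3 x t) c3"
  unfolding X3_def c3_def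
proof (rule square_bound_diff)
  have ke: "0 \<le> k * \<epsilon>" using P.k P.\<epsilon> by simp
  show "square_bound (\<lambda>x. complex_of_real (n0 x t - P.l0 x t) * u0 x t) (k * \<epsilon> * (4 * T * k\<^sup>2 * \<epsilon>\<^sup>2))"
  proof (rule square_bound_dominated[OF P.wave_bound[OF t] _ ke])
    show "continuous_on UNIV (\<lambda>x. complex_of_real (n0 x t - P.l0 x t) * u0 x t)"
      by (rule nice_cont_x[OF nice_mult[OF nice_of_real[OF nice_diff[OF P.nice_n(1) P.nice_l0]] P.nice_u(1)] t])
    show "cmod (complex_of_real (n0 x t - P.l0 x t) * u0 x t) \<le> k * \<epsilon> * cmod (complex_of_real (n0 x t - P.l0 x t))" for x
      using mult_right_mono[OF P.u_bound[OF t, of x] norm_ge_zero[of "complex_of_real (n0 x t - P.l0 x t)"]]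
      by (simp only: norm_mult mult.commute)
  qed
  \<comment> \<open>For Q the free wave is zero, so the bound on the wave remainder is one on
    \<open>m0\<close> itself.\<close>
  have m: "square_bound (\<lambda>x. complex_of_real (m0 x t)) (4 * T * k\<^sup>2 * \<epsilon>\<^sup>2)"
    using Q.wave_bound[OF t] by (simp add: Q.l0_def)
  show "square_bound (\<lambda>x. complex_of_real (m0 x t) * w0 x t) (k * \<epsilon> * (4 * T * k\<^sup>2 * \<epsilon>\<^sup>2))"
  proof (rule square_bound_dominated[OF m _ ke])
    show "continuous_on UNIV (\<lambda>x. complex_of_real (m0 x t) * w0 x t)"
      by (rule nice_cont_x[OF nice_mult[OF nice_of_real[OF Q.nice_n(1)] Q.nice_u(1)] t])
    show "cmod (complex_of_real (m0 x t) * w0 x t) \<le> k * \<epsilon> * cmod (complex_of_real (m0 x t))" for x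
      using mult_right_mono[OF Q.u_bound[OF t, of x] norm_ge_zero[of "complex_of_real (m0 x t)"]]
      by (simp only: norm_mult mult.commute)
  qed
qed

lemma G_split: "complex_of_real (P.l0 x t) * u0 x t + X3 x t = G x t"
  by (simp add: G_def X3_def algebra_simps)

lemma G_bound:
  assumes t: "t \<in> {0..T}"
  shows "square_bound (\<lambda>x. G x t) g0"
proof -
  have "square_bound (\<lambda>x. complex_of_real (P.l0 x t) * u0 x t) (\<beta> * \<epsilon> * (4 * (\<alpha> * \<epsilon>) * s))"
  proof (rule square_bound_dominated[OF P.mass_bound[OF t] _ P.B(1)])
    show "continuous_on UNIV (\<lambda>x. complex_of_real (P.l0 x t) * u0 x t)"
      by (rule nice_cont_x[OF nice_mult[OF nice_of_real[OF P.nice_l0] P.nice_u(1)] t])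
    show "cmod (complex_of_real (P.l0 x t) * u0 x t) \<le> \<beta> * \<epsilon> * cmod (u0 x t)" for x
      using mult_right_mono[OF P.l0_bound[of x t] norm_ge_zero[of "u0 x t"]] by (simp only: norm_mult norm_of_real)
  qed
  from square_bound_add[OF this X3_bound[OF t]] show ?thesis unfolding G_split g0_def .
qed

lemma d0_init: "d0 x 0 = 0"
  by (simp add: d0_def P.u_init Q.u_init)

lemma d_x: "t \<in> {0..T} \<Longrightarrow> ((\<lambda>y. d0 y t) has_vector_derivative d1 x t) (at x)"
  "t \<in> {0..T} \<Longrightarrow> ((\<lambda>y. d1 y t) has_vector_derivative d2 x t) (at x)"
  unfolding d0_def d1_def d2_def
  by (rule has_vector_derivative_diff[OF P.u0_x Q.u0_x] has_vector_derivative_diff[OF P.u1_x Q.u1_x]; assumption)+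

lemma d_t:
  assumes t: "t \<in> {0..T}"
  shows "((\<lambda>r. d0 x r) has_vector_derivative \<i> * d2 x t - \<i> * G x t) (at t within {0..T})"
proof -
  have "\<i> * d2 x t - \<i> * G x t = (\<i> * u2 x t - \<i> * (complex_of_real (n0 x t) * u0 x t)) - (\<i> * w2 x t - \<i> * (complex_of_real (m0 x t) * w0 x t))"
    by (simp add: d2_def G_def algebra_simps)
  with has_vector_derivative_diff[OF P.u0_t[OF t, of x] Q.u0_t[OF t, of x]] show ?thesis unfolding d0_def by (simp only:)
qed

lemma d_bound:
  assumes t: "t \<in> {0..T}"
  shows "square_bound (\<lambda>x. d0 x t) (2 * T * g0)"
proof (rule square_boundI)
  show "continuous_on UNIV (\<lambda>x. d0 x t)" by (rule nice_cont_x[OF nice_d(1) t])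
  show "0 \<le> 2 * T * g0" using P.T square_boundD(1)[OF G_bound[OF t]] by simp
  fix R :: real assume R: "0 \<le> R"
  have "integral {-R..R} (\<lambda>x. (cmod (d0 x t))\<^sup>2) \<le> 2 * 0 + 4 * T\<^sup>2 * g0\<^sup>2"
    by (rule schroedinger_estimate[where G = G, OF P.T d_x d_t nice_d nice_G nice_cmod_power2[OF nice_G] cmod_young[OF P.T]
          square_boundD(3)[OF G_bound] _ t R]) (simp_all add: d0_init)
  then show "integral {-R..R} (\<lambda>x. (cmod (d0 x t))\<^sup>2) \<le> (2 * T * g0)\<^sup>2" by (simp add: power_mult_distrib)
qed

lemma \<psi>_bound: "t \<in> {0..T} \<Longrightarrow> square_bound (\<lambda>x. \<psi>0 x t) (3 * s)"
  unfolding \<psi>0_def using square_bound_cmult[OF packet_square_bound(1)[OF P.s], of "phase t"] by (simp add: cmod_phase)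

lemma \<eta>_bound: "t \<in> {0..T} \<Longrightarrow> square_bound (\<lambda>x. \<eta> x t) (16 * (2 * N + 3) / s)"
  unfolding \<eta>_def using square_bound_cmult[OF packet_square_bound(2)[OF P.s, of "- (N + 1)"], of "phase t"] P.N
  by (simp add: cmod_phase algebra_simps)

lemma \<psi>_x: "((\<lambda>y. \<psi>0 y t) has_vector_derivative \<psi>1 x t) (at x)" "((\<lambda>y. \<psi>1 y t) has_vector_derivative \<psi>2 x t) (at x)"
proof -
  show "((\<lambda>y. \<psi>0 y t) has_vector_derivative \<psi>1 x t) (at x)"
    unfolding \<psi>0_def \<psi>1_def by (rule has_vector_derivative_mult_right[OF packet_deriv])
  have "\<psi>2 x t = phase t * packet_xx (s\<^sup>2) (- (N + 1)) x"
    unfolding \<psi>2_def \<eta>_def \<psi>0_def packet_xx_def power2_minus by (simp add: right_diff_distrib mult_ac)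
  then show "((\<lambda>y. \<psi>1 y t) has_vector_derivative \<psi>2 x t) (at x)"
    unfolding \<psi>1_def by (simp only: has_vector_derivative_mult_right[OF packet_x_deriv])
qed

lemma \<psi>_t: "((\<lambda>r. \<psi>0 x r) has_vector_derivative \<i> * complex_of_real ((N + 1)\<^sup>2) * \<psi>0 x t) (at t within {0..T})"
  using has_vector_derivative_mult_left[OF phase_vector_derivative[of "(N + 1)\<^sup>2" t "{0..T}"], of "packet (s\<^sup>2) (- (N + 1)) x"]
  unfolding \<psi>0_def phase_def by (simp only: mult.assoc)

text \<open>The balance law for d0 \<psi>0. The second derivatives of the two factors combine to the
  x-derivative of J, and d0 vanishes initially, so only flux and source remain.\<close>

lemma pairing_identity:
  assumes R: "0 \<le> R"
  shows "integral {-R..R} (\<lambda>x. d0 x T * \<psi>0 x T) = integral {0..T} (\<lambda>r. J R r - J (-R) r)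
    + integral {0..T} (\<lambda>r. integral {-R..R} (\<lambda>x. S x r))"
proof -
  let ?c = "\<i> * complex_of_real ((N + 1)\<^sup>2)"
  let ?q = "\<lambda>x t. d0 x t * (?c * \<psi>0 x t) + (\<i> * d2 x t - \<i> * G x t) * \<psi>0 x t"
  have TT: "T \<in> {0..T}" using P.T by simp
  have "integral {-R..R} (\<lambda>x. d0 x T * \<psi>0 x T) = integral {-R..R} (\<lambda>x. d0 x 0 * \<psi>0 x 0) + integral {0..T} (\<lambda>r. J R r - J (-R) r)
    + integral {0..T} (\<lambda>r. integral {-R..R} (\<lambda>x. S x r))"
  proof (rule balance[where q = ?q, OF _ _ _ _ nice_J nice_S TT R])
    fix x t assume t: "t \<in> {0..T}"
    show "((\<lambda>r. d0 x r * \<psi>0 x r) has_vector_derivative ?q x t) (at t within {0..T})"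
      by (rule has_vector_derivative_mult[OF d_t[OF t] \<psi>_t])
    have "((\<lambda>y. J y t) has_vector_derivative \<i> * ((d1 x t * \<psi>1 x t + d2 x t * \<psi>0 x t) - (d0 x t * \<psi>2 x t + d1 x t * \<psi>1 x t))) (at x)"
      unfolding J_def by (rule has_vector_derivative_mult_right[OF has_vector_derivative_diff[OF
            has_vector_derivative_mult[OF d_x(2)[OF t] \<psi>_x(1)] has_vector_derivative_mult[OF d_x(1)[OF t] \<psi>_x(2)]]])
    moreover have "\<i> * ((d1 x t * \<psi>1 x t + d2 x t * \<psi>0 x t) - (d0 x t * \<psi>2 x t + d1 x t * \<psi>1 x t)) = ?q x t - S x t"
      unfolding S_def \<psi>2_def by (simp add: algebra_simps)
    ultimately show "((\<lambda>y. J y t) has_vector_derivative ?q x t - S x t) (at x)" by (simp only:)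
  next
    show "nice T (\<lambda>x t. d0 x t * \<psi>0 x t)" by (rule nice_mult[OF nice_d(1) nice_\<psi>(1)])
    show "nice T ?q"
      by (rule nice_add[OF nice_mult[OF nice_d(1) nice_cmult[OF nice_\<psi>(1)]] nice_mult[OF nice_diff[OF nice_cmult[OF nice_d(3)] nice_cmult[OF nice_G]] nice_\<psi>(1)]])
  qed
  then show ?thesis by (simp add: d0_init)
qed

text \<open>p and q are the time and the space factor of the resonant product. The real part of p is
  a squared cosine, that of q a squared cosine times the cubed envelope, so neither averages
  out.\<close>

definition p where "p t = complex_of_real (cos ((2 * N + 1) * t)) * cis ((2 * N + 1) * t)"
definition q where "q x = complex_of_real (cos ((2 * N + 1) * x) * bump (s\<^sup>2) x ^ 3) * cis (- ((2 * N + 1) * x))"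

text \<open>Since \<open>(N + 1)\<^sup>2 - N\<^sup>2 = 2 N + 1\<close>, time and space carry the same frequency, that of the wave.\<close>

lemma resonance:
  "P.ua x t * \<psi>0 x t = cis ((2 * N + 1) * t) * cis (- ((2 * N + 1) * x)) * complex_of_real ((bump (s\<^sup>2) x)\<^sup>2)"
proof -
  have "cis (- N\<^sup>2 * t) * cis (- N * x) * (cis ((N + 1)\<^sup>2 * t) * cis (- (N + 1) * x)) = cis ((2 * N + 1) * t) * cis (- ((2 * N + 1) * x))"
    unfolding cis_mult by (rule arg_cong[where f = cis]) (simp add: power2_eq_square algebra_simps)
  moreover have "a * (b * e) * (c * (d * e)) = a * b * (c * d) * (e * e)" for a b c d e :: complex by (simp only: mult_ac)
  ultimately show ?thesis
    unfolding P.ua_def \<psi>0_def phase_def packet_bump cis_conv_exp[symmetric] of_real_power power2_eq_square[of "complex_of_real (bump (s\<^sup>2) x)"]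
    by (simp only:)
qed

definition AB where "AB = \<alpha> * \<epsilon> * (\<beta> * \<epsilon>)"

definition x2 where "x2 = \<beta> * \<epsilon> * (2 * T * (2 * (k * \<epsilon> * (k * \<epsilon>)) + 2 * (\<alpha> * \<epsilon> * (16 * (2 * N + 1) / s))))"

text \<open>The error of the source at one time: the three parts of the forcing error paired with
  \<psi>0, of size 3 s, and d0 paired with the residual of \<psi>0. The nested factors 2 come from
  \<open>square_bound_add\<close>.\<close>

definition e1 where "e1 = (2 * (2 * (\<alpha> * \<epsilon> * (\<beta> * \<epsilon> * (T / s\<^sup>2)) * (3 * s)) + 2 * x2) + 2 * c3) * (3 * s) + 2 * T * g0 * (16 * (2 * N + 3) / s)"

text \<open>Three replacements in the forcing: the free wave by a standing wave (\<open>X1\<close>),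
  u by its frozen packet (\<open>X2\<close>), and omission of the cubic part (\<open>X3\<close>).
  What is left factors into amplitudes, p and q.\<close>

lemma source_bound:
  assumes t: "t \<in> {0..T}" and R: "0 \<le> R"
  shows "cmod (integral {-R..R} (\<lambda>x. S x t) - (- \<i> * complex_of_real AB * p t) * integral {-R..R} q) \<le> e1"
proof -
  define A where "A = complex_of_real (\<alpha> * \<epsilon>)"
  define \<Phi> where "\<Phi> x = \<beta> * \<epsilon> * (cos ((2 * N + 1) * x) * cos ((2 * N + 1) * t) * bump (s\<^sup>2) x)" for x
  define X1 where "X1 x = A * (complex_of_real (P.l0 x t - \<Phi> x) * P.ua x t)" for x
  define X2 where "X2 x = complex_of_real (P.l0 x t) * (u0 x t - A * P.ua x t)" for x
  define X where "X x = (X1 x + X2 x) + X3 x t" for x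
  have Anorm: "cmod A = \<alpha> * \<epsilon>" using P.\<alpha> P.\<epsilon> unfolding A_def norm_of_real by simp
  have cl: "continuous_on UNIV (\<lambda>x. complex_of_real (P.l0 x t))" by (rule nice_cont_x[OF nice_of_real[OF P.nice_l0] t])
  have cu: "continuous_on UNIV (\<lambda>x. P.ua x t)" by (rule nice_cont_x[OF P.nice_ua t])
  have c\<Phi>: "continuous_on UNIV (\<lambda>x. complex_of_real (\<Phi> x))"
    unfolding \<Phi>_def by (intro continuous_intros continuous_bump)
  have "square_bound (\<lambda>x. complex_of_real (P.l0 x t - \<Phi> x) * P.ua x t) (\<beta> * \<epsilon> * (T / s\<^sup>2) * (3 * s))"
  proof (rule square_bound_dominated[OF P.ua_bound[OF t]])
    show "continuous_on UNIV (\<lambda>x. complex_of_real (P.l0 x t - \<Phi> x) * P.ua x t)"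
      unfolding of_real_diff by (intro continuous_on_mult continuous_on_diff cl cu c\<Phi>)
    show "0 \<le> \<beta> * \<epsilon> * (T / s\<^sup>2)" using P.B(1) P.T by simp
    show "cmod (complex_of_real (P.l0 x t - \<Phi> x) * P.ua x t) \<le> \<beta> * \<epsilon> * (T / s\<^sup>2) * cmod (P.ua x t)" for x
      unfolding norm_mult norm_of_real \<Phi>_def by (rule mult_right_mono[OF P.l0_approx[OF t] norm_ge_zero])
  qed
  from square_bound_cmult[OF this, of A]
  have b1: "square_bound X1 (\<alpha> * \<epsilon> * (\<beta> * \<epsilon> * (T / s\<^sup>2)) * (3 * s))" unfolding X1_def[abs_def] Anorm by (simp only: mult.assoc)
  have b2: "square_bound X2 x2"
    unfolding X2_def[abs_def] x2_def
  proof (rule square_bound_dominated[OF P.remainder_bound[OF t, folded A_def] _ P.B(1)])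
    show "continuous_on UNIV (\<lambda>x. complex_of_real (P.l0 x t) * (u0 x t - A * P.ua x t))"
      by (intro continuous_on_mult continuous_on_diff cl cu continuous_on_const nice_cont_x[OF P.nice_u(1) t])
    show "cmod (complex_of_real (P.l0 x t) * (u0 x t - A * P.ua x t)) \<le> \<beta> * \<epsilon> * cmod (u0 x t - A * P.ua x t)" for x
      unfolding norm_mult norm_of_real by (rule mult_right_mono[OF P.l0_bound norm_ge_zero])
  qed
  have bX: "square_bound X (2 * (2 * (\<alpha> * \<epsilon> * (\<beta> * \<epsilon> * (T / s\<^sup>2)) * (3 * s)) + 2 * x2) + 2 * c3)"
    unfolding X_def[abs_def] by (rule square_bound_add[OF square_bound_add[OF b1 b2] X3_bound[OF t]])
  let ?C = "- \<i> * complex_of_real AB * p t"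
  have main: "A * (complex_of_real (\<Phi> x) * P.ua x t) * \<psi>0 x t = complex_of_real AB * p t * q x" for x
  proof -
    have "A * (complex_of_real (\<Phi> x) * P.ua x t) * \<psi>0 x t = A * complex_of_real (\<Phi> x) * (P.ua x t * \<psi>0 x t)" by (simp only: mult.assoc)
    also have "\<dots> = complex_of_real AB * p t * q x"
      unfolding resonance A_def \<Phi>_def AB_def p_def q_def of_real_mult of_real_power power3_eq_cube power2_eq_square[of "complex_of_real (bump (s\<^sup>2) x)"]
      by (simp only: mult_ac)
    finally show ?thesis .
  qed
  have S: "S x t = ?C * q x + (- \<i> * (X x * \<psi>0 x t) + \<i> * (d0 x t * \<eta> x t))" for x
  proof -
    have "G x t = X x + A * (complex_of_real (\<Phi> x) * P.ua x t)"
      unfolding G_split[symmetric] X_def X1_def X2_def of_real_diff by (simp add: algebra_simps)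
    then have "G x t * \<psi>0 x t = X x * \<psi>0 x t + complex_of_real AB * p t * q x"
      by (simp only: distrib_right main)
    then show ?thesis unfolding S_def by (simp add: algebra_simps)
  qed
  have iq: "q integrable_on {-R..R}"
    unfolding q_def[abs_def] cis_conv_exp by (intro integrable_continuous_real continuous_intros continuous_bump)
  have iX: "(\<lambda>x. X x * \<psi>0 x t) integrable_on {-R..R}"
    by (intro integrable_continuous_real continuous_on_mult square_boundD(2)[OF bX] nice_cont_x[OF nice_\<psi>(1) t])
  have id: "(\<lambda>x. d0 x t * \<eta> x t) integrable_on {-R..R}"
    by (intro integrable_continuous_real continuous_on_mult nice_cont_x[OF nice_d(1) t] nice_cont_x[OF nice_\<psi>(3) t])
  have "integral {-R..R} (\<lambda>x. S x t) = ?C * integral {-R..R} q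
    + (- \<i> * integral {-R..R} (\<lambda>x. X x * \<psi>0 x t) + \<i> * integral {-R..R} (\<lambda>x. d0 x t * \<eta> x t))"
    unfolding S by (rule integral_unique[OF has_integral_add[OF has_integral_mult_right[OF integrable_integral[OF iq]]
          has_integral_add[OF has_integral_mult_right[OF integrable_integral[OF iX]] has_integral_mult_right[OF integrable_integral[OF id]]]]])
  then have "cmod (integral {-R..R} (\<lambda>x. S x t) - ?C * integral {-R..R} q)
    = cmod (- \<i> * integral {-R..R} (\<lambda>x. X x * \<psi>0 x t) + \<i> * integral {-R..R} (\<lambda>x. d0 x t * \<eta> x t))" by simp
  also have "\<dots> \<le> cmod (- \<i> * integral {-R..R} (\<lambda>x. X x * \<psi>0 x t)) + cmod (\<i> * integral {-R..R} (\<lambda>x. d0 x t * \<eta> x t))"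
    by (rule norm_triangle_ineq)
  also have "\<dots> = cmod (integral {-R..R} (\<lambda>x. X x * \<psi>0 x t)) + cmod (integral {-R..R} (\<lambda>x. d0 x t * \<eta> x t))"
    by (simp only: norm_mult norm_minus_cancel norm_ii mult_1_left)
  also have "\<dots> \<le> e1"
    unfolding e1_def by (rule add_mono[OF square_bound_pairing[OF bX \<psi>_bound[OF t] R] square_bound_pairing[OF d_bound[OF t] \<eta>_bound[OF t] R]])
  finally show ?thesis .
qed

lemma p_integral: "T / 4 \<le> cmod (integral {0..T} p)"
proof -
  have K: "0 < 2 * N + 1" using P.N by simp
  have ip: "p integrable_on {0..T}"
    unfolding p_def[abs_def] cis_conv_exp by (intro integrable_continuous_real continuous_intros)
  \<comment> \<open>This is \<open>TN\<close>: the oscillating part of the squared cosine takes away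
    at most half of its mean T / 2.\<close>
  have "1 / (2 * (2 * N + 1)) \<le> T / 4" using TN K by (simp add: field_simps)
  then have "T / 4 \<le> (T - 0) / 2 - 1 / (2 * (2 * N + 1))" by simp
  also have "\<dots> \<le> integral {0..T} (\<lambda>t. (cos ((2 * N + 1) * t))\<^sup>2)" by (rule integral_cos_square[OF K]) (use P.T in simp)
  also have "\<dots> = integral {0..T} (\<lambda>t. Re (p t))" by (simp add: p_def power2_eq_square)
  also have "\<dots> = Re (integral {0..T} p)"
    using integral_linear[OF ip bounded_linear_Re] by (simp add: o_def)
  also have "\<dots> \<le> cmod (integral {0..T} p)" by (rule complex_Re_le_cmod)
  finally show ?thesis .
qed

text \<open>The real part is nonnegative, so the integral may be restricted to |x| at most
  \<open>s^2\<close>, where the cubed envelope is at least exp (- 3 / 2). There the squared cosine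
  contributes \<open>s^2\<close> up to an error of at most 1 / 2.\<close>

lemma q_integral:
  assumes R: "s\<^sup>2 \<le> R"
  shows "exp (- 3 / 2) * (s\<^sup>2 / 2) \<le> cmod (integral {-R..R} q)"
proof -
  let ?\<kappa> = "2 * N + 1"
  have K: "0 < ?\<kappa>" "1 \<le> ?\<kappa>" using P.N by simp_all
  have iq: "q integrable_on {-R..R}"
    unfolding q_def[abs_def] cis_conv_exp by (intro integrable_continuous_real continuous_intros continuous_bump)
  have req: "Re (q x) = (cos (?\<kappa> * x))\<^sup>2 * bump (s\<^sup>2) x ^ 3" for x by (simp add: q_def power2_eq_square)
  have irq: "(\<lambda>x. (cos (?\<kappa> * x))\<^sup>2 * bump (s\<^sup>2) x ^ 3) integrable_on {a..b}" for a b
    by (intro integrable_continuous_real continuous_intros continuous_bump)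
  have pos: "0 \<le> (cos (?\<kappa> * x))\<^sup>2 * bump (s\<^sup>2) x ^ 3" for x using bump_pos[of "s\<^sup>2" x] by simp
  have le: "exp (- 3 / 2) * (cos (?\<kappa> * x))\<^sup>2 \<le> (cos (?\<kappa> * x))\<^sup>2 * bump (s\<^sup>2) x ^ 3" if x: "x \<in> {- (s\<^sup>2)..s\<^sup>2}" for x
  proof -
    have "\<bar>x\<bar> \<le> s\<^sup>2" using x by auto
    then have "\<bar>x\<bar>\<^sup>2 \<le> (s\<^sup>2)\<^sup>2" by (rule power_mono) simp
    then have "x\<^sup>2 / (2 * (s\<^sup>2)\<^sup>2) \<le> 1 / 2" using P.s by (simp add: divide_simps)
    then have "exp (- 3 / 2) \<le> exp (3 * (- x\<^sup>2 / (2 * (s\<^sup>2)\<^sup>2)))" by simp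
    also have "\<dots> = bump (s\<^sup>2) x ^ 3" unfolding bump_def exp_of_nat_mult[symmetric] by simp
    finally show ?thesis by (simp only: mult.commute[of "exp (- 3 / 2)"] mult_left_mono zero_le_power2)
  qed
  have "1 / (2 * ?\<kappa>) \<le> 1 / 2" using K by (intro divide_left_mono) auto
  also have "\<dots> \<le> s\<^sup>2 / 2" using P.s2 by simp
  finally have "s\<^sup>2 / 2 \<le> (s\<^sup>2 - - (s\<^sup>2)) / 2 - 1 / (2 * ?\<kappa>)" by simp
  also have "\<dots> \<le> integral {- (s\<^sup>2)..s\<^sup>2} (\<lambda>x. (cos (?\<kappa> * x))\<^sup>2)" by (rule integral_cos_square[OF K(1)]) simp
  finally have "exp (- 3 / 2) * (s\<^sup>2 / 2) \<le> exp (- 3 / 2) * integral {- (s\<^sup>2)..s\<^sup>2} (\<lambda>x. (cos (?\<kappa> * x))\<^sup>2)" by (rule mult_left_mono) simp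
  also have "\<dots> = integral {- (s\<^sup>2)..s\<^sup>2} (\<lambda>x. exp (- 3 / 2) * (cos (?\<kappa> * x))\<^sup>2)" by simp
  also have "\<dots> \<le> integral {- (s\<^sup>2)..s\<^sup>2} (\<lambda>x. (cos (?\<kappa> * x))\<^sup>2 * bump (s\<^sup>2) x ^ 3)"
    by (rule Henstock_Kurzweil_Integration.integral_le[OF _ irq le]) (intro integrable_continuous_real continuous_intros)
  also have "\<dots> \<le> integral {-R..R} (\<lambda>x. (cos (?\<kappa> * x))\<^sup>2 * bump (s\<^sup>2) x ^ 3)"
    by (rule integral_subset_le[OF _ irq irq]) (use R pos in auto)
  also have "\<dots> = Re (integral {-R..R} q)"
    using integral_linear[OF iq bounded_linear_Re] unfolding o_def req .
  also have "\<dots> \<le> cmod (integral {-R..R} q)" by (rule complex_Re_le_cmod)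
  finally show ?thesis .
qed

text \<open>Up to e1 T the time integral of the source is the product of the integrals of p and q,
  both bounded below; the pairing identity converts it into the pairing at time T and a
  flux.\<close>

lemma pairing_lower:
  assumes R: "s\<^sup>2 \<le> R"
  shows "AB * (T / 4 * (exp (- 3 / 2) * (s\<^sup>2 / 2))) - e1 * T
    \<le> cmod (integral {-R..R} (\<lambda>x. d0 x T * \<psi>0 x T)) + cmod (integral {0..T} (\<lambda>r. J R r - J (-R) r))"
proof -
  have R0: "0 \<le> R" using R by (meson order_trans zero_le_power2)
  define I where "I t = integral {-R..R} (\<lambda>x. S x t)" for t
  define Qi where "Qi = integral {-R..R} q"
  let ?C = "\<lambda>t. (- \<i> * complex_of_real AB * p t) * Qi"
  have cI: "continuous_on {0..T} I" unfolding I_def by (rule continuous_on_integral_nice[OF nice_S order_refl])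
  have cp: "continuous_on {0..T} p" unfolding p_def[abs_def] cis_conv_exp by (intro continuous_intros)
  have cE: "continuous_on {0..T} (\<lambda>t. I t - ?C t)" by (intro continuous_intros cI cp)
  have "cmod (integral {0..T} (\<lambda>t. I t - ?C t)) \<le> e1 * (T - 0)"
    by (rule integral_bound[OF _ cE]) (use P.T source_bound[OF _ R0] in \<open>simp_all add: I_def Qi_def\<close>)
  moreover have "integral {0..T} I = (- \<i> * complex_of_real AB * Qi) * integral {0..T} p + integral {0..T} (\<lambda>t. I t - ?C t)"
  proof -
    have "((\<lambda>t. (- \<i> * complex_of_real AB * Qi) * p t + (I t - ?C t)) has_integral
       (- \<i> * complex_of_real AB * Qi) * integral {0..T} p + integral {0..T} (\<lambda>t. I t - ?C t)) {0..T}"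
      by (rule has_integral_add[OF has_integral_mult_right[OF integrable_integral[OF integrable_continuous_real[OF cp]]]
            integrable_integral[OF integrable_continuous_real[OF cE]]])
    moreover have "(- \<i> * complex_of_real AB * Qi) * p t + (I t - ?C t) = I t" for t by (simp add: mult_ac)
    ultimately show ?thesis by (simp only: integral_unique)
  qed
  then have "(- \<i> * complex_of_real AB * Qi) * integral {0..T} p = integral {0..T} I - integral {0..T} (\<lambda>t. I t - ?C t)" by simp
  then have "cmod ((- \<i> * complex_of_real AB * Qi) * integral {0..T} p) \<le> cmod (integral {0..T} I) + cmod (integral {0..T} (\<lambda>t. I t - ?C t))"
    by (simp only: norm_triangle_ineq4)
  moreover have "cmod ((- \<i> * complex_of_real AB * Qi) * integral {0..T} p) = AB * (cmod (integral {0..T} p) * cmod Qi)"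
  proof -
    have "0 \<le> AB" unfolding AB_def using P.\<alpha> P.\<epsilon> P.B(1) by simp
    then show ?thesis by (simp only: norm_mult norm_minus_cancel norm_ii norm_of_real abs_of_nonneg mult_1_left mult_ac)
  qed
  moreover have "AB * (T / 4 * (exp (- 3 / 2) * (s\<^sup>2 / 2))) \<le> AB * (cmod (integral {0..T} p) * cmod Qi)"
    unfolding Qi_def using P.\<alpha> P.\<epsilon> P.B(1) P.T by (intro mult_left_mono mult_mono p_integral q_integral[OF R]) (auto simp: AB_def)
  moreover have "integral {0..T} I = integral {-R..R} (\<lambda>x. d0 x T * \<psi>0 x T) - integral {0..T} (\<lambda>r. J R r - J (-R) r)"
    unfolding I_def using pairing_identity[OF R0] by simp
  then have "cmod (integral {0..T} I) \<le> cmod (integral {-R..R} (\<lambda>x. d0 x T * \<psi>0 x T)) + cmod (integral {0..T} (\<lambda>r. J R r - J (-R) r))"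
    by (simp only: norm_triangle_ineq4)
  ultimately show ?thesis by simp
qed

lemma e1_bound: "e1 \<le> AB * (1060 * T * (2 * N + 3)) + \<epsilon> ^ 3 * (48 * s * T * \<beta> * k\<^sup>2 + 96 * s * T * k ^ 3 + 1024 * T\<^sup>2 * k ^ 3 * (2 * N + 3) / s)"
proof -
  have s: "0 < s" "s \<noteq> 0" using P.s by simp_all
  have "e1 = AB * (T * 36) + AB * (T * (768 * (2 * N + 1))) + AB * (T * (256 * (2 * N + 3)))
    + \<epsilon> ^ 3 * (48 * s * T * \<beta> * k\<^sup>2 + 96 * s * T * k ^ 3 + 1024 * T\<^sup>2 * k ^ 3 * (2 * N + 3) / s)"
    unfolding e1_def x2_def c3_def g0_def AB_def using s(2) by (simp add: field_simps power2_eq_square power3_eq_cube)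
  moreover have "AB * (T * 36) + AB * (T * (768 * (2 * N + 1))) + AB * (T * (256 * (2 * N + 3))) \<le> AB * (1060 * T * (2 * N + 3))"
  proof -
    have AB: "0 \<le> AB * T" unfolding AB_def using P.\<alpha> P.\<epsilon> P.B(1) P.T by simp
    have "36 + 768 * (2 * N + 1) + 256 * (2 * N + 3) \<le> 1060 * (2 * N + 3)" using P.N by simp
    from mult_left_mono[OF this AB] show ?thesis by (simp add: algebra_simps)
  qed
  ultimately show ?thesis by simp
qed

text \<open>The limit of growing truncations: the pairing converges by dominated convergence and the
  flux tends to 0.\<close>

lemma separation:
  assumes i: "integrable lborel (\<lambda>x. d0 x T * \<psi>0 x T)"
  shows "\<epsilon>\<^sup>2 * (\<alpha> * \<beta> * (T * exp (- 3 / 2) / 8 * s\<^sup>2 - 1060 * T\<^sup>2 * (2 * N + 3)))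
    - \<epsilon> ^ 3 * ((48 * s * T * \<beta> * k\<^sup>2 + 96 * s * T * k ^ 3 + 1024 * T\<^sup>2 * k ^ 3 * (2 * N + 3) / s) * T)
    \<le> cmod (LINT x|lborel. d0 x T * \<psi>0 x T)"
proof -
  let ?f = "\<lambda>x. d0 x T * \<psi>0 x T"
  have TT: "T \<in> {0..T}" using P.T by simp
  have I: "integral {- real j..real j} ?f = (LINT x|lborel. indicator {- real j..real j} x *\<^sub>R ?f x)" for j
  proof -
    have "set_integrable lborel {- real j..real j} ?f"
      unfolding set_integrable_def by (rule integrable_mult_indicator[OF _ i]) simp
    from set_borel_integral_eq_integral(2)[OF this] show ?thesis by (simp add: set_lebesgue_integral_def)
  qed
  have "(\<lambda>j. LINT x|lborel. indicator {- real j..real j} x *\<^sub>R ?f x) \<longlonglongrightarrow> (LINT x|lborel. ?f x)"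
  proof (rule integral_dominated_convergence[where w = "\<lambda>x. norm (?f x)"])
    show "AE x in lborel. (\<lambda>j. indicator {- real j..real j} x *\<^sub>R ?f x) \<longlonglongrightarrow> ?f x"
    proof (rule AE_I2, rule tendsto_eventually)
      fix x :: real
      have "\<forall>\<^sub>F j in sequentially. \<bar>x\<bar> \<le> real j"
        using filterlim_real_sequentially unfolding filterlim_at_top by blast
      then show "\<forall>\<^sub>F j in sequentially. indicator {- real j..real j} x *\<^sub>R ?f x = ?f x"
        by eventually_elim (auto simp: indicator_def)
    qed
    show "AE x in lborel. norm (indicator {- real j..real j} x *\<^sub>R ?f x) \<le> norm (?f x)" for j
      by (rule AE_I2) (simp add: indicator_def)
    show "integrable lborel (\<lambda>x. norm (?f x))" by (rule integrable_norm[OF i])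
    show "?f \<in> borel_measurable lborel" by (rule borel_measurable_integrable[OF i])
    show "(\<lambda>x. indicator {- real j..real j} x *\<^sub>R ?f x) \<in> borel_measurable lborel" for j
      by (rule borel_measurable_scaleR[OF _ borel_measurable_integrable[OF i]]) simp
  qed
  then have "(\<lambda>j. cmod (integral {- real j..real j} ?f) + cmod (integral {0..T} (\<lambda>r. J (real j) r - J (- real j) r)))
    \<longlonglongrightarrow> cmod (LINT x|lborel. ?f x) + cmod 0"
    unfolding I by (intro tendsto_add tendsto_norm flux_tendsto_0[OF nice_J TT])
  moreover have "\<forall>\<^sub>F j in sequentially. AB * (T / 4 * (exp (- 3 / 2) * (s\<^sup>2 / 2))) - e1 * T
    \<le> cmod (integral {- real j..real j} ?f) + cmod (integral {0..T} (\<lambda>r. J (real j) r - J (- real j) r))"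
  proof -
    have "\<forall>\<^sub>F j in sequentially. s\<^sup>2 \<le> real j"
      using filterlim_real_sequentially unfolding filterlim_at_top by blast
    then show ?thesis by eventually_elim (rule pairing_lower)
  qed
  ultimately have "AB * (T / 4 * (exp (- 3 / 2) * (s\<^sup>2 / 2))) - e1 * T \<le> cmod (LINT x|lborel. ?f x) + cmod 0"
    by (rule tendsto_lowerbound) simp
  moreover have "e1 * T \<le> (AB * (1060 * T * (2 * N + 3)) + \<epsilon> ^ 3 * (48 * s * T * \<beta> * k\<^sup>2 + 96 * s * T * k ^ 3 + 1024 * T\<^sup>2 * k ^ 3 * (2 * N + 3) / s)) * T"
    using e1_bound P.T by (intro mult_right_mono) auto
  moreover have "\<epsilon>\<^sup>2 * (\<alpha> * \<beta> * (T * exp (- 3 / 2) / 8 * s\<^sup>2 - 1060 * T\<^sup>2 * (2 * N + 3)))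
    = AB * (T / 4 * (exp (- 3 / 2) * (s\<^sup>2 / 2))) - AB * (1060 * T * (2 * N + 3)) * T"
    unfolding AB_def by (simp add: power2_eq_square algebra_simps)
  moreover have "(AB * a + \<epsilon> ^ 3 * c) * T = AB * a * T + \<epsilon> ^ 3 * (c * T)" for a c by (simp add: algebra_simps)
  ultimately show ?thesis by (simp only: norm_zero add_0_right)
qed

end

section \<open>Unboundedness of the second difference\<close>

lemma distr_of_cmult: "distr_of (\<lambda>x. complex_of_real c * f x) = c *\<^sub>R distr_of f"
  by (rule ext) (simp add: distr_of_def scaleR_fun_def scaleR_conv_of_real mult.assoc)

lemma distr_of_add:
  assumes "integrable lborel f" "integrable lborel g"
  shows "distr_of (\<lambda>x. f x + g x) = distr_of f + distr_of g"
proof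
  fix \<phi>
  show "distr_of (\<lambda>x. f x + g x) \<phi> = (distr_of f + distr_of g) \<phi>"
  proof (cases "\<phi> \<in> schwartz")
    case True
    then show ?thesis
      using Bochner_Integration.integral_add[OF schwartz_integrable_mult(1)[OF assms(1) True] schwartz_integrable_mult(1)[OF assms(2) True]]
      by (simp add: distr_of_def distrib_right)
  qed (simp add: distr_of_def)
qed

lemma distr_of_zero: "distr_of (\<lambda>x. 0) = 0"
  by (rule ext) (simp add: distr_of_def)

lemma fourier_mult_left: "fourier (\<lambda>x. c * f x) = (\<lambda>\<xi>. c * fourier f \<xi>)"
  unfolding fourier_def mult.left_commute[of _ c] by (rule ext) simp

lemma packet_uminus: "packet \<sigma> (- \<kappa>) x = cnj (packet \<sigma> \<kappa> x)"
  unfolding packet_bump by (simp add: exp_cnj)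

lemma Re_packet_eq: "complex_of_real (c * Re (packet \<sigma> \<kappa> x)) = complex_of_real (c / 2) * (packet \<sigma> \<kappa> x + packet \<sigma> (- \<kappa>) x)"
  unfolding packet_uminus complex_add_cnj by simp

lemma schwartz_sobolev_inf: "f \<in> schwartz \<Longrightarrow> distr_of f \<in> sobolev_inf"
  by (simp add: sobolev_inf_def schwartz_sobolev)

definition wave_datum :: "real \<Rightarrow> real \<Rightarrow> real \<Rightarrow> real \<Rightarrow> complex"
  where "wave_datum \<sigma> c \<kappa> x = complex_of_real (c * Re (packet \<sigma> \<kappa> x))"

lemma wave_datum_schwartz: "1 \<le> \<sigma> \<Longrightarrow> wave_datum \<sigma> c \<kappa> \<in> schwartz"
  unfolding wave_datum_def[abs_def] Re_packet_eq by (intro schwartz_cmult schwartz_add packet_schwartz)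

lemma wave_datum_real_sobolev:
  assumes "1 \<le> \<sigma>"
  shows "distr_of (wave_datum \<sigma> c \<kappa>) \<in> vecs (real_sobolev s)"
  using schwartz_sobolev[OF wave_datum_schwartz[OF assms]] real_valued_distr_of[OF schwartz_integrable[OF wave_datum_schwartz[OF assms]]]
  by (simp add: real_sobolev_vecs wave_datum_def)

lemma packet_datum_norm:
  assumes s: "1 \<le> \<sigma>" and c: "0 \<le> c"
  shows "sobolev_norm k (distr_of (\<lambda>x. complex_of_real c * packet \<sigma> \<omega> x)) \<le> c * sqrt (2 * pi * weight_const k * \<sigma> * sobolev_weight k \<omega>)"
  unfolding distr_of_cmult
  using normed_scale[OF normed_sobolev schwartz_sobolev[OF packet_schwartz[OF s]], of k c \<omega>] c
    mult_left_mono[OF packet_sobolev_norm[OF s, of k \<omega>] c] by simp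

text \<open>The real datum is half the sum of two packets with opposite frequencies, and the weight
  is even.\<close>

lemma wave_datum_norm:
  assumes s: "1 \<le> \<sigma>" and c: "0 \<le> c"
  shows "sobolev_norm s (distr_of (wave_datum \<sigma> c \<kappa>)) \<le> c * sqrt (2 * pi * weight_const s * \<sigma> * sobolev_weight s \<kappa>)"
proof -
  let ?p = "\<lambda>\<omega>. distr_of (packet \<sigma> \<omega>)"
  have mem: "?p \<omega> \<in> vecs (sobolev s)" for \<omega> by (rule schwartz_sobolev[OF packet_schwartz[OF s]])
  have "distr_of (wave_datum \<sigma> c \<kappa>) = (c / 2) *\<^sub>R (?p \<kappa> + ?p (- \<kappa>))"
    unfolding wave_datum_def[abs_def] Re_packet_eq distr_of_cmult
    by (simp only: distr_of_add[OF schwartz_integrable[OF packet_schwartz[OF s]] schwartz_integrable[OF packet_schwartz[OF s]]])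
  then have "sobolev_norm s (distr_of (wave_datum \<sigma> c \<kappa>)) = \<bar>c / 2\<bar> * sobolev_norm s (?p \<kappa> + ?p (- \<kappa>))"
    using normed_scale[OF normed_sobolev normed_add_mem[OF normed_sobolev mem mem], of "c / 2" \<kappa> "- \<kappa>"] by simp
  also have "\<dots> \<le> \<bar>c / 2\<bar> * (sobolev_norm s (?p \<kappa>) + sobolev_norm s (?p (- \<kappa>)))"
    using normed_triangle[OF normed_sobolev mem mem, of \<kappa> "- \<kappa>"] by (intro mult_left_mono) auto
  also have "\<dots> \<le> \<bar>c / 2\<bar> * (2 * sqrt (2 * pi * weight_const s * \<sigma> * sobolev_weight s \<kappa>))"
    using packet_sobolev_norm[OF s, of s \<kappa>] packet_sobolev_norm[OF s, of s "- \<kappa>"]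
    by (intro mult_left_mono) (auto simp: sobolev_weight_def)
  finally show ?thesis using c by simp
qed

text \<open>The packet is the Fourier transform of a Gaussian concentrated within 1 / \<sigma> of m,
  so \<open>sobolev_pairing\<close> reduces its dual norm to the integral in
  \<open>gauss_weight\<close>. The pairing is bilinear, which is why the packet of frequency - m
  tests the frequency m.\<close>

lemma packet_dual_norm:
  assumes s: "1 \<le> \<sigma>" and L: "\<Lambda> \<in> vecs (sobolev k)" and c: "cmod c = 1"
  shows "cmod (\<Lambda> (\<lambda>x. c * packet \<sigma> (- m) x)) \<le> sqrt (weight_const (- k) * \<sigma> * sobolev_weight (- k) m) * sobolev_norm k \<Lambda>"
proof -
  define b where "b = \<sigma>\<^sup>2 / 2"
  \<comment> \<open>Equal to \<open>exp (m^2 \<sigma>^2 / 2)\<close> times a Gaussian centred at m;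
    z collects this factor and the normalisation of the transform.\<close>
  define g where "g = gauss (complex_of_real (m * \<sigma>\<^sup>2)) b"
  define z where "z = sqrt (pi / b) * exp (m\<^sup>2 * \<sigma>\<^sup>2 / 2)"
  have b: "0 < b" using s by (simp add: b_def)
  have z: "0 < z" using b by (simp add: z_def)
  have F: "fourier g \<xi> = complex_of_real z * packet \<sigma> (- m) \<xi>" for \<xi>
  proof -
    define M X S where "M = complex_of_real m" and "X = complex_of_real \<xi>" and "S = complex_of_real (\<sigma>\<^sup>2)"
    have S: "S \<noteq> 0" using s by (simp add: S_def)
    have "(M * S - \<i> * X)\<^sup>2 = M\<^sup>2 * S\<^sup>2 - 2 * (M * S) * (\<i> * X) - X\<^sup>2" by (simp add: power2_diff power_mult_distrib)
    then have "(M * S - \<i> * X)\<^sup>2 / (2 * S) = M\<^sup>2 * S / 2 + (\<i> * (- M) * X - X\<^sup>2 / (2 * S))"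
      using S by (simp add: field_simps power2_eq_square)
    then have "exp ((M * S - \<i> * X)\<^sup>2 / (2 * S)) = exp (M\<^sup>2 * S / 2) * exp (\<i> * (- M) * X - X\<^sup>2 / (2 * S))"
      by (simp only: exp_add)
    moreover have "complex_of_real (exp (m\<^sup>2 * \<sigma>\<^sup>2 / 2)) = exp (M\<^sup>2 * S / 2)" by (simp add: M_def S_def exp_of_real[symmetric])
    moreover have "gauss (\<i> * complex_of_real (- m)) (1 / (2 * \<sigma>\<^sup>2)) \<xi> = exp (\<i> * (- M) * X - X\<^sup>2 / (2 * S))"
      by (simp add: gauss_def M_def X_def S_def)
    moreover have "fourier g \<xi> = complex_of_real (sqrt (pi / b)) * exp ((M * S - \<i> * X)\<^sup>2 / (2 * S))"
      unfolding g_def fourier_gauss[OF b] by (simp add: b_def M_def X_def S_def)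
    ultimately show ?thesis unfolding z_def packet_def of_real_mult by (simp only: mult.assoc)
  qed
  define \<phi> where "\<phi> = (\<lambda>x. c / complex_of_real z * g x)"
  have gs: "g \<in> schwartz" unfolding g_def by (rule gauss_schwartz[OF b])
  have ps: "\<phi> \<in> schwartz" unfolding \<phi>_def by (rule schwartz_cmult[OF gs])
  have fp: "fourier \<phi> = (\<lambda>x. c * packet \<sigma> (- m) x)"
    unfolding \<phi>_def fourier_mult_left F using z by (simp add: field_simps)
  have sq: "(cmod (\<phi> x))\<^sup>2 = \<sigma>\<^sup>2 / (2 * pi) * exp (- (\<sigma>\<^sup>2 * (x - m)\<^sup>2))" for x
  proof -
    have "z\<^sup>2 = 2 * pi / \<sigma>\<^sup>2 * (exp (m\<^sup>2 * \<sigma>\<^sup>2 / 2))\<^sup>2" using b by (simp add: z_def power_mult_distrib b_def)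
    also have "(exp (m\<^sup>2 * \<sigma>\<^sup>2 / 2))\<^sup>2 = exp (m\<^sup>2 * \<sigma>\<^sup>2)" unfolding power2_eq_square exp_add[symmetric] by simp
    finally have z2: "z\<^sup>2 = 2 * pi / \<sigma>\<^sup>2 * exp (m\<^sup>2 * \<sigma>\<^sup>2)" .
    have "(cmod (g x))\<^sup>2 = exp (2 * (m * \<sigma>\<^sup>2 * x - b * x\<^sup>2))"
      unfolding g_def cmod_gauss power2_eq_square[of "exp _"] exp_add[symmetric] by simp
    also have "2 * (m * \<sigma>\<^sup>2 * x - b * x\<^sup>2) = m\<^sup>2 * \<sigma>\<^sup>2 + - (\<sigma>\<^sup>2 * (x - m)\<^sup>2)" by (simp add: b_def power2_eq_square algebra_simps)
    finally have g2: "(cmod (g x))\<^sup>2 = exp (m\<^sup>2 * \<sigma>\<^sup>2) * exp (- (\<sigma>\<^sup>2 * (x - m)\<^sup>2))" unfolding exp_add .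
    have "(cmod (\<phi> x))\<^sup>2 = (cmod (g x))\<^sup>2 / z\<^sup>2" using z by (simp add: \<phi>_def norm_mult norm_divide c power_divide)
    also have "\<dots> = \<sigma>\<^sup>2 / (2 * pi) * exp (- (\<sigma>\<^sup>2 * (x - m)\<^sup>2))" unfolding z2 g2 using s by (simp add: field_simps)
    finally show ?thesis .
  qed
  have "(LINT \<xi>|lborel. sobolev_weight (- k) \<xi> * (cmod (\<phi> \<xi>))\<^sup>2)
      = \<sigma>\<^sup>2 / (2 * pi) * (LINT \<xi>|lborel. sobolev_weight (- k) \<xi> * exp (- (\<sigma>\<^sup>2 * (\<xi> - m)\<^sup>2)))"
    unfolding sq mult.left_commute[of "sobolev_weight _ _" "\<sigma>\<^sup>2 / (2 * pi)"] by simp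
  also have "\<dots> \<le> \<sigma>\<^sup>2 / (2 * pi) * (weight_const (- k) * sobolev_weight (- k) m / \<sigma>)"
    by (rule mult_left_mono[OF gauss_weight(2)[OF s]]) simp
  also have "\<dots> = weight_const (- k) * \<sigma> * sobolev_weight (- k) m * (1 / (2 * pi))" using s by (simp add: power2_eq_square)
  also have "\<dots> \<le> weight_const (- k) * \<sigma> * sobolev_weight (- k) m * 1"
    using s pi_ge_two weight_const_nonneg[of "- k"] sobolev_weight_pos[of "- k" m] by (intro mult_left_mono mult_nonneg_nonneg) auto
  finally have "sqrt (LINT \<xi>|lborel. sobolev_weight (- k) \<xi> * (cmod (\<phi> \<xi>))\<^sup>2) \<le> sqrt (weight_const (- k) * \<sigma> * sobolev_weight (- k) m)" by simp
  from mult_right_mono[OF this, of "sobolev_norm k \<Lambda>"] sobolev_pairing[OF L ps schwartz_weight_integrable[OF ps]] fp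
    normed_nonneg[OF normed_sobolev L] show ?thesis by simp
qed

lemma solution_packet_flow:
  assumes T: "0 < T" and s: "1 \<le> s" and N: "0 \<le> N" and \<alpha>: "0 < \<alpha>" and \<epsilon>: "0 < \<epsilon>" "\<epsilon> \<le> 1" and B: "0 \<le> B" "B \<le> \<beta> * \<epsilon>"
    and sol: "zakharov_solution T (distr_of (\<lambda>x. complex_of_real (\<alpha> * \<epsilon>) * packet (s\<^sup>2) (- N) x), distr_of (wave_datum (s\<^sup>2) B (2 * N + 1)), 0) (U, W, V)"
  obtains nt where
    "packet_flow T (\<lambda>x t. xderiv 0 (U t) x) (\<lambda>x t. xderiv 1 (U t) x) (\<lambda>x t. xderiv 2 (U t) x) (\<lambda>x t. xderiv 3 (U t) x)
       (\<lambda>x t. Re (xderiv 0 (W t) x)) (\<lambda>x t. Re (xderiv 1 (W t) x)) (\<lambda>x t. Re (xderiv 2 (W t) x)) nt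
       s N \<alpha> \<beta> \<epsilon> B (sqrt (flow_const s N \<alpha> \<beta>))"
    "is_function (U T) (\<lambda>x. xderiv 0 (U T) x)"
proof -
  obtain nt where fl: "zakharov_flow T (\<lambda>x t. xderiv 0 (U t) x) (\<lambda>x t. xderiv 1 (U t) x) (\<lambda>x t. xderiv 2 (U t) x) (\<lambda>x t. xderiv 3 (U t) x)
       (\<lambda>x t. Re (xderiv 0 (W t) x)) (\<lambda>x t. Re (xderiv 1 (W t) x)) (\<lambda>x t. Re (xderiv 2 (W t) x)) nt"
    and fU: "\<And>t. t \<in> {0..T} \<Longrightarrow> is_function (U t) (\<lambda>x. xderiv 0 (U t) x)"
    and init: "U 0 = distr_of (\<lambda>x. complex_of_real (\<alpha> * \<epsilon>) * packet (s\<^sup>2) (- N) x)" "W 0 = distr_of (wave_datum (s\<^sup>2) B (2 * N + 1))"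
    using solution_flow[OF T sol] by metis
  interpret zakharov_flow T "\<lambda>x t. xderiv 0 (U t) x" "\<lambda>x t. xderiv 1 (U t) x" "\<lambda>x t. xderiv 2 (U t) x" "\<lambda>x t. xderiv 3 (U t) x"
    "\<lambda>x t. Re (xderiv 0 (W t) x)" "\<lambda>x t. Re (xderiv 1 (W t) x)" "\<lambda>x t. Re (xderiv 2 (W t) x)" nt by (rule fl)
  have s2: "1 \<le> s\<^sup>2" using one_le_power[OF s] by simp
  have rep: "f = xderiv 0 (distr_of f)" if "f \<in> schwartz" for f
    by (rule sobolev_representation[OF schwartz_sobolev_inf[OF that] is_function_distr_of[OF schwartz_integrable[OF that]] schwartz_continuous[OF that]])
  have "packet_flow T (\<lambda>x t. xderiv 0 (U t) x) (\<lambda>x t. xderiv 1 (U t) x) (\<lambda>x t. xderiv 2 (U t) x) (\<lambda>x t. xderiv 3 (U t) x)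
       (\<lambda>x t. Re (xderiv 0 (W t) x)) (\<lambda>x t. Re (xderiv 1 (W t) x)) (\<lambda>x t. Re (xderiv 2 (W t) x)) nt
       s N \<alpha> \<beta> \<epsilon> B (sqrt (flow_const s N \<alpha> \<beta>))"
  proof unfold_locales
    show "xderiv 0 (U 0) x = complex_of_real (\<alpha> * \<epsilon>) * packet (s\<^sup>2) (- N) x" for x
      unfolding init(1) by (rule fun_cong[OF rep[OF schwartz_cmult[OF packet_schwartz[OF s2]]], symmetric])
    show "Re (xderiv 0 (W 0) x) = B * Re (packet (s\<^sup>2) (2 * N + 1) x)" for x
      unfolding init(2) fun_cong[OF rep[OF wave_datum_schwartz[OF s2]], symmetric] by (simp add: wave_datum_def)
    have "0 \<le> flow_const s N \<alpha> \<beta>" by (simp add: flow_const_def)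
    then show "0 \<le> sqrt (flow_const s N \<alpha> \<beta>)" "(sqrt (flow_const s N \<alpha> \<beta>))\<^sup>2 = flow_const s N \<alpha> \<beta>" by simp_all
  qed (rule s N \<alpha> \<epsilon> B)+
  then show ?thesis by (rule that) (rule fU, use T in simp)
qed

text \<open>Conservation of mass keeps u = 0 whatever the wave does; it removes two of the four
  terms of the second difference.\<close>

lemma zero_solution:
  assumes T: "0 < T" and du: "du = 0" and sol: "zakharov_solution T (du, dn, 0) (U, W, V)" and \<phi>: "\<phi> \<in> schwartz"
  shows "U T \<phi> = 0"
proof (rule solution_flow[OF T sol])
  fix nt
  assume fl: "zakharov_flow T (\<lambda>x t. xderiv 0 (U t) x) (\<lambda>x t. xderiv 1 (U t) x) (\<lambda>x t. xderiv 2 (U t) x) (\<lambda>x t. xderiv 3 (U t) x)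
       (\<lambda>x t. Re (xderiv 0 (W t) x)) (\<lambda>x t. Re (xderiv 1 (W t) x)) (\<lambda>x t. Re (xderiv 2 (W t) x)) nt"
    and fU: "\<And>t. t \<in> {0..T} \<Longrightarrow> is_function (U t) (\<lambda>x. xderiv 0 (U t) x)" and init: "U 0 = du"
  interpret zakharov_flow T "\<lambda>x t. xderiv 0 (U t) x" "\<lambda>x t. xderiv 1 (U t) x" "\<lambda>x t. xderiv 2 (U t) x" "\<lambda>x t. xderiv 3 (U t) x"
    "\<lambda>x t. Re (xderiv 0 (W t) x)" "\<lambda>x t. Re (xderiv 1 (W t) x)" "\<lambda>x t. Re (xderiv 2 (W t) x)" nt by (rule fl)
  have TT: "T \<in> {0..T}" using T by simp
  have "(\<lambda>x. 0) = xderiv 0 (0 :: distr)"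
    by (rule sobolev_representation) (auto simp: sobolev_inf_def is_function_def intro: normed_zero_mem[OF normed_sobolev])
  then have z: "xderiv 0 (U 0) x = 0" for x unfolding init du by metis
  have u: "xderiv 0 (U T) x = 0" for x
  proof -
    let ?R = "\<bar>x\<bar> + 1"
    have c: "continuous_on {-?R..?R} (\<lambda>x. f0 x T)" by (rule nice_cont_x[OF nice_f(1) TT])
    have "integral {-?R..?R} (\<lambda>x. f0 x T) \<le> 2 * 0" by (rule mass[OF _ TT]) (simp_all add: f0_def z)
    moreover have "0 \<le> integral {-?R..?R} (\<lambda>x. f0 x T)"
      by (rule Henstock_Kurzweil_Integration.integral_nonneg[OF integrable_continuous_real[OF c]]) (simp add: f0_def)
    ultimately have "integral {-?R..?R} (\<lambda>x. f0 x T) = 0" by simp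
    then have "\<forall>y\<in>{-?R..?R}. f0 y T = 0"
      using integral_eq_0_iff[OF c] by (simp add: f0_def)
    moreover have "x \<in> {-?R..?R}" by auto
    ultimately have "f0 x T = 0" by blast
    then show ?thesis by (simp add: f0_def)
  qed
  show "U T \<phi> = 0" using fU[OF TT] \<phi> unfolding is_function_def u by simp
qed

text \<open>For m = N + 1 this is \<open>\<psi>0\<close> at time T, stated without reference to a
  solution.\<close>

definition test_packet :: "real \<Rightarrow> real \<Rightarrow> real \<Rightarrow> real \<Rightarrow> complex"
  where "test_packet T \<sigma> m x = exp (\<i> * complex_of_real (m\<^sup>2 * T)) * packet \<sigma> (- m) x"

text \<open>The order of the quantifiers is the point: D is fixed before \<epsilon> and the
  solutions, so the cubic term disappears after division by \<epsilon>^2.\<close>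

lemma solution_separation:
  assumes T: "0 < T" and s: "1 \<le> s" and N: "0 \<le> N" "2 \<le> T * (2 * N + 1)" and \<alpha>: "0 < \<alpha>" and \<beta>: "0 \<le> \<beta>"
  shows "\<exists>D. \<forall>\<epsilon> U W V U' W' V'. 0 < \<epsilon> \<longrightarrow> \<epsilon> \<le> 1 \<longrightarrow>
    zakharov_solution T (distr_of (\<lambda>x. complex_of_real (\<alpha> * \<epsilon>) * packet (s\<^sup>2) (- N) x), distr_of (wave_datum (s\<^sup>2) (\<beta> * \<epsilon>) (2 * N + 1)), 0) (U, W, V) \<longrightarrow>
    zakharov_solution T (distr_of (\<lambda>x. complex_of_real (\<alpha> * \<epsilon>) * packet (s\<^sup>2) (- N) x), 0, 0) (U', W', V') \<longrightarrow>
    \<epsilon>\<^sup>2 * (\<alpha> * \<beta> * (T * exp (- 3 / 2) / 8 * s\<^sup>2 - 1060 * T\<^sup>2 * (2 * N + 3))) - \<epsilon> ^ 3 * D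
      \<le> cmod (U T (test_packet T (s\<^sup>2) (N + 1)) - U' T (test_packet T (s\<^sup>2) (N + 1)))"
proof -
  define k where "k = sqrt (flow_const s N \<alpha> \<beta>)"
  have s2: "1 \<le> s\<^sup>2" using one_le_power[OF s] by simp
  let ?D = "(48 * s * T * \<beta> * k\<^sup>2 + 96 * s * T * k ^ 3 + 1024 * T\<^sup>2 * k ^ 3 * (2 * N + 3) / s) * T"
  let ?\<psi> = "test_packet T (s\<^sup>2) (N + 1)"
  have \<psi>s: "?\<psi> \<in> schwartz" unfolding test_packet_def[abs_def] by (rule schwartz_cmult[OF packet_schwartz[OF s2]])
  have "\<epsilon>\<^sup>2 * (\<alpha> * \<beta> * (T * exp (- 3 / 2) / 8 * s\<^sup>2 - 1060 * T\<^sup>2 * (2 * N + 3))) - \<epsilon> ^ 3 * ?D \<le> cmod (U T ?\<psi> - U' T ?\<psi>)"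
    if \<epsilon>: "0 < \<epsilon>" "\<epsilon> \<le> 1"
      and sol: "zakharov_solution T (distr_of (\<lambda>x. complex_of_real (\<alpha> * \<epsilon>) * packet (s\<^sup>2) (- N) x), distr_of (wave_datum (s\<^sup>2) (\<beta> * \<epsilon>) (2 * N + 1)), 0) (U, W, V)"
      and sol': "zakharov_solution T (distr_of (\<lambda>x. complex_of_real (\<alpha> * \<epsilon>) * packet (s\<^sup>2) (- N) x), 0, 0) (U', W', V')"
    for \<epsilon> U W V U' W' V'
  proof -
    have be: "0 \<le> \<beta> * \<epsilon>" using \<beta> \<epsilon> by simp
    have sol0: "zakharov_solution T (distr_of (\<lambda>x. complex_of_real (\<alpha> * \<epsilon>) * packet (s\<^sup>2) (- N) x), distr_of (wave_datum (s\<^sup>2) 0 (2 * N + 1)), 0) (U', W', V')"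
      using sol' by (simp add: wave_datum_def[abs_def] distr_of_zero)
    obtain nt where P: "packet_flow T (\<lambda>x t. xderiv 0 (U t) x) (\<lambda>x t. xderiv 1 (U t) x) (\<lambda>x t. xderiv 2 (U t) x) (\<lambda>x t. xderiv 3 (U t) x)
       (\<lambda>x t. Re (xderiv 0 (W t) x)) (\<lambda>x t. Re (xderiv 1 (W t) x)) (\<lambda>x t. Re (xderiv 2 (W t) x)) nt s N \<alpha> \<beta> \<epsilon> (\<beta> * \<epsilon>) k"
      and fU: "is_function (U T) (\<lambda>x. xderiv 0 (U T) x)"
      using solution_packet_flow[OF T s N(1) \<alpha> \<epsilon> be order_refl sol] unfolding k_def by metis
    obtain nt' where Q: "packet_flow T (\<lambda>x t. xderiv 0 (U' t) x) (\<lambda>x t. xderiv 1 (U' t) x) (\<lambda>x t. xderiv 2 (U' t) x) (\<lambda>x t. xderiv 3 (U' t) x)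
       (\<lambda>x t. Re (xderiv 0 (W' t) x)) (\<lambda>x t. Re (xderiv 1 (W' t) x)) (\<lambda>x t. Re (xderiv 2 (W' t) x)) nt' s N \<alpha> \<beta> \<epsilon> 0 k"
      and fU': "is_function (U' T) (\<lambda>x. xderiv 0 (U' T) x)"
      using solution_packet_flow[OF T s N(1) \<alpha> \<epsilon> order_refl be sol0] unfolding k_def by metis
    interpret packet_pair T "\<lambda>x t. xderiv 0 (U t) x" "\<lambda>x t. xderiv 1 (U t) x" "\<lambda>x t. xderiv 2 (U t) x" "\<lambda>x t. xderiv 3 (U t) x"
       "\<lambda>x t. Re (xderiv 0 (W t) x)" "\<lambda>x t. Re (xderiv 1 (W t) x)" "\<lambda>x t. Re (xderiv 2 (W t) x)" nt
       "\<lambda>x t. xderiv 0 (U' t) x" "\<lambda>x t. xderiv 1 (U' t) x" "\<lambda>x t. xderiv 2 (U' t) x" "\<lambda>x t. xderiv 3 (U' t) x"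
       "\<lambda>x t. Re (xderiv 0 (W' t) x)" "\<lambda>x t. Re (xderiv 1 (W' t) x)" "\<lambda>x t. Re (xderiv 2 (W' t) x)" nt' s N \<alpha> \<beta> \<epsilon> k
      unfolding packet_pair_def packet_pair_axioms_def using P Q N(2) by blast
    have \<psi>T: "\<psi>0 x T = ?\<psi> x" for x by (simp add: \<psi>0_def phase_def test_packet_def)
    have i: "integrable lborel (\<lambda>x. xderiv 0 (U T) x * ?\<psi> x)" "U T ?\<psi> = (LINT x|lborel. xderiv 0 (U T) x * ?\<psi> x)"
      "integrable lborel (\<lambda>x. xderiv 0 (U' T) x * ?\<psi> x)" "U' T ?\<psi> = (LINT x|lborel. xderiv 0 (U' T) x * ?\<psi> x)"
      using fU fU' \<psi>s unfolding is_function_def by blast+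
    have e: "d0 x T * \<psi>0 x T = xderiv 0 (U T) x * ?\<psi> x - xderiv 0 (U' T) x * ?\<psi> x" for x
      unfolding \<psi>T d0_def by (rule left_diff_distrib)
    have "(LINT x|lborel. d0 x T * \<psi>0 x T) = U T ?\<psi> - U' T ?\<psi>"
      unfolding e i(2,4) by (rule Bochner_Integration.integral_diff[OF i(1,3)])
    moreover have "integrable lborel (\<lambda>x. d0 x T * \<psi>0 x T)"
      unfolding e by (rule Bochner_Integration.integrable_diff[OF i(1,3)])
    ultimately show ?thesis using separation by metis
  qed
  then show ?thesis by blast
qed

section \<open>Comparison with the bound for twice differentiable maps\<close>

lemma normed_data_space: "normed (data_space k s)"
  unfolding data_space_def by (intro normed_prod_space normed_sobolev normed_real_sobolev)

lemma normed_solution_space: "0 \<le> T \<Longrightarrow> normed (solution_space T k s)"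
  unfolding solution_space_def by (intro normed_prod_space normed_path_space normed_sobolev normed_real_sobolev)

lemma data_space_nrm:
  "nrm (data_space k s) (a, 0, 0) = \<bar>sobolev_norm k a\<bar>" "nrm (data_space k s) (0, b, 0) = \<bar>sobolev_norm s b\<bar>"
  using normed_zero[OF normed_sobolev] by (simp_all add: data_space_def prod_space_def)

lemma data_space_vecs:
  "(a, b, c) \<in> vecs (data_space k s) \<longleftrightarrow> a \<in> vecs (sobolev k) \<and> b \<in> vecs (real_sobolev s) \<and> c \<in> vecs (real_sobolev (s - 1))"
  by (simp add: data_space_def prod_space_def)

text \<open>C must not depend on v and N, although the amplitudes and D do: for fixed v and N the
  inequality is divided by \<epsilon>^2 and \<epsilon> tends to 0. The three square roots are the
  sizes of the test packet in H^(-k), of the Schroedinger datum in H^k and of the wave datum in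
  H^s.\<close>

lemma second_difference_bound:
  assumes T: "0 < T" and C2: "C2_on (data_space k s) (solution_space T k s) (unit_ball (data_space k s)) F"
    and sol: "\<forall>d \<in> unit_ball (data_space k s) \<inter> smooth_data. zakharov_solution T d (F d)"
  shows "\<exists>C\<ge>0. \<forall>v N. 1 \<le> v \<longrightarrow> 0 \<le> N \<longrightarrow> 2 \<le> T * (2 * N + 1) \<longrightarrow>
    T * exp (- 3 / 2) / 8 * v\<^sup>2 - 1060 * T\<^sup>2 * (2 * N + 3)
    \<le> C * sqrt (v\<^sup>2 * sobolev_weight (- k) (N + 1)) * sqrt (v\<^sup>2 * sobolev_weight k N) * sqrt (v\<^sup>2 * sobolev_weight s (2 * N + 1))"
proof -
  let ?X = "data_space k s" and ?Y = "solution_space T k s"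
  have Y: "normed ?Y" using T by (intro normed_solution_space) simp
  obtain C r where C: "0 \<le> C" "0 < r" and diff: "\<And>l K x y e. (\<forall>y y'. l (y - y') = l y - (l y' :: complex)) \<Longrightarrow>
     (\<forall>c y. l (c *\<^sub>R y) = c *\<^sub>R l y) \<Longrightarrow> (\<forall>y\<in>vecs ?Y. cmod (l y) \<le> K * nrm ?Y y) \<Longrightarrow> 0 \<le> K \<Longrightarrow> x \<in> vecs ?X \<Longrightarrow> y \<in> vecs ?X \<Longrightarrow>
     nrm ?X x \<le> e \<Longrightarrow> nrm ?X y \<le> e \<Longrightarrow> e < r \<Longrightarrow> cmod (l (F (x + y)) - l (F x) - l (F y) + l (F 0)) \<le> C * K * e\<^sup>2"
    using C2_second_difference[OF normed_data_space Y C2] by blast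
  \<comment> \<open>The added 1 makes the normalising factors positive, so that they can be divided
    by.\<close>
  define ck where "ck = 2 * pi * weight_const k + 1"
  define cs where "cs = 2 * pi * weight_const s + 1"
  define cm where "cm = weight_const (- k)"
  have cpos: "0 < ck" "0 < cs" "0 \<le> cm" "2 * pi * weight_const k \<le> ck" "2 * pi * weight_const s \<le> cs"
    using weight_const_nonneg[of k] weight_const_nonneg[of s] weight_const_nonneg[of "- k"] by (simp_all add: ck_def cs_def cm_def add_nonneg_pos)
  have main: "T * exp (- 3 / 2) / 8 * v\<^sup>2 - 1060 * T\<^sup>2 * (2 * N + 3)
    \<le> C * sqrt cm * sqrt ck * sqrt cs * sqrt (v\<^sup>2 * sobolev_weight (- k) (N + 1)) * sqrt (v\<^sup>2 * sobolev_weight k N) * sqrt (v\<^sup>2 * sobolev_weight s (2 * N + 1))"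
    if v: "1 \<le> v" and N: "0 \<le> N" "2 \<le> T * (2 * N + 1)" for v N
  proof -
    have v2: "1 \<le> v\<^sup>2" using one_le_power[OF v] by simp
    have v0: "0 < v\<^sup>2" using v2 by linarith
    define Wu where "Wu = sqrt (ck * (v\<^sup>2 * sobolev_weight k N))"
    define Wn where "Wn = sqrt (cs * (v\<^sup>2 * sobolev_weight s (2 * N + 1)))"
    define K where "K = sqrt (cm * (v\<^sup>2 * sobolev_weight (- k) (N + 1)))"
    define L where "L = T * exp (- 3 / 2) / 8 * v\<^sup>2 - 1060 * T\<^sup>2 * (2 * N + 3)"
    have W: "0 < Wu" "0 < Wn" unfolding Wu_def Wn_def using cpos v0 sobolev_weight_pos by simp_all
    have K: "0 \<le> K" unfolding K_def using cpos(3) sobolev_weight_pos[of "- k" "N + 1"] by simp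
    \<comment> \<open>These amplitudes give each datum norm at most \<epsilon>.\<close>
    define \<alpha> \<beta> where "\<alpha> = 1 / Wu" and "\<beta> = 1 / Wn"
    have ab: "0 < \<alpha>" "0 < \<beta>" using W by (simp_all add: \<alpha>_def \<beta>_def)
    let ?\<psi> = "test_packet T (v\<^sup>2) (N + 1)"
    have \<psi>s: "?\<psi> \<in> schwartz" unfolding test_packet_def[abs_def] by (rule schwartz_cmult[OF packet_schwartz[OF v2]])
    obtain D where D: "\<And>\<epsilon> U W V U' W' V'. 0 < \<epsilon> \<Longrightarrow> \<epsilon> \<le> 1 \<Longrightarrow>
      zakharov_solution T (distr_of (\<lambda>x. complex_of_real (\<alpha> * \<epsilon>) * packet (v\<^sup>2) (- N) x), distr_of (wave_datum (v\<^sup>2) (\<beta> * \<epsilon>) (2 * N + 1)), 0) (U, W, V) \<Longrightarrow>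
      zakharov_solution T (distr_of (\<lambda>x. complex_of_real (\<alpha> * \<epsilon>) * packet (v\<^sup>2) (- N) x), 0, 0) (U', W', V') \<Longrightarrow>
      \<epsilon>\<^sup>2 * (\<alpha> * \<beta> * L) - \<epsilon> ^ 3 * D \<le> cmod (U T ?\<psi> - U' T ?\<psi>)"
      using solution_separation[OF T v N ab(1) less_imp_le[OF ab(2)]] unfolding L_def by blast
    \<comment> \<open>Evaluation of the Schroedinger component at the final time on the test packet;
      K bounds its norm as a functional.\<close>
    define l :: "(real \<Rightarrow> distr) \<times> (real \<Rightarrow> distr) \<times> (real \<Rightarrow> distr) \<Rightarrow> complex" where "l y = fst y T ?\<psi>" for y
    have l1: "\<forall>y y'. l (y - y') = l y - l y'" by (simp add: l_def)
    have l2: "\<forall>c y. l (c *\<^sub>R y) = c *\<^sub>R l y" by (simp add: l_def scaleR_fun_def)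
    have l3: "\<forall>y\<in>vecs ?Y. cmod (l y) \<le> K * nrm ?Y y"
    proof
      fix y assume y: "y \<in> vecs ?Y"
      then have fy: "fst y \<in> vecs (path_space T (sobolev k))" by (auto simp: solution_space_def prod_space_def)
      have TT: "T \<in> {0..T}" using T by simp
      have "cmod (l y) \<le> K * sobolev_norm k (fst y T)"
        unfolding l_def K_def cm_def test_packet_def[abs_def]
        using packet_dual_norm[OF v2 path_space_mem[OF fy TT], of "exp (\<i> * complex_of_real ((N + 1)\<^sup>2 * T))" "N + 1"] by (simp add: mult.assoc)
      also have "sobolev_norm k (fst y T) \<le> nrm (path_space T (sobolev k)) (fst y)"
        using path_space_nrm_ge[OF normed_sobolev fy TT] by simp
      also have "\<dots> \<le> nrm ?Y y" unfolding solution_space_def by (rule prod_space_nrm_ge(1))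
      finally show "cmod (l y) \<le> K * nrm ?Y y" using K by (simp add: mult_left_mono)
    qed
    \<comment> \<open>The bound 1 / 2 on \<epsilon> keeps the sum of the two data in the open unit
      ball.\<close>
    have ineq: "\<alpha> * \<beta> * L - \<epsilon> * D \<le> C * K" if \<epsilon>: "0 < \<epsilon>" "\<epsilon> < min r (1 / 2)" for \<epsilon>
    proof -
      have e: "\<epsilon> \<le> 1" "\<epsilon> < r" "2 * \<epsilon> < 1" using \<epsilon> by auto
      define du where "du = distr_of (\<lambda>x. complex_of_real (\<alpha> * \<epsilon>) * packet (v\<^sup>2) (- N) x)"
      define dn where "dn = distr_of (wave_datum (v\<^sup>2) (\<beta> * \<epsilon>) (2 * N + 1))"
      have mu: "du \<in> vecs (sobolev m)" for m unfolding du_def by (rule schwartz_sobolev[OF schwartz_cmult[OF packet_schwartz[OF v2]]])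
      have mn: "dn \<in> vecs (real_sobolev m)" for m unfolding dn_def by (rule wave_datum_real_sobolev[OF v2])
      have z: "0 \<in> vecs (sobolev m)" "0 \<in> vecs (real_sobolev m)" for m
        by (rule normed_zero_mem[OF normed_sobolev] normed_zero_mem[OF normed_real_sobolev])+
      have "sobolev_norm k du \<le> \<alpha> * \<epsilon> * sqrt (2 * pi * weight_const k * v\<^sup>2 * sobolev_weight k (- N))"
        unfolding du_def by (rule packet_datum_norm[OF v2]) (use ab \<epsilon> in simp)
      also have "\<dots> \<le> \<alpha> * \<epsilon> * Wu"
        using ab \<epsilon> cpos(4) v0 sobolev_weight_pos[of k N] unfolding Wu_def
        by (intro mult_left_mono real_sqrt_le_mono) (auto simp: sobolev_weight_def mult.assoc intro!: mult_right_mono)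
      also have "\<dots> = \<epsilon>" using W by (simp add: \<alpha>_def)
      finally have nu: "nrm ?X (du, 0, 0) \<le> \<epsilon>" using normed_nonneg[OF normed_sobolev mu, of k] by (simp add: data_space_nrm)
      have "sobolev_norm s dn \<le> \<beta> * \<epsilon> * sqrt (2 * pi * weight_const s * v\<^sup>2 * sobolev_weight s (2 * N + 1))"
        unfolding dn_def by (rule wave_datum_norm[OF v2]) (use ab \<epsilon> in simp)
      also have "\<dots> \<le> \<beta> * \<epsilon> * Wn"
        using ab \<epsilon> cpos(5) v0 sobolev_weight_pos[of s "2 * N + 1"] unfolding Wn_def
        by (intro mult_left_mono real_sqrt_le_mono) (auto simp: mult.assoc intro!: mult_right_mono)
      also have "\<dots> = \<epsilon>" using W by (simp add: \<beta>_def)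
      finally have nn: "nrm ?X (0, dn, 0) \<le> \<epsilon>" using normed_nonneg[OF normed_real_sobolev mn, of s] by (simp add: data_space_nrm)
      have mx: "(du, 0, 0) \<in> vecs ?X" "(0, dn, 0) \<in> vecs ?X" using mu mn z by (simp_all add: data_space_vecs)
      have xy: "(du, 0, 0) + (0, dn, 0) = (du, dn, 0 :: distr)" by simp
      have nxy: "(du, dn, 0) \<in> vecs ?X" "nrm ?X (du, dn, 0) \<le> 2 * \<epsilon>"
        using normed_add_mem[OF normed_data_space mx] normed_triangle[OF normed_data_space mx] nu nn unfolding xy by simp_all
      have sm: "(du, dn, 0) \<in> smooth_data" "(du, 0, 0) \<in> smooth_data" "(0, dn, 0) \<in> smooth_data" "(0, 0, 0) \<in> smooth_data"
        using mu mn z by (simp_all add: smooth_data_def)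
      have ball: "(du, dn, 0) \<in> unit_ball ?X" "(du, 0, 0) \<in> unit_ball ?X" "(0, dn, 0) \<in> unit_ball ?X" "(0, 0, 0) \<in> unit_ball ?X"
        using nxy mx nu nn e z normed_zero[OF normed_sobolev] by (auto simp: unit_ball_def data_space_vecs data_space_nrm)
      have S: "zakharov_solution T d (fst (F d), fst (snd (F d)), snd (snd (F d)))" if "d \<in> unit_ball ?X" "d \<in> smooth_data" for d
        using sol that by simp
      have zy: "l (F (0, dn, 0)) = 0" "l (F (0, 0, 0)) = 0"
        unfolding l_def by (rule zero_solution[OF T refl S[OF ball(3) sm(3)] \<psi>s] zero_solution[OF T refl S[OF ball(4) sm(4)] \<psi>s])+
      have "\<epsilon>\<^sup>2 * (\<alpha> * \<beta> * L) - \<epsilon> ^ 3 * D \<le> cmod (l (F (du, dn, 0)) - l (F (du, 0, 0)))"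
        unfolding l_def by (rule D[OF \<epsilon>(1) e(1) S[OF ball(1) sm(1), unfolded du_def dn_def, folded du_def dn_def, unfolded du_def dn_def] S[OF ball(2) sm(2), unfolded du_def], folded du_def dn_def])
      also have "\<dots> = cmod (l (F ((du, 0, 0) + (0, dn, 0))) - l (F (du, 0, 0)) - l (F (0, dn, 0)) + l (F 0))"
        unfolding xy zero_prod_def zy by simp
      also have "\<dots> \<le> C * K * \<epsilon>\<^sup>2" by (rule diff[OF l1 l2 l3 K mx nu nn e(2)])
      finally have "(\<alpha> * \<beta> * L - \<epsilon> * D) * \<epsilon>\<^sup>2 \<le> C * K * \<epsilon>\<^sup>2" by (simp add: algebra_simps power2_eq_square power3_eq_cube)
      then show ?thesis using \<epsilon>(1) by simp
    qed
    have "((\<lambda>\<epsilon>. \<alpha> * \<beta> * L - \<epsilon> * D) \<longlongrightarrow> \<alpha> * \<beta> * L - 0 * D) (at_right 0)" by (intro tendsto_intros)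
    moreover have "\<forall>\<^sub>F \<epsilon> in at_right 0. \<alpha> * \<beta> * L - \<epsilon> * D \<le> C * K"
      using eventually_at_right_less[of 0] eventually_at_right[of 0 1] C(2)
      by (intro eventually_at_rightI[of 0 "min r (1 / 2)"] ineq) auto
    ultimately have "\<alpha> * \<beta> * L - 0 * D \<le> C * K" by (rule tendsto_upperbound) simp
    then have "L / (Wu * Wn) \<le> C * K" by (simp add: \<alpha>_def \<beta>_def)
    then have "L \<le> C * K * (Wu * Wn)" using W by (simp add: pos_divide_le_eq)
    then show ?thesis unfolding L_def K_def Wu_def Wn_def real_sqrt_mult[of ck] real_sqrt_mult[of cs] real_sqrt_mult[of cm] by (simp only: mult_ac)
  qed
  have "0 \<le> C * sqrt cm * sqrt ck * sqrt cs" using C cpos by simp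
  with main show ?thesis by (intro exI[of _ "C * sqrt cm * sqrt ck * sqrt cs"]) auto
qed

text \<open>The weights of H^(-k) at N + 1 and of H^k at N compensate by Peetre's inequality, since
  the frequencies differ by 1; this is why k is arbitrary. There remain the wave weight, of order
  N^s, and one factor v from each of the three norms.\<close>

lemma weight_product:
  assumes s: "s < 0" and N: "1 \<le> N" and v: "0 \<le> v"
  shows "sqrt (v\<^sup>2 * sobolev_weight (- k) (N + 1)) * sqrt (v\<^sup>2 * sobolev_weight k N) * sqrt (v\<^sup>2 * sobolev_weight s (2 * N + 1))
    \<le> 2 powr \<bar>k\<bar> * (v ^ 3 * N powr s)"
proof -
  have "sobolev_weight (- k) (N + 1) * sobolev_weight k N \<le> sobolev_weight (- k) (N + 1) * (2 powr \<bar>k\<bar> * sobolev_weight k (N + 1) * sobolev_weight \<bar>k\<bar> (N - (N + 1)))"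
    by (rule mult_left_mono[OF sobolev_weight_Peetre]) (rule less_imp_le[OF sobolev_weight_pos])
  also have "\<dots> = 2 powr \<bar>k\<bar> * 2 powr \<bar>k\<bar>"
  proof -
    have "(1 + (N + 1)\<^sup>2) powr (- k) * (1 + (N + 1)\<^sup>2) powr k = 1"
      unfolding powr_add[symmetric] by (simp add: add_nonneg_eq_0_iff)
    then show ?thesis by (simp add: sobolev_weight_def)
  qed
  finally have 1: "sobolev_weight (- k) (N + 1) * sobolev_weight k N \<le> (2 powr \<bar>k\<bar>)\<^sup>2" by (simp only: power2_eq_square)
  have "N\<^sup>2 \<le> 1 + (2 * N + 1)\<^sup>2" using N by (simp add: power2_eq_square algebra_simps)
  then have "sobolev_weight s (2 * N + 1) \<le> (N\<^sup>2) powr s"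
    unfolding sobolev_weight_def using s N by (intro powr_mono2') auto
  also have "\<dots> = (N powr s)\<^sup>2" using N by (simp add: power2_eq_square powr_mult)
  finally have 2: "sobolev_weight s (2 * N + 1) \<le> (N powr s)\<^sup>2" .
  have "sqrt (v\<^sup>2 * sobolev_weight (- k) (N + 1)) * sqrt (v\<^sup>2 * sobolev_weight k N) * sqrt (v\<^sup>2 * sobolev_weight s (2 * N + 1))
    = v ^ 3 * sqrt (sobolev_weight (- k) (N + 1) * sobolev_weight k N) * sqrt (sobolev_weight s (2 * N + 1))"
    using v by (simp add: real_sqrt_mult power3_eq_cube)
  also have "\<dots> \<le> v ^ 3 * (2 powr \<bar>k\<bar>) * (N powr s)"
    using v by (intro mult_mono mult_left_mono real_le_lsqrt 1 2 mult_nonneg_nonneg real_sqrt_ge_zero less_imp_le[OF sobolev_weight_pos]) auto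
  finally show ?thesis by (simp add: mult_ac)
qed

theorem theorem1p4:
  fixes k s T :: real
  assumes "s < - (1 / 2)" and "T > 0"
  shows "\<not> (\<exists>F. C2_on (data_space k s) (solution_space T k s) (unit_ball (data_space k s)) F \<and>
    (\<forall>d \<in> unit_ball (data_space k s) \<inter> smooth_data. zakharov_solution T d (F d)))"
proof
  assume "\<exists>F. C2_on (data_space k s) (solution_space T k s) (unit_ball (data_space k s)) F \<and>
    (\<forall>d \<in> unit_ball (data_space k s) \<inter> smooth_data. zakharov_solution T d (F d))"
  then obtain C where C: "0 \<le> C" and le: "\<And>v N. 1 \<le> v \<Longrightarrow> 0 \<le> N \<Longrightarrow> 2 \<le> T * (2 * N + 1) \<Longrightarrow>
    T * exp (- 3 / 2) / 8 * v\<^sup>2 - 1060 * T\<^sup>2 * (2 * N + 3)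
    \<le> C * sqrt (v\<^sup>2 * sobolev_weight (- k) (N + 1)) * sqrt (v\<^sup>2 * sobolev_weight k N) * sqrt (v\<^sup>2 * sobolev_weight s (2 * N + 1))"
    using second_difference_bound[OF assms(2)] by blast
  let ?c = "T * exp (- 3 / 2) / 8"
  \<comment> \<open>5300 = 5 * 1060, from 2 N + 3 at most 5 N. The second exponent is half of the
    first, and both are negative for s < - 1 / 2.\<close>
  let ?h = "\<lambda>N. 5300 * T\<^sup>2 * N powr (1 / 2 + s) + C * 2 powr \<bar>k\<bar> * N powr (1 / 4 + s / 2)"
  have bound: "?c \<le> ?h N" if N: "1 \<le> N" "2 \<le> T * (2 * N + 1)" for N
  proof -
    \<comment> \<open>The width \<open>v^2 = N^(1/2 - s)\<close> is the geometric mean of N and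
      \<open>N^(-2 s)\<close>: the dispersion error asks for a width far above N, the comparison of
      norms for one far below \<open>N^(-2 s)\<close>.\<close>
    define v where "v = N powr (1 / 4 - s / 2)"
    have v1: "1 \<le> v" unfolding v_def using N assms by (intro ge_one_powr_ge_zero) auto
    have v2: "v\<^sup>2 = N powr (1 / 2 - s)" unfolding v_def power2_eq_square powr_add[symmetric] by simp
    have vN: "N = N powr (1 / 2 + s) * v\<^sup>2" unfolding v2 powr_add[symmetric] using N by simp
    have v3: "v ^ 3 * N powr s = N powr (1 / 4 + s / 2) * v\<^sup>2"
      unfolding power3_eq_cube power2_eq_square unfolding v_def powr_add[symmetric] by simp
    have "?c * v\<^sup>2 \<le> 1060 * T\<^sup>2 * (2 * N + 3) + C * (sqrt (v\<^sup>2 * sobolev_weight (- k) (N + 1)) * sqrt (v\<^sup>2 * sobolev_weight k N) * sqrt (v\<^sup>2 * sobolev_weight s (2 * N + 1)))"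
      using le[OF v1 _ N(2)] N(1) unfolding mult.assoc by fastforce
    also have "\<dots> \<le> 1060 * T\<^sup>2 * (5 * N) + C * (2 powr \<bar>k\<bar> * (v ^ 3 * N powr s))"
      using N v1 assms C by (intro add_mono mult_left_mono weight_product) auto
    also have "\<dots> = 5300 * T\<^sup>2 * N + C * 2 powr \<bar>k\<bar> * (v ^ 3 * N powr s)" by simp
    also have "\<dots> = 5300 * T\<^sup>2 * (N powr (1 / 2 + s) * v\<^sup>2) + C * 2 powr \<bar>k\<bar> * (N powr (1 / 4 + s / 2) * v\<^sup>2)"
      unfolding v3 using vN by simp
    also have "\<dots> = ?h N * v\<^sup>2" by (simp add: algebra_simps)
    finally show ?thesis using v1 by (simp add: mult_le_cancel_right)
  qed
  have "((\<lambda>N. 5300 * T\<^sup>2 * N powr (1 / 2 + s) + C * 2 powr \<bar>k\<bar> * N powr (1 / 4 + s / 2)) \<longlongrightarrow> 5300 * T\<^sup>2 * 0 + C * 2 powr \<bar>k\<bar> * 0) at_top"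
    using assms by (intro tendsto_intros tendsto_neg_powr filterlim_ident) auto
  moreover have "\<forall>\<^sub>F N in at_top. ?c \<le> ?h N"
    using eventually_ge_at_top[of 1] eventually_ge_at_top[of "1 / T"]
  proof eventually_elim
    case (elim N)
    then have "2 \<le> T * (2 * N + 1)" using assms by (simp add: field_simps)
    with elim show ?case by (intro bound)
  qed
  ultimately have "?c \<le> 5300 * T\<^sup>2 * 0 + C * 2 powr \<bar>k\<bar> * 0"
    by (rule tendsto_lowerbound) simp
  then show False using assms by (simp add: mult_le_0_iff)
qed

end
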